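(* Let $\mathbb G$ be a Carnot group of homogeneous dimension $\nu$, let $\Omega\subset\mathbb G$ be a bounded domain, $1<p<\nu$ and $1<q<\nu^*=\frac{\nu p}{\nu-p}$. Let $U=W_0^{1,p}(\Omega)$ with $\|v\|_U=\|\nabla_{\mathrm H}v\|_{L^p(\Omega)}$, $SV=\{v\in L^q(\Omega):\|v\|_{L^q(\Omega)}=1\}$, and $$\lambda=\inf\Big\{\int_\Omega|\nabla_{\mathrm H}v|^p\,dx:\ v\in U\cap SV\Big\}.$$ Suppose $\{u_n\}\subset U\cap SV$ is a minimizing sequence for $\lambda$, i.e. $\|u_n\|_{L^q(\Omega)}=1$ and $\|u_n\|_U^p\to\lambda$. Then there exists a subsequence $\{u_{n_j}\}$ converging weakly in $U$ to some $u\in U\cap SV$ such that $\lambda=\int_\Omega|\nabla_{\mathrm H}u|^p\,dx$. Moreover, $u$ is an eigenfunction of the Dirichlet $(p,q)$-eigenvalue problem corresponding to $\lambda$, and the eigenfunctions corresponding to $\lambda$ are precisely the scalar multiples of the functions in $U\cap SV$ at which the infimum $\lambda$ is attained.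
   Context: A Carnot group $\mathbb G$ is a connected, simply connected nilpotent Lie group whose Lie algebra decomposes as $V_1\oplus\cdots\oplus V_m$ with $\dim V_1\ge2$, $[V_1,V_i]=V_{i+1}$, $[V_1,V_m]=\{0\}$; it is identified with $\mathbb R^N$ via the exponential map, and Lebesgue measure $dx$ is the Haar measure. Homogeneous dimension $\nu=\sum_i i\dim V_i$. With $X_1,\dots,X_n$ a basis of left-invariant fields of $V_1$, $\nabla_{\mathrm H}f=(X_1f,\dots,X_nf)$ (weak derivatives). $W_0^{1,p}(\Omega)$ is the closure of $C_c^\infty(\Omega)$ in the norm $\|f\|_{L^p}+\|\nabla_{\mathrm H}f\|_{L^p}$. Dirichlet $(p,q)$-eigenvalue problem: $(\lambda,u)\in\mathbb R\times(W_0^{1,p}(\Omega)\setminus\{0\})$ is an eigenpair ($\lambda$ an eigenvalue, $u$ an eigenfunction) if for every $v\in W_0^{1,p}(\Omega)$, $$\int_\Omega|\nabla_{\mathrm H}u|^{p-2}\nabla_{\mathrm H}u\cdot\nabla_{\mathrm H}v\,dx=\lambda\|u\|_{L^q(\Omega)}^{p-q}\int_\Omega|u|^{q-2}uv\,dx.$$ *)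

theory Defs
  imports "HOL-Analysis.Analysis"
begin

definition smooth_on :: "'a::euclidean_space set \<Rightarrow> ('a \<Rightarrow> real) \<Rightarrow> bool" where
  "smooth_on S f \<longleftrightarrow> (\<exists>F. f \<in> F \<and>
     (\<forall>g\<in>F. (\<forall>x\<in>S. g differentiable (at x)) \<and>
        (\<forall>b\<in>Basis. \<exists>h\<in>F. \<forall>x\<in>S. frechet_derivative g (at x) b = h x)))"

text \<open>Left-invariant vector field associated to v (tangent vector at the identity 0):
  (X_v f)(x) = d/dt f(x * exp(t v)) at t = 0, and exp is the identity map in exponential
  coordinates.\<close>
definition lfield :: "(real^'n \<Rightarrow> real^'n \<Rightarrow> real^'n) \<Rightarrow> real^'n \<Rightarrow> (real^'n \<Rightarrow> real) \<Rightarrow> real^'n \<Rightarrow> real" where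
  "lfield gmul v f x = deriv (\<lambda>t. f (gmul x (t *\<^sub>R v))) 0"

text \<open>Lie bracket in the Lie algebra (identified with R^N): the vector whose left-invariant
  field is the commutator [X_v, X_w], read off on the coordinate functions at 0.\<close>
definition lie_br :: "(real^'n \<Rightarrow> real^'n \<Rightarrow> real^'n) \<Rightarrow> real^'n \<Rightarrow> real^'n \<Rightarrow> real^'n" where
  "lie_br gmul v w = (\<chi> k. lfield gmul v (lfield gmul w (\<lambda>x. x $ k)) 0
                        - lfield gmul w (lfield gmul v (\<lambda>x. x $ k)) 0)"

text \<open>A Carnot group structure on R^N (identified via the exponential map) with
  stratification V 1, ..., V m of its Lie algebra.\<close>
definition carnot_group :: "(real^'n \<Rightarrow> real^'n \<Rightarrow> real^'n) \<Rightarrow> (nat \<Rightarrow> (real^'n) set) \<Rightarrow> nat \<Rightarrow> bool" where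
  "carnot_group gmul V m \<longleftrightarrow>
     (\<forall>x y z. gmul (gmul x y) z = gmul x (gmul y z)) \<and>
     (\<forall>x. gmul 0 x = x \<and> gmul x 0 = x) \<and>
     (\<forall>x. \<exists>y. gmul x y = 0 \<and> gmul y x = 0) \<and>
     (\<forall>k. smooth_on UNIV (\<lambda>z::(real^'n) \<times> (real^'n). gmul (fst z) (snd z) $ k)) \<and>
     (\<forall>v s t. gmul (s *\<^sub>R v) (t *\<^sub>R v) = (s + t) *\<^sub>R v) \<and>
     m \<ge> 1 \<and>
     (\<forall>i\<in>{1..m}. subspace (V i)) \<and>
     span (\<Union>i\<in>{1..m}. V i) = UNIV \<and>
     (\<Sum>i=1..m. dim (V i)) = CARD('n) \<and>
     dim (V 1) \<ge> 2 \<and>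
     (\<forall>i. 1 \<le> i \<and> i < m \<longrightarrow> V (Suc i) = span {lie_br gmul v w | v w. v \<in> V 1 \<and> w \<in> V i}) \<and>
     (\<forall>v\<in>V 1. \<forall>w\<in>V m. lie_br gmul v w = 0)"

definition hom_dim :: "(nat \<Rightarrow> (real^'n) set) \<Rightarrow> nat \<Rightarrow> nat" where
  "hom_dim V m = (\<Sum>i=1..m. i * dim (V i))"

definition test_fun :: "(real^'n) set \<Rightarrow> (real^'n \<Rightarrow> real) \<Rightarrow> bool" where
  "test_fun \<Omega> \<phi> \<longleftrightarrow> smooth_on UNIV \<phi> \<and> compact (closure {x. \<phi> x \<noteq> 0})
                      \<and> closure {x. \<phi> x \<noteq> 0} \<subseteq> \<Omega>"

text \<open>Smooth horizontal gradient, with respect to a basis B of V 1 indexed by 'k.\<close>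
definition hgrad :: "(real^'n \<Rightarrow> real^'n \<Rightarrow> real^'n) \<Rightarrow> ('k::finite \<Rightarrow> real^'n) \<Rightarrow> (real^'n \<Rightarrow> real) \<Rightarrow> real^'n \<Rightarrow> real^'k" where
  "hgrad gmul B f x = (\<chi> j. lfield gmul (B j) f x)"

definition in_Lp :: "(real^'n) set \<Rightarrow> real \<Rightarrow> (real^'n \<Rightarrow> 'b::euclidean_space) \<Rightarrow> bool" where
  "in_Lp \<Omega> p f \<longleftrightarrow> f \<in> borel_measurable (lebesgue_on \<Omega>) \<and>
                      integrable (lebesgue_on \<Omega>) (\<lambda>x. norm (f x) powr p)"

definition Lp_norm :: "(real^'n) set \<Rightarrow> real \<Rightarrow> (real^'n \<Rightarrow> 'b::euclidean_space) \<Rightarrow> real" where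
  "Lp_norm \<Omega> p f = (\<integral>x. norm (f x) powr p \<partial>lebesgue_on \<Omega>) powr (1 / p)"

text \<open>G is a weak horizontal gradient of f on \<Omega> (left-invariant fields have adjoint -X_j
  with respect to the Haar = Lebesgue measure).\<close>
definition weak_hgrad :: "(real^'n \<Rightarrow> real^'n \<Rightarrow> real^'n) \<Rightarrow> ('k::finite \<Rightarrow> real^'n) \<Rightarrow> (real^'n) set
     \<Rightarrow> (real^'n \<Rightarrow> real) \<Rightarrow> (real^'n \<Rightarrow> real^'k) \<Rightarrow> bool" where
  "weak_hgrad gmul B \<Omega> f G \<longleftrightarrow>
     G \<in> borel_measurable (lebesgue_on \<Omega>) \<and>
     (\<forall>j \<phi>. test_fun \<Omega> \<phi> \<longrightarrow>
        integrable (lebesgue_on \<Omega>) (\<lambda>x. f x * lfield gmul (B j) \<phi> x) \<and>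
        integrable (lebesgue_on \<Omega>) (\<lambda>x. G x $ j * \<phi> x) \<and>
        (\<integral>x. G x $ j * \<phi> x \<partial>lebesgue_on \<Omega>) = - (\<integral>x. f x * lfield gmul (B j) \<phi> x \<partial>lebesgue_on \<Omega>))"

text \<open>The weak horizontal gradient (unique up to null sets).\<close>
definition whgrad :: "(real^'n \<Rightarrow> real^'n \<Rightarrow> real^'n) \<Rightarrow> ('k::finite \<Rightarrow> real^'n) \<Rightarrow> (real^'n) set
     \<Rightarrow> (real^'n \<Rightarrow> real) \<Rightarrow> real^'n \<Rightarrow> real^'k" where
  "whgrad gmul B \<Omega> f = (SOME G. weak_hgrad gmul B \<Omega> f G)"

definition W0 :: "(real^'n \<Rightarrow> real^'n \<Rightarrow> real^'n) \<Rightarrow> ('k::finite \<Rightarrow> real^'n) \<Rightarrow> (real^'n) set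
     \<Rightarrow> real \<Rightarrow> (real^'n \<Rightarrow> real) set" where
  "W0 gmul B \<Omega> p = {u. \<exists>G. weak_hgrad gmul B \<Omega> u G \<and> in_Lp \<Omega> p u \<and> in_Lp \<Omega> p G \<and>
      (\<exists>\<phi>::nat \<Rightarrow> real^'n \<Rightarrow> real. (\<forall>k. test_fun \<Omega> (\<phi> k)) \<and>
         (\<lambda>k. Lp_norm \<Omega> p (\<lambda>x. \<phi> k x - u x) + Lp_norm \<Omega> p (\<lambda>x. hgrad gmul B (\<phi> k) x - G x))
            \<longlonglongrightarrow> 0)}"

definition weak_conv_U :: "(real^'n \<Rightarrow> real^'n \<Rightarrow> real^'n) \<Rightarrow> ('k::finite \<Rightarrow> real^'n) \<Rightarrow> (real^'n) set
     \<Rightarrow> real \<Rightarrow> (nat \<Rightarrow> real^'n \<Rightarrow> real) \<Rightarrow> (real^'n \<Rightarrow> real) \<Rightarrow> bool" where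
  "weak_conv_U gmul B \<Omega> p w u \<longleftrightarrow>
     (\<forall>L::(real^'n \<Rightarrow> real) \<Rightarrow> real.
        (\<forall>v\<in>W0 gmul B \<Omega> p. \<forall>v'\<in>W0 gmul B \<Omega> p. \<forall>a b.
            L (\<lambda>x. a * v x + b * v' x) = a * L v + b * L v') \<and>
        (\<exists>C. \<forall>v\<in>W0 gmul B \<Omega> p. \<bar>L v\<bar> \<le> C * Lp_norm \<Omega> p (whgrad gmul B \<Omega> v))
        \<longrightarrow> (\<lambda>n. L (w n)) \<longlonglongrightarrow> L u)"

definition eigenpair :: "(real^'n \<Rightarrow> real^'n \<Rightarrow> real^'n) \<Rightarrow> ('k::finite \<Rightarrow> real^'n) \<Rightarrow> (real^'n) set
     \<Rightarrow> real \<Rightarrow> real \<Rightarrow> real \<Rightarrow> (real^'n \<Rightarrow> real) \<Rightarrow> bool" where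
  "eigenpair gmul B \<Omega> p q lam u \<longleftrightarrow>
     u \<in> W0 gmul B \<Omega> p \<and> \<not> (AE x in lebesgue_on \<Omega>. u x = 0) \<and>
     (\<forall>v\<in>W0 gmul B \<Omega> p.
        (\<integral>x. norm (whgrad gmul B \<Omega> u x) powr (p - 2) *
               (whgrad gmul B \<Omega> u x \<bullet> whgrad gmul B \<Omega> v x) \<partial>lebesgue_on \<Omega>)
        = lam * Lp_norm \<Omega> q u powr (p - q) *
          (\<integral>x. \<bar>u x\<bar> powr (q - 2) * u x * v x \<partial>lebesgue_on \<Omega>))"

end

theory Submission
  imports Defs "HOL-Complex_Analysis.Great_Picard" "HOL-Real_Asymp.Real_Asymp"
begin

text \<open>Since the bracket conditions grade the Lie algebra, the linear maps scaling \<open>V i\<close> by \<open>t ^ i\<close>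
  are group automorphisms; letting \<open>t \<rightarrow> 0\<close> shows that translations are unipotent, hence preserve
  Lebesgue measure, and that \<open>V 1\<close> generates the group. By Baire's theorem all points near \<open>0\<close> are
  products of boundedly many horizontal ones, so the \<open>L\<^sup>p\<close> modulus of continuity of a test function
  under right translation at scale \<open>t\<close> is at most a multiple of \<open>t\<close> times its energy. This single
  estimate yields weak-type bounds that improve by bootstrap up to every exponent below \<open>\<nu>\<^sup>*\<close>, and
  equicontinuity of averages, hence precompactness in \<open>L\<^sup>1\<close>; interpolation makes the embedding of
  \<open>W\<^sub>0\<close> into every subcritical \<open>L\<^sup>q\<close> compact.

  A minimizing sequence thus has a subsequence converging in \<open>L\<^sup>q\<close>. Midpoints of its members have
  \<open>L\<^sup>q\<close> norm close to \<open>1\<close> and so energy at least about \<open>lam\<close>, and uniform convexity makes the gradients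
  converge strongly; no reflexivity is needed. Differentiating the Rayleigh quotient at a minimizer
  gives the eigenvalue equation, and testing the equation with the eigenfunction itself gives the
  converse.\<close>

text \<open>The group law is given only as smooth, with the lines \<open>t *\<^sub>R v\<close> as
  one-parameter subgroups. A polynomial form or a Baker-Campbell-Hausdorff series is not part of the
  data, so compatibility with dilations has to be earned from the bracket. A bracket-preserving
  linear map intertwines conjugations, because both sides solve the same linear differential
  equation. The differential of the exponential map is an average of conjugations, so left-invariant
  fields, and finally their integral curves, are respected too. The weak-type bounds come from
  comparing two levels. If |\<phi>| exceeds s at x, while the set where it exceeds s/2 fills at most
  half of a dilated ball translated to x, then \<phi> changes by at least s/2 across half of that
  ball. A known bound at level s/2 dictates the smallest admissible scale, and the translation
  estimate at that scale bounds the set of level s. The iteration starts from the finite volume of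
  \<Omega> and approaches the critical exponent without reaching it.\<close>

section \<open>Second-order calculus of smooth functions\<close>

definition fdir :: "('a::real_normed_vector \<Rightarrow> 'b::real_normed_vector) \<Rightarrow> 'a \<Rightarrow> 'a \<Rightarrow> 'b" where
  "fdir f e x = frechet_derivative f (at x) e"

text \<open>Iterated directional derivatives keep second derivatives in the codomain of
  \<open>f\<close>, avoiding functions with values in spaces of linear maps. Of the smoothness of
  the group law only this much is used.\<close>

definition C2 :: "('a::real_normed_vector \<Rightarrow> 'b::real_normed_vector) \<Rightarrow> bool" where
  "C2 f \<longleftrightarrow> (\<forall>x. f differentiable at x) \<and> (\<forall>e x. fdir f e differentiable at x) \<and>
     (\<forall>e e'. continuous_on UNIV (fdir (fdir f e) e'))"

lemma has_derivative_fdir: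
  assumes "f differentiable at x"
  shows "(f has_derivative (\<lambda>e. fdir f e x)) (at x)"
  using assms unfolding fdir_def by (simp add: frechet_derivative_works)

lemma fdir_eqI:
  assumes "(f has_derivative f') (at x)"
  shows "fdir f e x = f' e"
  unfolding fdir_def using frechet_derivative_at[OF assms] by simp

text \<open>The family in \<open>smooth_on\<close> is closed under derivatives along basis vectors
  only. Expanding a direction in the basis writes \<open>fdir g e\<close> as a combination of
  members of the family, which are again differentiable.\<close>

lemma smooth_on_imp_C2:
  fixes f :: "'a::euclidean_space \<Rightarrow> real"
  assumes "smooth_on UNIV f"
  shows "C2 f"
proof -
  obtain F where fF: "f \<in> F"
    and F: "\<And>g x. g \<in> F \<Longrightarrow> g differentiable at x"
    and F': "\<And>g b. g \<in> F \<Longrightarrow> b \<in> Basis \<Longrightarrow> \<exists>h\<in>F. \<forall>x. frechet_derivative g (at x) b = h x"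
    using assms unfolding smooth_on_def by auto
  have "\<exists>h. \<forall>g\<in>F. \<forall>b\<in>Basis. h g b \<in> F \<and> fdir g b = h g b"
  proof -
    have "\<forall>g b. \<exists>h. g \<in> F \<and> b \<in> Basis \<longrightarrow> h \<in> F \<and> fdir g b = h"
      using F' unfolding fdir_def fun_eq_iff by metis
    then show ?thesis by metis
  qed
  then obtain h where h: "\<And>g b. g \<in> F \<Longrightarrow> b \<in> Basis \<Longrightarrow> h g b \<in> F"
    and hd: "\<And>g b. g \<in> F \<Longrightarrow> b \<in> Basis \<Longrightarrow> fdir g b = h g b" by blast
  have expand: "fdir g e = (\<lambda>x. \<Sum>b\<in>Basis. (e \<bullet> b) *\<^sub>R h g b x)" if "g \<in> F" for g e
  proof
    fix x
    have lin: "linear (\<lambda>e. fdir g e x)"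
      using has_derivative_fdir[OF F[OF that]] has_derivative_linear by blast
    have "fdir g e x = fdir g (\<Sum>b\<in>Basis. (e \<bullet> b) *\<^sub>R b) x"
      by (simp add: euclidean_representation)
    also have "\<dots> = (\<Sum>b\<in>Basis. (e \<bullet> b) *\<^sub>R fdir g b x)"
      by (simp only: linear_sum[OF lin] linear_cmul[OF lin])
    also have "\<dots> = (\<Sum>b\<in>Basis. (e \<bullet> b) *\<^sub>R h g b x)"
      using hd[OF that] by (intro sum.cong) auto
    finally show "fdir g e x = (\<Sum>b\<in>Basis. (e \<bullet> b) *\<^sub>R h g b x)" .
  qed
  have der: "(fdir f e has_derivative (\<lambda>e'. \<Sum>b\<in>Basis. (e \<bullet> b) *\<^sub>R fdir (h f b) e' x)) (at x)" for e x
    unfolding expand[OF fF]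
    by (intro has_derivative_sum has_derivative_scaleR_right has_derivative_fdir F h fF)
  have "fdir (fdir f e) e' = (\<lambda>x. \<Sum>b\<in>Basis. (e \<bullet> b) *\<^sub>R fdir (h f b) e' x)" for e e'
    using fdir_eqI[OF der] by blast
  moreover have "continuous_on UNIV (fdir g e')" if "g \<in> F" for g e'
    unfolding expand[OF that]
    by (intro continuous_on_sum continuous_intros continuous_at_imp_continuous_on ballI
          differentiable_imp_continuous_within F h that)
  ultimately have "continuous_on UNIV (fdir (fdir f e) e')" for e e'
    by (auto intro!: continuous_on_sum continuous_on_mult continuous_on_const simp: h fF)
  then show ?thesis
    unfolding C2_def using F fF der differentiable_def by blast
qed

text \<open>The mean value theorem twice: along \<open>e\<close> for the difference over the side
  \<open>h *\<^sub>R e'\<close>, then along \<open>e'\<close> for \<open>fdir f e\<close>. The left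
  side is symmetric in the two directions, the right side not visibly so.\<close>

lemma C2_second_difference:
  fixes f :: "'a::real_normed_vector \<Rightarrow> real"
  assumes "C2 f" "h > 0"
  shows "\<exists>\<xi> \<eta>. 0 < \<xi> \<and> \<xi> < h \<and> 0 < \<eta> \<and> \<eta> < h \<and>
     f (x + h *\<^sub>R e + h *\<^sub>R e') - f (x + h *\<^sub>R e) - f (x + h *\<^sub>R e') + f x
      = h * h * fdir (fdir f e) e' (x + \<xi> *\<^sub>R e + \<eta> *\<^sub>R e')"
proof -
  have d1: "f differentiable at y" and d2: "fdir f e differentiable at y" for y e
    using assms unfolding C2_def by auto
  have line: "((\<lambda>s. g (a + s *\<^sub>R v)) has_real_derivative fdir g v (a + s *\<^sub>R v)) (at s)"
    if "\<And>y. g differentiable at y" for g :: "'a \<Rightarrow> real" and a v s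
  proof -
    have "((\<lambda>s. a + s *\<^sub>R v) has_derivative (\<lambda>h. h *\<^sub>R v)) (at s)"
      by (auto intro!: derivative_eq_intros)
    from has_derivative_compose[OF this has_derivative_fdir[OF that]]
    have D: "((\<lambda>s. g (a + s *\<^sub>R v)) has_derivative (\<lambda>h. fdir g (h *\<^sub>R v) (a + s *\<^sub>R v))) (at s)" .
    have lin: "linear (\<lambda>e. fdir g e (a + s *\<^sub>R v))"
      using has_derivative_fdir[OF that] has_derivative_linear by blast
    have "(\<lambda>h. fdir g (h *\<^sub>R v) (a + s *\<^sub>R v)) = (*) (fdir g v (a + s *\<^sub>R v))"
      using linear_cmul[OF lin] by (auto simp: mult.commute)
    with D show ?thesis unfolding has_field_derivative_def by simp
  qed
  define \<phi> where "\<phi> s = f (x + h *\<^sub>R e' + s *\<^sub>R e) - f (x + s *\<^sub>R e)" for s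
  have "\<exists>\<xi>. 0 < \<xi> \<and> \<xi> < h \<and> \<phi> h - \<phi> 0
      = (h - 0) * (fdir f e (x + h *\<^sub>R e' + \<xi> *\<^sub>R e) - fdir f e (x + \<xi> *\<^sub>R e))"
    unfolding \<phi>_def by (intro MVT2 assms DERIV_diff line d1)
  then obtain \<xi> where xi: "0 < \<xi>" "\<xi> < h" "\<phi> h - \<phi> 0
      = h * (fdir f e (x + h *\<^sub>R e' + \<xi> *\<^sub>R e) - fdir f e (x + \<xi> *\<^sub>R e))" by auto
  have "\<exists>\<eta>. 0 < \<eta> \<and> \<eta> < h \<and> fdir f e (x + \<xi> *\<^sub>R e + h *\<^sub>R e') - fdir f e (x + \<xi> *\<^sub>R e + 0 *\<^sub>R e')
      = (h - 0) * fdir (fdir f e) e' (x + \<xi> *\<^sub>R e + \<eta> *\<^sub>R e')"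
    by (intro MVT2 assms line d2)
  then obtain \<eta> where eta: "0 < \<eta>" "\<eta> < h" "fdir f e (x + \<xi> *\<^sub>R e + h *\<^sub>R e') - fdir f e (x + \<xi> *\<^sub>R e)
      = h * fdir (fdir f e) e' (x + \<xi> *\<^sub>R e + \<eta> *\<^sub>R e')" by auto
  have "f (x + h *\<^sub>R e + h *\<^sub>R e') - f (x + h *\<^sub>R e) - f (x + h *\<^sub>R e') + f x = \<phi> h - \<phi> 0"
    unfolding \<phi>_def by (simp add: algebra_simps)
  also have "\<dots> = h * (h * fdir (fdir f e) e' (x + \<xi> *\<^sub>R e + \<eta> *\<^sub>R e'))"
    unfolding xi(3) eta(3)[symmetric] by (simp add: algebra_simps)
  finally show ?thesis using xi eta by (metis mult.assoc)
qed

text \<open>Schwarz's theorem: both orders of differentiation represent the same second difference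
  over ever smaller parallelograms, and continuity of the second derivatives lets the intermediate
  points tend to \<open>x\<close>.\<close>

lemma C2_symmetric:
  fixes f :: "'a::real_normed_vector \<Rightarrow> real"
  assumes "C2 f"
  shows "fdir (fdir f e) e' x = fdir (fdir f e') e x"
proof -
  have lim: "\<exists>z. z \<longlonglongrightarrow> x \<and> (\<forall>n. f (x + (1 / real (Suc n)) *\<^sub>R e + (1 / real (Suc n)) *\<^sub>R e')
        - f (x + (1 / real (Suc n)) *\<^sub>R e) - f (x + (1 / real (Suc n)) *\<^sub>R e') + f x
      = (1 / real (Suc n)) * (1 / real (Suc n)) * fdir (fdir f e) e' (z n))" for e e'
  proof -
    define h where "h n = 1 / real (Suc n)" for n
    have h: "h n > 0" for n by (simp add: h_def)
    have hl: "h \<longlonglongrightarrow> 0" unfolding h_def by (rule LIMSEQ_Suc[OF lim_1_over_n])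
    obtain \<xi> \<eta> where b: "\<And>n. 0 < \<xi> n" "\<And>n. \<xi> n < h n" "\<And>n. 0 < \<eta> n" "\<And>n. \<eta> n < h n"
      and eq: "\<And>n. f (x + h n *\<^sub>R e + h n *\<^sub>R e') - f (x + h n *\<^sub>R e) - f (x + h n *\<^sub>R e') + f x
        = h n * h n * fdir (fdir f e) e' (x + \<xi> n *\<^sub>R e + \<eta> n *\<^sub>R e')"
      using C2_second_difference[OF assms h, of _ x e e'] by metis
    have 1: "\<xi> \<longlonglongrightarrow> 0" "\<eta> \<longlonglongrightarrow> 0"
      using b by (auto intro!: tendsto_sandwich[OF _ _ tendsto_const hl] always_eventually less_imp_le)
    have "(\<lambda>n. x + \<xi> n *\<^sub>R e + \<eta> n *\<^sub>R e') \<longlonglongrightarrow> x + 0 *\<^sub>R e + 0 *\<^sub>R e'"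
      by (intro tendsto_intros 1)
    then show ?thesis using eq unfolding h_def by (intro exI conjI) auto
  qed
  obtain z1 where z1: "z1 \<longlonglongrightarrow> x" and e1: "\<And>n. f (x + (1 / real (Suc n)) *\<^sub>R e + (1 / real (Suc n)) *\<^sub>R e')
        - f (x + (1 / real (Suc n)) *\<^sub>R e) - f (x + (1 / real (Suc n)) *\<^sub>R e') + f x
      = (1 / real (Suc n)) * (1 / real (Suc n)) * fdir (fdir f e) e' (z1 n)"
    using lim[of e e'] by blast
  obtain z2 where z2: "z2 \<longlonglongrightarrow> x" and e2: "\<And>n. f (x + (1 / real (Suc n)) *\<^sub>R e' + (1 / real (Suc n)) *\<^sub>R e)
        - f (x + (1 / real (Suc n)) *\<^sub>R e') - f (x + (1 / real (Suc n)) *\<^sub>R e) + f x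
      = (1 / real (Suc n)) * (1 / real (Suc n)) * fdir (fdir f e') e (z2 n)"
    using lim[of e' e] by blast
  have "fdir (fdir f e) e' (z1 n) = fdir (fdir f e') e (z2 n)" for n
  proof -
    have "(1 / real (Suc n)) * (1 / real (Suc n)) * fdir (fdir f e) e' (z1 n)
        = (1 / real (Suc n)) * (1 / real (Suc n)) * fdir (fdir f e') e (z2 n)"
      unfolding e1[symmetric] e2[symmetric] by (simp add: algebra_simps)
    then show ?thesis by simp
  qed
  moreover have "(\<lambda>n. fdir (fdir f e) e' (z1 n)) \<longlonglongrightarrow> fdir (fdir f e) e' x"
    "(\<lambda>n. fdir (fdir f e') e (z2 n)) \<longlonglongrightarrow> fdir (fdir f e') e x"
    using assms z1 z2 unfolding C2_def
    by (auto simp: continuous_on_eq_continuous_at intro: isCont_tendsto_compose)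
  ultimately show ?thesis using LIMSEQ_unique by fastforce
qed

lemma C2_vec:
  fixes f :: "'a::real_normed_vector \<Rightarrow> real^'n"
  assumes "\<And>k. C2 (\<lambda>x. f x $ k)"
  shows "C2 f" "fdir f e x $ k = fdir (\<lambda>x. f x $ k) e x"
    "fdir (fdir f e) e' x $ k = fdir (fdir (\<lambda>x. f x $ k) e) e' x"
proof -
  have d: "(\<lambda>x. f x $ k) differentiable at x" "fdir (\<lambda>x. f x $ k) e differentiable at x"
    and c: "continuous_on UNIV (fdir (fdir (\<lambda>x. f x $ k) e) e')" for k e x e'
    using assms unfolding C2_def by auto
  have vec: "(g has_derivative (\<lambda>e. \<chi> k. fdir (\<lambda>x. g x $ k) e x)) (at x)"
    if "\<And>k. (\<lambda>x. g x $ k) differentiable at x" for g :: "'a \<Rightarrow> real^'n" and x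
    using has_derivative_fdir[OF that]
    by (subst has_derivative_componentwise_within) (auto simp: Basis_vec_def inner_axis)
  have f1: "fdir f e = (\<lambda>x. \<chi> k. fdir (\<lambda>x. f x $ k) e x)" for e
    using fdir_eqI[OF vec[OF d(1)]] by blast
  have v2: "(fdir f e has_derivative (\<lambda>e'. \<chi> k. fdir (fdir (\<lambda>x. f x $ k) e) e' x)) (at x)" for e x
    unfolding f1 using vec[of "\<lambda>x. \<chi> k. fdir (\<lambda>x. f x $ k) e x"] d(2) by simp
  have f2: "fdir (fdir f e) e' = (\<lambda>x. \<chi> k. fdir (fdir (\<lambda>x. f x $ k) e) e' x)" for e e'
    using fdir_eqI[OF v2] by blast
  have "continuous_on UNIV (fdir (fdir f e) e')" for e e'
    unfolding f2 by (intro continuous_on_vec_lambda c)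
  moreover have "f differentiable at x" "fdir f e differentiable at x" for e x
    using vec[OF d(1)] v2 unfolding differentiable_def by blast+
  ultimately show "C2 f" unfolding C2_def by blast
  show "fdir f e x $ k = fdir (\<lambda>x. f x $ k) e x" by (simp add: f1)
  show "fdir (fdir f e) e' x $ k = fdir (fdir (\<lambda>x. f x $ k) e) e' x" by (simp add: f2)
qed

section \<open>The group law and its Lie bracket\<close>

locale carnot =
  fixes gmul :: "real^'n \<Rightarrow> real^'n \<Rightarrow> real^'n" (infixl "\<odot>" 70)
    and V :: "nat \<Rightarrow> (real^'n) set" and m :: nat
  assumes carnot: "carnot_group gmul V m"
begin

lemma gmul_assoc: "(x \<odot> y) \<odot> z = x \<odot> (y \<odot> z)"
  and gmul_0 [simp]: "0 \<odot> x = x" "x \<odot> 0 = x"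
  and gmul_scale: "(s *\<^sub>R v) \<odot> (t *\<^sub>R v) = (s + t) *\<^sub>R v"
  using carnot unfolding carnot_group_def by auto

lemma gmul_inverse [simp]: "x \<odot> (- x) = 0" "(- x) \<odot> x = 0"
  using gmul_scale[of 1 x "-1"] gmul_scale[of "-1" x 1] by auto

lemma gmul_cancel [simp]: "x \<odot> ((- x) \<odot> y) = y" "(- x) \<odot> (x \<odot> y) = y"
  by (simp_all flip: gmul_assoc)

lemma gmul_cancel_right [simp]: "y \<odot> x \<odot> (- x) = y" "y \<odot> (- x) \<odot> x = y"
  by (simp_all add: gmul_assoc)

lemma gmul_left_eq_iff [simp]: "x \<odot> y = x \<odot> z \<longleftrightarrow> y = z"
  using arg_cong[of "x \<odot> y" "x \<odot> z" "(\<odot>) (- x)", unfolded gmul_cancel] by blast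

lemma minus_gmul: "- (x \<odot> y) = (- y) \<odot> (- x)"
proof -
  have "(x \<odot> y) \<odot> ((- y) \<odot> (- x)) = 0"
    by (simp only: gmul_assoc gmul_cancel gmul_inverse)
  also have "\<dots> = (x \<odot> y) \<odot> (- (x \<odot> y))" by simp
  finally show ?thesis by (simp only: gmul_left_eq_iff)
qed

definition pmul :: "(real^'n) \<times> (real^'n) \<Rightarrow> real^'n" where
  "pmul z = fst z \<odot> snd z"

text \<open>Two special cases recur: \<open>dM (x, 0) (0, v)\<close> is the left-invariant field of
  \<open>v\<close> at \<open>x\<close>, and \<open>dM (0, x) (v, 0)\<close> is the right-invariant
  one.\<close>

abbreviation dM :: "(real^'n) \<times> (real^'n) \<Rightarrow> (real^'n) \<times> (real^'n) \<Rightarrow> real^'n" where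
  "dM z e \<equiv> fdir pmul e z"

lemma C2_pmul_component: "C2 (\<lambda>z. pmul z $ k)"
  using carnot smooth_on_imp_C2 unfolding carnot_group_def pmul_def by blast

lemma C2_pmul: "C2 pmul"
  by (rule C2_vec(1)[OF C2_pmul_component])

lemma pmul_symmetric: "fdir (fdir pmul e) e' z = fdir (fdir pmul e') e z"
  by (simp add: vec_eq_iff C2_vec(3)[OF C2_pmul_component] C2_symmetric[OF C2_pmul_component])

lemma pmul_has_derivative: "(pmul has_derivative dM z) (at z)"
  using C2_pmul unfolding C2_def by (blast intro: has_derivative_fdir)

lemma dM_has_derivative: "((\<lambda>z. dM z e) has_derivative (\<lambda>e'. fdir (fdir pmul e) e' z)) (at z)"
  using C2_pmul unfolding C2_def by (blast intro: has_derivative_fdir)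

lemma continuous_dM: "continuous_on S (\<lambda>z. dM z e)"
  by (meson dM_has_derivative has_derivative_continuous continuous_at_imp_continuous_on)

lemma linear_dM: "linear (dM z)"
  using pmul_has_derivative has_derivative_linear by blast

lemma dM_split: "dM z (a, b) = dM z (a, 0) + dM z (0, b)"
  using linear_add[OF linear_dM, of "(a, 0)" "(0, b)" z] by simp

lemma gmul_has_derivative [derivative_intros]:
  assumes "(f has_derivative f') (at x within S)" "(g has_derivative g') (at x within S)"
  shows "((\<lambda>x. f x \<odot> g x) has_derivative (\<lambda>h. dM (f x, g x) (f' h, g' h))) (at x within S)"
  using has_derivative_compose[OF has_derivative_Pair[OF assms] pmul_has_derivative]
  by (simp add: pmul_def)

lemma gmul_has_vector_derivative:
  assumes "(f has_vector_derivative f') (at s)" "(g has_vector_derivative g') (at s)"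
  shows "((\<lambda>s. f s \<odot> g s) has_vector_derivative dM (f s, g s) (f', g')) (at s)"
  using gmul_has_derivative[OF assms[unfolded has_vector_derivative_def]]
    linear_cmul[OF linear_dM, of _ "(f', g')"]
  by (simp add: has_vector_derivative_def)

lemma continuous_gmul [continuous_intros]:
  assumes "continuous_on S f" "continuous_on S g"
  shows "continuous_on S (\<lambda>x. f x \<odot> g x)"
proof -
  have "continuous_on UNIV pmul"
    by (meson pmul_has_derivative has_derivative_continuous continuous_at_imp_continuous_on)
  from continuous_on_compose2[OF this continuous_on_Pair[OF assms]] show ?thesis
    unfolding pmul_def by simp
qed

lemma dM_unit [simp]: "dM (x, 0) (a, 0) = a" "dM (0, x) (0, a) = a"
proof -
  have "((\<lambda>y. y \<odot> 0) has_derivative (\<lambda>h. dM (x, 0) (h, 0))) (at x)"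
    by (intro gmul_has_derivative has_derivative_ident has_derivative_const)
  then have "((\<lambda>y. y) has_derivative (\<lambda>h. dM (x, 0) (h, 0))) (at x)" by simp
  from has_derivative_unique[OF this has_derivative_ident] show "dM (x, 0) (a, 0) = a" by metis
  have "((\<lambda>y. 0 \<odot> y) has_derivative (\<lambda>h. dM (0, x) (0, h))) (at x)"
    by (intro gmul_has_derivative has_derivative_ident has_derivative_const)
  then have "((\<lambda>y. y) has_derivative (\<lambda>h. dM (0, x) (0, h))) (at x)" by simp
  from has_derivative_unique[OF this has_derivative_ident] show "dM (0, x) (0, a) = a" by metis
qed

lemma dM_0 [simp]: "dM (0, 0) (a, b) = a + b"
  by (subst dM_split) simp

section \<open>Conjugation and the Lie bracket\<close>

definition Ad :: "real^'n \<Rightarrow> real^'n \<Rightarrow> real^'n" where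
  "Ad g w = g \<odot> w \<odot> (- g)"

lemma Ad_gmul: "Ad (g \<odot> h) w = Ad g (Ad h w)"
  by (simp add: Ad_def minus_gmul gmul_assoc)

lemma Ad_0_left [simp]: "Ad 0 w = w"
  and Ad_0_right [simp]: "Ad g 0 = 0"
  by (simp_all add: Ad_def)

lemma Ad_distrib: "Ad g (x \<odot> y) = Ad g x \<odot> Ad g y"
  by (simp add: Ad_def gmul_assoc)

lemma Ad_commute: "Ad g w \<odot> g = g \<odot> w"
  by (simp add: Ad_def gmul_assoc)

lemma Ad_of_nat: "Ad g (real n *\<^sub>R w) = real n *\<^sub>R Ad g w"
proof (induction n)
  case (Suc n)
  have "Ad g (real (Suc n) *\<^sub>R w) = Ad g ((real n *\<^sub>R w) \<odot> (1 *\<^sub>R w))"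
    unfolding gmul_scale by (simp add: add.commute)
  also have "\<dots> = (real n *\<^sub>R Ad g w) \<odot> (1 *\<^sub>R Ad g w)"
    by (simp add: Ad_distrib Suc)
  finally show ?case unfolding gmul_scale by (simp add: add.commute)
qed simp

lemma Ad_has_derivative:
  assumes "(f has_derivative f') (at x)" "(g has_derivative g') (at x)"
  shows "((\<lambda>x. Ad (f x) (g x)) has_derivative
    (\<lambda>h. dM (f x \<odot> g x, - f x) (dM (f x, g x) (f' h, g' h), - f' h))) (at x)"
  unfolding Ad_def by (intro derivative_intros assms)

text \<open>As the exponential map is the identity, conjugation commutes with integer multiples;
  rescaling by \<open>1/n\<close> identifies it with its derivative at the identity.\<close>

lemma linear_Ad: "linear (Ad g)"
proof -
  define L where "L h = dM (g \<odot> 0, - g) (dM (g, 0) (0, h), - 0)" for h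
  have L: "(Ad g has_derivative L) (at 0)"
    unfolding L_def using Ad_has_derivative[OF has_derivative_const has_derivative_ident, of g 0]
    by simp
  have "Ad g w $ k = L w $ k" for w k
  proof -
    have "((\<lambda>t. t *\<^sub>R w) has_derivative (\<lambda>h. h *\<^sub>R w)) (at (0::real))"
      by (auto intro!: derivative_eq_intros)
    from has_derivative_compose[OF this, of "Ad g" L] L
    have "((\<lambda>t. Ad g (t *\<^sub>R w)) has_derivative (\<lambda>h. L (h *\<^sub>R w))) (at 0)" by simp
    then have "((\<lambda>t. Ad g (t *\<^sub>R w) $ k) has_derivative (\<lambda>h. L (h *\<^sub>R w) $ k)) (at 0)"
      by (rule bounded_linear.has_derivative[OF bounded_linear_vec_nth])
    moreover have "(\<lambda>h. L (h *\<^sub>R w) $ k) = (*) (L w $ k)"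
      using linear_cmul[OF has_derivative_linear[OF L]] by (auto simp: mult.commute)
    ultimately have "((\<lambda>t. Ad g (t *\<^sub>R w) $ k) has_real_derivative L w $ k) (at 0)"
      unfolding has_field_derivative_def by simp
    then have lim: "(\<lambda>h. Ad g (h *\<^sub>R w) $ k / h) \<midarrow>0\<rightarrow> L w $ k"
      by (simp add: DERIV_def)
    have "(\<lambda>n. Ad g ((1 / real (Suc n)) *\<^sub>R w) $ k / (1 / real (Suc n))) \<longlonglongrightarrow> L w $ k"
      by (rule filterlim_compose[OF lim])
        (simp add: filterlim_at LIMSEQ_Suc[OF lim_1_over_n] del: of_nat_Suc)
    moreover have "Ad g ((1 / real (Suc n)) *\<^sub>R w) $ k / (1 / real (Suc n)) = Ad g w $ k" for n
    proof -
      have "Ad g (real (Suc n) *\<^sub>R (1 / real (Suc n)) *\<^sub>R w)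
          = real (Suc n) *\<^sub>R Ad g ((1 / real (Suc n)) *\<^sub>R w)" by (rule Ad_of_nat)
      then have "Ad g w $ k = real (Suc n) * Ad g ((1 / real (Suc n)) *\<^sub>R w) $ k" by simp
      then show ?thesis by (simp add: field_simps)
    qed
    ultimately show ?thesis by (simp only: LIMSEQ_const_iff)
  qed
  then have "Ad g = L" by (auto simp: vec_eq_iff)
  then show ?thesis using has_derivative_linear[OF L] by simp
qed

abbreviation br :: "real^'n \<Rightarrow> real^'n \<Rightarrow> real^'n" where
  "br \<equiv> lie_br gmul"

lemma lfield_eq:
  assumes "(f has_derivative f') (at x)"
  shows "lfield gmul w f x = f' (dM (x, 0) (0, w))"
proof -
  have "((\<lambda>t. x \<odot> (t *\<^sub>R w)) has_derivative (\<lambda>h. dM (x, 0 *\<^sub>R w) (0, h *\<^sub>R w))) (at 0)"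
    by (auto intro!: derivative_eq_intros)
  from has_derivative_compose[OF this, of f f'] assms
  have "((\<lambda>t. f (x \<odot> (t *\<^sub>R w))) has_derivative (\<lambda>h. f' (dM (x, 0) (0, h *\<^sub>R w)))) (at 0)"
    by simp
  moreover have "(\<lambda>h. f' (dM (x, 0) (0, h *\<^sub>R w))) = (*) (f' (dM (x, 0) (0, w)))"
    using linear_cmul[OF linear_dM, of _ "(0, w)"] linear_cmul[OF has_derivative_linear[OF assms]]
    by (auto simp: mult.commute)
  ultimately show ?thesis
    unfolding lfield_def by (intro DERIV_imp_deriv) (simp add: has_field_derivative_def)
qed

abbreviation d2M :: "(real^'n) \<times> (real^'n) \<Rightarrow> (real^'n) \<times> (real^'n) \<Rightarrow> real^'n" where
  "d2M e e' \<equiv> fdir (fdir pmul e) e' (0, 0)"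

lemma linear_d2M_right: "linear (d2M e)"
  using dM_has_derivative has_derivative_linear by blast

lemma linear_d2M_left: "linear (\<lambda>e. d2M e e')"
  using linear_d2M_right[of e'] by (simp add: pmul_symmetric[of _ e'])

lemma dM_curve:
  assumes "(f has_vector_derivative f') (at (0::real))" "(g has_vector_derivative g') (at 0)"
    "f 0 = 0" "g 0 = 0"
  shows "((\<lambda>s. dM (f s, g s) e) has_vector_derivative d2M e (f', g')) (at 0)"
proof -
  have "((\<lambda>s. (f s, g s)) has_derivative (\<lambda>h. (h *\<^sub>R f', h *\<^sub>R g'))) (at 0)"
    using assms(1,2)[unfolded has_vector_derivative_def] by (rule has_derivative_Pair)
  from has_derivative_compose[OF this dM_has_derivative]
  have "((\<lambda>s. dM (f s, g s) e) has_derivative (\<lambda>h. d2M e (h *\<^sub>R f', h *\<^sub>R g'))) (at 0)"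
    using assms by simp
  then show ?thesis
    using linear_cmul[OF linear_d2M_right, of e _ "(f', g')"] by (simp add: has_vector_derivative_def)
qed

lemma has_vector_derivative_scaleR_id: "((\<lambda>s::real. s *\<^sub>R v) has_vector_derivative v) (at s)"
  by (auto simp: has_vector_derivative_def intro!: derivative_eq_intros)

text \<open>A left-invariant field applied to a coordinate function is a coordinate of
  \<open>dM (x, 0) (0, w)\<close>, so the commutator at 0 sees only mixed second derivatives of the
  law.\<close>

lemma br_eq: "br v w = d2M (0, w) (v, 0) - d2M (0, v) (w, 0)"
proof -
  have *: "lfield gmul v (lfield gmul w (\<lambda>x. x $ k)) 0 = d2M (0, w) (v, 0) $ k" for v w k
  proof -
    have "lfield gmul w (\<lambda>x. x $ k) = (\<lambda>x. dM (x, 0) (0, w) $ k)"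
      by (intro ext lfield_eq bounded_linear.has_derivative[OF bounded_linear_vec_nth]
          has_derivative_ident)
    moreover have "((\<lambda>t. dM (t *\<^sub>R v, 0) (0, w) $ k) has_real_derivative d2M (0, w) (v, 0) $ k) (at 0)"
    proof -
      have "((\<lambda>t. dM (t *\<^sub>R v, 0) (0, w)) has_vector_derivative d2M (0, w) (v, 0)) (at 0)"
        by (rule dM_curve) (auto intro: has_vector_derivative_scaleR_id)
      from bounded_linear.has_vector_derivative[OF bounded_linear_vec_nth this]
      show ?thesis by (simp add: has_real_derivative_iff_has_vector_derivative)
    qed
    ultimately show ?thesis
      unfolding lfield_def[of _ v] by (auto intro: DERIV_imp_deriv)
  qed
  show ?thesis by (simp add: vec_eq_iff lie_br_def *)
qed

lemma br_antisym: "br v w = - br w v"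
  by (simp add: br_eq)

lemma bilinear_br: "bilinear br"
proof -
  have r: "linear (br v)" for v
    unfolding br_eq[abs_def]
  proof (intro linear_compose_sub)
    show "linear (\<lambda>w. d2M (0, w) (v, 0))"
      using linear_compose[of "\<lambda>w. (0, w)" "\<lambda>e. d2M e (v, 0)"] linear_d2M_left
      by (auto simp: o_def linear_iff)
    show "linear (\<lambda>w. d2M (0, v) (w, 0))"
      using linear_compose[of "\<lambda>w. (w, 0)" "d2M (0, v)"] linear_d2M_right
      by (auto simp: o_def linear_iff)
  qed
  have "linear (\<lambda>v. br v w)" for w
    using linear_compose_neg[OF r[of w]] by (simp flip: br_antisym)
  with r show ?thesis unfolding bilinear_def by blast
qed

lemmas br_simps = bilinear_ladd[OF bilinear_br] bilinear_radd[OF bilinear_br]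
  bilinear_lmul[OF bilinear_br] bilinear_rmul[OF bilinear_br]
  bilinear_lzero[OF bilinear_br] bilinear_rzero[OF bilinear_br]
  bilinear_lneg[OF bilinear_br] bilinear_rneg[OF bilinear_br]
  bilinear_lsub[OF bilinear_br] bilinear_rsub[OF bilinear_br]

text \<open>The product rule for a moving linear map applied to a moving vector. Pointwise
  differentiability of the map suffices, because a linear map on \<open>real^'a\<close> is a finite
  combination of its values on the basis.\<close>

lemma has_vector_derivative_linear_family:
  fixes F :: "real \<Rightarrow> real^'a \<Rightarrow> real^'b"
  assumes lin: "\<And>s. linear (F s)" and lin': "linear F'"
    and F: "\<And>w. ((\<lambda>s. F s w) has_vector_derivative F' w) (at t)"
    and b: "(b has_vector_derivative b') (at t)"
  shows "((\<lambda>s. F s (b s)) has_vector_derivative F' (b t) + F t b') (at t)"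
proof -
  have expand: "G x = (\<Sum>i\<in>Basis. (x \<bullet> i) *\<^sub>R G i)" if "linear G"
    for G :: "real^'a \<Rightarrow> real^'b" and x
  proof -
    have "G x = G (\<Sum>i\<in>Basis. (x \<bullet> i) *\<^sub>R i)" by (simp add: euclidean_representation)
    also have "\<dots> = (\<Sum>i\<in>Basis. (x \<bullet> i) *\<^sub>R G i)"
      by (simp only: linear_sum[OF that] linear_cmul[OF that])
    finally show ?thesis .
  qed
  have bi: "((\<lambda>s. b s \<bullet> i) has_real_derivative b' \<bullet> i) (at t)" for i
    using bounded_linear.has_vector_derivative[OF bounded_linear_inner_left b, of i]
    by (simp add: has_real_derivative_iff_has_vector_derivative)
  have "((\<lambda>s. \<Sum>i\<in>Basis. (b s \<bullet> i) *\<^sub>R F s i) has_vector_derivative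
      (\<Sum>i\<in>Basis. (b t \<bullet> i) *\<^sub>R F' i + (b' \<bullet> i) *\<^sub>R F t i)) (at t)"
    by (intro has_vector_derivative_sum has_vector_derivative_scaleR bi F)
  then show ?thesis
    unfolding sum.distrib expand[OF lin, symmetric] expand[OF lin', symmetric] .
qed

text \<open>At the point \<open>s *\<^sub>R v\<close> the right-invariant field of
  \<open>Ad (s *\<^sub>R v) w\<close> equals the left-invariant field of \<open>w\<close>.
  Differentiating this identity at \<open>s = 0\<close> leaves exactly the two mixed second
  derivatives of \<open>br_eq\<close>.\<close>

lemma Ad_curve_0: "((\<lambda>s. Ad (s *\<^sub>R v) w) has_vector_derivative br v w) (at 0)"
proof -
  have "((\<lambda>s. Ad (s *\<^sub>R v) w) has_derivative
      (\<lambda>h. dM (0 *\<^sub>R v \<odot> w, - (0 *\<^sub>R v)) (dM (0 *\<^sub>R v, w) (h *\<^sub>R v, 0), - (h *\<^sub>R v)))) (at 0)"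
    by (intro Ad_has_derivative) (auto intro!: derivative_eq_intros)
  then have "(\<lambda>s. Ad (s *\<^sub>R v) w) differentiable at 0" unfolding differentiable_def by blast
  then obtain a where a: "((\<lambda>s. Ad (s *\<^sub>R v) w) has_vector_derivative a) (at 0)"
    unfolding vector_derivative_works by blast
  have eq: "dM (0, s *\<^sub>R v) (Ad (s *\<^sub>R v) w, 0) = dM (s *\<^sub>R v, 0) (0, w)" for s
  proof -
    have 1: "((\<lambda>t. (t *\<^sub>R Ad (s *\<^sub>R v) w) \<odot> (s *\<^sub>R v)) has_vector_derivative
        dM (0 *\<^sub>R Ad (s *\<^sub>R v) w, s *\<^sub>R v) (Ad (s *\<^sub>R v) w, 0)) (at (0::real))"
      by (intro gmul_has_vector_derivative has_vector_derivative_scaleR_id has_vector_derivative_const)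
    have 2: "((\<lambda>t. (s *\<^sub>R v) \<odot> (t *\<^sub>R w)) has_vector_derivative
        dM (s *\<^sub>R v, 0 *\<^sub>R w) (0, w)) (at (0::real))"
      by (intro gmul_has_vector_derivative has_vector_derivative_scaleR_id has_vector_derivative_const)
    have "(t *\<^sub>R Ad (s *\<^sub>R v) w) \<odot> (s *\<^sub>R v) = (s *\<^sub>R v) \<odot> (t *\<^sub>R w)" for t
      by (simp only: linear_cmul[OF linear_Ad, symmetric] Ad_commute)
    with 1 2 show ?thesis by (simp add: vector_derivative_unique_at)
  qed
  have "((\<lambda>s. dM (0, s *\<^sub>R v) (Ad (s *\<^sub>R v) w, 0)) has_vector_derivative
      d2M (Ad (0 *\<^sub>R v) w, 0) (0, v) + dM (0, 0 *\<^sub>R v) (a, 0)) (at 0)"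
  proof (rule has_vector_derivative_linear_family[where F = "\<lambda>s w. dM (0, s *\<^sub>R v) (w, 0)"
        and F' = "\<lambda>w. d2M (w, 0) (0, v)"])
    show "linear (\<lambda>w. dM (0, s *\<^sub>R v) (w, 0))" for s
      using linear_compose[of "\<lambda>w. (w, 0)" "dM (0, s *\<^sub>R v)"] linear_dM
      by (auto simp: o_def linear_iff)
    show "linear (\<lambda>w. d2M (w, 0) (0, v))"
      using linear_compose[of "\<lambda>w. (w, 0)" "\<lambda>e. d2M e (0, v)"] linear_d2M_left
      by (auto simp: o_def linear_iff)
    show "((\<lambda>s. dM (0, s *\<^sub>R v) (w, 0)) has_vector_derivative d2M (w, 0) (0, v)) (at 0)" for w
      by (rule dM_curve) (auto intro: has_vector_derivative_scaleR_id)
  qed (rule a)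
  moreover have "((\<lambda>s. dM (s *\<^sub>R v, 0) (0, w)) has_vector_derivative d2M (0, w) (v, 0)) (at 0)"
    by (rule dM_curve) (auto intro: has_vector_derivative_scaleR_id)
  ultimately have "d2M (w, 0) (0, v) + a = d2M (0, w) (v, 0)"
    unfolding eq by (simp add: vector_derivative_unique_at)
  then have "a = br v w" by (simp add: br_eq pmul_symmetric[of "(w, 0)"] algebra_simps)
  with a show ?thesis by simp
qed

text \<open>The maps \<open>Ad (s *\<^sub>R v)\<close> form a one-parameter group. Splitting off
  \<open>Ad (t *\<^sub>R v)\<close> on the left or on the right moves \<open>Ad_curve_0\<close> to
  time \<open>t\<close>, with the bracket inside or outside.\<close>

lemma Ad_curve: "((\<lambda>s. Ad (s *\<^sub>R v) w) has_vector_derivative Ad (t *\<^sub>R v) (br v w)) (at t)"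
  and Ad_curve': "((\<lambda>s. Ad (s *\<^sub>R v) w) has_vector_derivative br v (Ad (t *\<^sub>R v) w)) (at t)"
proof -
  have shift: "((\<lambda>s. f (s - t)) has_vector_derivative f') (at t)"
    if "(f has_vector_derivative f') (at 0)" for f :: "real \<Rightarrow> real^'n" and f'
  proof -
    have "((\<lambda>s. s - t) has_real_derivative 1) (at t)" by (auto intro!: derivative_eq_intros)
    from vector_diff_chain_at[OF this[unfolded has_real_derivative_iff_has_vector_derivative], of f f']
    show ?thesis using that by (simp add: o_def)
  qed
  have eq: "(\<lambda>s. Ad (s *\<^sub>R v) w) = (\<lambda>s. Ad (t *\<^sub>R v) (Ad ((s - t) *\<^sub>R v) w))"
    and eq': "(\<lambda>s. Ad (s *\<^sub>R v) w) = (\<lambda>s. Ad ((s - t) *\<^sub>R v) (Ad (t *\<^sub>R v) w))"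
    by (simp_all add: Ad_gmul[symmetric] gmul_scale)
  show "((\<lambda>s. Ad (s *\<^sub>R v) w) has_vector_derivative Ad (t *\<^sub>R v) (br v w)) (at t)"
    unfolding eq by (rule bounded_linear.has_vector_derivative
      [OF linear_conv_bounded_linear[THEN iffD1, OF linear_Ad] shift[OF Ad_curve_0]])
  show "((\<lambda>s. Ad (s *\<^sub>R v) w) has_vector_derivative br v (Ad (t *\<^sub>R v) w)) (at t)"
    unfolding eq' by (rule shift[OF Ad_curve_0])
qed

lemma Ad_br: "Ad g (br v w) = br (Ad g v) (Ad g w)"
proof -
  have "Ad (s *\<^sub>R Ad g v) (Ad g w) = Ad g (Ad (s *\<^sub>R v) w)" for s
  proof -
    have "s *\<^sub>R Ad g v = g \<odot> (s *\<^sub>R v) \<odot> (- g)"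
      using linear_cmul[OF linear_Ad, of g s v] by (simp add: Ad_def)
    then show ?thesis by (simp only: Ad_gmul[symmetric]) (simp add: gmul_assoc)
  qed
  with bounded_linear.has_vector_derivative[OF linear_conv_bounded_linear[THEN iffD1, OF linear_Ad]
      Ad_curve_0, of g v w] Ad_curve_0[of "Ad g v" "Ad g w"]
  show ?thesis by (simp add: vector_derivative_unique_at)
qed

text \<open>The derivative at \<open>s = 0\<close> of \<open>Ad_br\<close> with
  \<open>g = s *\<^sub>R u\<close>: a curve of automorphisms differentiates to a derivation.\<close>

lemma br_jacobi: "br u (br v w) = br (br u v) w + br v (br u w)"
proof -
  have "bounded_bilinear br"
    using bilinear_conv_bounded_bilinear bilinear_br by blast
  from bounded_bilinear.has_vector_derivative[OF this Ad_curve_0[of u v] Ad_curve_0[of u w]]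
  have "((\<lambda>s. br (Ad (s *\<^sub>R u) v) (Ad (s *\<^sub>R u) w)) has_vector_derivative
      br v (br u w) + br (br u v) w) (at 0)" by simp
  with Ad_curve_0[of u "br v w"] show ?thesis
    unfolding Ad_br by (simp add: vector_derivative_unique_at add.commute)
qed

text \<open>The dimensions of the layers add up to \<open>CARD('n)\<close>, so the disjoint union of
  bases of the layers can be labelled by the coordinate indices themselves; \<open>\<sigma>\<close>
  records the layer. Independence of the union is not shown here: it follows later, since the right
  number of vectors spans.\<close>

lemma adapted_basis:
  obtains e :: "'n \<Rightarrow> real^'n" and \<sigma> :: "'n \<Rightarrow> nat"
  where "\<And>k. \<sigma> k \<in> {1..m}" "\<And>i. i \<in> {1..m} \<Longrightarrow> V i = span (e ` {k. \<sigma> k = i})"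
    "span (range e) = UNIV" "(\<Sum>k\<in>UNIV. \<sigma> k) = hom_dim V m"
proof -
  have V: "\<And>i. i \<in> {1..m} \<Longrightarrow> subspace (V i)" "span (\<Union>i\<in>{1..m}. V i) = UNIV"
    "(\<Sum>i=1..m. dim (V i)) = CARD('n)"
    using carnot unfolding carnot_group_def by auto
  have "\<forall>i. \<exists>B. B \<subseteq> V i \<and> independent B \<and> V i \<subseteq> span B \<and> card B = dim (V i)"
    by (metis basis_exists)
  then obtain B where B: "\<And>i. B i \<subseteq> V i" "\<And>i. independent (B i)" "\<And>i. V i \<subseteq> span (B i)"
    "\<And>i. card (B i) = dim (V i)" by metis
  have fin: "finite (B i)" for i using B(2) independent_imp_finite by blast
  have "card (Sigma {1..m} B) = CARD('n)" using V(3) fin B(4) by simp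
  then obtain j where j: "bij_betw j (UNIV :: 'n set) (Sigma {1..m} B)"
    using fin by (metis finite_same_card_bij finite_SigmaI finite_atLeastAtMost finite_class.finite_UNIV)
  define e \<sigma> where "e k = snd (j k)" and "\<sigma> k = fst (j k)" for k
  have img: "e ` {k. \<sigma> k = i} = B i" if "i \<in> {1..m}" for i
  proof (intro equalityI subsetI)
    fix x assume "x \<in> e ` {k. \<sigma> k = i}"
    then obtain k where "x = snd (j k)" "fst (j k) = i" unfolding e_def \<sigma>_def by auto
    with bij_betw_apply[OF j, of k] show "x \<in> B i" by (auto simp: mem_Sigma_iff split: prod.splits)
  next
    fix x assume "x \<in> B i"
    then have "(i, x) \<in> Sigma {1..m} B" using that by simp
    then obtain k where "j k = (i, x)" using j unfolding bij_betw_def by (metis imageE)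
    then have "x = e k" "\<sigma> k = i" unfolding e_def \<sigma>_def by simp_all
    then show "x \<in> e ` {k. \<sigma> k = i}" by blast
  qed
  have sp: "V i = span (B i)" if "i \<in> {1..m}" for i
    using B(1,3) V(1)[OF that] by (meson span_minimal subset_antisym)
  show ?thesis
  proof
    show \<sigma>: "\<sigma> k \<in> {1..m}" for k
      using bij_betw_apply[OF j, of k] by (auto simp: \<sigma>_def split: prod.splits)
    show "V i = span (e ` {k. \<sigma> k = i})" if "i \<in> {1..m}" for i
      using img[OF that] sp[OF that] by simp
    have "(\<Union>i\<in>{1..m}. V i) \<subseteq> span (range e)"
    proof (rule UN_least)
      fix i assume i: "i \<in> {1..m}"
      have "span (e ` {k. \<sigma> k = i}) \<subseteq> span (range e)" by (intro span_mono) auto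
      then show "V i \<subseteq> span (range e)" using img[OF i] sp[OF i] by simp
    qed
    then show "span (range e) = UNIV"
      using V(2) by (metis span_minimal subspace_span top.extremum_unique)
    have "(\<Sum>k\<in>UNIV. \<sigma> k) = (\<Sum>z\<in>Sigma {1..m} B. fst z)"
      unfolding \<sigma>_def by (rule sum.reindex_bij_betw[OF j])
    also have "\<dots> = (\<Sum>i=1..m. \<Sum>b\<in>B i. i)"
      using fin by (subst sum.Sigma) (auto simp: case_prod_unfold)
    also have "\<dots> = hom_dim V m" unfolding hom_dim_def by (simp add: B(4) mult.commute)
    finally show "(\<Sum>k\<in>UNIV. \<sigma> k) = hom_dim V m" .
  qed
qed

end

section \<open>Dilations\<close>

locale graded_carnot = carnot +
  fixes e :: "'a::finite \<Rightarrow> real^'a" and \<sigma> :: "'a \<Rightarrow> nat"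
  assumes \<sigma>_range: "\<sigma> k \<in> {1..m}"
    and V_span: "i \<in> {1..m} \<Longrightarrow> V i = span (e ` {k. \<sigma> k = i})"
    and e_span: "span (range e) = UNIV"
    and \<sigma>_sum: "(\<Sum>k\<in>UNIV. \<sigma> k) = hom_dim V m"
begin

definition lin_comb :: "real^'a \<Rightarrow> real^'a" where
  "lin_comb x = (\<Sum>k\<in>UNIV. (x $ k) *\<^sub>R e k)"

definition coord :: "real^'a \<Rightarrow> real^'a" where
  "coord = inv lin_comb"

lemma linear_lin_comb: "linear lin_comb"
  by (rule linearI) (simp_all add: lin_comb_def scaleR_add_left sum.distrib scaleR_sum_right)

lemma lin_comb_axis [simp]: "lin_comb (axis k 1) = e k"
proof -
  have "lin_comb (axis k 1) = (\<Sum>i\<in>UNIV. if i = k then e i else 0)"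
    unfolding lin_comb_def by (intro sum.cong) (auto simp: axis_def)
  then show ?thesis by simp
qed

lemma bij_lin_comb: "bij lin_comb"
proof -
  have "range e \<subseteq> range lin_comb" using lin_comb_axis by (metis image_subset_iff rangeI)
  then have "span (range e) \<subseteq> range lin_comb"
    by (rule span_minimal) (rule linear_subspace_image[OF linear_lin_comb subspace_UNIV])
  then have "surj lin_comb" using e_span by blast
  then show ?thesis
    using linear_surjective_imp_injective[OF linear_lin_comb] by (simp add: bij_def)
qed

lemma coord_lin_comb [simp]: "coord (lin_comb x) = x"
  and lin_comb_coord [simp]: "lin_comb (coord x) = x"
  using bij_lin_comb unfolding coord_def
  by (simp_all add: bij_is_inj bij_is_surj surj_f_inv_f)

lemma linear_coord: "linear coord"
proof (rule linearI)
  show "coord (x + y) = coord x + coord y" for x y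
    by (metis coord_lin_comb lin_comb_coord linear_add[OF linear_lin_comb])
  show "coord (r *\<^sub>R x) = r *\<^sub>R coord x" for r x
    by (metis coord_lin_comb lin_comb_coord linear_cmul[OF linear_lin_comb])
qed

lemma coord_e [simp]: "coord (e k) = axis k 1"
  by (metis coord_lin_comb lin_comb_axis)

lemma coord_eqI: "(\<And>k. coord x $ k = coord y $ k) \<Longrightarrow> x = y"
  by (metis lin_comb_coord vec_eq_iff)

lemmas coord_simps = linear_add[OF linear_coord] linear_cmul[OF linear_coord]
  linear_diff[OF linear_coord] linear_neg[OF linear_coord] linear_0[OF linear_coord]

lemma coord_expand: "x = (\<Sum>k\<in>UNIV. (coord x $ k) *\<^sub>R e k)"
  using lin_comb_coord[of x] unfolding lin_comb_def by simp

lemma continuous_coord: "continuous_on S coord"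
  by (rule linear_continuous_on) (use linear_coord linear_conv_bounded_linear in blast)

text \<open>Equal to \<open>V i\<close> for \<open>i \<in> {1..m}\<close>, but \<open>{0}\<close> at
  all other indices, about which nothing is known of \<open>V\<close>. The grading rule for brackets
  then holds for all indices.\<close>

definition layer :: "nat \<Rightarrow> (real^'a) set" where
  "layer i = span (e ` {k. \<sigma> k = i})"

lemma layer_eq_V: "i \<in> {1..m} \<Longrightarrow> layer i = V i"
  using V_span by (simp add: layer_def)

lemma layer_trivial: "i \<notin> {1..m} \<Longrightarrow> layer i = {0}"
proof -
  assume "i \<notin> {1..m}"
  then have "{k. \<sigma> k = i} = {}" using \<sigma>_range by auto
  then show ?thesis by (simp add: layer_def)
qed

lemma subspace_layer: "subspace (layer i)"
  by (simp add: layer_def)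

lemma e_in_layer: "e k \<in> layer (\<sigma> k)"
  unfolding layer_def by (auto intro: span_base)

lemma coord_layer:
  assumes "x \<in> layer i" "\<sigma> k \<noteq> i"
  shows "coord x $ k = 0"
  using assms(1) unfolding layer_def
proof (induction rule: span_induct_alt)
  case (step c x y)
  then obtain l where "x = e l" "\<sigma> l = i" by auto
  then have "coord x $ k = 0" using assms(2) by (auto simp: axis_def)
  with step.IH show ?case by (simp add: coord_simps)
qed (simp add: coord_simps)

lemma m_ge_1: "m \<ge> 1"
  using carnot unfolding carnot_group_def by auto

lemma br_layer_1:
  assumes "v \<in> layer 1" "w \<in> layer j"
  shows "br v w \<in> layer (Suc j)"
proof (cases "j \<in> {1..m}")
  case True
  have V: "v \<in> V 1" "w \<in> V j" using assms layer_eq_V True m_ge_1 by auto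
  show ?thesis
  proof (cases "j < m")
    case True
    then have "V (Suc j) = span {br v w | v w. v \<in> V 1 \<and> w \<in> V j}"
      using carnot \<open>j \<in> {1..m}\<close> unfolding carnot_group_def by auto
    then show ?thesis using V True layer_eq_V[of "Suc j"] by (auto intro: span_base)
  next
    case False
    then have "br v w = 0" using carnot V True unfolding carnot_group_def by auto
    then show ?thesis by (simp add: subspace_0 subspace_layer)
  qed
next
  case False
  then show ?thesis using assms layer_trivial by (auto simp: br_simps subspace_0 subspace_layer)
qed

text \<open>The definition of a Carnot group only speaks of brackets with the first layer. An
  element of layer \<open>Suc i\<close> is a combination of brackets \<open>br a b\<close> with
  \<open>a\<close> in the first layer, and the Jacobi identity reduces \<open>br (br a b) w\<close>
  to brackets with \<open>a\<close> and with \<open>b\<close>, which lies one layer lower.\<close>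

lemma br_layer:
  assumes "v \<in> layer i" "w \<in> layer j"
  shows "br v w \<in> layer (i + j)"
  using assms
proof (induction i arbitrary: j v w)
  case 0
  then have "v = 0" using layer_trivial[of 0] by simp
  then show ?case by (simp add: br_simps subspace_0 subspace_layer)
next
  case (Suc i)
  consider "i = 0" | "i \<ge> 1" "Suc i \<le> m" | "Suc i > m" by linarith
  then show ?case
  proof cases
    case 1
    then show ?thesis using br_layer_1 Suc.prems by simp
  next
    case 2
    then have "V (Suc i) = span {br a b | a b. a \<in> V 1 \<and> b \<in> V i}"
      using carnot unfolding carnot_group_def by auto
    then have "v \<in> span {br a b | a b. a \<in> layer 1 \<and> b \<in> layer i}"
      using Suc.prems 2 layer_eq_V by simp
    then show ?thesis
    proof (induction rule: span_induct_alt)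
      case base
      then show ?case by (simp add: br_simps subspace_0 subspace_layer)
    next
      case (step c x y)
      then obtain a b where ab: "x = br a b" "a \<in> layer 1" "b \<in> layer i" by auto
      have "br x w = br a (br b w) - br b (br a w)"
        using br_jacobi[of a b w] ab(1) by simp
      moreover have "br a (br b w) \<in> layer (Suc i + j)"
        using br_layer_1[OF ab(2) Suc.IH[OF ab(3) Suc.prems(2)]] by simp
      moreover have "br b (br a w) \<in> layer (Suc i + j)"
        using Suc.IH[OF ab(3) br_layer_1[OF ab(2) Suc.prems(2)]] by simp
      ultimately have "br x w \<in> layer (Suc i + j)"
        by (simp add: subspace_diff[OF subspace_layer])
      with step.IH show ?case
        by (simp add: br_simps subspace_add[OF subspace_layer] subspace_mul[OF subspace_layer])
    qed
  next
    case 3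
    then have "v = 0" using Suc.prems layer_trivial[of "Suc i"] by simp
    then show ?thesis by (simp add: br_simps subspace_0 subspace_layer)
  qed
qed

text \<open>The exponents are natural numbers, all at least 1, so \<open>t = 0\<close> is allowed
  and gives the zero map; contracting a configuration to the identity is then plain continuity at
  \<open>t = 0\<close>.\<close>

definition dil :: "real \<Rightarrow> real^'a \<Rightarrow> real^'a" where
  "dil t x = lin_comb (\<chi> k. t ^ \<sigma> k * coord x $ k)"

lemma coord_dil [simp]: "coord (dil t x) $ k = t ^ \<sigma> k * coord x $ k"
  by (simp add: dil_def)

lemma linear_dil: "linear (dil t)"
  by (rule linearI; rule coord_eqI) (simp_all add: coord_simps algebra_simps)

lemma dil_dil [simp]: "dil s (dil t x) = dil (s * t) x"
  by (rule coord_eqI) (simp add: power_mult_distrib)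

lemma dil_1 [simp]: "dil 1 x = x"
  by (rule coord_eqI) simp

lemma dil_0_left [simp]: "dil 0 x = 0"
proof (rule coord_eqI)
  fix k
  have "\<sigma> k > 0" using \<sigma>_range[of k] by simp
  then show "coord (dil 0 x) $ k = coord 0 $ k" by (simp add: coord_simps zero_power)
qed

lemma dil_0_right [simp]: "dil t 0 = 0"
  by (rule linear_0[OF linear_dil])

lemma continuous_dil: "continuous_on S (\<lambda>t. dil t x)"
proof -
  have "dil t x = (\<Sum>k\<in>UNIV. (t ^ \<sigma> k * coord x $ k) *\<^sub>R e k)" for t
    by (simp add: dil_def lin_comb_def)
  then show ?thesis by (simp add: continuous_intros)
qed

lemma continuous_dil_right: "continuous_on S (dil t)"
  by (rule linear_continuous_on) (use linear_dil linear_conv_bounded_linear in blast)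

lemma dil_layer:
  assumes "v \<in> layer i"
  shows "dil t v = t ^ i *\<^sub>R v"
proof (rule coord_eqI)
  show "coord (dil t v) $ k = coord (t ^ i *\<^sub>R v) $ k" for k
    using coord_layer[OF assms, of k] by (cases "\<sigma> k = i") (simp_all add: coord_simps)
qed

lemma dil_br: "dil t (br v w) = br (dil t v) (dil t w)"
proof -
  have 1: "bilinear (\<lambda>v w. dil t (br v w))"
    by (auto simp: bilinear_def intro!: linearI
        simp: br_simps linear_add[OF linear_dil] linear_cmul[OF linear_dil])
  have 2: "bilinear (\<lambda>v w. br (dil t v) (dil t w))"
    by (auto simp: bilinear_def intro!: linearI
        simp: br_simps linear_add[OF linear_dil] linear_cmul[OF linear_dil])
  have "dil t (br (e k) (e l)) = br (dil t (e k)) (dil t (e l))" for k l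
    using dil_layer[OF br_layer[OF e_in_layer e_in_layer]]
    by (simp add: dil_layer[OF e_in_layer] br_simps power_add)
  then show ?thesis
    using bilinear_eq[OF 1 2, of UNIV "range e" UNIV "range e" v w] e_span by auto
qed

text \<open>Along \<open>s *\<^sub>R y\<close> both sides solve \<open>b' = br (dil t y) b\<close>,
  by \<open>dil_br\<close> and \<open>Ad_curve'\<close>. Uniqueness is made explicit: applying
  \<open>Ad (s *\<^sub>R - dil t y)\<close> to the solution \<open>b\<close> gives a curve with zero
  derivative.\<close>

lemma dil_Ad: "dil t (Ad y w) = Ad (dil t y) (dil t w)"
proof -
  define b where "b s = dil t (Ad (s *\<^sub>R y) w)" for s
  have b: "(b has_vector_derivative br (dil t y) (b s)) (at s)" for s
    using bounded_linear.has_vector_derivative[OF linear_conv_bounded_linear[THEN iffD1, OF linear_dil]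
      Ad_curve'] unfolding b_def by (simp add: dil_br)
  have "((\<lambda>s. Ad (s *\<^sub>R - dil t y) (b s)) has_vector_derivative 0) (at s)" for s
  proof -
    have "((\<lambda>s. Ad (s *\<^sub>R - dil t y) (b s)) has_vector_derivative
        Ad (s *\<^sub>R - dil t y) (br (- dil t y) (b s)) + Ad (s *\<^sub>R - dil t y) (br (dil t y) (b s))) (at s)"
    proof (rule has_vector_derivative_linear_family[OF linear_Ad _ Ad_curve b])
      show "linear (\<lambda>x. Ad (s *\<^sub>R - dil t y) (br (- dil t y) x))"
        using linear_compose[OF _ linear_Ad, of "br (- dil t y)"] bilinear_br
        by (auto simp: o_def bilinear_def)
    qed
    moreover have "Ad (s *\<^sub>R - dil t y) (br (- dil t y) (b s)) = - Ad (s *\<^sub>R - dil t y) (br (dil t y) (b s))"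
      by (simp add: br_simps linear_neg[OF linear_Ad])
    ultimately show ?thesis by simp
  qed
  then obtain c where c: "\<And>s. Ad (s *\<^sub>R - dil t y) (b s) = c"
    using has_vector_derivative_zero_constant[of UNIV] by auto
  have "Ad (- dil t y) (dil t (Ad y w)) = dil t w"
    using c[of 1] c[of 0] by (simp add: b_def)
  then have "Ad (dil t y) (Ad (- dil t y) (dil t (Ad y w))) = Ad (dil t y) (dil t w)" by simp
  then show ?thesis by (simp flip: Ad_gmul)
qed

end

section \<open>The differential of the exponential map\<close>

context carnot
begin

lemma has_vector_derivative_affine: "((\<lambda>s::real. a + s *\<^sub>R v) has_vector_derivative v) (at s)"
  by (auto simp: has_vector_derivative_def intro!: derivative_eq_intros)

text \<open>The derivative of left translation by \<open>- y\<close> at \<open>y\<close>, which is the logarithmic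
  derivative of the exponential map; classically it equals \<open>\<integral>\<^sub>0\<^sup>1 Ad (- s y) ds\<close>.\<close>

definition dlog :: "real^'n \<Rightarrow> real^'n \<Rightarrow> real^'n" where
  "dlog y w = dM (- y, y) (0, w)"

lemma linear_dlog: "linear (dlog y)"
  using linear_compose[of "\<lambda>w. (0, w)" "dM (- y, y)"] linear_dM
  unfolding dlog_def by (auto simp: o_def linear_iff)

lemma dlog_0 [simp]: "dlog 0 w = w"
  by (simp add: dlog_def)

text \<open>A discrete form of the integral formula, exact for every \<open>n\<close>. Since
  \<open>x\<close> is the \<open>n\<close>-fold product of \<open>x / n\<close>, the point
  \<open>(- x) \<odot> (x + \<epsilon> *\<^sub>R w)\<close> is a product of \<open>n\<close>
  conjugates of the corresponding expression for \<open>x / n\<close>. At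
  \<open>\<epsilon> = 0\<close> all factors are 0, where the derivative of a product is the sum of
  the derivatives.\<close>

lemma dlog_sum:
  assumes "n > 0"
  shows "dlog x w = (1 / real n) *\<^sub>R (\<Sum>k<n. Ad (- (real k / real n) *\<^sub>R x) (dlog ((1 / real n) *\<^sub>R x) w))"
proof -
  define E where "E k \<epsilon> = (- (real k / real n) *\<^sub>R x) \<odot> ((real k / real n) *\<^sub>R (x + \<epsilon> *\<^sub>R w))" for k and \<epsilon> :: real
  define F where "F \<epsilon> = (- (1 / real n) *\<^sub>R x) \<odot> ((1 / real n) *\<^sub>R (x + \<epsilon> *\<^sub>R w))" for \<epsilon> :: real
  have scaled: "((\<lambda>\<epsilon>. r *\<^sub>R (x + \<epsilon> *\<^sub>R w)) has_vector_derivative r *\<^sub>R w) (at (0::real))" for r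
    by (rule bounded_linear.has_vector_derivative[OF bounded_linear_scaleR_right has_vector_derivative_affine])
  have F: "(F has_vector_derivative (1 / real n) *\<^sub>R dlog ((1 / real n) *\<^sub>R x) w) (at 0)"
  proof -
    have "(F has_vector_derivative dM (- (1 / real n) *\<^sub>R x, (1 / real n) *\<^sub>R (x + 0 *\<^sub>R w)) (0, (1 / real n) *\<^sub>R w)) (at 0)"
      unfolding F_def by (intro gmul_has_vector_derivative scaled has_vector_derivative_const)
    then show ?thesis
      using linear_cmul[OF linear_dlog, of "(1 / real n) *\<^sub>R x" "1 / real n" w] by (simp add: dlog_def)
  qed
  have "(E k has_vector_derivative
      (\<Sum>i<k. Ad (- (real i / real n) *\<^sub>R x) ((1 / real n) *\<^sub>R dlog ((1 / real n) *\<^sub>R x) w))) (at 0)" for k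
  proof (induction k)
    case 0
    then show ?case by (simp add: E_def[abs_def])
  next
    case (Suc k)
    have E: "E (Suc k) = (\<lambda>\<epsilon>. Ad (- (real k / real n) *\<^sub>R x) (F \<epsilon>) \<odot> E k \<epsilon>)"
    proof
      fix \<epsilon> :: real
      have 1: "(- (real k / real n) *\<^sub>R x) \<odot> (- (1 / real n) *\<^sub>R x) = - (real (Suc k) / real n) *\<^sub>R x"
        unfolding gmul_scale by (simp add: add_divide_distrib algebra_simps)
      have 2: "((1 / real n) *\<^sub>R (x + \<epsilon> *\<^sub>R w)) \<odot> ((real k / real n) *\<^sub>R (x + \<epsilon> *\<^sub>R w))
          = (real (Suc k) / real n) *\<^sub>R (x + \<epsilon> *\<^sub>R w)"
        unfolding gmul_scale by (simp add: add_divide_distrib)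
      have "Ad (- (real k / real n) *\<^sub>R x) (F \<epsilon>) \<odot> E k \<epsilon>
          = ((- (real k / real n) *\<^sub>R x) \<odot> (- (1 / real n) *\<^sub>R x))
            \<odot> (((1 / real n) *\<^sub>R (x + \<epsilon> *\<^sub>R w)) \<odot> ((real k / real n) *\<^sub>R (x + \<epsilon> *\<^sub>R w)))"
        unfolding Ad_def E_def F_def by (simp only: gmul_assoc gmul_cancel)
      also have "\<dots> = E (Suc k) \<epsilon>" unfolding 1 2 E_def ..
      finally show "E (Suc k) \<epsilon> = Ad (- (real k / real n) *\<^sub>R x) (F \<epsilon>) \<odot> E k \<epsilon>" ..
    qed
    have 0: "F 0 = 0" "E k 0 = 0" by (simp_all add: F_def E_def)
    have A: "((\<lambda>\<epsilon>. Ad (- (real k / real n) *\<^sub>R x) (F \<epsilon>)) has_vector_derivative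
        Ad (- (real k / real n) *\<^sub>R x) ((1 / real n) *\<^sub>R dlog ((1 / real n) *\<^sub>R x) w)) (at 0)"
      by (rule bounded_linear.has_vector_derivative[OF linear_conv_bounded_linear[THEN iffD1, OF linear_Ad] F])
    from gmul_has_vector_derivative[OF A Suc] 0 show ?case
      unfolding E by (simp add: add.commute)
  qed
  from this[of n] have "((\<lambda>\<epsilon>. (- x) \<odot> (x + \<epsilon> *\<^sub>R w)) has_vector_derivative
      (\<Sum>i<n. Ad (- (real i / real n) *\<^sub>R x) ((1 / real n) *\<^sub>R dlog ((1 / real n) *\<^sub>R x) w))) (at 0)"
    using assms by (simp add: E_def[abs_def])
  moreover have "((\<lambda>\<epsilon>. (- x) \<odot> (x + \<epsilon> *\<^sub>R w)) has_vector_derivative dM (- x, x + 0 *\<^sub>R w) (0, w)) (at 0)"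
    by (intro gmul_has_vector_derivative has_vector_derivative_affine has_vector_derivative_const)
  ultimately show ?thesis
    by (simp add: vector_derivative_unique_at dlog_def scaleR_sum_right linear_cmul[OF linear_Ad])
qed

text \<open>Bounds all terms of \<open>dlog_sum\<close> at once, uniformly in the number
  \<open>n\<close> of summands, as their parameters \<open>k / n\<close> lie in the unit
  interval.\<close>

lemma Ad_bounded_on_segment:
  obtains K where "K > 0" "\<And>s u. s \<in> {0..1} \<Longrightarrow> norm (Ad (- s *\<^sub>R y) u) \<le> K * norm u"
proof -
  have "continuous_on {0..1} (\<lambda>s. Ad (- s *\<^sub>R y) i)" for i
    unfolding Ad_def by (intro continuous_intros)
  then have "compact ((\<lambda>s. Ad (- s *\<^sub>R y) i) ` {0..1})" for i
    by (intro compact_continuous_image) auto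
  then have "\<forall>i. \<exists>K. \<forall>s\<in>{0..1}. norm (Ad (- s *\<^sub>R y) i) \<le> K"
    using compact_imp_bounded by (meson bounded_iff image_eqI)
  then obtain K where K: "\<And>i s. s \<in> {0..1} \<Longrightarrow> norm (Ad (- s *\<^sub>R y) i) \<le> K i" by metis
  have "norm (Ad (- s *\<^sub>R y) u) \<le> (1 + (\<Sum>i\<in>Basis. \<bar>K i\<bar>)) * norm u" if "s \<in> {0..1}" for s u
  proof -
    have "Ad (- s *\<^sub>R y) u = Ad (- s *\<^sub>R y) (\<Sum>i\<in>Basis. (u \<bullet> i) *\<^sub>R i)"
      by (simp add: euclidean_representation)
    also have "\<dots> = (\<Sum>i\<in>Basis. (u \<bullet> i) *\<^sub>R Ad (- s *\<^sub>R y) i)"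
      by (simp only: linear_sum[OF linear_Ad] linear_cmul[OF linear_Ad])
    also have "norm \<dots> \<le> (\<Sum>i\<in>Basis. norm u * \<bar>K i\<bar>)"
    proof (intro sum_norm_le)
      fix i :: "real^'n" assume i: "i \<in> Basis"
      have "norm (Ad (- s *\<^sub>R y) i) \<le> \<bar>K i\<bar>" using K[OF that, of i] by linarith
      then show "norm ((u \<bullet> i) *\<^sub>R Ad (- s *\<^sub>R y) i) \<le> norm u * \<bar>K i\<bar>"
        using Basis_le_norm[OF i, of u] by (simp add: mult_mono)
    qed
    also have "\<dots> \<le> (1 + (\<Sum>i\<in>Basis. \<bar>K i\<bar>)) * norm u"
      by (simp add: sum_distrib_left[symmetric] algebra_simps)
    finally show ?thesis .
  qed
  moreover have "1 + (\<Sum>i\<in>Basis. \<bar>K i\<bar>) > 0" by (simp add: add_pos_nonneg sum_nonneg)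
  ultimately show ?thesis using that by blast
qed

lemma dlog_left: "dlog y (dM (y, 0) (0, v)) = v"
proof -
  have "((\<lambda>s. (- y) \<odot> (y \<odot> (s *\<^sub>R v))) has_vector_derivative
      dM (- y, y \<odot> (0 *\<^sub>R v)) (0, dM (y, 0 *\<^sub>R v) (0, v))) (at (0::real))"
    by (intro gmul_has_vector_derivative has_vector_derivative_scaleR_id has_vector_derivative_const)
  then have "((\<lambda>s. s *\<^sub>R v) has_vector_derivative dlog y (dM (y, 0) (0, v))) (at (0::real))"
    by (simp add: dlog_def)
  with has_vector_derivative_scaleR_id[of v 0] show ?thesis by (simp add: vector_derivative_unique_at)
qed

lemma dlog_right: "dM (y, 0) (0, dlog y w) = w"
proof -
  have "((\<lambda>s. y \<odot> ((- y) \<odot> (y + s *\<^sub>R w))) has_vector_derivative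
      dM (y, (- y) \<odot> (y + 0 *\<^sub>R w)) (0, dM (- y, y + 0 *\<^sub>R w) (0, w))) (at (0::real))"
    by (intro gmul_has_vector_derivative has_vector_derivative_affine has_vector_derivative_const)
  then have "((\<lambda>s. y + s *\<^sub>R w) has_vector_derivative dM (y, 0) (0, dlog y w)) (at (0::real))"
    by (simp add: dlog_def)
  with has_vector_derivative_affine[of y w 0] show ?thesis by (simp add: vector_derivative_unique_at)
qed

lemma has_vector_derivative_shift:
  assumes "(f has_vector_derivative f') (at (0::real))"
  shows "((\<lambda>s. f (s - t)) has_vector_derivative f') (at t)"
proof -
  have "((\<lambda>s. s - t) has_real_derivative 1) (at t)" by (auto intro!: derivative_eq_intros)
  from vector_diff_chain_at[OF this[unfolded has_real_derivative_iff_has_vector_derivative], of f f']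
  show ?thesis using assms by (simp add: o_def)
qed

lemma right_line_derivative:
  "((\<lambda>s. x \<odot> (s *\<^sub>R v)) has_vector_derivative dM (x \<odot> (t *\<^sub>R v), 0) (0, v)) (at t)"
proof -
  have "((\<lambda>h. (x \<odot> (t *\<^sub>R v)) \<odot> (h *\<^sub>R v)) has_vector_derivative
      dM (x \<odot> (t *\<^sub>R v), 0 *\<^sub>R v) (0, v)) (at (0::real))"
    by (intro gmul_has_vector_derivative has_vector_derivative_scaleR_id has_vector_derivative_const)
  then have "((\<lambda>h. (x \<odot> (t *\<^sub>R v)) \<odot> (h *\<^sub>R v)) has_vector_derivative
      dM (x \<odot> (t *\<^sub>R v), 0) (0, v)) (at (0::real))" by simp
  from has_vector_derivative_shift[OF this, of t] show ?thesis
    by (simp add: gmul_assoc gmul_scale)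
qed

end

section \<open>Dilations as group automorphisms\<close>

context graded_carnot
begin

text \<open>The defect \<open>D\<close> satisfies the averaging identity of \<open>dlog_sum\<close>,
  because \<open>dil\<close> commutes with \<open>Ad\<close>. Hence
  \<open>norm (D x) \<le> K * norm (D (x / n))\<close> with \<open>K\<close> independent of
  \<open>n\<close>, and \<open>D\<close> is continuous along the ray and vanishes at 0.\<close>

lemma dil_dlog: "dil t (dlog x w) = dlog (dil t x) (dil t w)"
proof -
  define D where "D x = dil t (dlog x w) - dlog (dil t x) (dil t w)" for x
  obtain K where K: "K > 0" "\<And>s u. s \<in> {0..1} \<Longrightarrow> norm (Ad (- s *\<^sub>R dil t x) u) \<le> K * norm u"
    using Ad_bounded_on_segment by blast
  have rec: "D x = (1 / real n) *\<^sub>R (\<Sum>k<n. Ad (- (real k / real n) *\<^sub>R dil t x) (D ((1 / real n) *\<^sub>R x)))"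
    if "n > 0" for n
    unfolding D_def dlog_sum[OF that, of x] dlog_sum[OF that, of "dil t x"]
    by (simp add: linear_cmul[OF linear_dil] linear_sum[OF linear_dil] dil_Ad linear_neg[OF linear_dil]
        linear_diff[OF linear_Ad] sum_subtractf scaleR_diff_right)
  have le: "norm (D x) \<le> K * norm (D ((1 / real n) *\<^sub>R x))" if "n > 0" for n
  proof -
    have "norm (D x) = (1 / real n) * norm (\<Sum>k<n. Ad (- (real k / real n) *\<^sub>R dil t x) (D ((1 / real n) *\<^sub>R x)))"
      by (subst rec[OF that]) simp
    also have "\<dots> \<le> (1 / real n) * (\<Sum>k<n. K * norm (D ((1 / real n) *\<^sub>R x)))"
      using that by (intro mult_left_mono sum_norm_le K) auto
    also have "\<dots> = K * norm (D ((1 / real n) *\<^sub>R x))" using that by simp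
    finally show ?thesis .
  qed
  have cont: "continuous_on UNIV (\<lambda>s. D (s *\<^sub>R x))"
  proof -
    have "continuous_on UNIV (\<lambda>s. dlog (s *\<^sub>R y) v)" for v y
      unfolding dlog_def
      by (rule continuous_on_compose2[OF continuous_dM[of UNIV]]) (auto intro!: continuous_intros)
    then show ?thesis
      unfolding D_def linear_cmul[OF linear_dil]
      by (intro continuous_intros continuous_on_compose2[OF continuous_dil_right[of UNIV]]) auto
  qed
  have "(\<lambda>n. D ((1 / real (Suc n)) *\<^sub>R x)) \<longlonglongrightarrow> D (0 *\<^sub>R x)"
    by (rule continuous_on_tendsto_compose[OF cont LIMSEQ_Suc[OF lim_1_over_n]]) auto
  then have "(\<lambda>n. K * norm (D ((1 / real (Suc n)) *\<^sub>R x))) \<longlonglongrightarrow> K * norm (D (0 *\<^sub>R x))"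
    by (intro tendsto_intros)
  then have "norm (D x) \<le> K * norm (D (0 *\<^sub>R x))"
    by (rule LIMSEQ_le_const) (use le[of "Suc _"] in blast)
  then have "D x = 0" by (simp add: D_def)
  then show ?thesis by (simp add: D_def)
qed

lemma dil_left_field: "dil t (dM (y, 0) (0, v)) = dM (dil t y, 0) (0, dil t v)"
proof -
  have "dlog (dil t y) (dil t (dM (y, 0) (0, v))) = dil t v"
    by (simp only: dil_dlog[symmetric] dlog_left)
  then show ?thesis by (metis dlog_right)
qed

text \<open>The dilated line \<open>\<gamma>\<close> follows the left-invariant field of
  \<open>dil t v\<close>, by \<open>dil_left_field\<close>, and the flow of that field is right
  translation by \<open>s *\<^sub>R dil t v\<close>. Undoing this translation leaves a curve that
  does not move.\<close>

theorem dil_gmul: "dil t (x \<odot> v) = dil t x \<odot> dil t v"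
proof -
  define \<gamma> where "\<gamma> s = dil t (x \<odot> (s *\<^sub>R v))" for s :: real
  have \<gamma>: "(\<gamma> has_vector_derivative dM (\<gamma> s, 0) (0, dil t v)) (at s)" for s
    unfolding \<gamma>_def dil_left_field[symmetric]
    by (rule bounded_linear.has_vector_derivative[OF linear_conv_bounded_linear[THEN iffD1, OF linear_dil]
        right_line_derivative])
  have "((\<lambda>s. \<gamma> s \<odot> (s *\<^sub>R (- dil t v))) has_vector_derivative 0) (at s)" for s
  proof -
    \<comment> \<open>The right factor vanishes at \<open>r = s\<close>, so only the derivative of
      the law at \<open>(\<gamma> s, 0)\<close> enters and the two contributions cancel. Multiplying
      afterwards by the constant \<open>s *\<^sub>R (- dil t v)\<close> restores the curve in
      question.\<close>
    have 1: "((\<lambda>r. (r - s) *\<^sub>R (- dil t v)) has_vector_derivative - dil t v) (at s)"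
      by (rule has_vector_derivative_shift[OF has_vector_derivative_scaleR_id])
    have "((\<lambda>r. \<gamma> r \<odot> ((r - s) *\<^sub>R (- dil t v))) has_vector_derivative
        dM (\<gamma> s, (s - s) *\<^sub>R (- dil t v)) (dM (\<gamma> s, 0) (0, dil t v), - dil t v)) (at s)"
      by (rule gmul_has_vector_derivative[OF \<gamma> 1])
    moreover have "dM (\<gamma> s, 0) (0, - dil t v) = - dM (\<gamma> s, 0) (0, dil t v)"
      using linear_neg[OF linear_dM, of "(0, dil t v)"] by simp
    ultimately have "((\<lambda>r. \<gamma> r \<odot> ((r - s) *\<^sub>R (- dil t v))) has_vector_derivative 0) (at s)"
      by (simp add: dM_split[of "dM (\<gamma> s, 0) (0, dil t v)" "- dil t v"])
    from gmul_has_vector_derivative[OF this has_vector_derivative_const, of "s *\<^sub>R (- dil t v)"]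
    show ?thesis
      using linear_0[OF linear_dM] by (simp add: gmul_assoc gmul_scale zero_prod_def del: scaleR_minus_right)
  qed
  then obtain c where c: "\<And>s. \<gamma> s \<odot> (s *\<^sub>R (- dil t v)) = c"
    using has_vector_derivative_zero_constant[of UNIV] by auto
  have "dil t (x \<odot> v) \<odot> (- dil t v) = dil t x"
    using c[of 1] c[of 0] by (simp add: \<gamma>_def)
  then have "(dil t (x \<odot> v) \<odot> (- dil t v)) \<odot> dil t v = dil t x \<odot> dil t v" by simp
  then show ?thesis by simp
qed

lemma dM_dil: "dM (dil t x, dil t y) (dil t a, dil t b) = dil t (dM (x, y) (a, b))"
proof -
  have "((\<lambda>s. dil t ((x + s *\<^sub>R a) \<odot> (y + s *\<^sub>R b))) has_vector_derivative
      dil t (dM (x + 0 *\<^sub>R a, y + 0 *\<^sub>R b) (a, b))) (at (0::real))"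
    by (intro bounded_linear.has_vector_derivative[OF linear_conv_bounded_linear[THEN iffD1, OF linear_dil]]
        gmul_has_vector_derivative has_vector_derivative_affine)
  moreover have "((\<lambda>s. (dil t x + s *\<^sub>R dil t a) \<odot> (dil t y + s *\<^sub>R dil t b)) has_vector_derivative
      dM (dil t x + 0 *\<^sub>R dil t a, dil t y + 0 *\<^sub>R dil t b) (dil t a, dil t b)) (at (0::real))"
    by (intro gmul_has_vector_derivative has_vector_derivative_affine)
  ultimately show ?thesis
    by (simp add: dil_gmul linear_add[OF linear_dil] linear_cmul[OF linear_dil] vector_derivative_unique_at)
qed

text \<open>Scaling a point to the identity shows that every translation is unipotent with respect
  to the filtration by \<open>\<sigma>\<close>.\<close>

lemma coord_dM_unipotent:
  assumes ab: "\<And>l. \<sigma> l < \<sigma> k \<Longrightarrow> coord a $ l = 0 \<and> coord b $ l = 0"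
  shows "coord (dM (x, y) (a, b)) $ k = coord a $ k + coord b $ k"
proof -
  have basis: "coord (dM (x, y) (c *\<^sub>R e l, d *\<^sub>R e l)) $ k = (c + d) * coord (e l) $ k" if "\<sigma> k \<le> \<sigma> l" for c d l
  proof -
    have tend: "(\<lambda>n. coord (dM (dil (1 / real (Suc n)) x, dil (1 / real (Suc n)) y) (c *\<^sub>R e l, d *\<^sub>R e l)) $ k)
        \<longlonglongrightarrow> coord (dM (dil 0 x, dil 0 y) (c *\<^sub>R e l, d *\<^sub>R e l)) $ k"
    proof -
      have "continuous_on UNIV (\<lambda>t. coord (dM (dil t x, dil t y) (c *\<^sub>R e l, d *\<^sub>R e l)) $ k)"
        by (intro continuous_intros continuous_on_compose2[OF continuous_coord[of UNIV]]
            continuous_on_compose2[OF continuous_dM[of UNIV]] continuous_dil) auto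
      from continuous_on_tendsto_compose[OF this LIMSEQ_Suc[OF lim_1_over_n]] show ?thesis by simp
    qed
    \<comment> \<open>Both increments lie in layer \<open>\<sigma> l\<close>, so dilating them by
      \<open>t\<close> multiplies them by \<open>t ^ \<sigma> l\<close>, while the
      \<open>k\<close>-th coordinate of the image is multiplied by \<open>t ^ \<sigma> k\<close>.
      The left side is independent of \<open>t\<close>, which may therefore tend to 0.\<close>
    have eq: "coord (dM (x, y) (c *\<^sub>R e l, d *\<^sub>R e l)) $ k
        = t ^ (\<sigma> l - \<sigma> k) * coord (dM (dil t x, dil t y) (c *\<^sub>R e l, d *\<^sub>R e l)) $ k" if "t > 0" for t
    proof -
      have "t ^ \<sigma> l *\<^sub>R dM (dil t x, dil t y) (c *\<^sub>R e l, d *\<^sub>R e l)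
          = dM (dil t x, dil t y) (dil t (c *\<^sub>R e l), dil t (d *\<^sub>R e l))"
        using linear_cmul[OF linear_dM, of "t ^ \<sigma> l" "(c *\<^sub>R e l, d *\<^sub>R e l)"]
        by (simp add: linear_cmul[OF linear_dil] dil_layer[OF e_in_layer] mult.commute)
      also have "\<dots> = dil t (dM (x, y) (c *\<^sub>R e l, d *\<^sub>R e l))" by (rule dM_dil)
      finally have "t ^ \<sigma> k * coord (dM (x, y) (c *\<^sub>R e l, d *\<^sub>R e l)) $ k
          = t ^ \<sigma> l * coord (dM (dil t x, dil t y) (c *\<^sub>R e l, d *\<^sub>R e l)) $ k"
        by (metis coord_dil coord_simps(2) vector_scaleR_component real_scaleR_def)
      then have "t ^ \<sigma> k * coord (dM (x, y) (c *\<^sub>R e l, d *\<^sub>R e l)) $ k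
          = t ^ \<sigma> k * (t ^ (\<sigma> l - \<sigma> k) * coord (dM (dil t x, dil t y) (c *\<^sub>R e l, d *\<^sub>R e l)) $ k)"
        using \<open>\<sigma> k \<le> \<sigma> l\<close> by (simp flip: power_add mult.assoc)
      then show ?thesis using that by simp
    qed
    have "(\<lambda>n. (1 / real (Suc n)) ^ (\<sigma> l - \<sigma> k) * coord (dM (dil (1 / real (Suc n)) x, dil (1 / real (Suc n)) y) (c *\<^sub>R e l, d *\<^sub>R e l)) $ k)
        \<longlonglongrightarrow> 0 ^ (\<sigma> l - \<sigma> k) * coord (dM (dil 0 x, dil 0 y) (c *\<^sub>R e l, d *\<^sub>R e l)) $ k"
      by (intro tendsto_intros tend LIMSEQ_Suc[OF lim_1_over_n])
    moreover have "(1 / real (Suc n)) ^ (\<sigma> l - \<sigma> k) * coord (dM (dil (1 / real (Suc n)) x, dil (1 / real (Suc n)) y) (c *\<^sub>R e l, d *\<^sub>R e l)) $ k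
        = coord (dM (x, y) (c *\<^sub>R e l, d *\<^sub>R e l)) $ k" for n
      by (rule eq[symmetric]) simp
    \<comment> \<open>Here \<open>0 ^ 0 = 1\<close> matters: for equal weights the increments
      survive and are added, for \<open>\<sigma> l > \<sigma> k\<close> the limit is 0.\<close>
    ultimately have lim: "coord (dM (x, y) (c *\<^sub>R e l, d *\<^sub>R e l)) $ k = 0 ^ (\<sigma> l - \<sigma> k) * coord (c *\<^sub>R e l + d *\<^sub>R e l) $ k"
      by (simp only: LIMSEQ_const_iff dil_0_left dM_0)
    show ?thesis
    proof (cases "\<sigma> l = \<sigma> k")
      case True
      then show ?thesis using lim by (simp add: coord_simps algebra_simps)
    next
      case False
      then have "k \<noteq> l" "\<sigma> l - \<sigma> k > 0" using \<open>\<sigma> k \<le> \<sigma> l\<close> by auto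
      then show ?thesis using lim by (simp add: axis_def)
    qed
  qed
  have "dM (x, y) (a, b) = dM (x, y) (\<Sum>l\<in>UNIV. (coord a $ l *\<^sub>R e l, coord b $ l *\<^sub>R e l))"
    using coord_expand[of a] coord_expand[of b] by (simp add: sum_prod)
  also have "\<dots> = (\<Sum>l\<in>UNIV. dM (x, y) (coord a $ l *\<^sub>R e l, coord b $ l *\<^sub>R e l))"
    by (rule linear_sum[OF linear_dM])
  finally have "coord (dM (x, y) (a, b)) $ k
      = (\<Sum>l\<in>UNIV. coord (dM (x, y) (coord a $ l *\<^sub>R e l, coord b $ l *\<^sub>R e l)) $ k)"
    by (simp add: linear_sum[OF linear_coord])
  also have "\<dots> = (\<Sum>l\<in>UNIV. (coord a $ l + coord b $ l) * coord (e l) $ k)"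
  proof (intro sum.cong refl)
    fix l
    show "coord (dM (x, y) (coord a $ l *\<^sub>R e l, coord b $ l *\<^sub>R e l)) $ k
        = (coord a $ l + coord b $ l) * coord (e l) $ k"
    proof (cases "\<sigma> k \<le> \<sigma> l")
      case True
      then show ?thesis by (rule basis)
    next
      case False
      then show ?thesis using ab[of l] linear_0[OF linear_dM]
        by (simp add: zero_prod_def[symmetric] coord_simps)
    qed
  qed
  also have "\<dots> = (\<Sum>l\<in>UNIV. if l = k then coord a $ l + coord b $ l else 0)"
    by (intro sum.cong) (auto simp: axis_def)
  finally show ?thesis by simp
qed

section \<open>Generation by horizontal elements\<close>

lemma real_const_slope:
  fixes f :: "real \<Rightarrow> real"
  assumes "\<And>s. (f has_real_derivative c) (at s)"
  shows "f 1 = f 0 + c"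
proof -
  have "((\<lambda>s. f s - s * c) has_real_derivative 0) (at s)" for s
    using assms by (auto intro!: derivative_eq_intros)
  then have "f 1 - 1 * c = f 0 - 0 * c"
    by (intro DERIV_isconst_all) auto
  then show ?thesis by simp
qed

lemma coord_has_derivative:
  assumes "(f has_vector_derivative f') (at s)"
  shows "((\<lambda>s. coord (f s) $ k) has_real_derivative coord f' $ k) (at s)"
proof -
  have "bounded_linear (\<lambda>x. coord x $ k)"
    using linear_compose[OF linear_coord, of "\<lambda>x. x $ k"]
    by (auto simp: o_def linear_conv_bounded_linear intro: bounded_linear_vec_nth bounded_linear_compose)
  from bounded_linear.has_vector_derivative[OF this assms]
  show ?thesis by (simp add: has_real_derivative_iff_has_vector_derivative)
qed

text \<open>The derivative in \<open>coord_dM_unipotent\<close> is constant along the segment, so it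
  integrates exactly: in the lowest weight that is changed, the group law acts as addition.\<close>

lemma coord_gmul_add:
  assumes "\<And>l. \<sigma> l < \<sigma> k \<Longrightarrow> coord a $ l = 0 \<and> coord b $ l = 0"
  shows "coord ((x + a) \<odot> (y + b)) $ k = coord (x \<odot> y) $ k + coord a $ k + coord b $ k"
proof -
  have "((\<lambda>s. coord ((x + s *\<^sub>R a) \<odot> (y + s *\<^sub>R b)) $ k) has_real_derivative coord a $ k + coord b $ k) (at s)" for s
  proof -
    have "coord (dM (x + s *\<^sub>R a, y + s *\<^sub>R b) (a, b)) $ k = coord a $ k + coord b $ k"
      by (rule coord_dM_unipotent[OF assms])
    then show ?thesis
      using coord_has_derivative[OF gmul_has_vector_derivative[OF has_vector_derivative_affine[of x a s]
          has_vector_derivative_affine[of y b s]], of k] by simp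
  qed
  from real_const_slope[OF this] show ?thesis by simp
qed

lemma coord_Ad:
  assumes z: "\<And>l. \<sigma> l < \<sigma> k \<Longrightarrow> coord z $ l = 0"
  shows "coord (Ad g z) $ k = coord z $ k"
proof -
  define a where "a = g \<odot> z - g"
  have a: "coord a $ l = coord z $ l" if "\<sigma> l \<le> \<sigma> k" for l
  proof -
    have "coord ((g + 0) \<odot> (0 + z)) $ l = coord (g \<odot> 0) $ l + coord 0 $ l + coord z $ l"
      by (rule coord_gmul_add) (use that z in \<open>auto simp: coord_simps\<close>)
    then show ?thesis by (simp add: a_def coord_simps)
  qed
  have "coord ((g + a) \<odot> (- g + 0)) $ k = coord (g \<odot> (- g)) $ k + coord a $ k + coord 0 $ k"
    by (rule coord_gmul_add) (use a z in \<open>auto simp: coord_simps\<close>)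
  then show ?thesis using a[of k] by (simp add: a_def Ad_def coord_simps)
qed

primrec wprod :: "(real^'a) list \<Rightarrow> real^'a" where
  "wprod [] = 0"
| "wprod (v # vs) = v \<odot> wprod vs"

lemma wprod_append: "wprod (vs @ ws) = wprod vs \<odot> wprod ws"
  by (induction vs) (simp_all add: gmul_assoc)

lemma wprod_minus: "wprod (map uminus (rev vs)) = - wprod vs"
  by (induction vs) (simp_all add: wprod_append minus_gmul)

lemma wprod_dil: "wprod (map (dil t) vs) = dil t (wprod vs)"
  by (induction vs) (simp_all add: dil_gmul)

lemma wprod_replicate_0: "wprod (replicate n 0) = 0"
  by (induction n) simp_all

definition horizontal :: "(real^'a) set" where
  "horizontal = {wprod vs |vs. set vs \<subseteq> layer 1}"

lemma horizontal_0: "0 \<in> horizontal"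
  unfolding horizontal_def by (auto intro!: exI[of _ "[]"])

lemma horizontal_layer: "v \<in> layer 1 \<Longrightarrow> v \<in> horizontal"
  unfolding horizontal_def by (auto intro!: exI[of _ "[v]"])

lemma horizontal_gmul:
  assumes "x \<in> horizontal" "y \<in> horizontal"
  shows "x \<odot> y \<in> horizontal"
proof -
  obtain vs ws where "x = wprod vs" "set vs \<subseteq> layer 1" "y = wprod ws" "set ws \<subseteq> layer 1"
    using assms unfolding horizontal_def by blast
  then have "x \<odot> y = wprod (vs @ ws)" "set (vs @ ws) \<subseteq> layer 1" by (simp_all add: wprod_append)
  then show ?thesis unfolding horizontal_def by blast
qed

lemma horizontal_minus:
  assumes "x \<in> horizontal"
  shows "- x \<in> horizontal"
proof -
  obtain vs where "x = wprod vs" "set vs \<subseteq> layer 1"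
    using assms unfolding horizontal_def by blast
  then have "- x = wprod (map uminus (rev vs))" "set (map uminus (rev vs)) \<subseteq> layer 1"
    using subspace_neg[OF subspace_layer] by (simp_all only: wprod_minus) auto
  then show ?thesis unfolding horizontal_def by blast
qed

text \<open>The group commutator of \<open>a\<close> with a word \<open>h\<close> that imitates
  \<open>b\<close> imitates the bracket. As \<open>br a\<close> raises weights by one, it sees in
  weights up to \<open>Suc i\<close> only the coordinates of \<open>h\<close> of weight at most
  \<open>i\<close>, and there \<open>h\<close> agrees with \<open>b\<close>.\<close>

lemma horizontal_br:
  assumes a: "a \<in> layer 1" and b: "b \<in> layer i" and h: "h \<in> horizontal"
    and hb: "\<And>k. \<sigma> k \<le> i \<Longrightarrow> coord h $ k = coord b $ k"
  shows "\<exists>g\<in>horizontal. \<forall>k. \<sigma> k \<le> Suc i \<longrightarrow> coord g $ k = coord (br a b) $ k"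
proof -
  have low: "coord (br a b) $ k = 0" if "\<sigma> k \<le> i" for k
    using coord_layer[OF br_layer[OF a b]] that by auto
  have br_h: "coord (br a h) $ k = coord (br a b) $ k" if "\<sigma> k \<le> Suc i" for k
  proof -
    have "br a (h - b) = br a (\<Sum>l\<in>UNIV. coord (h - b) $ l *\<^sub>R e l)"
      using coord_expand[of "h - b"] by simp
    also have "\<dots> = (\<Sum>l\<in>UNIV. coord (h - b) $ l *\<^sub>R br a (e l))"
      using bilinear_br by (simp add: bilinear_def linear_sum linear_cmul)
    finally have "coord (br a (h - b)) $ k = (\<Sum>l\<in>UNIV. coord (h - b) $ l * coord (br a (e l)) $ k)"
      by (simp add: linear_sum[OF linear_coord] coord_simps)
    also have "\<dots> = 0"
    proof (rule sum.neutral, rule ballI)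
      fix l
      show "coord (h - b) $ l * coord (br a (e l)) $ k = 0"
      proof (cases "\<sigma> l \<le> i")
        case True
        then show ?thesis using hb[of l] by (simp add: coord_simps)
      next
        case False
        then show ?thesis
          using coord_layer[OF br_layer[OF a e_in_layer[of l]], of k] that by simp
      qed
    qed
    finally show ?thesis by (simp add: br_simps coord_simps)
  qed
  define z where "z = Ad a h - h"
  have z: "coord z $ k = coord (br a b) $ k" if "\<sigma> k \<le> Suc i" for k
  proof -
    have "((\<lambda>s. coord (Ad (s *\<^sub>R a) h) $ k) has_real_derivative coord (br a b) $ k) (at s)" for s
    proof -
      have "coord (Ad (s *\<^sub>R a) (br a h)) $ k = coord (br a h) $ k"
        by (rule coord_Ad) (use that br_h low in auto)
      then show ?thesis
        using coord_has_derivative[OF Ad_curve[of a h s], of k] br_h[OF that] by simp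
    qed
    from real_const_slope[OF this] show ?thesis by (simp add: z_def coord_simps)
  qed
  have "coord ((h + z) \<odot> (- h + 0)) $ k = coord (h \<odot> (- h)) $ k + coord z $ k + coord 0 $ k"
    if "\<sigma> k \<le> Suc i" for k
    by (rule coord_gmul_add) (use that z low in \<open>auto simp: coord_simps\<close>)
  then have "\<forall>k. \<sigma> k \<le> Suc i \<longrightarrow> coord (Ad a h \<odot> (- h)) $ k = coord (br a b) $ k"
    using z by (simp add: z_def coord_simps)
  moreover have "Ad a h \<odot> (- h) \<in> horizontal"
    unfolding Ad_def by (intro horizontal_gmul horizontal_minus horizontal_layer a h)
  ultimately show ?thesis by blast
qed

lemma horizontal_layer_approx:
  assumes "i \<ge> 1" "w \<in> layer i"
  shows "\<exists>h\<in>horizontal. \<forall>k. \<sigma> k \<le> i \<longrightarrow> coord h $ k = coord w $ k"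
  using assms
proof (induction i arbitrary: w rule: nat_induct_at_least)
  case base
  then show ?case using horizontal_layer by auto
next
  case (Suc i)
  show ?case
  proof (cases "Suc i \<le> m")
    case False
    then have "w = 0" using Suc.prems layer_trivial[of "Suc i"] by simp
    then show ?thesis using horizontal_0 by auto
  next
    case True
    then have "V (Suc i) = span {br a b | a b. a \<in> V 1 \<and> b \<in> V i}"
      using carnot Suc.hyps unfolding carnot_group_def by auto
    then have "w \<in> span {br a b | a b. a \<in> layer 1 \<and> b \<in> layer i}"
      using Suc.prems Suc.hyps True layer_eq_V by simp
    \<comment> \<open>Vanishing in weights up to \<open>i\<close> is carried through the induction
      because \<open>coord_gmul_add\<close> needs it in order to add the coordinates of two words in
      weight \<open>Suc i\<close>.\<close>
    then have "(\<forall>k. \<sigma> k \<le> i \<longrightarrow> coord w $ k = 0) \<and>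
      (\<exists>h\<in>horizontal. \<forall>k. \<sigma> k \<le> Suc i \<longrightarrow> coord h $ k = coord w $ k)"
    proof (induction rule: span_induct_alt)
      case base
      then show ?case using horizontal_0 by (auto simp: coord_simps intro!: bexI[of _ 0])
    next
      case (step c x y)
      then obtain a b where ab: "x = br a b" "a \<in> layer 1" "b \<in> layer i" by auto
      \<comment> \<open>The scalar is moved into the horizontal factor of the bracket, because
        \<open>horizontal\<close> is known to be closed only under products and inverses.\<close>
      have ca: "c *\<^sub>R a \<in> layer 1" using ab(2) subspace_mul[OF subspace_layer] by blast
      have cx: "br (c *\<^sub>R a) b = c *\<^sub>R x" by (simp add: ab(1) br_simps)
      obtain h where "h \<in> horizontal" "\<And>k. \<sigma> k \<le> i \<Longrightarrow> coord h $ k = coord b $ k"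
        using Suc.IH[OF ab(3)] by blast
      from horizontal_br[OF ca ab(3) this] obtain g where g: "g \<in> horizontal"
        "\<And>k. \<sigma> k \<le> Suc i \<Longrightarrow> coord g $ k = coord (c *\<^sub>R x) $ k"
        unfolding cx by blast
      obtain h' where h': "h' \<in> horizontal" "\<And>k. \<sigma> k \<le> Suc i \<Longrightarrow> coord h' $ k = coord y $ k"
        and y: "\<And>k. \<sigma> k \<le> i \<Longrightarrow> coord y $ k = 0" using step.IH by blast
      have x: "coord (c *\<^sub>R x) $ k = 0" if "\<sigma> k \<le> i" for k
        using coord_layer[OF br_layer[OF ca ab(3)], of k] that unfolding cx by auto
      have "coord ((0 + g) \<odot> (0 + h')) $ k = coord (0 \<odot> 0) $ k + coord g $ k + coord h' $ k"
        if "\<sigma> k \<le> Suc i" for k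
        by (rule coord_gmul_add) (use that g h' x y in auto)
      then have "\<forall>k. \<sigma> k \<le> Suc i \<longrightarrow> coord (g \<odot> h') $ k = coord (c *\<^sub>R x + y) $ k"
        using g h' by (simp add: coord_simps)
      moreover have "\<forall>k. \<sigma> k \<le> i \<longrightarrow> coord (c *\<^sub>R x + y) $ k = 0"
        using x y by (simp add: coord_simps)
      ultimately show ?case using horizontal_gmul[OF g(1) h'(1)] by blast
    qed
    then show ?thesis by blast
  qed
qed

text \<open>Descending induction on the lowest weight of \<open>x\<close>: multiplying from the left
  by the inverse of a word that matches \<open>x\<close> in this weight pushes \<open>x\<close> into
  higher weights, and beyond weight \<open>m\<close> only 0 is left.\<close>

lemma horizontal_downward:
  assumes "\<And>k. \<sigma> k < Suc m - j \<Longrightarrow> coord x $ k = 0"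
  shows "x \<in> horizontal"
  using assms
proof (induction j arbitrary: x)
  case 0
  then have "x = 0" using \<sigma>_range by (intro coord_eqI) (auto simp: coord_simps less_Suc_eq_le)
  then show ?case using horizontal_0 by simp
next
  case (Suc j)
  show ?case
  proof (cases "m - j = 0")
    case True
    \<comment> \<open>Subtraction is truncated: \<open>m \<le> j\<close> gives
      \<open>Suc m - j \<le> 1\<close>, and no weight lies below 1.\<close>
    have "\<not> \<sigma> k < Suc m - j" for k using \<sigma>_range[of k] True by auto
    then show ?thesis using Suc.IH by blast
  next
    case False
    define i where "i = m - j"
    define w where "w = (\<Sum>k\<in>{k. \<sigma> k = i}. coord x $ k *\<^sub>R e k)"
    have i: "i \<ge> 1" "Suc m - j = Suc i" "Suc m - Suc j = i" using False by (auto simp: i_def)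
    have w: "w \<in> layer i" unfolding w_def layer_def
      by (intro span_sum span_mul span_base) auto
    have "coord w $ k = (\<Sum>l\<in>{k. \<sigma> k = i}. if l = k then coord x $ k else 0)" for k
      unfolding w_def by (simp add: linear_sum[OF linear_coord] coord_simps axis_def if_distrib cong: if_cong sum.cong)
    then have wk: "coord w $ k = coord x $ k" if "\<sigma> k \<le> i" for k
      using that Suc.prems[of k] unfolding i(3) by (auto simp: order_le_less)
    obtain h where h: "h \<in> horizontal" "\<And>k. \<sigma> k \<le> i \<Longrightarrow> coord h $ k = coord w $ k"
      using horizontal_layer_approx[OF i(1) w] by blast
    have "coord ((- h + 0) \<odot> (h + (x - h))) $ k = coord ((- h) \<odot> h) $ k + coord 0 $ k + coord (x - h) $ k"
      if "\<sigma> k \<le> i" for k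
      by (rule coord_gmul_add) (use that h wk in \<open>auto simp: coord_simps\<close>)
    then have "(- h) \<odot> x \<in> horizontal"
      using h wk by (intro Suc.IH) (simp add: i(2) coord_simps less_Suc_eq_le)
    then have "h \<odot> ((- h) \<odot> x) \<in> horizontal" by (rule horizontal_gmul[OF h(1)])
    then show ?thesis by simp
  qed
qed

lemma horizontal_UNIV: "x \<in> horizontal"
  by (rule horizontal_downward[of "Suc m"]) simp

lemma compact_words:
  assumes "compact K"
  shows "compact {wprod vs |vs. length vs = n \<and> set vs \<subseteq> K}"
proof (induction n)
  case 0
  have "{wprod vs |vs. length vs = 0 \<and> set vs \<subseteq> K} = {0}" by auto
  then show ?case by simp
next
  case (Suc n)
  let ?Q = "{wprod vs |vs. length vs = n \<and> set vs \<subseteq> K}"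
  have "{wprod vs |vs. length vs = Suc n \<and> set vs \<subseteq> K} = (\<lambda>z. fst z \<odot> snd z) ` (K \<times> ?Q)"
  proof (intro equalityI subsetI)
    fix x assume "x \<in> {wprod vs |vs. length vs = Suc n \<and> set vs \<subseteq> K}"
    then obtain v vs where "x = v \<odot> wprod vs" "length vs = n" "v \<in> K" "set vs \<subseteq> K"
      by (auto simp: length_Suc_conv)
    then show "x \<in> (\<lambda>z. fst z \<odot> snd z) ` (K \<times> ?Q)"
      by (intro image_eqI[of _ _ "(v, wprod vs)"]) auto
  next
    fix x assume "x \<in> (\<lambda>z. fst z \<odot> snd z) ` (K \<times> ?Q)"
    then obtain v vs where "x = v \<odot> wprod vs" "length vs = n" "v \<in> K" "set vs \<subseteq> K" by auto
    then show "x \<in> {wprod vs |vs. length vs = Suc n \<and> set vs \<subseteq> K}"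
      by (auto intro!: exI[of _ "v # vs"])
  qed
  then show ?case
    using compact_Times[OF assms Suc] by (auto intro!: compact_continuous_image continuous_intros)
qed

text \<open>Chow's theorem in the quantitative form needed here, obtained from Baire's theorem.\<close>

lemma ball_subset_words:
  obtains \<epsilon> N R where "\<epsilon> > 0" "R > 0"
    "ball 0 \<epsilon> \<subseteq> {wprod vs |vs. length vs = N \<and> set vs \<subseteq> layer 1 \<inter> cball 0 R}"
proof -
  \<comment> \<open>One index bounds both the number of letters and their norms, so countably many
    closed sets exhaust the group; shorter words are padded with the letter 0.\<close>
  define K where "K n = layer 1 \<inter> cball 0 (real n)" for n
  define P where "P n = {wprod vs |vs. length vs = n \<and> set vs \<subseteq> K n}" for n
  have "closed (layer 1)" unfolding layer_def by (rule closed_subspace) simp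
  then have "compact (K n)" for n unfolding K_def by (simp add: closed_Int_compact)
  then have P: "closed (P n)" for n
    unfolding P_def using compact_words compact_imp_closed by blast
  have cover: "\<exists>n. x \<in> P n" for x
  proof -
    obtain vs where vs: "x = wprod vs" "set vs \<subseteq> layer 1"
      using horizontal_UNIV[of x] unfolding horizontal_def by blast
    obtain b where b: "\<And>v. v \<in> set vs \<Longrightarrow> norm v \<le> b"
      using finite_imp_bounded[of "set vs"] by (auto simp: bounded_iff)
    define n where "n = max (length vs) (nat \<lceil>b\<rceil>)"
    have "wprod (vs @ replicate (n - length vs) 0) = x"
      by (simp add: wprod_append wprod_replicate_0 vs)
    moreover have "length (vs @ replicate (n - length vs) 0) = n" by (simp add: n_def)
    moreover have "set (vs @ replicate (n - length vs) 0) \<subseteq> K n"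
    proof
      fix v assume "v \<in> set (vs @ replicate (n - length vs) 0)"
      then have "v \<in> set vs \<or> v = 0" by (auto simp: in_set_replicate split: if_splits)
      then show "v \<in> K n"
      proof
        assume v: "v \<in> set vs"
        have "norm v \<le> real n" using b[OF v] unfolding n_def by linarith
        then show ?thesis using v vs by (auto simp: K_def)
      qed (auto simp: K_def subspace_0[OF subspace_layer])
    qed
    ultimately show ?thesis unfolding P_def by (intro exI[of _ n]) blast
  qed
  have "\<exists>n. interior (P n) \<noteq> {}"
  proof (rule ccontr)
    assume "\<nexists>n. interior (P n) \<noteq> {}"
    then have "closure (- P n) = UNIV" for n by (simp add: closure_complement)
    then have "UNIV \<subseteq> closure (\<Inter> (range (\<lambda>n. - P n)))"
      by (intro Baire) (auto intro: P)
    moreover have "\<Inter> (range (\<lambda>n. - P n)) = {}" using cover by auto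
    ultimately show False by (metis closure_empty UNIV_I empty_iff subsetD)
  qed
  then obtain n a where a: "a \<in> interior (P n)" by blast
  have "open ((\<lambda>x. a \<odot> x) -` interior (P n))"
    by (intro open_vimage open_interior continuous_intros)
  moreover have "0 \<in> (\<lambda>x. a \<odot> x) -` interior (P n)" using a by simp
  ultimately obtain \<epsilon> where \<epsilon>: "\<epsilon> > 0" "ball 0 \<epsilon> \<subseteq> (\<lambda>x. a \<odot> x) -` interior (P n)"
    using open_contains_ball by metis
  \<comment> \<open>Writing \<open>x\<close> as \<open>(- a) \<odot> (a \<odot> x)\<close> turns a
    neighbourhood of the interior point \<open>a\<close> into one of 0 at the price of doubling the
    word length. The radius \<open>real n + 1\<close> is positive even for
    \<open>n = 0\<close>.\<close>
  have "ball 0 \<epsilon> \<subseteq> {wprod vs |vs. length vs = n + n \<and> set vs \<subseteq> layer 1 \<inter> cball 0 (real n + 1)}"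
  proof
    fix x :: "real^'a" assume "x \<in> ball 0 \<epsilon>"
    then have "a \<odot> x \<in> P n" using \<epsilon>(2) interior_subset by blast
    then obtain vs where vs: "a \<odot> x = wprod vs" "length vs = n" "set vs \<subseteq> K n" by (auto simp: P_def)
    obtain ws where ws: "a = wprod ws" "length ws = n" "set ws \<subseteq> K n"
      using a interior_subset[of "P n"] by (auto simp: P_def)
    have "x = (- a) \<odot> (a \<odot> x)" by simp
    also have "\<dots> = wprod (map uminus (rev ws) @ vs)"
      unfolding vs(1) wprod_append wprod_minus ws(1)[symmetric] ..
    finally have "x = wprod (map uminus (rev ws) @ vs)" .
    moreover have "set (map uminus (rev ws) @ vs) \<subseteq> layer 1 \<inter> cball 0 (real n + 1)"
      using vs(3) ws(3) by (fastforce simp: K_def subspace_neg[OF subspace_layer])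
    moreover have "length (map uminus (rev ws) @ vs) = n + n" using vs ws by simp
    ultimately show "x \<in> {wprod vs |vs. length vs = n + n \<and> set vs \<subseteq> layer 1 \<inter> cball 0 (real n + 1)}"
      by blast
  qed
  then show ?thesis using that[OF \<epsilon>(1), of "real n + 1" "n + n"] by simp
qed

end

section \<open>Invariance of Lebesgue measure\<close>

text \<open>The change-of-variables theorem of the library is stated for well-ordered index types;
  a well-ordered copy of the index type makes it available for every finite one.\<close>

typedef ('a::finite) idx = "UNIV :: 'a set" by simp

lemma Rep_Abs_idx [simp]: "Rep_idx (Abs_idx x) = x"
  by (simp add: Abs_idx_inverse)

lemma bij_Rep_idx: "bij Rep_idx"
  by (rule bijI') (auto simp: Rep_idx_inject intro: Abs_idx_inverse[symmetric, OF UNIV_I])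

instance idx :: (finite) finite
proof
  show "finite (UNIV :: 'a idx set)"
    using bij_betw_finite[OF bij_Rep_idx] by simp
qed

definition idx_rank :: "'a::finite idx \<Rightarrow> nat" where
  "idx_rank = (SOME f. inj f)"

lemma inj_idx_rank: "inj idx_rank"
  unfolding idx_rank_def
  using finite_imp_inj_to_nat_seg[OF finite_class.finite_UNIV, where 'a1 = "'a idx"] someI_ex[of "\<lambda>f. inj f"]
  by blast

instantiation idx :: (finite) linorder
begin

definition "x \<le> y \<longleftrightarrow> idx_rank x \<le> idx_rank y"
definition "x < y \<longleftrightarrow> idx_rank x < idx_rank y"

instance
proof
  fix x y :: "'a idx"
  assume "x \<le> y" "y \<le> x"
  then have "idx_rank x = idx_rank y" unfolding less_eq_idx_def by simp
  then show "x = y" by (rule injD[OF inj_idx_rank])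
next
  fix x y z :: "'a idx"
  show "x < y \<longleftrightarrow> x \<le> y \<and> \<not> y \<le> x"
    unfolding less_eq_idx_def less_idx_def by linarith
  show "x \<le> x"
    unfolding less_eq_idx_def by (rule order_refl)
  show "x \<le> y \<or> y \<le> x"
    unfolding less_eq_idx_def by (rule linear)
  show "x \<le> z" if "x \<le> y" "y \<le> z"
    using that unfolding less_eq_idx_def by (rule order_trans)
qed

end

instance idx :: (finite) wellorder
proof
  fix P :: "'a idx \<Rightarrow> bool" and a
  assume step: "\<And>x. (\<And>y. y < x \<Longrightarrow> P y) \<Longrightarrow> P x"
  show "P a"
  proof (induction "idx_rank a" arbitrary: a rule: less_induct)
    case less
    show ?case
      by (rule step) (rule less, simp only: less_idx_def)
  qed
qed

definition to_idx :: "real^'n \<Rightarrow> real^('n idx)" where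
  "to_idx x = (\<chi> i. x $ Rep_idx i)"

definition of_idx :: "real^('n idx) \<Rightarrow> real^'n" where
  "of_idx x = (\<chi> i. x $ Abs_idx i)"

lemma to_of_idx [simp]: "to_idx (of_idx x) = x" "of_idx (to_idx y) = y"
  by (simp_all add: to_idx_def of_idx_def vec_eq_iff Rep_idx_inverse)

lemma linear_to_idx: "linear to_idx" and linear_of_idx: "linear of_idx"
  by (auto intro!: linearI simp: to_idx_def of_idx_def vec_eq_iff)

lemma continuous_to_idx: "continuous_on S to_idx" and continuous_of_idx: "continuous_on T of_idx"
  using linear_to_idx linear_of_idx linear_conv_bounded_linear linear_continuous_on by blast+

lemma to_idx_measurable [measurable]: "to_idx \<in> borel_measurable borel"
  and of_idx_measurable [measurable]: "of_idx \<in> borel_measurable borel"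
  using borel_measurable_continuous_onI continuous_to_idx continuous_of_idx by blast+

lemma prod_Basis_vec: "(\<Prod>b\<in>(Basis :: (real^'n) set). x \<bullet> b) = (\<Prod>i\<in>UNIV. x $ i)"
proof -
  have B: "(Basis :: (real^'n) set) = (\<lambda>i. axis i 1) ` UNIV" by (auto simp: Basis_vec_def)
  have "inj (\<lambda>i::'n. axis i (1::real))" by (auto simp: inj_on_def axis_eq_axis)
  then show ?thesis unfolding B by (subst prod.reindex) (simp_all add: inner_axis)
qed

lemma distr_to_idx: "distr lborel borel to_idx = (lborel :: (real^('n::finite idx)) measure)"
proof (rule lborel_eqI[symmetric])
  fix l u :: "real^('n idx)"
  assume lu: "\<And>b. b \<in> Basis \<Longrightarrow> l \<bullet> b \<le> u \<bullet> b"
  have le: "l $ i \<le> u $ i" for i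
    using lu[of "axis i 1"] by (simp add: inner_axis axis_in_Basis_iff)
  have pre: "to_idx -` box l u = box (of_idx l) (of_idx u)"
  proof -
    have "(\<forall>i. l $ i < x $ Rep_idx i \<and> x $ Rep_idx i < u $ i) \<longleftrightarrow>
        (\<forall>i. l $ Abs_idx i < x $ i \<and> x $ i < u $ Abs_idx i)" for x :: "real^'n"
      by (metis Rep_Abs_idx Rep_idx_inverse)
    then show ?thesis by (auto simp: mem_box_cart to_idx_def of_idx_def)
  qed
  have "emeasure (distr lborel borel to_idx) (box l u) = emeasure lborel (box (of_idx l) (of_idx u))"
    by (simp add: emeasure_distr pre)
  also have "\<dots> = (\<Prod>b\<in>Basis. (of_idx u - of_idx l) \<bullet> b)"
    by (rule emeasure_lborel_box) (auto simp: Basis_vec_def inner_axis of_idx_def le)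
  also have "(\<Prod>b\<in>Basis. (of_idx u - of_idx l) \<bullet> b) = (\<Prod>i\<in>UNIV. (u - l) $ Abs_idx i)"
    by (simp add: prod_Basis_vec of_idx_def)
  also have "(\<Prod>i\<in>UNIV. (u - l) $ Abs_idx i) = (\<Prod>i\<in>UNIV. (u - l) $ Abs_idx (Rep_idx i))"
    by (rule prod.reindex_bij_betw[OF bij_Rep_idx, symmetric])
  also have "\<dots> = (\<Prod>b\<in>Basis. (u - l) \<bullet> b)"
    by (simp add: Rep_idx_inverse prod_Basis_vec)
  finally show "emeasure (distr lborel borel to_idx) (box l u) = ennreal (\<Prod>b\<in>Basis. (u - l) \<bullet> b)" .
qed simp

text \<open>The determinant is taken on the well-ordered copy of the coordinates, where the
  change-of-variables theorem is applied.\<close>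

definition jdet :: "(real^'n \<Rightarrow> real^'n) \<Rightarrow> real" where
  "jdet A = det (matrix (to_idx \<circ> A \<circ> of_idx))"

lemma linear_conj_idx: "linear A \<Longrightarrow> linear (to_idx \<circ> A \<circ> of_idx)"
  by (intro linear_compose linear_to_idx linear_of_idx)

lemma jdet_compose:
  assumes "linear A" "linear B"
  shows "jdet (A \<circ> B) = jdet A * jdet B"
proof -
  have "to_idx \<circ> (A \<circ> B) \<circ> of_idx = (to_idx \<circ> A \<circ> of_idx) \<circ> (to_idx \<circ> B \<circ> of_idx)"
    by (auto simp: o_def)
  then show ?thesis
    unfolding jdet_def
    by (simp only: matrix_compose[OF linear_conj_idx[OF assms(2)] linear_conj_idx[OF assms(1)]] det_mul)
qed

lemma of_idx_axis: "of_idx (axis i x) = axis (Rep_idx i) x"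
proof -
  have "Abs_idx j = i \<longleftrightarrow> j = Rep_idx i" for j by (metis Rep_Abs_idx Rep_idx_inverse)
  then show ?thesis by (simp add: of_idx_def axis_def vec_eq_iff)
qed

lemma jdet_entry: "matrix (to_idx \<circ> A \<circ> of_idx) $ i $ j = A (axis (Rep_idx j) 1) $ Rep_idx i"
  by (simp add: matrix_def of_idx_axis to_idx_def)

lemma jdet_diag:
  assumes "\<And>x k. A x $ k = d k * x $ k"
  shows "jdet A = (\<Prod>k\<in>UNIV. d k)"
proof -
  have "jdet A = (\<Prod>i\<in>UNIV. matrix (to_idx \<circ> A \<circ> of_idx) $ i $ i)"
    unfolding jdet_def
    by (rule det_diagonal) (auto simp: jdet_entry assms axis_def Rep_idx_inject)
  also have "\<dots> = (\<Prod>i\<in>UNIV. d (Rep_idx i))" by (simp add: jdet_entry assms axis_def)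
  also have "\<dots> = (\<Prod>k\<in>UNIV. d k)" by (rule prod.reindex_bij_betw[OF bij_Rep_idx])
  finally show ?thesis .
qed

lemma jdet_id [simp]: "jdet (\<lambda>x. x) = 1"
  using jdet_diag[of "\<lambda>x. x" "\<lambda>_. 1"] by simp

lemma tendsto_jdet:
  assumes "\<And>k l. ((\<lambda>n. A n (axis l 1) $ k) \<longlongrightarrow> B (axis l 1) $ k) F"
  shows "((\<lambda>n. jdet (A n)) \<longlongrightarrow> jdet B) F"
  unfolding jdet_def det_def jdet_entry by (intro tendsto_intros assms)

text \<open>For a constant Jacobian it is enough to look at boxes: the pushforward of
  \<open>lborel\<close> under \<open>f\<close>, divided by \<open>c\<close>, gives every box its
  volume and therefore is \<open>lborel\<close>. The preimage of a box under \<open>f\<close> is its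
  image under \<open>g\<close>, whose measure the change-of-variables theorem computes.\<close>

lemma nn_integral_change_of_variables:
  fixes f g :: "real^'n \<Rightarrow> real^'n"
  assumes g: "\<And>x. (g has_derivative g' x) (at x)" and det: "\<And>x. \<bar>jdet (g' x)\<bar> = c"
    and f: "continuous_on UNIV f" and fg: "\<And>x. f (g x) = x" and gf: "\<And>x. g (f x) = x"
    and h: "h \<in> borel_measurable borel" and c: "c > 0"
  shows "(\<integral>\<^sup>+x. h (f x) \<partial>lborel) = ennreal c * (\<integral>\<^sup>+x. h x \<partial>lborel)"
proof -
  have [measurable]: "f \<in> borel_measurable borel" using f by (rule borel_measurable_continuous_onI)
  have contg: "continuous_on UNIV g"
    by (meson g has_derivative_continuous continuous_at_imp_continuous_on)
  have "lborel = density (distr lborel borel f) (\<lambda>_. ennreal (1 / c))"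
  proof (rule lborel_eqI)
    fix l u :: "real^'n" assume le: "\<And>b. b \<in> Basis \<Longrightarrow> l \<bullet> b \<le> u \<bullet> b"
    define G where "G = to_idx \<circ> g \<circ> of_idx"
    define S where "S = to_idx ` box l u"
    have S: "S = of_idx -` box l u" unfolding S_def by (force simp: image_iff intro: to_of_idx(1)[symmetric])
    have "open S" unfolding S by (intro open_vimage open_box continuous_of_idx)
    then have Sm: "S \<in> sets lebesgue" by (simp add: borel_open sets_completionI_sets)
    have bS: "bounded S"
    proof -
      have "compact (to_idx ` cbox l u)"
        by (intro compact_continuous_image continuous_to_idx compact_cbox)
      moreover have "S \<subseteq> to_idx ` cbox l u" unfolding S_def using box_subset_cbox by blast
      ultimately show ?thesis using bounded_subset compact_imp_bounded by blast
    qed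
    have fm: "S \<in> lmeasurable" using bS Sm bounded_set_imp_lmeasurable by blast
    have dG: "(G has_derivative (to_idx \<circ> g' (of_idx x) \<circ> of_idx)) (at x within S)" for x
    proof -
      have 1: "(of_idx has_derivative of_idx) (at x within S)" "(to_idx has_derivative to_idx) (at y)" for y :: "real^'n"
        by (auto intro: linear_imp_has_derivative linear_of_idx linear_to_idx)
      show ?thesis unfolding G_def o_def
        using has_derivative_compose[OF has_derivative_compose[OF 1(1) g] 1(2)] .
    qed
    have inj: "inj_on G S" unfolding G_def
      by (rule inj_onI) (metis comp_apply fg to_of_idx)
    have detG: "\<bar>det (matrix (to_idx \<circ> g' (of_idx x) \<circ> of_idx))\<bar> = c" for x
      using det by (simp add: jdet_def)
    have int: "(\<lambda>x. c) integrable_on S" using fm by (simp add: integrable_on_const)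
    have GS: "G ` S \<in> lmeasurable"
      using measurable_differentiable_image_eq[OF Sm dG inj] int by (simp add: detG)
    have "measure lebesgue (G ` S) = integral S (\<lambda>x. c)"
      using measure_differentiable_image_eq[OF Sm dG inj] int by (simp add: detG)
    also have "\<dots> = c * measure lebesgue S" using fm integral_mult_right[of S c "\<lambda>_. 1"]
      by (simp add: lmeasure_integral)
    finally have mG: "emeasure lebesgue (G ` S) = ennreal c * emeasure lebesgue S"
      using c by (simp add: emeasure_eq_measure2 GS fm ennreal_mult)
    have img: "G ` S = of_idx -` (f -` box l u)"
    proof (intro equalityI subsetI)
      fix y assume "y \<in> of_idx -` (f -` box l u)"
      then have "y = G (to_idx (f (of_idx y)))" "to_idx (f (of_idx y)) \<in> S"
        by (auto simp: G_def gf S)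
      then show "y \<in> G ` S" by blast
    qed (auto simp: G_def S fg)
    have eq: "emeasure lebesgue (of_idx -` A) = emeasure lborel A" if "A \<in> sets borel" for A :: "(real^'n) set"
    proof -
      have "of_idx -` A \<in> sets borel" using measurable_sets[OF of_idx_measurable that] by simp
      then have "emeasure lebesgue (of_idx -` A) = emeasure (distr lborel borel to_idx) (of_idx -` A)"
        by (simp add: distr_to_idx)
      also have "\<dots> = emeasure lborel (to_idx -` (of_idx -` A))"
        using \<open>of_idx -` A \<in> sets borel\<close> by (simp add: emeasure_distr)
      also have "to_idx -` (of_idx -` A) = A" by auto
      finally show ?thesis .
    qed
    have fb: "f -` box l u \<in> sets borel" by (intro borel_open open_vimage open_box f)
    have "emeasure lborel (f -` box l u) = ennreal c * emeasure lborel (box l u)"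
      using mG unfolding img unfolding S eq[OF fb] using eq[of "box l u"] by simp
    then have "emeasure (density (distr lborel borel f) (\<lambda>_. ennreal (1 / c))) (box l u)
        = ennreal (1 / c) * (ennreal c * emeasure lborel (box l u))"
      by (simp add: emeasure_density_const emeasure_distr)
    also have "\<dots> = emeasure lborel (box l u)"
      using c by (simp add: mult.assoc[symmetric] ennreal_mult[symmetric])
    also have "\<dots> = (\<Prod>b\<in>Basis. (u - l) \<bullet> b)" by (rule emeasure_lborel_box[OF le])
    finally show "emeasure (density (distr lborel borel f) (\<lambda>_. ennreal (1 / c))) (box l u)
        = ennreal (\<Prod>b\<in>Basis. (u - l) \<bullet> b)" .
  qed simp
  then have "(\<integral>\<^sup>+x. h x \<partial>lborel) = (\<integral>\<^sup>+x. h x \<partial>density (distr lborel borel f) (\<lambda>_. ennreal (1 / c)))"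
    by simp
  also have "\<dots> = ennreal (1 / c) * (\<integral>\<^sup>+x. h (f x) \<partial>lborel)"
    using h by (simp add: nn_integral_density nn_integral_distr nn_integral_cmult)
  finally show ?thesis
    using c by (simp add: mult.assoc[symmetric] ennreal_mult[symmetric])
qed

context graded_carnot
begin

text \<open>Conjugating by \<open>dil t\<close> moves the base point from \<open>(x, y)\<close> to
  \<open>(dil t x, dil t y)\<close> without changing the determinant, and at \<open>t = 0\<close>
  the map is \<open>h \<mapsto> (a + b) *\<^sub>R h\<close>. The weights \<open>a\<close> and
  \<open>b\<close> treat left and right translations together.\<close>

lemma jdet_dM:
  assumes "a + b = 1"
  shows "jdet (\<lambda>h. dM (x, y) (a *\<^sub>R h, b *\<^sub>R h)) = 1"
proof -
  define B where "B t h = dM (dil t x, dil t y) (a *\<^sub>R h, b *\<^sub>R h)" for t h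
  have linB: "linear (B t)" for t
    using linear_compose[of "\<lambda>h. (a *\<^sub>R h, b *\<^sub>R h)" "dM (dil t x, dil t y)"] linear_dM
    unfolding B_def by (auto simp: o_def linear_iff algebra_simps)
  have const: "jdet (B 1) = jdet (B t)" if "t > 0" for t
  proof -
    have id: "dil (1 / t) \<circ> dil t = (\<lambda>x. x)" using that by (auto simp: o_def)
    have "B 1 = dil (1 / t) \<circ> (B t \<circ> dil t)"
    proof
      fix h
      have "B t (dil t h) = dil t (B 1 h)"
        unfolding B_def by (simp add: dM_dil[symmetric] linear_cmul[OF linear_dil])
      then show "B 1 h = (dil (1 / t) \<circ> (B t \<circ> dil t)) h" using that by simp
    qed
    then have "jdet (B 1) = jdet (dil (1 / t)) * (jdet (B t) * jdet (dil t))"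
      by (simp add: jdet_compose linear_compose linB linear_dil)
    also have "\<dots> = jdet (dil (1 / t) \<circ> dil t) * jdet (B t)"
      by (simp add: jdet_compose linear_dil)
    finally show ?thesis by (simp add: id)
  qed
  have "(\<lambda>n. jdet (B (1 / real (Suc n)))) \<longlonglongrightarrow> jdet (B 0)"
  proof (rule tendsto_jdet)
    fix k l
    have "continuous_on UNIV (\<lambda>t. B t (axis l 1) $ k)"
      unfolding B_def
      by (intro continuous_intros continuous_on_compose2[OF continuous_dM[of UNIV]] continuous_dil) auto
    from continuous_on_tendsto_compose[OF this LIMSEQ_Suc[OF lim_1_over_n]]
    show "(\<lambda>n. B (1 / real (Suc n)) (axis l 1) $ k) \<longlonglongrightarrow> B 0 (axis l 1) $ k" by simp
  qed
  moreover have "jdet (B (1 / real (Suc n))) = jdet (B 1)" for n by (rule const[symmetric]) simp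
  moreover have "B 0 = (\<lambda>h. h)"
    unfolding B_def using assms by (auto simp flip: scaleR_add_left)
  ultimately have "jdet (B 1) = 1" by (simp add: LIMSEQ_const_iff)
  then show ?thesis by (simp add: B_def[abs_def])
qed

lemma gmul_borel [measurable]:
  "(\<lambda>y. x \<odot> y) \<in> borel_measurable borel" "(\<lambda>y. y \<odot> x) \<in> borel_measurable borel"
  by (auto intro!: borel_measurable_continuous_onI continuous_intros)

lemma nn_integral_left_translation:
  assumes "h \<in> borel_measurable borel"
  shows "(\<integral>\<^sup>+y. h (x \<odot> y) \<partial>lborel) = (\<integral>\<^sup>+y. h y \<partial>lborel)"
proof -
  have "(\<integral>\<^sup>+y. h (x \<odot> y) \<partial>lborel) = ennreal 1 * (\<integral>\<^sup>+y. h y \<partial>lborel)"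
  proof (rule nn_integral_change_of_variables[where g = "\<lambda>y. (- x) \<odot> y" and g' = "\<lambda>y h. dM (- x, y) (0, h)"])
    show "((\<lambda>y. (- x) \<odot> y) has_derivative (\<lambda>h. dM (- x, y) (0, h))) (at y)" for y
      by (intro derivative_intros)
    show "\<bar>jdet (\<lambda>h. dM (- x, y) (0, h))\<bar> = 1" for y
      using jdet_dM[of 0 1 "- x" y] by simp
  qed (use assms gmul_cancel[of "- x"] in \<open>auto intro!: continuous_intros\<close>)
  then show ?thesis by simp
qed

lemma nn_integral_right_translation:
  assumes "h \<in> borel_measurable borel"
  shows "(\<integral>\<^sup>+y. h (y \<odot> x) \<partial>lborel) = (\<integral>\<^sup>+y. h y \<partial>lborel)"
proof -
  have "(\<integral>\<^sup>+y. h (y \<odot> x) \<partial>lborel) = ennreal 1 * (\<integral>\<^sup>+y. h y \<partial>lborel)"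
  proof (rule nn_integral_change_of_variables[where g = "\<lambda>y. y \<odot> (- x)" and g' = "\<lambda>y h. dM (y, - x) (h, 0)"])
    show "((\<lambda>y. y \<odot> (- x)) has_derivative (\<lambda>h. dM (y, - x) (h, 0))) (at y)" for y
      by (intro derivative_intros)
    show "\<bar>jdet (\<lambda>h. dM (y, - x) (h, 0))\<bar> = 1" for y
      using jdet_dM[of 1 0 y "- x"] by simp
  qed (use assms gmul_cancel_right in \<open>auto intro!: continuous_intros\<close>)
  then show ?thesis by simp
qed

lemma jdet_dil: "jdet (dil t) = t ^ hom_dim V m"
proof -
  define D where "D x = (\<chi> k. t ^ \<sigma> k * x $ k)" for x :: "real^'a"
  have linD: "linear D" by (rule linearI) (simp_all add: D_def vec_eq_iff algebra_simps)
  have "dil t = lin_comb \<circ> (D \<circ> coord)" by (auto simp: dil_def D_def)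
  then have "jdet (dil t) = jdet D * jdet (lin_comb \<circ> coord)"
    by (simp add: jdet_compose linear_lin_comb linD linear_coord linear_compose)
  also have "lin_comb \<circ> coord = (\<lambda>x. x)" by auto
  also have "jdet D = (\<Prod>k\<in>UNIV. t ^ \<sigma> k)" by (rule jdet_diag) (simp add: D_def)
  also have "\<dots> = t ^ hom_dim V m" by (simp flip: power_sum \<sigma>_sum)
  finally show ?thesis by simp
qed

lemma nn_integral_dil:
  assumes "h \<in> borel_measurable borel" "t > 0"
  shows "(\<integral>\<^sup>+y. h (dil (1 / t) y) \<partial>lborel) = ennreal (t ^ hom_dim V m) * (\<integral>\<^sup>+y. h y \<partial>lborel)"
  by (rule nn_integral_change_of_variables[where g = "dil t" and g' = "\<lambda>_. dil t"])
    (use assms in \<open>auto simp: jdet_dil intro: linear_imp_has_derivative linear_dil continuous_dil_right\<close>)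

end

section \<open>Horizontal energy and weak-type bounds\<close>

text \<open>A convex function lies above its tangent at \<open>c\<close>; \<open>y = 0\<close> is
  separate because the derivative is taken on the positive reals. Jensen's inequality, weighted
  convexity and the Lipschitz bound for powers are all derived from it.\<close>

lemma powr_tangent_le:
  fixes y c P :: real
  assumes "P \<ge> 1" "y \<ge> 0" "c > 0"
  shows "c powr P + P * c powr (P - 1) * (y - c) \<le> y powr P"
proof (cases "y = 0")
  case True
  have "c powr P = c powr (P - 1) * c" using assms by (simp add: powr_diff)
  then have "c powr P + P * c powr (P - 1) * (0 - c) = (1 - P) * c powr P" by (simp add: algebra_simps)
  also have "\<dots> \<le> 0" using assms by (simp add: mult_nonpos_nonneg)
  finally show ?thesis using True by simp
next
  case False
  have "((\<lambda>x. x powr P) has_real_derivative P * c powr (P - 1)) (at c within {0<..})"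
    using assms by (auto intro!: derivative_eq_intros)
  with convex_on_imp_above_tangent[OF powr_convex[OF assms(1)], of c y "P * c powr (P - 1)"]
  have "P * c powr (P - 1) * (y - c) \<le> y powr P - c powr P"
    using assms False by (simp add: interior_open)
  then show ?thesis by simp
qed

lemma norm_add_powr_le:
  fixes a b :: "'a::real_normed_vector"
  assumes "P > 0"
  shows "norm (a + b) powr P \<le> 2 powr P * (norm a powr P + norm b powr P)"
proof -
  have "norm (a + b) \<le> 2 * max (norm a) (norm b)"
    using norm_triangle_ineq[of a b] by linarith
  then have "norm (a + b) powr P \<le> (2 * max (norm a) (norm b)) powr P"
    using assms by (intro powr_mono2) auto
  also have "\<dots> = 2 powr P * max (norm a) (norm b) powr P"
    by (simp add: powr_mult)
  also have "max (norm a) (norm b) powr P \<le> norm a powr P + norm b powr P"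
    by (auto simp: max_def)
  finally show ?thesis by simp
qed

text \<open>The tangent inequality at \<open>c = \<bar>I\<bar>\<close>, integrated: the linear term
  contributes something nonnegative, because \<open>\<bar>I\<bar>\<close> is at most the integral of
  \<open>\<bar>g\<bar>\<close>.\<close>

lemma Jensen_powr_unit_interval:
  fixes g :: "real \<Rightarrow> real"
  assumes P: "P \<ge> 1" and g: "continuous_on UNIV g" and I: "(g has_integral I) {0..1}"
  shows "ennreal (\<bar>I\<bar> powr P) \<le> (\<integral>\<^sup>+s. ennreal (\<bar>g s\<bar> powr P) * indicator {0..1} s \<partial>lborel)"
proof (cases "I = 0")
  case False
  define c where "c = \<bar>I\<bar>"
  have c: "c > 0" using False by (simp add: c_def)
  have i1: "(\<lambda>s. \<bar>g s\<bar>) integrable_on {0..1}"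
    by (intro integrable_continuous_interval continuous_intros continuous_on_subset[OF g]) auto
  have i2: "(\<lambda>s. \<bar>g s\<bar> powr P) integrable_on {0..1}"
    using P by (intro integrable_continuous_interval continuous_on_powr' continuous_intros
        continuous_on_subset[OF g]) auto
  have const: "((\<lambda>x. d) has_integral d) {0..1::real}" for d :: real
    using has_integral_const_real[of d 0 1] by simp
  have "\<bar>integral {0..1} g\<bar> \<le> integral {0..1} (\<lambda>s. \<bar>g s\<bar>)"
    using integral_norm_bound_integral[of g "{0..1}" "\<lambda>s. \<bar>g s\<bar>"] I i1 by (auto simp: has_integral_iff)
  then have ci: "c \<le> integral {0..1} (\<lambda>s. \<bar>g s\<bar>)" using I by (simp add: c_def has_integral_iff)
  have "c powr P \<le> c powr P + P * c powr (P - 1) * (integral {0..1} (\<lambda>s. \<bar>g s\<bar>) - c)"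
    using ci P by simp
  also have "\<dots> = integral {0..1} (\<lambda>s. c powr P + P * c powr (P - 1) * (\<bar>g s\<bar> - c))"
  proof -
    have "((\<lambda>s. c powr P + P * c powr (P - 1) * (\<bar>g s\<bar> - c)) has_integral
        c powr P + P * c powr (P - 1) * (integral {0..1} (\<lambda>s. \<bar>g s\<bar>) - c)) {0..1}"
      by (intro has_integral_add has_integral_mult_right has_integral_diff const integrable_integral i1)
    then show ?thesis by (simp add: has_integral_iff)
  qed
  also have "\<dots> \<le> integral {0..1} (\<lambda>s. \<bar>g s\<bar> powr P)"
    by (intro integral_le i2 powr_tangent_le P c integrable_add integrable_on_mult_right integrable_diff i1) auto
  finally have le: "c powr P \<le> integral {0..1} (\<lambda>s. \<bar>g s\<bar> powr P)" .
  have "(\<integral>\<^sup>+s. ennreal (if s \<in> {0..1} then \<bar>g s\<bar> powr P else 0) \<partial>lborel)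
      = ennreal (integral {0..1} (\<lambda>s. \<bar>g s\<bar> powr P))"
  proof (rule nn_integral_has_integral_lborel)
    show "((\<lambda>s. if s \<in> {0..1} then \<bar>g s\<bar> powr P else 0) has_integral
        integral {0..1} (\<lambda>s. \<bar>g s\<bar> powr P)) UNIV"
      using i2 by (subst has_integral_restrict_UNIV) (rule integrable_integral)
    have [measurable]: "g \<in> borel_measurable borel" using g by (rule borel_measurable_continuous_onI)
    show "(\<lambda>s. if s \<in> {0..1} then \<bar>g s\<bar> powr P else 0) \<in> borel_measurable borel" by measurable
  qed auto
  moreover have "ennreal (if s \<in> {0..1} then \<bar>g s\<bar> powr P else 0) = ennreal (\<bar>g s\<bar> powr P) * indicator {0..1} s" for s :: real
    by auto
  ultimately show ?thesis using le by (simp add: c_def ennreal_leI)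
qed simp

lemma C2_differentiable: "C2 f \<Longrightarrow> f differentiable at x"
  by (auto simp: C2_def)

lemma C2_continuous: "C2 f \<Longrightarrow> continuous_on S f"
  and C2_fdir_continuous: "C2 f \<Longrightarrow> continuous_on S (fdir f e)"
  unfolding C2_def by (auto intro!: continuous_at_imp_continuous_on differentiable_imp_continuous_within)

lemma ennreal_factor:
  assumes "a \<ge> 0" "b \<ge> 0" "c \<ge> 0"
  shows "ennreal a * (ennreal b * x + ennreal c * x) = ennreal (a * (b + c)) * x"
  using assms by (simp add: ennreal_mult distrib_left distrib_right mult.assoc)

context carnot
begin

lemma lfield_C2:
  assumes "C2 \<phi>"
  shows "lfield gmul w \<phi> x = (\<Sum>b\<in>Basis. (dM (x, 0) (0, w) \<bullet> b) * fdir \<phi> b x)"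
proof -
  have D: "(\<phi> has_derivative (\<lambda>e. fdir \<phi> e x)) (at x)"
    by (rule has_derivative_fdir[OF C2_differentiable[OF assms]])
  let ?v = "dM (x, 0) (0, w)"
  have "lfield gmul w \<phi> x = fdir \<phi> (\<Sum>b\<in>Basis. (?v \<bullet> b) *\<^sub>R b) x"
    unfolding euclidean_representation by (rule lfield_eq[OF D])
  also have "\<dots> = (\<Sum>b\<in>Basis. (?v \<bullet> b) * fdir \<phi> b x)"
    by (simp only: linear_sum[OF has_derivative_linear[OF D]] linear_cmul[OF has_derivative_linear[OF D]]
        real_scaleR_def)
  finally show ?thesis .
qed

lemma continuous_lfield:
  assumes "C2 \<phi>"
  shows "continuous_on S (lfield gmul w \<phi>)"
  unfolding lfield_C2[OF assms, abs_def]
  by (intro continuous_intros C2_fdir_continuous assms continuous_on_compose2[OF continuous_dM[of UNIV]]) auto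

lemma linear_lfield:
  assumes "C2 \<phi>"
  shows "linear (\<lambda>w. lfield gmul w \<phi> x)"
proof -
  have D: "(\<phi> has_derivative (\<lambda>e. fdir \<phi> e x)) (at x)"
    by (rule has_derivative_fdir[OF C2_differentiable[OF assms]])
  have "linear (\<lambda>w. dM (x, 0) (0, w))"
    using linear_compose[of "\<lambda>w. (0, w)" "dM (x, 0)"] linear_dM by (auto simp: o_def linear_iff)
  from linear_compose[OF this has_derivative_linear[OF D]] show ?thesis
    unfolding lfield_eq[OF D] by (simp add: o_def)
qed

lemma continuous_hgrad: "C2 \<phi> \<Longrightarrow> continuous_on S (hgrad gmul B \<phi>)"
  unfolding hgrad_def[abs_def] by (intro continuous_on_vec_lambda continuous_lfield)

lemma hgrad_measurable: "C2 \<phi> \<Longrightarrow> hgrad gmul B \<phi> \<in> borel_measurable borel"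
  by (intro borel_measurable_continuous_onI continuous_hgrad)

lemma line_derivative:
  assumes "C2 \<phi>"
  shows "((\<lambda>s. \<phi> (x \<odot> (s *\<^sub>R v))) has_real_derivative lfield gmul v \<phi> (x \<odot> (s *\<^sub>R v))) (at s)"
proof -
  let ?y = "x \<odot> (s *\<^sub>R v)"
  have D: "(\<phi> has_derivative (\<lambda>e. fdir \<phi> e ?y)) (at ?y)"
    by (rule has_derivative_fdir[OF C2_differentiable[OF assms]])
  have "((\<lambda>s. \<phi> (x \<odot> (s *\<^sub>R v))) has_derivative
      (\<lambda>h. fdir \<phi> (h *\<^sub>R dM (?y, 0) (0, v)) ?y)) (at s)"
    using has_derivative_compose[OF right_line_derivative[unfolded has_vector_derivative_def] D] .
  moreover have "(\<lambda>h. fdir \<phi> (h *\<^sub>R dM (?y, 0) (0, v)) ?y) = (*) (lfield gmul v \<phi> ?y)"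
    using linear_cmul[OF has_derivative_linear[OF D]] by (auto simp: lfield_eq[OF D] mult.commute)
  ultimately show ?thesis by (simp add: has_field_derivative_def)
qed

lemma continuous_lfield_line:
  assumes "C2 \<phi>"
  shows "continuous_on UNIV (\<lambda>z::(real^'n) \<times> real. lfield gmul v \<phi> (fst z \<odot> (snd z *\<^sub>R v)))"
  by (intro continuous_on_compose2[OF continuous_lfield[OF assms, of UNIV]] continuous_intros) auto

end

locale horizontal_basis = graded_carnot gmul V m e \<sigma>
  for gmul :: "real^'a \<Rightarrow> real^'a \<Rightarrow> real^'a" (infixl "\<odot>" 70) and V m and e :: "'a::finite \<Rightarrow> real^'a" and \<sigma> +
  fixes B :: "'k::finite \<Rightarrow> real^'a"
  assumes B: "inj B" "independent (range B)" "span (range B) = V 1"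
begin

abbreviation "grad \<equiv> hgrad gmul B"

definition energy :: "real \<Rightarrow> (real^'a \<Rightarrow> real) \<Rightarrow> ennreal" where
  "energy P \<phi> = (\<integral>\<^sup>+x. ennreal (norm (grad \<phi> x) powr P) \<partial>lborel)"

text \<open>The coordinate map of \<open>V 1\<close> in the basis \<open>B\<close>, extended to a
  linear map \<open>g\<close> on the whole space, gives
  \<open>lfield gmul v \<phi> x = g v \<bullet> grad \<phi> x\<close>; \<open>K\<close> is a bound
  for \<open>g\<close>.\<close>

lemma lfield_le_grad:
  "\<exists>K>0. \<forall>v \<phi> x. v \<in> layer 1 \<longrightarrow> C2 \<phi> \<longrightarrow>
    \<bar>lfield gmul v \<phi> x\<bar> \<le> K * norm v * norm (grad \<phi> x)"
proof -
  obtain g :: "real^'a \<Rightarrow> real^'k" where g: "linear g" "\<And>x. x \<in> range B \<Longrightarrow> g x = axis (inv B x) 1"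
    using linear_independent_extend[OF B(2), of "\<lambda>x. axis (inv B x) 1"] by blast
  have gB: "g (B j) = axis j 1" for j using g(2) B(1) by simp
  obtain K where K: "K > 0" "\<And>x. norm (g x) \<le> norm x * K"
    using bounded_linear.pos_bounded[OF linear_conv_bounded_linear[THEN iffD1, OF g(1)]] by blast
  have "\<bar>lfield gmul v \<phi> x\<bar> \<le> K * norm v * norm (grad \<phi> x)" if v: "v \<in> layer 1" and \<phi>: "C2 \<phi>" for v \<phi> x
  proof -
    have "v \<in> span (range B)" using v B(3) layer_eq_V[of 1] m_ge_1 by simp
    then have "lfield gmul v \<phi> x = g v \<bullet> grad \<phi> x"
    proof (induction rule: span_induct_alt)
      case base
      then show ?case using linear_0[OF linear_lfield[OF \<phi>]] linear_0[OF g(1)] by simp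
    next
      case (step c y z)
      then obtain j where j: "y = B j" by blast
      have "lfield gmul (c *\<^sub>R y + z) \<phi> x = c * lfield gmul y \<phi> x + lfield gmul z \<phi> x"
        using linear_add[OF linear_lfield[OF \<phi>]] linear_cmul[OF linear_lfield[OF \<phi>]] by simp
      also have "lfield gmul y \<phi> x = g y \<bullet> grad \<phi> x"
        by (simp add: j gB inner_axis inner_axis' hgrad_def)
      finally show ?case
        using step.IH by (simp add: linear_add[OF g(1)] linear_cmul[OF g(1)] inner_add_left)
    qed
    then have "\<bar>lfield gmul v \<phi> x\<bar> \<le> norm (g v) * norm (grad \<phi> x)"
      by (simp add: Cauchy_Schwarz_ineq2)
    also have "\<dots> \<le> (norm v * K) * norm (grad \<phi> x)" by (intro mult_right_mono K) simp
    finally show ?thesis by (simp add: mult.commute)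
  qed
  with K(1) show ?thesis by blast
qed

text \<open>Jensen's inequality along the integral curve from \<open>x\<close> to
  \<open>x \<odot> v\<close>, followed by Fubini: for each fixed time \<open>s\<close> the shift by
  \<open>s *\<^sub>R v\<close> disappears by right invariance of the measure.\<close>

lemma translation_step:
  assumes "P \<ge> 1" "C2 \<phi>" "v \<in> layer 1"
    and K: "\<And>x. \<bar>lfield gmul v \<phi> x\<bar> \<le> k * norm (grad \<phi> x)" and k: "k \<ge> 0"
  shows "(\<integral>\<^sup>+x. ennreal (\<bar>\<phi> (x \<odot> v) - \<phi> x\<bar> powr P) \<partial>lborel) \<le> ennreal (k powr P) * energy P \<phi>"
proof -
  define F where "F z = ennreal (\<bar>lfield gmul v \<phi> (fst z \<odot> (snd z *\<^sub>R v))\<bar> powr P) * indicator {0..1} (snd z)"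
    for z :: "(real^'a) \<times> real"
  have [measurable]: "(\<lambda>z::(real^'a) \<times> real. lfield gmul v \<phi> (fst z \<odot> (snd z *\<^sub>R v))) \<in> borel_measurable (lborel \<Otimes>\<^sub>M lborel)"
    using continuous_lfield_line[OF assms(2)]
    by (simp add: borel_measurable_continuous_onI lborel_prod)
  have [measurable]: "F \<in> borel_measurable (lborel \<Otimes>\<^sub>M lborel)" unfolding F_def by measurable
  have [measurable]: "lfield gmul v \<phi> \<in> borel_measurable borel"
    by (intro borel_measurable_continuous_onI continuous_lfield assms)
  have "ennreal (\<bar>\<phi> (x \<odot> v) - \<phi> x\<bar> powr P) \<le> (\<integral>\<^sup>+s. F (x, s) \<partial>lborel)" for x
  proof -
    have "((\<lambda>s. lfield gmul v \<phi> (x \<odot> (s *\<^sub>R v))) has_integral \<phi> (x \<odot> (1 *\<^sub>R v)) - \<phi> (x \<odot> (0 *\<^sub>R v))) {0..1}"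
      using line_derivative[OF assms(2)]
      by (intro fundamental_theorem_of_calculus)
        (auto simp: has_real_derivative_iff_has_vector_derivative[symmetric] intro: has_field_derivative_at_within)
    moreover have "continuous_on UNIV (\<lambda>s. lfield gmul v \<phi> (x \<odot> (s *\<^sub>R v)))"
      by (intro continuous_on_compose2[OF continuous_lfield[OF assms(2), of UNIV]] continuous_intros) auto
    ultimately show ?thesis
      using Jensen_powr_unit_interval[OF assms(1)] by (simp add: F_def)
  qed
  then have "(\<integral>\<^sup>+x. ennreal (\<bar>\<phi> (x \<odot> v) - \<phi> x\<bar> powr P) \<partial>lborel) \<le> (\<integral>\<^sup>+x. \<integral>\<^sup>+s. F (x, s) \<partial>lborel \<partial>lborel)"
    by (intro nn_integral_mono)
  also have "\<dots> = (\<integral>\<^sup>+s. \<integral>\<^sup>+x. F (x, s) \<partial>lborel \<partial>lborel)"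
    by (rule lborel_pair.Fubini'[symmetric]) simp
  also have "\<dots> = (\<integral>\<^sup>+s. (\<integral>\<^sup>+x. ennreal (\<bar>lfield gmul v \<phi> x\<bar> powr P) \<partial>lborel) * indicator {0..1::real} s \<partial>lborel)"
  proof (rule nn_integral_cong)
    fix s :: real
    have "(\<integral>\<^sup>+x. F (x, s) \<partial>lborel)
        = (\<integral>\<^sup>+x. ennreal (\<bar>lfield gmul v \<phi> (x \<odot> (s *\<^sub>R v))\<bar> powr P) \<partial>lborel) * indicator {0..1} s"
      unfolding F_def fst_conv snd_conv by (rule nn_integral_multc) measurable
    also have "(\<integral>\<^sup>+x. ennreal (\<bar>lfield gmul v \<phi> (x \<odot> (s *\<^sub>R v))\<bar> powr P) \<partial>lborel)
        = (\<integral>\<^sup>+x. ennreal (\<bar>lfield gmul v \<phi> x\<bar> powr P) \<partial>lborel)"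
      by (rule nn_integral_right_translation[of "\<lambda>x. ennreal (\<bar>lfield gmul v \<phi> x\<bar> powr P)"]) measurable
    finally show "(\<integral>\<^sup>+x. F (x, s) \<partial>lborel)
        = (\<integral>\<^sup>+x. ennreal (\<bar>lfield gmul v \<phi> x\<bar> powr P) \<partial>lborel) * indicator {0..1} s" .
  qed
  also have "\<dots> = (\<integral>\<^sup>+x. ennreal (\<bar>lfield gmul v \<phi> x\<bar> powr P) \<partial>lborel)"
    by (subst nn_integral_cmult) auto
  also have "\<dots> \<le> (\<integral>\<^sup>+x. ennreal (k powr P) * ennreal (norm (grad \<phi> x) powr P) \<partial>lborel)"
  proof (intro nn_integral_mono)
    fix x
    have "\<bar>lfield gmul v \<phi> x\<bar> powr P \<le> (k * norm (grad \<phi> x)) powr P"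
      using assms(1) by (intro powr_mono2 K) auto
    then show "ennreal (\<bar>lfield gmul v \<phi> x\<bar> powr P) \<le> ennreal (k powr P) * ennreal (norm (grad \<phi> x) powr P)"
      using k by (simp add: powr_mult ennreal_mult[symmetric] ennreal_leI)
  qed
  also have "\<dots> = ennreal (k powr P) * energy P \<phi>"
    unfolding energy_def using hgrad_measurable[OF assms(2), of B]
    by (intro nn_integral_cmult) measurable
  finally show ?thesis .
qed

text \<open>The difference telescopes over the letters. The difference over the remaining letters
  starts at \<open>x \<odot> v\<close>, and right invariance moves its starting point back to
  \<open>x\<close>.\<close>

lemma translation_word:
  assumes P: "P \<ge> 1" and \<phi>: "C2 \<phi>" and k: "k \<ge> 0"
    and K: "\<And>v x. v \<in> set vs \<Longrightarrow> \<bar>lfield gmul v \<phi> x\<bar> \<le> k * norm (grad \<phi> x)"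
    and vs: "set vs \<subseteq> layer 1"
  shows "(\<integral>\<^sup>+x. ennreal (\<bar>\<phi> (x \<odot> wprod vs) - \<phi> x\<bar> powr P) \<partial>lborel)
    \<le> ennreal (((2 powr P + 1) ^ (length vs + 1)) * k powr P) * energy P \<phi>"
  using K vs
proof (induction vs)
  case Nil
  then show ?case by simp
next
  case (Cons v vs)
  define D where "D h = (\<integral>\<^sup>+x. ennreal (\<bar>\<phi> (x \<odot> h) - \<phi> x\<bar> powr P) \<partial>lborel)" for h
  have [measurable]: "\<phi> \<in> borel_measurable borel"
    by (intro borel_measurable_continuous_onI C2_continuous \<phi>)
  have "D (v \<odot> wprod vs) \<le> (\<integral>\<^sup>+x. ennreal (2 powr P) * (ennreal (\<bar>\<phi> (x \<odot> v \<odot> wprod vs) - \<phi> (x \<odot> v)\<bar> powr P)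
      + ennreal (\<bar>\<phi> (x \<odot> v) - \<phi> x\<bar> powr P)) \<partial>lborel)"
    unfolding D_def
  proof (intro nn_integral_mono)
    fix x
    have "\<bar>\<phi> (x \<odot> (v \<odot> wprod vs)) - \<phi> x\<bar> powr P \<le> 2 powr P * (\<bar>\<phi> (x \<odot> v \<odot> wprod vs) - \<phi> (x \<odot> v)\<bar> powr P
        + \<bar>\<phi> (x \<odot> v) - \<phi> x\<bar> powr P)"
      using norm_add_powr_le[of P "\<phi> (x \<odot> v \<odot> wprod vs) - \<phi> (x \<odot> v)" "\<phi> (x \<odot> v) - \<phi> x"] P
      by (simp add: gmul_assoc)
    then show "ennreal (\<bar>\<phi> (x \<odot> (v \<odot> wprod vs)) - \<phi> x\<bar> powr P) \<le> ennreal (2 powr P) *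
        (ennreal (\<bar>\<phi> (x \<odot> v \<odot> wprod vs) - \<phi> (x \<odot> v)\<bar> powr P) + ennreal (\<bar>\<phi> (x \<odot> v) - \<phi> x\<bar> powr P))"
      by (simp add: ennreal_mult[symmetric] ennreal_plus[symmetric] ennreal_leI del: ennreal_plus)
  qed
  also have "\<dots> = ennreal (2 powr P) * ((\<integral>\<^sup>+x. ennreal (\<bar>\<phi> (x \<odot> v \<odot> wprod vs) - \<phi> (x \<odot> v)\<bar> powr P) \<partial>lborel) + D v)"
    unfolding D_def by (subst nn_integral_cmult, measurable, subst nn_integral_add) auto
  also have "(\<integral>\<^sup>+x. ennreal (\<bar>\<phi> (x \<odot> v \<odot> wprod vs) - \<phi> (x \<odot> v)\<bar> powr P) \<partial>lborel) = D (wprod vs)"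
    unfolding D_def
    by (rule nn_integral_right_translation[of "\<lambda>x. ennreal (\<bar>\<phi> (x \<odot> wprod vs) - \<phi> x\<bar> powr P)"]) measurable
  also have "ennreal (2 powr P) * (D (wprod vs) + D v)
      \<le> ennreal (2 powr P) * (ennreal (((2 powr P + 1) ^ (length vs + 1)) * k powr P) * energy P \<phi> + ennreal (k powr P) * energy P \<phi>)"
  proof (intro mult_left_mono add_mono)
    show "D (wprod vs) \<le> ennreal (((2 powr P + 1) ^ (length vs + 1)) * k powr P) * energy P \<phi>"
      unfolding D_def using Cons by auto
    show "D v \<le> ennreal (k powr P) * energy P \<phi>"
      unfolding D_def using Cons.prems by (intro translation_step P \<phi> k) auto
  qed simp
  also have "\<dots> = ennreal (2 powr P * (((2 powr P + 1) ^ (length vs + 1)) * k powr P + k powr P)) * energy P \<phi>"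
    by (rule ennreal_factor) auto
  also have "\<dots> \<le> ennreal (((2 powr P + 1) ^ (length (v # vs) + 1)) * k powr P) * energy P \<phi>"
  proof (intro mult_right_mono ennreal_leI)
    \<comment> \<open>With \<open>a = 2 powr P\<close> and
      \<open>A = (a + 1) ^ (length vs + 1)\<close> the recursion requires
      \<open>a * (A + 1) \<le> (a + 1) * A\<close>, that is \<open>a \<le> A\<close>. This is why
      each letter is charged \<open>a + 1\<close> and the exponent exceeds the length by
      one.\<close>
    let ?c = "2 powr P"
    have "?c \<le> (?c + 1) ^ (length vs + 1)"
    proof -
      have "(?c + 1) ^ 1 \<le> (?c + 1) ^ (length vs + 1)" by (intro power_increasing) auto
      then show ?thesis by simp
    qed
    then have "?c * ((?c + 1) ^ (length vs + 1) + 1) \<le> (?c + 1) ^ (length (v # vs) + 1)"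
      by (simp add: algebra_simps)
    from mult_right_mono[OF this, of "k powr P"]
    show "?c * (((?c + 1) ^ (length vs + 1)) * k powr P + k powr P) \<le> ((?c + 1) ^ (length (v # vs) + 1)) * k powr P"
      by (simp add: algebra_simps)
  qed simp
  finally show ?case by (simp add: D_def)
qed

text \<open>Points of a small ball are words of one length with letters of bounded size, and
  dilating a word multiplies its letters by \<open>t\<close>; hence the factor
  \<open>t powr P\<close>. The constant is a function of \<open>P\<close> because the estimate is
  used both for \<open>P = p\<close> and for \<open>P = 1\<close>.\<close>

lemma translation_estimate:
  "\<exists>\<epsilon>>0. \<exists>C. (\<forall>P. C P > 0) \<and> (\<forall>P t h \<phi>. P \<ge> 1 \<longrightarrow> t > 0 \<longrightarrow> C2 \<phi> \<longrightarrow> h \<in> ball 0 \<epsilon> \<longrightarrow>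
      (\<integral>\<^sup>+x. ennreal (\<bar>\<phi> (x \<odot> dil t h) - \<phi> x\<bar> powr P) \<partial>lborel) \<le> ennreal (C P * t powr P) * energy P \<phi>)"
proof -
  obtain K where K: "K > 0"
    "\<And>v \<phi> x. v \<in> layer 1 \<Longrightarrow> C2 \<phi> \<Longrightarrow> \<bar>lfield gmul v \<phi> x\<bar> \<le> K * norm v * norm (grad \<phi> x)"
    using lfield_le_grad by metis
  obtain \<epsilon> N R where \<epsilon>: "\<epsilon> > 0" "R > 0"
    "ball 0 \<epsilon> \<subseteq> {wprod vs |vs. length vs = N \<and> set vs \<subseteq> layer 1 \<inter> cball 0 R}"
    by (rule ball_subset_words)
  show ?thesis
  proof (intro exI[of _ \<epsilon>] exI[of _ "\<lambda>P. (2 powr P + 1) ^ (N + 1) * (K * R) powr P"] conjI allI impI)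
    show "\<epsilon> > 0" by fact
    show "(2 powr P + 1) ^ (N + 1) * (K * R) powr P > 0" for P :: real
      using K \<epsilon> by (simp add: add_pos_pos)
    fix P t :: real and h :: "real^'a" and \<phi> :: "real^'a \<Rightarrow> real" assume *: "P \<ge> 1" "t > 0" "C2 \<phi>" "h \<in> ball 0 \<epsilon>"
    obtain vs where vs: "h = wprod vs" "length vs = N" "set vs \<subseteq> layer 1 \<inter> cball 0 R"
      using \<epsilon>(3) *(4) by blast
    have dv: "dil t v = t *\<^sub>R v" if "v \<in> set vs" for v
      using dil_layer[of v 1] that vs(3) by auto
    have "(\<integral>\<^sup>+x. ennreal (\<bar>\<phi> (x \<odot> wprod (map (dil t) vs)) - \<phi> x\<bar> powr P) \<partial>lborel)
      \<le> ennreal (((2 powr P + 1) ^ (length (map (dil t) vs) + 1)) * (K * R * t) powr P) * energy P \<phi>"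
    proof (intro translation_word *)
      show "set (map (dil t) vs) \<subseteq> layer 1"
        using vs(3) dv subspace_mul[OF subspace_layer, of _ 1 t] by auto
      fix v x assume "v \<in> set (map (dil t) vs)"
      then obtain w where "w \<in> set vs" "v = dil t w" by auto
      then have w: "v = t *\<^sub>R w" "w \<in> layer 1" "norm w \<le> R" using vs(3) dv by auto
      have "\<bar>lfield gmul v \<phi> x\<bar> \<le> K * norm v * norm (grad \<phi> x)"
        using w *(3) subspace_mul[OF subspace_layer] by (intro K) auto
      also have "\<dots> \<le> K * (R * t) * norm (grad \<phi> x)"
        using w * K by (intro mult_right_mono mult_left_mono) (auto simp: mult.commute)
      finally show "\<bar>lfield gmul v \<phi> x\<bar> \<le> K * R * t * norm (grad \<phi> x)" by (simp add: mult.assoc)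
    qed (use K \<epsilon> * in auto)
    then show "(\<integral>\<^sup>+x. ennreal (\<bar>\<phi> (x \<odot> dil t h) - \<phi> x\<bar> powr P) \<partial>lborel)
        \<le> ennreal ((2 powr P + 1) ^ (N + 1) * (K * R) powr P * t powr P) * energy P \<phi>"
      using vs K \<epsilon> * by (simp add: wprod_dil powr_mult mult.assoc)
  qed
qed

end

section \<open>Weak-type inequalities\<close>

lemma powr_indicator_le_dyadic:
  fixes y T q :: real
  assumes "y > T" "T > 0" "q > 0"
  shows "\<exists>k::nat. y > 2 ^ k * T \<and> y powr q \<le> (2 ^ (k + 1) * T) powr q"
proof -
  obtain n where n: "y / T < 2 ^ n" using real_arch_pow[of 2 "y / T"] by auto
  define N where "N = (LEAST n. y \<le> 2 ^ n * T)"
  have ex: "y \<le> 2 ^ n * T" using n assms by (simp add: field_simps)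
  have N: "y \<le> 2 ^ N * T" unfolding N_def using LeastI[of "\<lambda>n. y \<le> 2 ^ n * T" n] ex by simp
  then have "N \<noteq> 0" using assms by (intro notI) simp
  then obtain k where k: "N = Suc k" using not0_implies_Suc by blast
  have "\<not> y \<le> 2 ^ k * T" using not_less_Least[of k "\<lambda>n. y \<le> 2 ^ n * T"] k unfolding N_def by simp
  moreover have "y powr q \<le> (2 ^ (k + 1) * T) powr q"
    using N assms k by (intro powr_mono2) auto
  ultimately show ?thesis by (intro exI[of _ k]) simp
qed

text \<open>Summing the weak bound over the levels \<open>2 ^ k * T\<close> gives a geometric series
  of ratio \<open>2 powr (q - r) < 1\<close>. The remaining factor \<open>T powr (q - r)\<close>
  makes the tails uniformly small as \<open>T\<close> grows.\<close>

lemma nn_integral_tail_weak: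
  fixes f :: "'a \<Rightarrow> real"
  assumes f [measurable]: "f \<in> borel_measurable M" and q: "0 < q" "q < r" and A: "A \<ge> 0" and T: "T > 0"
    and weak: "\<And>s. s > 0 \<Longrightarrow> emeasure M {x \<in> space M. f x > s} \<le> ennreal (A * s powr (- r))"
  shows "(\<integral>\<^sup>+x. ennreal (f x powr q) * indicator {x. f x > T} x \<partial>M)
    \<le> ennreal (A * 2 powr q * T powr (q - r) / (1 - 2 powr (q - r)))"
proof -
  define g where "g k x = ennreal ((2 ^ (k + 1) * T) powr q) * indicator {x. f x > 2 ^ k * T} x" for k :: nat and x
  have [measurable]: "g k \<in> borel_measurable M" for k unfolding g_def by measurable
  have "(\<integral>\<^sup>+x. ennreal (f x powr q) * indicator {x. f x > T} x \<partial>M) \<le> (\<integral>\<^sup>+x. (\<Sum>k. g k x) \<partial>M)"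
  proof (intro nn_integral_mono)
    fix x
    show "ennreal (f x powr q) * indicator {x. f x > T} x \<le> (\<Sum>k. g k x)"
    proof (cases "f x > T")
      case True
      then obtain k where "f x > 2 ^ k * T" "f x powr q \<le> (2 ^ (k + 1) * T) powr q"
        using powr_indicator_le_dyadic[OF True T q(1)] by auto
      then have "ennreal (f x powr q) * indicator {x. f x > T} x \<le> g k x"
        using True by (simp add: g_def ennreal_leI)
      also have "\<dots> = (\<Sum>k\<in>{k}. g k x)" by simp
      also have "\<dots> \<le> (\<Sum>k. g k x)" by (rule sum_le_suminf) auto
      finally show ?thesis .
    qed simp
  qed
  also have "\<dots> = (\<Sum>k. \<integral>\<^sup>+x. g k x \<partial>M)" by (rule nn_integral_suminf) simp
  also have "\<dots> \<le> (\<Sum>k. ennreal (A * 2 powr q * T powr (q - r) * (2 powr (q - r)) ^ k))"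
  proof (intro suminf_le)
    fix k
    have "(\<integral>\<^sup>+x. g k x \<partial>M)
        = (\<integral>\<^sup>+x. ennreal ((2 ^ (k + 1) * T) powr q) * indicator {x \<in> space M. f x > 2 ^ k * T} x \<partial>M)"
      unfolding g_def by (intro nn_integral_cong) (simp split: split_indicator)
    also have "\<dots> = ennreal ((2 ^ (k + 1) * T) powr q) * emeasure M {x \<in> space M. f x > 2 ^ k * T}"
      by (rule nn_integral_cmult_indicator) measurable
    also have "\<dots> \<le> ennreal ((2 ^ (k + 1) * T) powr q) * ennreal (A * (2 ^ k * T) powr (- r))"
      using T by (intro mult_left_mono weak) auto
    also have "\<dots> = ennreal (A * 2 powr q * T powr (q - r) * (2 powr (q - r)) ^ k)"
    proof -
      have "(2 ^ (k + 1) * T) powr q * (A * (2 ^ k * T) powr (- r))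
          = A * 2 powr q * T powr (q - r) * (2 powr (q - r)) ^ k"
        using T by (simp add: powr_mult powr_diff powr_minus powr_realpow[symmetric] powr_powr
            powr_add field_simps)
      then show ?thesis using A by (simp add: ennreal_mult[symmetric])
    qed
    finally show "(\<integral>\<^sup>+x. g k x \<partial>M) \<le> ennreal (A * 2 powr q * T powr (q - r) * (2 powr (q - r)) ^ k)" .
  qed auto
  also have "\<dots> = ennreal (A * 2 powr q * T powr (q - r) / (1 - 2 powr (q - r)))"
  proof (rule suminf_ennreal_eq)
    have "2 powr (q - r) < 1" using q by (simp add: powr_less_one)
    then have "(\<lambda>k. (2 powr (q - r)) ^ k) sums (1 / (1 - 2 powr (q - r)))"
      by (intro geometric_sums) simp
    from sums_mult[OF this, of "A * 2 powr q * T powr (q - r)"]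
    show "(\<lambda>k. A * 2 powr q * T powr (q - r) * (2 powr (q - r)) ^ k) sums (A * 2 powr q * T powr (q - r) / (1 - 2 powr (q - r)))"
      by simp
  qed (use A in auto)
  finally show ?thesis .
qed

context horizontal_basis
begin

lemma weak_type_step:
  assumes \<phi>: "C2 \<phi>" and s: "s > 0" and t: "t > 0" and a: "a \<ge> 0" and d: "d > 0" and C: "C \<ge> 0"
    and p: "p \<ge> 1"
    and trans: "\<And>h. h \<in> ball 0 \<epsilon> \<Longrightarrow>
      (\<integral>\<^sup>+x. ennreal (\<bar>\<phi> (x \<odot> dil t h) - \<phi> x\<bar> powr p) \<partial>lborel) \<le> ennreal C"
    and ball: "emeasure lborel (ball (0::real^'a) \<epsilon>) = ennreal d"
    and half: "emeasure lborel {x. \<bar>\<phi> x\<bar> > s / 2} \<le> ennreal a"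
    and big: "2 * a \<le> t ^ hom_dim V m * d"
  shows "emeasure lborel {x. \<bar>\<phi> x\<bar> > s} \<le> ennreal (2 * C / (s / 2) powr p)"
proof -
  define D where "D = t ^ hom_dim V m * d"
  have D: "D > 0" using t d by (simp add: D_def)
  have [measurable]: "\<phi> \<in> borel_measurable borel"
    by (intro borel_measurable_continuous_onI C2_continuous \<phi>)
  define S where "S h = (indicator (ball 0 \<epsilon>) (dil (1 / t) h) :: ennreal)" for h
  have ball_m: "indicator (ball 0 \<epsilon>) \<in> borel_measurable (borel :: (real^'a) measure)"
    by (rule borel_measurable_indicator) (simp add: borel_open)
  have dil_m: "dil (1 / t) \<in> borel_measurable borel"
    by (intro borel_measurable_continuous_onI continuous_dil_right)
  have [measurable]: "S \<in> borel_measurable borel" unfolding S_def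
    by (rule measurable_compose[OF dil_m ball_m])
  have SD: "(\<integral>\<^sup>+h. S h \<partial>lborel) = ennreal D"
    unfolding S_def using nn_integral_dil[OF ball_m t] t d
    by (simp add: ball D_def ennreal_mult)
  define F where "F z = S (snd z) * ennreal (\<bar>\<phi> (fst z \<odot> snd z) - \<phi> (fst z)\<bar> powr p)" for z
  have [measurable]: "(\<lambda>z. fst z \<odot> snd z) \<in> borel_measurable (lborel \<Otimes>\<^sub>M lborel)"
    unfolding lborel_prod by (auto intro!: borel_measurable_continuous_onI continuous_intros)
  have [measurable]: "F \<in> borel_measurable (lborel \<Otimes>\<^sub>M lborel)" unfolding F_def by measurable
  \<comment> \<open>\<open>D\<close> is the measure of the dilated ball. By \<open>big\<close>, at
    most half of the shifts \<open>h\<close> lead to a point where \<open>\<bar>\<phi>\<bar>\<close>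
    exceeds \<open>s / 2\<close>; on the other half the difference is at least \<open>s / 2\<close>,
    since \<open>\<bar>\<phi> x\<bar> > s\<close>.\<close>
  have low: "ennreal ((s / 2) powr p * (D / 2)) \<le> (\<integral>\<^sup>+h. F (x, h) \<partial>lborel)" if x: "\<bar>\<phi> x\<bar> > s" for x
  proof -
    have 1: "S h \<le> S h * indicator {h. \<bar>\<phi> (x \<odot> h)\<bar> \<le> s / 2} h + indicator {h. \<bar>\<phi> (x \<odot> h)\<bar> > s / 2} h" for h
      by (auto simp: S_def split: split_indicator)
    have "ennreal D \<le> (\<integral>\<^sup>+h. S h * indicator {h. \<bar>\<phi> (x \<odot> h)\<bar> \<le> s / 2} h + indicator {h. \<bar>\<phi> (x \<odot> h)\<bar> > s / 2} h \<partial>lborel)"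
      unfolding SD[symmetric] by (intro nn_integral_mono 1)
    also have "\<dots> = (\<integral>\<^sup>+h. S h * indicator {h. \<bar>\<phi> (x \<odot> h)\<bar> \<le> s / 2} h \<partial>lborel)
        + (\<integral>\<^sup>+h. indicator {h. \<bar>\<phi> (x \<odot> h)\<bar> > s / 2} h \<partial>lborel)"
      by (rule nn_integral_add) measurable
    also have "(\<integral>\<^sup>+h. indicator {h. \<bar>\<phi> (x \<odot> h)\<bar> > s / 2} h \<partial>lborel)
        = (\<integral>\<^sup>+h. indicator {h. \<bar>\<phi> h\<bar> > s / 2} (x \<odot> h) \<partial>lborel)"
      by (intro nn_integral_cong) (auto split: split_indicator)
    also have "\<dots> = (\<integral>\<^sup>+h. indicator {h. \<bar>\<phi> h\<bar> > s / 2} h \<partial>lborel)"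
      by (rule nn_integral_left_translation) measurable
    also have "\<dots> \<le> ennreal a" using half by simp
    finally have 2: "ennreal D \<le> (\<integral>\<^sup>+h. S h * indicator {h. \<bar>\<phi> (x \<odot> h)\<bar> \<le> s / 2} h \<partial>lborel) + ennreal a"
      by (simp add: add_left_mono)
    have "ennreal a + ennreal (D / 2) = ennreal (a + D / 2)" using a D by (simp add: ennreal_plus)
    also have "\<dots> \<le> ennreal D" using big by (intro ennreal_leI) (simp add: D_def)
    finally have "ennreal a + ennreal (D / 2) \<le> ennreal a + (\<integral>\<^sup>+h. S h * indicator {h. \<bar>\<phi> (x \<odot> h)\<bar> \<le> s / 2} h \<partial>lborel)"
      using order_trans[OF _ 2] by (simp add: add.commute)
    then have 3: "ennreal (D / 2) \<le> (\<integral>\<^sup>+h. S h * indicator {h. \<bar>\<phi> (x \<odot> h)\<bar> \<le> s / 2} h \<partial>lborel)"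
      by (simp add: ennreal_add_left_cancel_le)
    have "ennreal ((s / 2) powr p * (D / 2)) = ennreal ((s / 2) powr p) * ennreal (D / 2)"
      using s D by (intro ennreal_mult) auto
    also have "\<dots> \<le> ennreal ((s / 2) powr p) * (\<integral>\<^sup>+h. S h * indicator {h. \<bar>\<phi> (x \<odot> h)\<bar> \<le> s / 2} h \<partial>lborel)"
      by (intro mult_left_mono 3) simp
    also have "\<dots> = (\<integral>\<^sup>+h. ennreal ((s / 2) powr p) * (S h * indicator {h. \<bar>\<phi> (x \<odot> h)\<bar> \<le> s / 2} h) \<partial>lborel)"
      by (rule nn_integral_cmult[symmetric]) measurable
    also have "\<dots> \<le> (\<integral>\<^sup>+h. F (x, h) \<partial>lborel)"
    proof (intro nn_integral_mono)
      fix h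
      show "ennreal ((s / 2) powr p) * (S h * indicator {h. \<bar>\<phi> (x \<odot> h)\<bar> \<le> s / 2} h) \<le> F (x, h)"
      proof (cases "\<bar>\<phi> (x \<odot> h)\<bar> \<le> s / 2")
        case True
        have "s / 2 \<le> \<bar>\<phi> (x \<odot> h) - \<phi> x\<bar>" using True x by linarith
        then have "(s / 2) powr p \<le> \<bar>\<phi> (x \<odot> h) - \<phi> x\<bar> powr p"
          using s p by (intro powr_mono2) auto
        then have "ennreal ((s / 2) powr p) * S h \<le> ennreal (\<bar>\<phi> (x \<odot> h) - \<phi> x\<bar> powr p) * S h"
          by (intro mult_right_mono ennreal_leI) auto
        then show ?thesis using True by (simp add: F_def mult.commute)
      qed simp
    qed
    finally show ?thesis .
  qed
  have "ennreal ((s / 2) powr p * (D / 2)) * emeasure lborel {x. \<bar>\<phi> x\<bar> > s}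
      = (\<integral>\<^sup>+x. ennreal ((s / 2) powr p * (D / 2)) * indicator {x. \<bar>\<phi> x\<bar> > s} x \<partial>lborel)"
    by (subst nn_integral_cmult) auto
  also have "\<dots> \<le> (\<integral>\<^sup>+x. \<integral>\<^sup>+h. F (x, h) \<partial>lborel \<partial>lborel)"
    by (intro nn_integral_mono) (use low in \<open>auto split: split_indicator\<close>)
  also have "\<dots> = (\<integral>\<^sup>+h. \<integral>\<^sup>+x. F (x, h) \<partial>lborel \<partial>lborel)"
    by (rule lborel_pair.Fubini'[symmetric]) simp
  also have "\<dots> \<le> (\<integral>\<^sup>+h. ennreal C * S h \<partial>lborel)"
  proof (intro nn_integral_mono)
    fix h
    have "(\<integral>\<^sup>+x. F (x, h) \<partial>lborel) = S h * (\<integral>\<^sup>+x. ennreal (\<bar>\<phi> (x \<odot> h) - \<phi> x\<bar> powr p) \<partial>lborel)"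
      unfolding F_def fst_conv snd_conv by (rule nn_integral_cmult) measurable
    also have "\<dots> \<le> S h * ennreal C"
    proof (cases "dil (1 / t) h \<in> ball 0 \<epsilon>")
      case True
      from trans[OF this] t show ?thesis by (intro mult_left_mono) auto
    qed (simp add: S_def)
    finally show "(\<integral>\<^sup>+x. F (x, h) \<partial>lborel) \<le> ennreal C * S h" by (simp add: mult.commute)
  qed
  also have "\<dots> = ennreal (C * D)" using C D by (simp add: nn_integral_cmult SD ennreal_mult)
  finally have le: "ennreal ((s / 2) powr p * (D / 2)) * emeasure lborel {x. \<bar>\<phi> x\<bar> > s} \<le> ennreal (C * D)" .
  \<comment> \<open>Division in \<open>ennreal\<close> is replaced by multiplication with an
    explicit inverse. The factor \<open>D\<close> cancels, so the scale \<open>t\<close> influences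
    the bound only through \<open>C\<close>.\<close>
  define X where "X = (s / 2) powr p"
  have X: "X > 0" using s by (simp add: X_def)
  let ?E = "emeasure lborel {x. \<bar>\<phi> x\<bar> > s}"
  have "ennreal (2 / (X * D)) * ennreal (X * (D / 2)) = ennreal (2 / (X * D) * (X * (D / 2)))"
    using X D by (intro ennreal_mult[symmetric]) auto
  also have "2 / (X * D) * (X * (D / 2)) = 1" using X D by simp
  finally have "?E = (ennreal (2 / (X * D)) * ennreal (X * (D / 2))) * ?E" by simp
  also have "\<dots> = ennreal (2 / (X * D)) * (ennreal (X * (D / 2)) * ?E)" by (rule mult.assoc)
  also have "\<dots> \<le> ennreal (2 / (X * D)) * ennreal (C * D)"
    using le unfolding X_def by (rule mult_left_mono) simp
  also have "\<dots> = ennreal (2 / (X * D) * (C * D))"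
    using X C D by (intro ennreal_mult[symmetric]) auto
  also have "2 / (X * D) * (C * D) = 2 * C / X" using X D by simp
  finally show ?thesis unfolding X_def .
qed

definition admissible :: "(real^'a) set \<Rightarrow> real \<Rightarrow> (real^'a \<Rightarrow> real) \<Rightarrow> bool" where
  "admissible \<Omega> p \<phi> \<longleftrightarrow> test_fun \<Omega> \<phi> \<and> energy p \<phi> \<le> 1"

lemma admissible_C2: "admissible \<Omega> p \<phi> \<Longrightarrow> C2 \<phi>"
  unfolding admissible_def test_fun_def using smooth_on_imp_C2 by blast

lemma test_fun_zero: "test_fun \<Omega> \<phi> \<Longrightarrow> x \<notin> \<Omega> \<Longrightarrow> \<phi> x = 0"
  unfolding test_fun_def using closure_subset[of "{x. \<phi> x \<noteq> 0}"] by blast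

abbreviation (input) "\<nu> \<equiv> real (hom_dim V m)"

lemma hom_dim_pos: "hom_dim V m > 0"
proof -
  have "1 \<le> \<sigma> k" for k using \<sigma>_range by simp
  then have "(\<Sum>k\<in>(UNIV::'a set). 1) \<le> hom_dim V m" unfolding \<sigma>_sum[symmetric] by (intro sum_mono) simp
  then have "CARD('a) \<le> hom_dim V m" by simp
  then show ?thesis using zero_less_card_finite[where 'a = 'a] by linarith
qed

text \<open>One step of the bootstrap turns a weak \<open>L\<^sup>r\<close> bound into a weak bound with exponent
  \<open>p + p r / \<nu>\<close>, whose fixed point is the critical exponent.\<close>

lemma weak_type_bootstrap:
  assumes p: "p \<ge> 1" and r: "r \<ge> 0" and A: "A > 0"
    and weak: "\<And>\<phi> s. admissible \<Omega> p \<phi> \<Longrightarrow> s > 0 \<Longrightarrow> emeasure lborel {x. \<bar>\<phi> x\<bar> > s} \<le> ennreal (A * s powr (- r))"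
  shows "\<exists>A'>0. \<forall>\<phi> s. admissible \<Omega> p \<phi> \<longrightarrow> s > 0 \<longrightarrow>
    emeasure lborel {x. \<bar>\<phi> x\<bar> > s} \<le> ennreal (A' * s powr (- (p + p * r / \<nu>)))"
proof -
  from translation_estimate obtain \<epsilon> C where \<epsilon>: "\<epsilon> > 0" and C': "\<forall>P. C P > 0"
    and trans': "\<forall>P t h \<phi>. P \<ge> 1 \<longrightarrow> t > 0 \<longrightarrow> C2 \<phi> \<longrightarrow> h \<in> ball 0 \<epsilon> \<longrightarrow>
      (\<integral>\<^sup>+x. ennreal (\<bar>\<phi> (x \<odot> dil t h) - \<phi> x\<bar> powr P) \<partial>lborel) \<le> ennreal (C P * t powr P) * energy P \<phi>"
    by (elim exE conjE)
  note C = C'[rule_format] and trans = trans'[rule_format]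
  define d where "d = measure lborel (ball (0::real^'a) \<epsilon>)"
  have d: "emeasure lborel (ball (0::real^'a) \<epsilon>) = ennreal d"
    unfolding d_def using emeasure_bounded_finite[OF bounded_ball, of "0::real^'a" \<epsilon>]
    by (intro emeasure_eq_ennreal_measure) auto
  have "\<not> negligible (ball (0::real^'a) \<epsilon>)" using \<epsilon> by (intro open_not_negligible) auto
  then have "emeasure lborel (ball (0::real^'a) \<epsilon>) \<noteq> 0"
    unfolding negligible_iff_null_sets null_sets_def by (simp add: borel_open)
  then have d0: "d > 0" unfolding d by (simp add: ennreal_eq_0_iff)
  have \<nu>: "\<nu> > 0" using hom_dim_pos by simp
  define A' where "A' = 2 * C p * (2 * A * 2 powr r / d) powr (p / \<nu>) * 2 powr p"
  have "A' > 0" using C A d0 by (simp add: A'_def)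
  moreover have "emeasure lborel {x. \<bar>\<phi> x\<bar> > s} \<le> ennreal (A' * s powr (- (p + p * r / \<nu>)))"
    if \<phi>: "admissible \<Omega> p \<phi>" and s: "s > 0" for \<phi> s
  proof -
    define a where "a = A * (s / 2) powr (- r)"
    have a: "a > 0" using A s by (simp add: a_def)
    \<comment> \<open>The smallest scale at which the set of level \<open>s / 2\<close> is known to
      fill at most half of the dilated ball. It is proportional to
      \<open>s powr (- r / \<nu>)\<close>, which produces the summand \<open>p * r / \<nu>\<close>
      in the new exponent.\<close>
    define t where "t = (2 * a / d) powr (1 / \<nu>)"
    have t: "t > 0" using a d0 by (simp add: t_def)
    have tn: "t ^ hom_dim V m = 2 * a / d"
      using t a d0 \<nu> by (simp add: powr_realpow[symmetric] t_def powr_powr)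
    have "emeasure lborel {x. \<bar>\<phi> x\<bar> > s} \<le> ennreal (2 * (C p * t powr p) / (s / 2) powr p)"
    proof (rule weak_type_step[OF admissible_C2[OF \<phi>] s t _ d0 _ p _ d])
      show "emeasure lborel {x. \<bar>\<phi> x\<bar> > s / 2} \<le> ennreal a"
        using weak[OF \<phi>, of "s / 2"] s by (simp add: a_def)
      show "2 * a \<le> t ^ hom_dim V m * d" using d0 by (simp add: tn)
      fix h assume "h \<in> ball (0::real^'a) \<epsilon>"
      from trans[OF p t admissible_C2[OF \<phi>] this]
      have "(\<integral>\<^sup>+x. ennreal (\<bar>\<phi> (x \<odot> dil t h) - \<phi> x\<bar> powr p) \<partial>lborel) \<le> ennreal (C p * t powr p) * energy p \<phi>" .
      also have "\<dots> \<le> ennreal (C p * t powr p) * 1"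
        using \<phi> by (intro mult_left_mono) (auto simp: admissible_def)
      finally show "(\<integral>\<^sup>+x. ennreal (\<bar>\<phi> (x \<odot> dil t h) - \<phi> x\<bar> powr p) \<partial>lborel) \<le> ennreal (C p * t powr p)" by simp
    qed (use a C[of p] in auto)
    also have "2 * (C p * t powr p) / (s / 2) powr p = A' * s powr (- (p + p * r / \<nu>))"
    proof -
      have "2 * a / d = (2 * A * 2 powr r / d) * s powr (- r)"
        using s by (simp add: a_def powr_divide powr_minus field_simps)
      then have "t powr p = ((2 * A * 2 powr r / d) * s powr (- r)) powr (p / \<nu>)"
        by (simp only: t_def powr_powr times_divide_eq_left mult_1_left)
      also have "\<dots> = (2 * A * 2 powr r / d) powr (p / \<nu>) * (s powr (- r)) powr (p / \<nu>)"
        by (rule powr_mult)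
      also have "(s powr (- r)) powr (p / \<nu>) = s powr (- (p * r / \<nu>))"
        by (simp add: powr_powr mult.commute)
      finally have "t powr p = (2 * A * 2 powr r / d) powr (p / \<nu>) * s powr (- (p * r / \<nu>))" .
      moreover have "(s / 2) powr p = s powr p / 2 powr p" using s by (simp add: powr_divide)
      moreover have "s powr (- (p + p * r / \<nu>)) = s powr (- (p * r / \<nu>)) / s powr p"
      proof -
        have "- (p + p * r / \<nu>) = - (p * r / \<nu>) - p" by simp
        then show ?thesis by (simp only: powr_diff)
      qed
      ultimately show ?thesis using s by (simp add: A'_def)
    qed
    finally show ?thesis .
  qed
  ultimately show ?thesis by blast
qed

text \<open>For \<open>r = 0\<close> the bound is the volume of \<open>\<Omega>\<close>, outside of
  which test functions vanish. From there the bootstrap runs through the exponents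
  \<open>qs * (1 - (p / \<nu>) ^ k)\<close>, which tend to \<open>qs\<close>; a given
  \<open>q < qs\<close> is passed after finitely many steps.\<close>

lemma weak_type_subcritical:
  assumes \<Omega>: "bounded \<Omega>" "open \<Omega>" and p: "1 \<le> p" "p < \<nu>" and q: "q < \<nu> * p / (\<nu> - p)"
  shows "\<exists>r A. q < r \<and> A > 0 \<and> (\<forall>\<phi> s. admissible \<Omega> p \<phi> \<longrightarrow> s > 0 \<longrightarrow>
    emeasure lborel {x. \<bar>\<phi> x\<bar> > s} \<le> ennreal (A * s powr (- r)))"
proof -
  define qs where "qs = \<nu> * p / (\<nu> - p)"
  have qs: "qs = p + p * qs / \<nu>" "qs > 0"
    using p by (auto simp: qs_def field_simps)
  define R where "R k = qs * (1 - (p / \<nu>) ^ k)" for k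
  have base: "p / \<nu> \<ge> 0" "p / \<nu> < 1" using p by auto
  have R0: "R k \<ge> 0" for k
    unfolding R_def using base qs(2) power_le_one[of "p / \<nu>" k] by (intro mult_nonneg_nonneg) auto
  have RS: "R (Suc k) = p + p * R k / \<nu>" for k
  proof -
    have "p + p * R k / \<nu> = (p + p * qs / \<nu>) - qs * (p / \<nu>) ^ Suc k"
      by (simp add: R_def diff_divide_distrib algebra_simps)
    then show ?thesis by (simp add: R_def algebra_simps flip: qs(1))
  qed
  have "\<exists>A>0. \<forall>\<phi> s. admissible \<Omega> p \<phi> \<longrightarrow> s > 0 \<longrightarrow>
      emeasure lborel {x. \<bar>\<phi> x\<bar> > s} \<le> ennreal (A * s powr (- R k))" for k
  proof (induction k)
    case 0
    have fin: "emeasure lborel \<Omega> < \<infinity>" using emeasure_bounded_finite[OF \<Omega>(1)] by simp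
    have "emeasure lborel {x. \<bar>\<phi> x\<bar> > s} \<le> ennreal ((measure lborel \<Omega> + 1) * s powr (- R 0))"
      if "admissible \<Omega> p \<phi>" "s > 0" for \<phi> s
    proof -
      have "{x. \<bar>\<phi> x\<bar> > s} \<subseteq> \<Omega>"
        using that test_fun_zero[of \<Omega> \<phi>] unfolding admissible_def by force
      then have "emeasure lborel {x. \<bar>\<phi> x\<bar> > s} \<le> emeasure lborel \<Omega>"
        using \<Omega> by (intro emeasure_mono) auto
      also have "\<dots> = ennreal (measure lborel \<Omega>)" using fin by (intro emeasure_eq_ennreal_measure) auto
      also have "\<dots> \<le> ennreal ((measure lborel \<Omega> + 1) * s powr (- R 0))"
        using that by (intro ennreal_leI) (simp add: R_def)
      finally show ?thesis .
    qed
    moreover have "measure lborel \<Omega> + 1 > 0" by (simp add: add_nonneg_pos)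
    ultimately show ?case by blast
  next
    case (Suc k)
    then obtain A where "A > 0" "\<And>\<phi> s. admissible \<Omega> p \<phi> \<Longrightarrow> s > 0 \<Longrightarrow>
      emeasure lborel {x. \<bar>\<phi> x\<bar> > s} \<le> ennreal (A * s powr (- R k))" by blast
    from weak_type_bootstrap[OF p(1) R0 this] show ?case unfolding RS by blast
  qed
  moreover have "\<exists>k. q < R k"
  proof -
    have "(\<lambda>k. R k) \<longlonglongrightarrow> qs * (1 - 0)"
      unfolding R_def using base by (intro tendsto_intros LIMSEQ_power_zero) auto
    moreover have "q < qs * (1 - 0)" using q by (simp add: qs_def)
    ultimately have "\<forall>\<^sub>F k in sequentially. q < R k" by (rule order_tendstoD)
    then show ?thesis by (auto simp: eventually_sequentially)
  qed
  ultimately show ?thesis by metis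
qed

section \<open>Compactness in the space of integrable functions\<close>

lemma test_fun_C2: "test_fun \<Omega> \<phi> \<Longrightarrow> C2 \<phi>"
  unfolding test_fun_def using smooth_on_imp_C2 by blast

lemma grad_zero_outside:
  assumes "test_fun \<Omega> \<phi>" "x \<notin> \<Omega>"
  shows "grad \<phi> x = 0"
proof -
  define U where "U = - closure {x. \<phi> x \<noteq> 0}"
  have "open U" "x \<in> U" using assms by (auto simp: U_def test_fun_def)
  moreover have "\<phi> y = 0" if "y \<in> U" for y
    using that closure_subset[of "{x. \<phi> x \<noteq> 0}"] by (auto simp: U_def)
  ultimately have "(\<phi> has_derivative (\<lambda>_. 0)) (at x)"
    by (intro has_derivative_transform_within_open[OF has_derivative_const[of 0]]) auto
  then show ?thesis by (simp add: hgrad_def vec_eq_iff lfield_eq)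
qed

lemma test_fun_bounded:
  assumes "test_fun \<Omega> \<phi>"
  obtains b where "\<And>x. \<bar>\<phi> x\<bar> \<le> b"
proof -
  let ?S = "closure {x. \<phi> x \<noteq> 0}"
  have "compact (\<phi> ` ?S)"
    using assms by (intro compact_continuous_image C2_continuous test_fun_C2) (auto simp: test_fun_def)
  then have "bounded (\<phi> ` ?S)" by (rule compact_imp_bounded)
  then obtain b where "\<forall>y\<in>\<phi> ` ?S. norm y \<le> b" unfolding bounded_iff by blast
  from bspec[OF this imageI] have b: "\<bar>\<phi> x\<bar> \<le> b" if "x \<in> ?S" for x using that by simp
  have "\<bar>\<phi> x\<bar> \<le> max b 0" for x
  proof (cases "\<phi> x = 0")
    case False
    then have "x \<in> {x. \<phi> x \<noteq> 0}" by simp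
    with closure_subset have "x \<in> ?S" by (rule subsetD)
    from b[OF this] show ?thesis by linarith
  qed simp
  then show ?thesis by (rule that)
qed

text \<open>Converts the normalisation with exponent \<open>p\<close> into the exponent-one energy
  that controls translation differences in \<open>L\<^sup>1\<close>. In
  \<open>y \<le> 1 + y powr p\<close> the constant costs only the volume of \<open>\<Omega>\<close>,
  because the gradient vanishes outside.\<close>

lemma admissible_energy_1:
  assumes \<Omega>: "bounded \<Omega>" "open \<Omega>" and p: "p \<ge> 1" and \<phi>: "admissible \<Omega> p \<phi>"
  shows "energy 1 \<phi> \<le> ennreal (measure lborel \<Omega> + 1)"
proof -
  have t: "test_fun \<Omega> \<phi>" and e: "energy p \<phi> \<le> 1" using \<phi> by (auto simp: admissible_def)
  have [measurable]: "grad \<phi> \<in> borel_measurable borel" by (rule hgrad_measurable[OF test_fun_C2[OF t]])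
  have [measurable]: "\<Omega> \<in> sets borel" using \<Omega> by auto
  have fin: "emeasure lborel \<Omega> = ennreal (measure lborel \<Omega>)"
    using emeasure_bounded_finite[OF \<Omega>(1)] by (intro emeasure_eq_ennreal_measure) auto
  have "energy 1 \<phi> \<le> (\<integral>\<^sup>+x. indicator \<Omega> x + ennreal (norm (grad \<phi> x) powr p) \<partial>lborel)"
    unfolding energy_def
  proof (intro nn_integral_mono)
    fix x
    have le: "norm (grad \<phi> x) \<le> 1 + norm (grad \<phi> x) powr p"
    proof (cases "norm (grad \<phi> x) \<le> 1")
      case False
      then have "norm (grad \<phi> x) powr 1 \<le> norm (grad \<phi> x) powr p" using p by (intro powr_mono) auto
      then show ?thesis using False by simp
    qed (simp add: add_increasing2)
    show "ennreal (norm (grad \<phi> x) powr 1) \<le> indicator \<Omega> x + ennreal (norm (grad \<phi> x) powr p)"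
    proof (cases "x \<in> \<Omega>")
      case True
      then show ?thesis using le
        by (simp add: ennreal_plus[symmetric] ennreal_leI flip: ennreal_1 del: ennreal_plus)
    next
      case False
      then show ?thesis using grad_zero_outside[OF t] by simp
    qed
  qed
  also have "\<dots> = emeasure lborel \<Omega> + energy p \<phi>"
    unfolding energy_def by (subst nn_integral_add) auto
  also have "\<dots> \<le> ennreal (measure lborel \<Omega>) + 1" unfolding fin by (intro add_left_mono e)
  also have "\<dots> = ennreal (measure lborel \<Omega> + 1)" by (simp add: ennreal_plus flip: ennreal_1)
  finally show ?thesis .
qed

lemma admissible_L1_bound:
  assumes \<Omega>: "bounded \<Omega>" "open \<Omega>" and p: "1 \<le> p" "p < \<nu>"
  shows "\<exists>M>0. \<forall>\<phi>. admissible \<Omega> p \<phi> \<longrightarrow> (\<integral>\<^sup>+x. ennreal \<bar>\<phi> x\<bar> \<partial>lborel) \<le> ennreal M"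
proof -
  have "1 < \<nu> * p / (\<nu> - p)"
  proof -
    have "\<nu> * 1 \<le> \<nu> * p" using p by (intro mult_left_mono) auto
    then have "\<nu> - p < \<nu> * p" using p by linarith
    then show ?thesis using p by simp
  qed
  from weak_type_subcritical[OF \<Omega> p this] obtain r A where r: "1 < r" and A: "A > 0"
    and weak: "\<And>\<phi> s. admissible \<Omega> p \<phi> \<Longrightarrow> s > 0 \<Longrightarrow> emeasure lborel {x. \<bar>\<phi> x\<bar> > s} \<le> ennreal (A * s powr (- r))"
    by blast
  define M where "M = A * 2 powr 1 * 1 powr (1 - r) / (1 - 2 powr (1 - r))"
  have "(2::real) powr (1 - r) < 1" using r by (simp add: powr_less_one)
  then have M: "M > 0" using A by (simp add: M_def)
  have [measurable]: "\<Omega> \<in> sets borel" using \<Omega> by auto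
  have fin: "emeasure lborel \<Omega> = ennreal (measure lborel \<Omega>)"
    using emeasure_bounded_finite[OF \<Omega>(1)] by (intro emeasure_eq_ennreal_measure) auto
  have "(\<integral>\<^sup>+x. ennreal \<bar>\<phi> x\<bar> \<partial>lborel) \<le> ennreal (measure lborel \<Omega> + M)" if \<phi>: "admissible \<Omega> p \<phi>" for \<phi>
  proof -
    have [measurable]: "\<phi> \<in> borel_measurable borel"
      by (intro borel_measurable_continuous_onI C2_continuous admissible_C2[OF \<phi>])
    have z: "\<phi> x = 0" if "x \<notin> \<Omega>" for x using \<phi> test_fun_zero that by (auto simp: admissible_def)
    have "(\<integral>\<^sup>+x. ennreal \<bar>\<phi> x\<bar> \<partial>lborel)
        \<le> (\<integral>\<^sup>+x. indicator \<Omega> x + ennreal (\<bar>\<phi> x\<bar> powr 1) * indicator {x. \<bar>\<phi> x\<bar> > 1} x \<partial>lborel)"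
    proof (intro nn_integral_mono)
      fix x
      show "ennreal \<bar>\<phi> x\<bar> \<le> indicator \<Omega> x + ennreal (\<bar>\<phi> x\<bar> powr 1) * indicator {x. \<bar>\<phi> x\<bar> > 1} x"
      proof (cases "x \<in> \<Omega>")
        case True
        have "ennreal \<bar>\<phi> x\<bar> \<le> 1" if "\<bar>\<phi> x\<bar> \<le> 1" using that by (simp flip: ennreal_1)
        then show ?thesis using True by (auto split: split_indicator simp: not_less)
      qed (simp add: z)
    qed
    also have "\<dots> = emeasure lborel \<Omega> + (\<integral>\<^sup>+x. ennreal (\<bar>\<phi> x\<bar> powr 1) * indicator {x. \<bar>\<phi> x\<bar> > 1} x \<partial>lborel)"
      by (subst nn_integral_add) auto
    also have "\<dots> \<le> ennreal (measure lborel \<Omega>) + ennreal M"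
      unfolding fin M_def
      by (intro add_left_mono nn_integral_tail_weak) (use r A weak[OF \<phi>] in auto)
    also have "\<dots> = ennreal (measure lborel \<Omega> + M)" using M by (simp add: ennreal_plus)
    finally show ?thesis .
  qed
  moreover have "measure lborel \<Omega> + M > 0" using M by (simp add: add_nonneg_pos)
  ultimately show ?thesis by blast
qed

section \<open>Averages over dilated balls\<close>

lemma distr_left_translation: "distr lborel borel (\<lambda>y. x \<odot> y) = lborel"
proof (rule measure_eqI)
  fix A assume "A \<in> sets (distr lborel borel (\<lambda>y. x \<odot> y))"
  then have [measurable]: "A \<in> sets borel" by simp
  have "emeasure (distr lborel borel (\<lambda>y. x \<odot> y)) A = (\<integral>\<^sup>+y. indicator A y \<partial>distr lborel borel (\<lambda>y. x \<odot> y))"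
    by simp
  also have "\<dots> = (\<integral>\<^sup>+y. indicator A (x \<odot> y) \<partial>lborel)"
    by (rule nn_integral_distr) (simp_all add: gmul_borel)
  also have "\<dots> = (\<integral>\<^sup>+y. indicator A y \<partial>lborel)"
    by (rule nn_integral_left_translation) measurable
  finally show "emeasure (distr lborel borel (\<lambda>y. x \<odot> y)) A = emeasure lborel A" by simp
qed simp

text \<open>A continuous tent over the dilated ball in place of its indicator, so that averages
  against it vary continuously with their centre.\<close>

definition bump :: "real \<Rightarrow> real \<Rightarrow> real^'a \<Rightarrow> real" where
  "bump \<epsilon> t h = max 0 (1 - inverse \<epsilon> * norm (dil (1 / t) h))"

lemma continuous_bump: "continuous_on S (bump \<epsilon> t)"
  unfolding bump_def
  by (intro continuous_intros continuous_on_compose2[OF continuous_dil_right[of UNIV]]) auto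

lemma bump_measurable [measurable]: "bump \<epsilon> t \<in> borel_measurable borel"
  by (intro borel_measurable_continuous_onI continuous_bump)

lemma bump_bounds: "\<epsilon> > 0 \<Longrightarrow> 0 \<le> bump \<epsilon> t h" "\<epsilon> > 0 \<Longrightarrow> bump \<epsilon> t h \<le> 1"
  by (simp_all add: bump_def)

lemma bump_support: "\<epsilon> > 0 \<Longrightarrow> bump \<epsilon> t h \<noteq> 0 \<Longrightarrow> dil (1 / t) h \<in> ball 0 \<epsilon>"
  by (auto simp: bump_def field_simps max_def split: if_splits)

lemma nn_integral_bump:
  assumes "\<epsilon> > 0"
  shows "\<exists>c>0. \<forall>t>0. (\<integral>\<^sup>+h. ennreal (bump \<epsilon> t h) \<partial>lborel) = ennreal (t ^ hom_dim V m * c)"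
proof -
  define N where "N = (\<integral>\<^sup>+h. ennreal (bump \<epsilon> 1 h) \<partial>lborel)"
  have "N \<le> (\<integral>\<^sup>+h. indicator (ball (0::real^'a) \<epsilon>) h \<partial>lborel)"
    unfolding N_def
  proof (intro nn_integral_mono)
    fix h
    show "ennreal (bump \<epsilon> 1 h) \<le> indicator (ball 0 \<epsilon>) h"
      using bump_support[OF assms, of 1 h] bump_bounds[OF assms, of 1 h]
      by (auto split: split_indicator simp flip: ennreal_1)
  qed
  also have "\<dots> < \<infinity>" using emeasure_bounded_finite[OF bounded_ball, of "0::real^'a" \<epsilon>] by simp
  finally have fin: "N < \<infinity>" .
  have pos: "N \<noteq> 0"
  proof
    assume "N = 0"
    then have "AE h in lborel. ennreal (bump \<epsilon> 1 h) = 0"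
      unfolding N_def by (subst (asm) nn_integral_0_iff_AE) auto
    then have "AE h in lborel. bump \<epsilon> 1 h \<le> 0"
      by eventually_elim (simp add: ennreal_eq_0_iff)
    then have "AE h in lborel. h \<notin> ball (0::real^'a) \<epsilon>"
      by eventually_elim (use assms in \<open>auto simp: bump_def field_simps\<close>)
    then have "emeasure lborel (ball (0::real^'a) \<epsilon>) = 0"
      by (subst (asm) AE_iff_measurable[where N = "ball 0 \<epsilon>"]) (auto simp: borel_open)
    then have "negligible (ball (0::real^'a) \<epsilon>)"
      unfolding negligible_iff_null_sets null_sets_def by (simp add: borel_open)
    moreover have "\<not> negligible (ball (0::real^'a) \<epsilon>)"
      using assms by (intro open_not_negligible) auto
    ultimately show False by simp
  qed
  obtain c where c: "N = ennreal c" "c \<ge> 0" using fin by (cases N) auto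
  have "(\<integral>\<^sup>+h. ennreal (bump \<epsilon> t h) \<partial>lborel) = ennreal (t ^ hom_dim V m * c)" if "t > 0" for t
  proof -
    have "bump \<epsilon> t = (\<lambda>h. bump \<epsilon> 1 (dil (1 / t) h))" by (auto simp: bump_def)
    then have "(\<integral>\<^sup>+h. ennreal (bump \<epsilon> t h) \<partial>lborel) = ennreal (t ^ hom_dim V m) * N"
      unfolding N_def using nn_integral_dil[of "\<lambda>h. ennreal (bump \<epsilon> 1 h)" t] that by simp
    then show ?thesis using that c by (simp add: ennreal_mult)
  qed
  moreover have "c > 0" using pos c by (cases "c = 0") auto
  ultimately show ?thesis by blast
qed

text \<open>The centre \<open>x\<close> sits in the kernel and not in \<open>\<phi>\<close>, so that
  regularity in \<open>x\<close> comes from the bump alone. The average is not normalised: it has to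
  be compared with \<open>\<phi>\<close> times the mass of the bump.\<close>

definition smear :: "real \<Rightarrow> real \<Rightarrow> (real^'a \<Rightarrow> real) \<Rightarrow> real^'a \<Rightarrow> real" where
  "smear \<epsilon> t \<phi> x = (\<integral>y. \<phi> y * bump \<epsilon> t ((- x) \<odot> y) \<partial>lborel)"

lemma continuous_bump_translate:
  "continuous_on UNIV (\<lambda>z. bump \<epsilon> t ((- fst z) \<odot> snd z))"
  by (rule continuous_on_compose2[OF continuous_bump[of UNIV]]) (auto intro!: continuous_intros)

lemma smear_measurable:
  assumes "\<phi> \<in> borel_measurable borel"
  shows "smear \<epsilon> t \<phi> \<in> borel_measurable lborel"
proof -
  have [measurable]: "(\<lambda>z. bump \<epsilon> t ((- fst z) \<odot> snd z)) \<in> borel_measurable (lborel \<Otimes>\<^sub>M lborel)"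
    using continuous_bump_translate by (simp add: lborel_prod borel_measurable_continuous_onI)
  have "(\<lambda>z. \<phi> (snd z) * bump \<epsilon> t ((- fst z) \<odot> snd z)) \<in> borel_measurable (lborel \<Otimes>\<^sub>M lborel)"
    using assms by measurable
  then show ?thesis
    unfolding smear_def
    by (intro lborel.borel_measurable_lebesgue_integral) (simp add: case_prod_unfold)
qed

lemma smear_integrable:
  assumes "integrable lborel \<phi>" "\<epsilon> > 0"
  shows "integrable lborel (\<lambda>y. \<phi> y * bump \<epsilon> t ((- x) \<odot> y))"
proof (rule Bochner_Integration.integrable_bound[OF assms(1)])
  have "(\<lambda>y. bump \<epsilon> t ((- x) \<odot> y)) \<in> borel_measurable borel"
    by (intro borel_measurable_continuous_onI continuous_on_compose2[OF continuous_bump[of UNIV]])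
      (auto intro!: continuous_intros)
  then show "(\<lambda>y. \<phi> y * bump \<epsilon> t ((- x) \<odot> y)) \<in> borel_measurable lborel"
    using assms(1) by measurable
  show "AE y in lborel. norm (\<phi> y * bump \<epsilon> t ((- x) \<odot> y)) \<le> norm (\<phi> y)"
    using bump_bounds[OF assms(2)] by (auto simp: abs_mult intro!: AE_I2 mult_left_le)
qed

text \<open>Left invariance rewrites the average as an integral of
  \<open>\<phi> (x \<odot> h)\<close> against \<open>bump \<epsilon> t h\<close>. The error is then
  an average of translation differences over shifts in the dilated ball, and Fubini lets
  \<open>trans\<close> act on each shift separately.\<close>

lemma smear_approx:
  assumes \<epsilon>: "\<epsilon> > 0" and t: "t > 0" and \<phi>: "test_fun \<Omega> \<phi>" and int: "integrable lborel \<phi>"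
    and I: "(\<integral>\<^sup>+h. ennreal (bump \<epsilon> t h) \<partial>lborel) = ennreal I" "I \<ge> 0" and C: "C \<ge> 0"
    and trans: "\<And>h. h \<in> ball 0 \<epsilon> \<Longrightarrow>
      (\<integral>\<^sup>+x. ennreal \<bar>\<phi> (x \<odot> dil t h) - \<phi> x\<bar> \<partial>lborel) \<le> ennreal C"
  shows "(\<integral>\<^sup>+x. ennreal \<bar>I * \<phi> x - smear \<epsilon> t \<phi> x\<bar> \<partial>lborel) \<le> ennreal (C * I)"
proof -
  have \<phi>m [measurable]: "\<phi> \<in> borel_measurable borel"
    by (intro borel_measurable_continuous_onI C2_continuous test_fun_C2[OF \<phi>])
  define F where "F z = ennreal \<bar>\<phi> (fst z \<odot> snd z) - \<phi> (fst z)\<bar> * ennreal (bump \<epsilon> t (snd z))" for z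
  have [measurable]: "(\<lambda>z. fst z \<odot> snd z) \<in> borel_measurable (lborel \<Otimes>\<^sub>M lborel)"
    unfolding lborel_prod by (auto intro!: borel_measurable_continuous_onI continuous_intros)
  have [measurable]: "F \<in> borel_measurable (lborel \<Otimes>\<^sub>M lborel)" unfolding F_def by measurable
  obtain b where b: "\<And>x. \<bar>\<phi> x\<bar> \<le> b" using test_fun_bounded[OF \<phi>] by blast
  have bint: "integrable lborel (bump \<epsilon> t)"
    using bump_bounds[OF \<epsilon>] I by (intro integrableI_nonneg) auto
  have "ennreal \<bar>I * \<phi> x - smear \<epsilon> t \<phi> x\<bar> \<le> (\<integral>\<^sup>+h. F (x, h) \<partial>lborel)" for x
  proof -
    have "smear \<epsilon> t \<phi> x = (\<integral>y. \<phi> y * bump \<epsilon> t ((- x) \<odot> y) \<partial>distr lborel borel (\<lambda>y. x \<odot> y))"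
      unfolding smear_def distr_left_translation ..
    also have "\<dots> = (\<integral>h. \<phi> (x \<odot> h) * bump \<epsilon> t ((- x) \<odot> (x \<odot> h)) \<partial>lborel)"
    proof (rule integral_distr)
      have "(\<lambda>y. bump \<epsilon> t ((- x) \<odot> y)) \<in> borel_measurable borel"
        by (intro borel_measurable_continuous_onI continuous_on_compose2[OF continuous_bump[of UNIV]])
          (auto intro!: continuous_intros)
      then show "(\<lambda>y. \<phi> y * bump \<epsilon> t ((- x) \<odot> y)) \<in> borel_measurable borel" by measurable
    qed (simp add: gmul_borel)
    finally have s: "smear \<epsilon> t \<phi> x = (\<integral>h. \<phi> (x \<odot> h) * bump \<epsilon> t h \<partial>lborel)" by simp
    have Ib: "I = (\<integral>h. bump \<epsilon> t h \<partial>lborel)"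
      using I bump_bounds[OF \<epsilon>] by (subst integral_eq_nn_integral) auto
    have i1: "integrable lborel (\<lambda>h. \<phi> (x \<odot> h) * bump \<epsilon> t h)"
    proof (rule Bochner_Integration.integrable_bound[OF integrable_mult_right[OF bint, of b]])
      show "(\<lambda>h. \<phi> (x \<odot> h) * bump \<epsilon> t h) \<in> borel_measurable lborel" by measurable
      show "AE h in lborel. norm (\<phi> (x \<odot> h) * bump \<epsilon> t h) \<le> norm (b * bump \<epsilon> t h)"
      proof (intro AE_I2)
        fix h
        have "\<bar>\<phi> (x \<odot> h)\<bar> \<le> \<bar>b\<bar>" using b[of "x \<odot> h"] by linarith
        then show "norm (\<phi> (x \<odot> h) * bump \<epsilon> t h) \<le> norm (b * bump \<epsilon> t h)"
          by (simp add: abs_mult mult_right_mono)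
      qed
    qed
    have "I * \<phi> x - smear \<epsilon> t \<phi> x = (\<integral>h. \<phi> x * bump \<epsilon> t h - \<phi> (x \<odot> h) * bump \<epsilon> t h \<partial>lborel)"
      using bint i1 by (simp add: s Ib Bochner_Integration.integral_diff)
    also have "\<dots> = (\<integral>h. (\<phi> x - \<phi> (x \<odot> h)) * bump \<epsilon> t h \<partial>lborel)" by (simp add: left_diff_distrib)
    finally have eq: "I * \<phi> x - smear \<epsilon> t \<phi> x = (\<integral>h. (\<phi> x - \<phi> (x \<odot> h)) * bump \<epsilon> t h \<partial>lborel)" .
    have "integrable lborel (\<lambda>h. (\<phi> x - \<phi> (x \<odot> h)) * bump \<epsilon> t h)"
      using bint i1 by (simp add: left_diff_distrib)
    from integral_norm_bound_ennreal[OF this]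
    have "ennreal \<bar>I * \<phi> x - smear \<epsilon> t \<phi> x\<bar> \<le> (\<integral>\<^sup>+h. ennreal (norm ((\<phi> x - \<phi> (x \<odot> h)) * bump \<epsilon> t h)) \<partial>lborel)"
      unfolding eq by simp
    also have "\<dots> = (\<integral>\<^sup>+h. F (x, h) \<partial>lborel)"
      using bump_bounds[OF \<epsilon>] by (intro nn_integral_cong)
        (simp add: F_def abs_mult ennreal_mult abs_minus_commute)
    finally show ?thesis .
  qed
  then have "(\<integral>\<^sup>+x. ennreal \<bar>I * \<phi> x - smear \<epsilon> t \<phi> x\<bar> \<partial>lborel) \<le> (\<integral>\<^sup>+x. \<integral>\<^sup>+h. F (x, h) \<partial>lborel \<partial>lborel)"
    by (intro nn_integral_mono)
  also have "\<dots> = (\<integral>\<^sup>+h. \<integral>\<^sup>+x. F (x, h) \<partial>lborel \<partial>lborel)"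
    by (rule lborel_pair.Fubini'[symmetric]) simp
  also have "\<dots> \<le> (\<integral>\<^sup>+h. ennreal C * ennreal (bump \<epsilon> t h) \<partial>lborel)"
  proof (intro nn_integral_mono)
    fix h
    have "(\<integral>\<^sup>+x. F (x, h) \<partial>lborel) = (\<integral>\<^sup>+x. ennreal \<bar>\<phi> (x \<odot> h) - \<phi> x\<bar> \<partial>lborel) * ennreal (bump \<epsilon> t h)"
      unfolding F_def fst_conv snd_conv by (rule nn_integral_multc) measurable
    also have "\<dots> \<le> ennreal C * ennreal (bump \<epsilon> t h)"
    proof (cases "bump \<epsilon> t h = 0")
      case False
      from trans[OF bump_support[OF \<epsilon> this]] t show ?thesis by (intro mult_right_mono) auto
    qed simp
    finally show "(\<integral>\<^sup>+x. F (x, h) \<partial>lborel) \<le> ennreal C * ennreal (bump \<epsilon> t h)" .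
  qed
  also have "\<dots> = ennreal (C * I)" using C I by (simp add: nn_integral_cmult ennreal_mult)
  finally show ?thesis .
qed

text \<open>The kernel is uniformly continuous on \<open>K \<times> K\<close>, so one
  \<open>\<delta>\<close> serves every \<open>\<phi>\<close> supported in \<open>K\<close> whose
  \<open>L\<^sup>1\<close> norm is at most \<open>M\<close>.\<close>

lemma smear_equicontinuous:
  assumes \<epsilon>: "\<epsilon> > 0" and K: "compact K" and M: "M > 0" and \<eta>: "\<eta> > 0"
  shows "\<exists>\<delta>>0. \<forall>\<phi> x x'. integrable lborel \<phi> \<longrightarrow> (\<forall>y. y \<notin> K \<longrightarrow> \<phi> y = 0) \<longrightarrow> (\<integral>y. \<bar>\<phi> y\<bar> \<partial>lborel) \<le> M \<longrightarrow>
    x \<in> K \<longrightarrow> x' \<in> K \<longrightarrow> dist x x' < \<delta> \<longrightarrow> \<bar>smear \<epsilon> t \<phi> x - smear \<epsilon> t \<phi> x'\<bar> \<le> \<eta>"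
proof -
  let ?g = "\<lambda>z. bump \<epsilon> t ((- fst z) \<odot> snd z)"
  have "uniformly_continuous_on (K \<times> K) ?g"
    by (intro compact_uniformly_continuous compact_Times K continuous_on_subset[OF continuous_bump_translate]) auto
  then obtain \<delta> where \<delta>: "\<delta> > 0"
    "\<And>z z'. z \<in> K \<times> K \<Longrightarrow> z' \<in> K \<times> K \<Longrightarrow> dist z' z < \<delta> \<Longrightarrow> dist (?g z') (?g z) < \<eta> / M"
    unfolding uniformly_continuous_on_def using \<eta> M by (metis divide_pos_pos)
  have "\<bar>smear \<epsilon> t \<phi> x - smear \<epsilon> t \<phi> x'\<bar> \<le> \<eta>"
    if \<phi>: "integrable lborel \<phi>" "\<forall>y. y \<notin> K \<longrightarrow> \<phi> y = 0" "(\<integral>y. \<bar>\<phi> y\<bar> \<partial>lborel) \<le> M"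
      and x: "x \<in> K" "x' \<in> K" "dist x x' < \<delta>" for \<phi> x x'
  proof -
    have "\<bar>smear \<epsilon> t \<phi> x - smear \<epsilon> t \<phi> x'\<bar>
        = \<bar>\<integral>y. \<phi> y * bump \<epsilon> t ((- x) \<odot> y) - \<phi> y * bump \<epsilon> t ((- x') \<odot> y) \<partial>lborel\<bar>"
      unfolding smear_def
      by (subst Bochner_Integration.integral_diff[OF smear_integrable[OF \<phi>(1) \<epsilon>] smear_integrable[OF \<phi>(1) \<epsilon>]]) simp
    also have "\<dots> \<le> (\<integral>y. norm (\<phi> y * bump \<epsilon> t ((- x) \<odot> y) - \<phi> y * bump \<epsilon> t ((- x') \<odot> y)) \<partial>lborel)"
      using integral_norm_bound[of lborel "\<lambda>y. \<phi> y * bump \<epsilon> t ((- x) \<odot> y) - \<phi> y * bump \<epsilon> t ((- x') \<odot> y)"] by simp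
    also have "\<dots> \<le> (\<integral>y. \<bar>\<phi> y\<bar> * (\<eta> / M) \<partial>lborel)"
    proof (rule integral_mono)
      show "integrable lborel (\<lambda>y. norm (\<phi> y * bump \<epsilon> t ((- x) \<odot> y) - \<phi> y * bump \<epsilon> t ((- x') \<odot> y)))"
        by (intro integrable_norm Bochner_Integration.integrable_diff smear_integrable \<phi> \<epsilon>)
      show "integrable lborel (\<lambda>y. \<bar>\<phi> y\<bar> * (\<eta> / M))" using \<phi>(1) by simp
      fix y
      show "norm (\<phi> y * bump \<epsilon> t ((- x) \<odot> y) - \<phi> y * bump \<epsilon> t ((- x') \<odot> y)) \<le> \<bar>\<phi> y\<bar> * (\<eta> / M)"
      proof (cases "y \<in> K")
        case True
        then have "dist (?g (x, y)) (?g (x', y)) < \<eta> / M"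
          using x by (intro \<delta>(2)) (auto simp: dist_Pair_Pair)
        then have "\<bar>bump \<epsilon> t ((- x) \<odot> y) - bump \<epsilon> t ((- x') \<odot> y)\<bar> \<le> \<eta> / M" by (simp add: dist_real_def)
        from mult_left_mono[OF this, of "\<bar>\<phi> y\<bar>"] show ?thesis
          by (simp flip: right_diff_distrib add: abs_mult)
      qed (use \<phi> in simp)
    qed
    also have "\<dots> = (\<integral>y. \<bar>\<phi> y\<bar> \<partial>lborel) * (\<eta> / M)" by simp
    also have "\<dots> \<le> M * (\<eta> / M)" using \<phi>(3) \<eta> M by (intro mult_right_mono) auto
    finally show ?thesis using M by simp
  qed
  with \<delta>(1) show ?thesis by blast
qed

text \<open>The argument of Kolmogorov and Riesz. A diagonal subsequence makes the averages at all
  scales \<open>1 / (j + 1)\<close> converge on a countable dense set, hence on \<open>K\<close> by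
  equicontinuity, hence in \<open>L\<^sup>1\<close> by domination; and the averages approximate the
  functions uniformly along the sequence.\<close>

lemma admissible_L1_precompact:
  assumes \<Omega>: "bounded \<Omega>" "open \<Omega>" and p: "1 \<le> p" "p < \<nu>"
    and \<phi>: "\<And>k::nat. admissible \<Omega> p (\<phi> k)"
  shows "\<exists>r::nat \<Rightarrow> nat. strict_mono r \<and> (\<forall>\<eta>>0. \<exists>N. \<forall>i\<ge>N. \<forall>j\<ge>N.
    (\<integral>\<^sup>+x. ennreal \<bar>\<phi> (r i) x - \<phi> (r j) x\<bar> \<partial>lborel) \<le> ennreal \<eta>)"
proof -
  from translation_estimate obtain \<epsilon> C where \<epsilon>: "\<epsilon> > 0" and C': "\<forall>P. C P > 0"
    and trans': "\<forall>P t h \<phi>. P \<ge> 1 \<longrightarrow> t > 0 \<longrightarrow> C2 \<phi> \<longrightarrow> h \<in> ball 0 \<epsilon> \<longrightarrow>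
      (\<integral>\<^sup>+x. ennreal (\<bar>\<phi> (x \<odot> dil t h) - \<phi> x\<bar> powr P) \<partial>lborel) \<le> ennreal (C P * t powr P) * energy P \<phi>"
    by (elim exE conjE)
  note C = C'[rule_format] and trans = trans'[rule_format]
  from nn_integral_bump[OF \<epsilon>] obtain c where c: "c > 0"
    and bump: "\<And>t. t > 0 \<Longrightarrow> (\<integral>\<^sup>+h. ennreal (bump \<epsilon> t h) \<partial>lborel) = ennreal (t ^ hom_dim V m * c)" by blast
  from admissible_L1_bound[OF \<Omega> p] obtain M where M: "M > 0"
    and L1: "\<And>\<phi>. admissible \<Omega> p \<phi> \<Longrightarrow> (\<integral>\<^sup>+x. ennreal \<bar>\<phi> x\<bar> \<partial>lborel) \<le> ennreal M" by blast
  define K where "K = closure \<Omega>"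
  have K: "compact K" using \<Omega> by (simp add: K_def compact_closure)
  have [measurable]: "K \<in> sets borel" by (simp add: K_def)
  have Kfin: "emeasure lborel K < \<infinity>" using emeasure_bounded_finite[OF compact_imp_bounded[OF K]] by simp
  have test: "test_fun \<Omega> (\<phi> k)" for k using \<phi> by (simp add: admissible_def)
  have \<phi>m [measurable]: "\<phi> k \<in> borel_measurable borel" for k
    by (intro borel_measurable_continuous_onI C2_continuous admissible_C2[OF \<phi>])
  have \<phi>0: "\<phi> k y = 0" if "y \<notin> K" for k y
  proof -
    have "y \<notin> \<Omega>" using that closure_subset[of \<Omega>] by (auto simp: K_def)
    then show ?thesis using test_fun_zero[OF test] by blast
  qed
  have int: "integrable lborel (\<phi> k)" for k
  proof (rule integrableI_bounded)
    have "(\<integral>\<^sup>+x. ennreal (norm (\<phi> k x)) \<partial>lborel) \<le> ennreal M" using L1[OF \<phi>, of k] by simp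
    then show "(\<integral>\<^sup>+x. ennreal (norm (\<phi> k x)) \<partial>lborel) < \<infinity>" by (rule le_less_trans) simp
  qed simp
  have intM: "(\<integral>x. \<bar>\<phi> k x\<bar> \<partial>lborel) \<le> M" for k
  proof -
    have "ennreal (\<integral>x. \<bar>\<phi> k x\<bar> \<partial>lborel) = (\<integral>\<^sup>+x. ennreal \<bar>\<phi> k x\<bar> \<partial>lborel)"
      using int[of k] by (intro nn_integral_eq_integral[symmetric]) auto
    also have "\<dots> \<le> ennreal M" by (rule L1[OF \<phi>])
    finally show ?thesis using M by (simp add: ennreal_le_iff)
  qed
  define t where "t j = 1 / real (Suc j)" for j
  have t: "t j > 0" for j by (simp add: t_def)
  define s where "s j k = smear \<epsilon> (t j) (\<phi> k)" for j k
  have s_le: "\<bar>s j k x\<bar> \<le> M" for j k x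
  proof -
    have "\<bar>s j k x\<bar> \<le> (\<integral>y. norm (\<phi> k y * bump \<epsilon> (t j) ((- x) \<odot> y)) \<partial>lborel)"
      unfolding s_def smear_def
      using integral_norm_bound[of lborel "\<lambda>y. \<phi> k y * bump \<epsilon> (t j) ((- x) \<odot> y)"] by simp
    also have "\<dots> \<le> (\<integral>y. \<bar>\<phi> k y\<bar> \<partial>lborel)"
    proof (rule integral_mono)
      show "integrable lborel (\<lambda>y. norm (\<phi> k y * bump \<epsilon> (t j) ((- x) \<odot> y)))"
        by (intro integrable_norm smear_integrable int \<epsilon>)
      show "integrable lborel (\<lambda>y. \<bar>\<phi> k y\<bar>)" using int by simp
      show "norm (\<phi> k y * bump \<epsilon> (t j) ((- x) \<odot> y)) \<le> \<bar>\<phi> k y\<bar>" for y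
        using bump_bounds[OF \<epsilon>] by (simp add: abs_mult mult_left_le)
    qed
    also have "\<dots> \<le> M" by (rule intM)
    finally show ?thesis .
  qed
  obtain D where D: "countable D" "D \<subseteq> K" "K \<subseteq> closure D" using separable by blast
  have cD: "countable ((UNIV :: nat set) \<times> D)" using D by simp
  have "\<exists>r::nat \<Rightarrow> nat. strict_mono r \<and> (\<forall>z\<in>(UNIV :: nat set) \<times> D. \<exists>l. (\<lambda>k. s (fst z) (r k) (snd z)) \<longlonglongrightarrow> l)"
  proof (rule function_convergent_subsequence[OF cD, of "\<lambda>k z. s (fst z) k (snd z)" M])
    show "norm (s (fst z) k (snd z)) \<le> M" for k z using s_le by simp
  next
    fix r :: "nat \<Rightarrow> nat"
    assume "strict_mono r" "\<And>z. z \<in> (UNIV :: nat set) \<times> D \<Longrightarrow> \<exists>l. (\<lambda>k. s (fst z) (r k) (snd z)) \<longlonglongrightarrow> l"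
    then show ?thesis by blast
  qed
  then obtain r where r: "strict_mono (r :: nat \<Rightarrow> nat)"
    and conv: "\<forall>z\<in>(UNIV :: nat set) \<times> D. \<exists>l. (\<lambda>k. s (fst z) (r k) (snd z)) \<longlonglongrightarrow> l"
    by blast
  have convK: "convergent (\<lambda>k. s j (r k) x)" if x: "x \<in> K" for j x
  proof -
    have "Cauchy (\<lambda>k. s j (r k) x)"
    proof (rule CauchyI)
      fix e :: real assume e: "e > 0"
      then have "e / 4 > 0" by simp
      from smear_equicontinuous[OF \<epsilon> K M this, of "t j"] obtain \<delta> where \<delta>: "\<delta> > 0"
        "\<And>\<phi> x x'. integrable lborel \<phi> \<Longrightarrow> (\<forall>y. y \<notin> K \<longrightarrow> \<phi> y = 0) \<Longrightarrow> (\<integral>y. \<bar>\<phi> y\<bar> \<partial>lborel) \<le> M \<Longrightarrow>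
          x \<in> K \<Longrightarrow> x' \<in> K \<Longrightarrow> dist x x' < \<delta> \<Longrightarrow> \<bar>smear \<epsilon> (t j) \<phi> x - smear \<epsilon> (t j) \<phi> x'\<bar> \<le> e / 4"
        by blast
      obtain x' where x': "x' \<in> D" "dist x' x < \<delta>"
        using x D(3) \<delta>(1) by (meson closure_approachable subsetD)
      have close: "\<bar>s j k x - s j k x'\<bar> \<le> e / 4" for k
        unfolding s_def using x x' D(2) \<phi>0 intM int by (intro \<delta>(2)) (auto simp: dist_commute)
      have "convergent (\<lambda>k. s j (r k) x')" using bspec[OF conv, of "(j, x')"] x' by (auto simp: convergent_def)
      then have "Cauchy (\<lambda>k. s j (r k) x')" by (rule convergent_Cauchy)
      from CauchyD[OF this \<open>e / 4 > 0\<close>] obtain N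
        where N: "\<forall>k\<ge>N. \<forall>l\<ge>N. norm (s j (r k) x' - s j (r l) x') < e / 4" by blast
      have "norm (s j (r k) x - s j (r l) x) < e" if "k \<ge> N" "l \<ge> N" for k l
      proof -
        have "\<bar>s j (r k) x' - s j (r l) x'\<bar> < e / 4" using N that by simp
        with close[of "r k"] close[of "r l"] e show ?thesis unfolding real_norm_def by linarith
      qed
      then show "\<exists>N. \<forall>k\<ge>N. \<forall>l\<ge>N. norm (s j (r k) x - s j (r l) x) < e" by blast
    qed
    then show ?thesis by (rule real_Cauchy_convergent)
  qed
  \<comment> \<open>An average may spread beyond \<open>K\<close>. Cutting it off there gives the
    integrable majorant \<open>M * indicator K\<close>, and loses nothing because the functions
    themselves vanish outside \<open>K\<close>.\<close>
  define g where "g j k x = indicator K x * s j (r k) x" for j k x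
  define G where "G j x = lim (\<lambda>k. g j k x)" for j x
  have gG: "(\<lambda>k. g j k x) \<longlonglongrightarrow> G j x" for j x
  proof -
    have "convergent (\<lambda>k. g j k x)"
      using convK[of x j] by (cases "x \<in> K") (simp_all add: g_def convergent_const)
    then show ?thesis by (simp add: G_def convergent_LIMSEQ_iff)
  qed
  have gm [measurable]: "g j k \<in> borel_measurable lborel" for j k
    unfolding g_def s_def by (intro borel_measurable_times borel_measurable_indicator smear_measurable \<phi>m) simp
  have Gm [measurable]: "G j \<in> borel_measurable lborel" for j
    by (rule borel_measurable_LIMSEQ_real[OF gG gm])
  have g_le: "\<bar>g j k x\<bar> \<le> M * indicator K x" for j k x
    using s_le by (auto simp: g_def split: split_indicator)
  have G_le: "\<bar>G j x\<bar> \<le> M * indicator K x" for j x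
    using g_le by (intro LIMSEQ_le_const2[OF tendsto_rabs[OF gG]]) auto
  have dom: "(\<lambda>k. \<integral>\<^sup>+x. ennreal \<bar>g j k x - G j x\<bar> \<partial>lborel) \<longlonglongrightarrow> 0" for j
  proof -
    have "(\<lambda>k. \<integral>\<^sup>+x. ennreal \<bar>g j k x - G j x\<bar> \<partial>lborel) \<longlonglongrightarrow> (\<integral>\<^sup>+x. 0 \<partial>(lborel :: (real^'a) measure))"
    proof (rule nn_integral_dominated_convergence[where w = "\<lambda>x. ennreal (2 * M) * indicator K x"])
      show "AE x in lborel. ennreal \<bar>g j k x - G j x\<bar> \<le> ennreal (2 * M) * indicator K x" for k
      proof (intro AE_I2)
        fix x
        show "ennreal \<bar>g j k x - G j x\<bar> \<le> ennreal (2 * M) * indicator K x"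
          using g_le[of j k x] G_le[of j x] by (auto split: split_indicator intro!: ennreal_leI)
      qed
      show "(\<integral>\<^sup>+x. ennreal (2 * M) * indicator K x \<partial>lborel) < \<infinity>"
        using Kfin by (simp add: nn_integral_cmult_indicator ennreal_mult_less_top)
      show "AE x in lborel. (\<lambda>k. ennreal \<bar>g j k x - G j x\<bar>) \<longlonglongrightarrow> 0"
      proof (intro AE_I2)
        fix x
        have "(\<lambda>k. \<bar>g j k x - G j x\<bar>) \<longlonglongrightarrow> \<bar>G j x - G j x\<bar>" by (intro tendsto_intros gG)
        then show "(\<lambda>k. ennreal \<bar>g j k x - G j x\<bar>) \<longlonglongrightarrow> 0"
          using tendsto_ennrealI by fastforce
      qed
    qed measurable
    then show ?thesis by simp
  qed
  define E1 where "E1 = measure lborel \<Omega> + 1"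
  have E1: "E1 > 0" by (simp add: E1_def add_nonneg_pos)
  have main: "\<exists>N. \<forall>i\<ge>N. \<forall>j\<ge>N. (\<integral>\<^sup>+x. ennreal \<bar>\<phi> (r i) x - \<phi> (r j) x\<bar> \<partial>lborel) \<le> ennreal \<eta>" if \<eta>: "\<eta> > 0" for \<eta>
  proof -
    \<comment> \<open>The scale is fixed first: \<open>C 1 * t j * E1\<close> is the error of the
      average relative to the mass of the bump, the same for all members of the sequence. Only
      afterwards is the index \<open>N\<close> chosen for this scale.\<close>
    obtain j where j: "C 1 * t j * E1 < \<eta> / 4"
    proof -
      have "(\<lambda>j. C 1 * t j * E1) \<longlonglongrightarrow> C 1 * 0 * E1"
        unfolding t_def by (intro tendsto_intros LIMSEQ_Suc[OF lim_1_over_n])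
      then have "\<forall>\<^sub>F j in sequentially. C 1 * t j * E1 < \<eta> / 4"
        using \<eta> by (intro order_tendstoD(2)) auto
      then show ?thesis using that by (auto simp: eventually_sequentially)
    qed
    define I where "I = t j ^ hom_dim V m * c"
    have I: "I > 0" using t c by (simp add: I_def)
    have approx: "(\<integral>\<^sup>+x. ennreal \<bar>I * \<phi> k x - s j k x\<bar> \<partial>lborel) \<le> ennreal (\<eta> / 4 * I)" for k
    proof -
      have "(\<integral>\<^sup>+x. ennreal \<bar>I * \<phi> k x - s j k x\<bar> \<partial>lborel) \<le> ennreal (C 1 * t j * E1 * I)"
        unfolding s_def
      proof (rule smear_approx[OF \<epsilon> t test int])
        fix h assume h: "h \<in> ball (0::real^'a) \<epsilon>"
        have "(\<integral>\<^sup>+x. ennreal (\<bar>\<phi> k (x \<odot> dil (t j) h) - \<phi> k x\<bar> powr 1) \<partial>lborel) \<le> ennreal (C 1 * t j powr 1) * energy 1 (\<phi> k)"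
          by (intro trans t admissible_C2[OF \<phi>] h) simp
        also have "\<dots> \<le> ennreal (C 1 * t j powr 1) * ennreal E1"
          unfolding E1_def by (intro mult_left_mono admissible_energy_1[OF \<Omega> p(1) \<phi>]) simp
        finally show "(\<integral>\<^sup>+x. ennreal \<bar>\<phi> k (x \<odot> dil (t j) h) - \<phi> k x\<bar> \<partial>lborel) \<le> ennreal (C 1 * t j * E1)"
          using C[of 1] t[of j] E1 by (simp add: ennreal_mult)
      qed (use bump[OF t] I C[of 1] t[of j] E1 in \<open>auto simp: I_def\<close>)
      also have "\<dots> \<le> ennreal (\<eta> / 4 * I)" using j I by (intro ennreal_leI mult_right_mono) auto
      finally show ?thesis .
    qed
    have "\<forall>\<^sub>F k in sequentially. (\<integral>\<^sup>+x. ennreal \<bar>g j k x - G j x\<bar> \<partial>lborel) < ennreal (\<eta> / 4 * I)"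
      using \<eta> I by (intro order_tendstoD(2)[OF dom]) auto
    then obtain N where N: "\<And>k. k \<ge> N \<Longrightarrow> (\<integral>\<^sup>+x. ennreal \<bar>g j k x - G j x\<bar> \<partial>lborel) \<le> ennreal (\<eta> / 4 * I)"
      by (force simp: eventually_sequentially less_imp_le)
    have "(\<integral>\<^sup>+x. ennreal \<bar>\<phi> (r a) x - \<phi> (r b) x\<bar> \<partial>lborel) \<le> ennreal \<eta>" if ab: "a \<ge> N" "b \<ge> N" for a b
    proof -
      let ?A = "\<lambda>k x. ennreal \<bar>I * \<phi> (r k) x - s j (r k) x\<bar>" and ?B = "\<lambda>k x. ennreal \<bar>g j k x - G j x\<bar>"
      have [measurable]: "?A k \<in> borel_measurable lborel" "?B k \<in> borel_measurable lborel" for k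
        using smear_measurable[OF \<phi>m] by (simp_all add: s_def)
      have pt: "ennreal \<bar>\<phi> (r a) x - \<phi> (r b) x\<bar> \<le> ennreal (1 / I) * ((?A a x + ?A b x) + (?B a x + ?B b x))" for x
      proof (cases "x \<in> K")
        case True
        then have "g j k x = s j (r k) x" for k by (simp add: g_def)
        then have "I * \<bar>\<phi> (r a) x - \<phi> (r b) x\<bar> \<le> (\<bar>I * \<phi> (r a) x - s j (r a) x\<bar> + \<bar>I * \<phi> (r b) x - s j (r b) x\<bar>)
            + (\<bar>g j a x - G j x\<bar> + \<bar>g j b x - G j x\<bar>)" (is "_ \<le> ?R")
        proof -
          have "I * \<bar>\<phi> (r a) x - \<phi> (r b) x\<bar> = \<bar>I * \<phi> (r a) x - I * \<phi> (r b) x\<bar>"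
            using I by (simp flip: right_diff_distrib add: abs_mult)
          then show ?thesis using \<open>\<And>k. g j k x = s j (r k) x\<close> by simp
        qed
        then have "\<bar>\<phi> (r a) x - \<phi> (r b) x\<bar> \<le> 1 / I * ?R" using I by (simp add: field_simps)
        then have "ennreal \<bar>\<phi> (r a) x - \<phi> (r b) x\<bar> \<le> ennreal (1 / I * ?R)" by (rule ennreal_leI)
        also have "\<dots> = ennreal (1 / I) * ennreal ?R" using I by (intro ennreal_mult) auto
        also have "ennreal ?R = (?A a x + ?A b x) + (?B a x + ?B b x)" by (simp add: ennreal_plus)
        finally show ?thesis .
      qed (simp add: \<phi>0)
      have "(\<integral>\<^sup>+x. ennreal \<bar>\<phi> (r a) x - \<phi> (r b) x\<bar> \<partial>lborel)
          \<le> (\<integral>\<^sup>+x. ennreal (1 / I) * ((?A a x + ?A b x) + (?B a x + ?B b x)) \<partial>lborel)"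
        by (intro nn_integral_mono pt)
      also have "\<dots> = ennreal (1 / I) * (((\<integral>\<^sup>+x. ?A a x \<partial>lborel) + (\<integral>\<^sup>+x. ?A b x \<partial>lborel))
          + ((\<integral>\<^sup>+x. ?B a x \<partial>lborel) + (\<integral>\<^sup>+x. ?B b x \<partial>lborel)))"
        by (subst nn_integral_cmult, measurable, subst nn_integral_add, measurable, subst nn_integral_add, measurable,
            subst nn_integral_add, measurable)
      also have "\<dots> \<le> ennreal (1 / I) * ((ennreal (\<eta> / 4 * I) + ennreal (\<eta> / 4 * I)) + (ennreal (\<eta> / 4 * I) + ennreal (\<eta> / 4 * I)))"
        by (intro mult_left_mono add_mono approx N ab) simp
      also have "\<dots> = ennreal (1 / I) * ennreal (\<eta> * I)"
        using \<eta> I by (simp add: mult.commute flip: ennreal_plus)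
      also have "\<dots> = ennreal (1 / I * (\<eta> * I))" using \<eta> I by (intro ennreal_mult[symmetric]) auto
      also have "1 / I * (\<eta> * I) = \<eta>" using I by simp
      finally show ?thesis .
    qed
    then show ?thesis by blast
  qed
  show ?thesis by (intro exI[of _ r] conjI allI impI r main)
qed

end

section \<open>Uniqueness of weak gradients\<close>

text \<open>Boxes generate the Borel sets and are stable under intersection, so the integral over
  every Borel set vanishes; \<open>total\<close> supplies the step to complements. The sets
  \<open>{x. G x > 0}\<close> and \<open>{x. G x < 0}\<close> then show that \<open>G\<close>
  vanishes.\<close>

lemma AE_zero_if_box_integrals_zero:
  fixes G :: "'a::euclidean_space \<Rightarrow> real"
  assumes int: "integrable lborel G" and total: "(\<integral>x. G x \<partial>lborel) = 0"
    and box: "\<And>c d. (\<integral>x. indicator (box c d) x * G x \<partial>lborel) = 0"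
  shows "AE x in lborel. G x = 0"
proof -
  have [measurable]: "G \<in> borel_measurable borel" using int by auto
  let ?E = "range (\<lambda>(a, b). box a b :: 'a set)"
  have intA: "integrable lborel (\<lambda>x. indicator A x * G x)" if "A \<in> sets borel" for A
    using integrable_mult_indicator[of A lborel G] that int by simp
  have zero: "(\<integral>x. indicator A x * G x \<partial>lborel) = 0" if "A \<in> sets borel" for A
  proof -
    have stable: "Int_stable ?E" by (auto simp: Int_stable_def box_Int_box)
    have A: "A \<in> sigma_sets UNIV ?E" using that by (simp add: borel_eq_box)
    have sb: "B \<in> sets borel" if "B \<in> sigma_sets UNIV ?E" for B using that by (simp add: borel_eq_box)
    have "?E \<subseteq> Pow UNIV" by simp
    from stable this A show ?thesis
    proof (induction rule: sigma_sets_induct_disjoint)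
      case (basic A)
      then show ?case using box by auto
    next
      case (compl A)
      have "(\<integral>x. indicator (UNIV - A) x * G x \<partial>lborel) = (\<integral>x. G x - indicator A x * G x \<partial>lborel)"
        by (intro Bochner_Integration.integral_cong) (auto split: split_indicator)
      also have "\<dots> = 0" using compl total int intA[OF sb] by (simp add: Bochner_Integration.integral_diff)
      finally show ?case by simp
    next
      case (union A)
      have m: "A i \<in> sets lborel" for i using union sb by auto
      then have "set_integrable lborel (\<Union>i. A i) G"
        unfolding set_integrable_def using intA[of "\<Union>i. A i"] by auto
      from lebesgue_integral_countable_add[OF m _ this] union(1,3)
      show ?case by (auto simp: set_lebesgue_integral_def disjoint_family_on_def)
    qed auto
  qed
  have "AE x in lborel. indicator {x. G x > 0} x * G x = 0"
    using zero[of "{x. G x > 0}"] intA[of "{x. G x > 0}"]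
    by (subst integral_nonneg_eq_0_iff_AE[symmetric]) (auto split: split_indicator)
  moreover have "AE x in lborel. indicator {x. G x < 0} x * (- G x) = 0"
    using zero[of "{x. G x < 0}"] intA[of "{x. G x < 0}"]
    by (subst integral_nonneg_eq_0_iff_AE[symmetric]) (auto split: split_indicator)
  ultimately show ?thesis by eventually_elim (auto split: split_indicator_asm)
qed

text \<open>The functions \<open>s\<^sup>-\<^sup>n exp (- c / s)\<close>, extended by zero to \<open>s \<le> 0\<close>; the family is closed
  under differentiation up to linear combinations.\<close>

definition flat :: "nat \<Rightarrow> real \<Rightarrow> real \<Rightarrow> real" where
  "flat n c s = (if s > 0 then (1 / s) ^ n * exp (- c / s) else 0)"

lemma flat_over_tendsto:
  assumes "c > 0"
  shows "((\<lambda>s. flat n c s / s) \<longlongrightarrow> 0) (at 0)"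
proof -
  have inv: "filterlim (\<lambda>s::real. c / s) at_top (at_right 0)"
    using assms by real_asymp
  have "((\<lambda>s. (c / s) ^ (n + 1) / exp (c / s) * (1 / c) ^ (n + 1)) \<longlongrightarrow> 0 * (1 / c) ^ (n + 1)) (at_right 0)"
    by (intro tendsto_mult tendsto_const filterlim_compose[OF tendsto_power_div_exp_0 inv])
  moreover have "\<forall>\<^sub>F s in at_right 0. (c / s) ^ (n + 1) / exp (c / s) * (1 / c) ^ (n + 1) = flat n c s / s"
    using eventually_at_right_less[of 0]
    by eventually_elim (use assms in \<open>simp add: flat_def power_divide exp_minus field_simps\<close>)
  ultimately have "((\<lambda>s. flat n c s / s) \<longlongrightarrow> 0) (at_right 0)"
    by (simp add: tendsto_cong)
  moreover have "((\<lambda>s. flat n c s / s) \<longlongrightarrow> 0) (at_left 0)"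
  proof -
    have "\<forall>\<^sub>F s in at_left (0::real). flat n c s / s = 0"
      by (simp add: eventually_at_filter flat_def)
    then show ?thesis by (rule tendsto_eventually)
  qed
  ultimately show ?thesis by (rule filterlim_split_at[rotated])
qed

lemma flat_deriv:
  assumes "c > 0"
  shows "(flat n c has_real_derivative c * flat (n + 2) c s - real n * flat (n + 1) c s) (at s)"
proof -
  consider "s > 0" | "s < 0" | "s = 0" by linarith
  then show ?thesis
  proof cases
    case 1
    have "((\<lambda>s. (1 / s) ^ n * exp (- c / s)) has_real_derivative c * flat (n + 2) c s - real n * flat (n + 1) c s) (at s)"
    proof -
      have d1: "((\<lambda>s. 1 / s) has_real_derivative - 1 / s\<^sup>2) (at s)"
        and d2: "((\<lambda>s. exp (- c / s)) has_real_derivative exp (- c / s) * (c / s\<^sup>2)) (at s)"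
        using 1 by (auto intro!: derivative_eq_intros simp: power2_eq_square)
      have "((\<lambda>s. (1 / s) ^ n * exp (- c / s)) has_real_derivative
          real n * (1 / s) ^ (n - 1) * (- 1 / s^2) * exp (- c / s) + (1 / s) ^ n * (exp (- c / s) * (c / s^2))) (at s)"
        using DERIV_mult[OF DERIV_power[OF d1, of n] d2] by (simp add: algebra_simps)
      \<comment> \<open>For \<open>n = 0\<close> the truncated exponent \<open>n - 1\<close> does no
        harm, because it is multiplied by \<open>real n\<close>.\<close>
      moreover have e: "real n * (1 / s) ^ (n - 1) * (- 1 / s^2) = - real n * (1 / s) ^ (n + 1)"
        using 1 by (cases n) (simp_all add: power2_eq_square field_simps)
      have "real n * (1 / s) ^ (n - 1) * (- 1 / s^2) * exp (- c / s) + (1 / s) ^ n * (exp (- c / s) * (c / s^2))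
          = c * flat (n + 2) c s - real n * flat (n + 1) c s"
        unfolding e using 1 by (simp add: flat_def power2_eq_square mult_ac)
      ultimately show ?thesis by simp
    qed
    then show ?thesis
      by (rule has_field_derivative_transform_within_open[where S = "{0<..}"]) (use 1 in \<open>auto simp: flat_def\<close>)
  next
    case 2
    have "((\<lambda>s. 0) has_real_derivative 0) (at s)" by simp
    then have "(flat n c has_real_derivative 0) (at s)"
      by (rule has_field_derivative_transform_within_open[where S = "{..<0}"]) (use 2 in \<open>auto simp: flat_def\<close>)
    then show ?thesis using 2 by (simp add: flat_def)
  next
    case 3
    then show ?thesis using flat_over_tendsto[OF assms, of n] by (simp add: DERIV_def flat_def)
  qed
qed

text \<open>This set is itself the witness demanded by \<open>smooth_on\<close>: besides sums and
  products it is closed under directional derivatives. Functions of a single coordinate suffice as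
  generators, since cutoffs for boxes are products of such functions.\<close>

inductive_set flat_algebra :: "(real^'n \<Rightarrow> real) set" where
  flat: "c > 0 \<Longrightarrow> (\<lambda>x. flat n c (a * x $ i + b)) \<in> flat_algebra"
| const: "(\<lambda>x. r) \<in> flat_algebra"
| add: "f \<in> flat_algebra \<Longrightarrow> g \<in> flat_algebra \<Longrightarrow> (\<lambda>x. f x + g x) \<in> flat_algebra"
| mult: "f \<in> flat_algebra \<Longrightarrow> g \<in> flat_algebra \<Longrightarrow> (\<lambda>x. f x * g x) \<in> flat_algebra"

lemma flat_algebra_prod:
  "finite I \<Longrightarrow> (\<And>i. i \<in> I \<Longrightarrow> f i \<in> flat_algebra) \<Longrightarrow> (\<lambda>x. \<Prod>i\<in>I. f i x) \<in> flat_algebra"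
  by (induction I rule: finite_induct) (auto intro: flat_algebra.const flat_algebra.mult)

lemma flat_algebra_deriv:
  fixes f :: "real^'n \<Rightarrow> real"
  assumes "f \<in> flat_algebra"
  shows "\<exists>D. (\<forall>x. (f has_derivative D x) (at x)) \<and> (\<forall>e. (\<lambda>x. D x e) \<in> flat_algebra)"
  using assms
proof induction
  case (flat c n a i b)
  let ?D = "\<lambda>x h. (c * flat (n + 2) c (a * x $ i + b) - real n * flat (n + 1) c (a * x $ i + b)) * (a * h $ i)"
  have "((\<lambda>x. flat n c (a * x $ i + b)) has_derivative ?D x) (at x)" for x :: "real^'n"
  proof -
    have 1: "((\<lambda>x. a * x $ i + b) has_derivative (\<lambda>h. a * h $ i)) (at x)"
      by (auto intro!: derivative_eq_intros bounded_linear.has_derivative[OF bounded_linear_vec_nth])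
    show ?thesis
      using has_derivative_compose[OF 1 flat_deriv[OF flat, unfolded has_field_derivative_def]] .
  qed
  moreover have "(\<lambda>x. ?D x e) \<in> flat_algebra" for e :: "real^'n"
  proof -
    have "(\<lambda>x. ((c * flat (n + 2) c (a * x $ i + b) + (- real n) * flat (n + 1) c (a * x $ i + b)) * (a * e $ i))) \<in> flat_algebra"
      by (intro flat_algebra.intros flat)
    then show ?thesis by simp
  qed
  ultimately show ?case by (intro exI[of _ ?D]) blast
next
  case (const r)
  then show ?case by (intro exI[of _ "\<lambda>_ _. 0"]) (auto intro: flat_algebra.const)
next
  case (add f g)
  then obtain D E where "\<And>x. (f has_derivative D x) (at x)" "\<And>e. (\<lambda>x. D x e) \<in> flat_algebra"
    "\<And>x. (g has_derivative E x) (at x)" "\<And>e. (\<lambda>x. E x e) \<in> flat_algebra" by blast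
  then show ?case
    by (intro exI[of _ "\<lambda>x e. D x e + E x e"]) (auto intro: has_derivative_add flat_algebra.add)
next
  case (mult f g)
  then obtain D E where "\<And>x. (f has_derivative D x) (at x)" "\<And>e. (\<lambda>x. D x e) \<in> flat_algebra"
    "\<And>x. (g has_derivative E x) (at x)" "\<And>e. (\<lambda>x. E x e) \<in> flat_algebra" by blast
  note DE = this
  have "((\<lambda>x. f x * g x) has_derivative (\<lambda>e. f x * E x e + D x e * g x)) (at x)" for x
    by (intro has_derivative_mult DE)
  moreover have "(\<lambda>x. f x * E x e + D x e * g x) \<in> flat_algebra" for e
    by (intro flat_algebra.add flat_algebra.mult DE mult.hyps)
  ultimately show ?case by (intro exI[of _ "\<lambda>x e. f x * E x e + D x e * g x"]) blast
qed

lemma flat_algebra_smooth: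
  fixes f :: "real^'n \<Rightarrow> real"
  assumes "f \<in> flat_algebra"
  shows "smooth_on UNIV f"
  unfolding smooth_on_def
proof (intro exI[of _ flat_algebra] conjI ballI assms)
  fix g :: "real^'n \<Rightarrow> real" and x b assume "g \<in> flat_algebra"
  from flat_algebra_deriv[OF this] obtain D
    where D: "\<And>x. (g has_derivative D x) (at x)" "\<And>e. (\<lambda>x. D x e) \<in> flat_algebra" by blast
  show "g differentiable at x" using D(1) unfolding differentiable_def by blast
  show "\<exists>h\<in>flat_algebra. \<forall>x\<in>UNIV. frechet_derivative g (at x) b = h x"
    using D(2)[of b] frechet_derivative_at[OF D(1)] by (metis (no_types))
qed

definition box_fun :: "real \<Rightarrow> real^'n \<Rightarrow> real^'n \<Rightarrow> real^'n \<Rightarrow> real" where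
  "box_fun c a b x = (\<Prod>i\<in>UNIV. flat 0 c (x $ i - a $ i) * flat 0 c (b $ i - x $ i))"

lemma box_fun_algebra: "c > 0 \<Longrightarrow> box_fun c a b \<in> flat_algebra"
proof -
  assume c: "c > 0"
  have "(\<lambda>x. \<Prod>i\<in>UNIV. flat 0 c (1 * x $ i + (- a $ i)) * flat 0 c ((-1) * x $ i + b $ i)) \<in> flat_algebra"
    by (intro flat_algebra_prod flat_algebra.mult flat_algebra.flat c) auto
  then show ?thesis by (simp add: box_fun_def[abs_def])
qed

lemma flat_0_bounds: "c > 0 \<Longrightarrow> 0 \<le> flat 0 c s \<and> flat 0 c s \<le> 1"
  by (simp add: flat_def)

lemma box_fun_bounds: "c > 0 \<Longrightarrow> 0 \<le> box_fun c a b x" "c > 0 \<Longrightarrow> box_fun c a b x \<le> 1"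
  unfolding box_fun_def
  by (auto intro!: prod_nonneg prod_le_1 mult_nonneg_nonneg mult_le_one simp: flat_0_bounds)

lemma box_fun_support: "box_fun c a b x \<noteq> 0 \<longleftrightarrow> x \<in> box a b"
  by (auto simp: box_fun_def flat_def mem_box_cart)

lemma test_fun_mult_box_fun:
  assumes "cbox a b \<subseteq> \<Omega>" "c > 0" "f \<in> flat_algebra"
  shows "test_fun \<Omega> (\<lambda>x. box_fun c a b x * f x)"
proof -
  have sub0: "{x. box_fun c a b x * f x \<noteq> 0} \<subseteq> cbox a b"
    using box_subset_cbox[of a b] by (auto simp: box_fun_support)
  from sub0 have sub: "closure {x. box_fun c a b x * f x \<noteq> 0} \<subseteq> cbox a b"
    by (rule closure_minimal) (rule closed_cbox)
  have "bounded {x. box_fun c a b x * f x \<noteq> 0}"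
    by (rule bounded_subset[OF bounded_cbox sub0])
  then show ?thesis
    unfolding test_fun_def using sub assms
    by (auto intro!: flat_algebra_smooth flat_algebra.mult box_fun_algebra simp: compact_closure)
qed

lemma box_fun_tendsto: "(\<lambda>n. box_fun (1 / real (Suc n)) a b x) \<longlonglongrightarrow> indicator (box a b) x"
proof (cases "x \<in> box a b")
  case True
  have "(\<lambda>n. flat 0 (1 / real (Suc n)) s) \<longlonglongrightarrow> 1" if "s > 0" for s
  proof -
    have "(\<lambda>n. exp (- (1 / real (Suc n)) / s)) \<longlonglongrightarrow> exp (- 0 / s)"
      using that by (intro tendsto_intros LIMSEQ_Suc[OF lim_1_over_n]) auto
    then show ?thesis using that by (simp add: flat_def)
  qed
  then have "(\<lambda>n. box_fun (1 / real (Suc n)) a b x) \<longlonglongrightarrow> (\<Prod>i\<in>(UNIV :: 'a set). 1 * 1)"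
    unfolding box_fun_def using True by (intro tendsto_prod tendsto_mult) (auto simp: mem_box_cart)
  then show ?thesis using True by simp
next
  case False
  then have "box_fun (1 / real (Suc n)) a b x = 0" for n using box_fun_support by blast
  then show ?thesis using False by simp
qed

text \<open>Integrability of \<open>g\<close> is available only against test functions. The weight
  \<open>w\<close> is one, so \<open>g * w\<close> is integrable, and multiplying \<open>w\<close>
  by further box functions gives test functions again. Letting these tend to indicators shows that
  \<open>g * w\<close> integrates to 0 over every box, and \<open>w\<close> has no zero in its own
  box.\<close>

lemma AE_zero_if_test_integrals_zero:
  fixes g :: "real^'n \<Rightarrow> real"
  assumes \<Omega>: "open \<Omega>"
    and int: "\<And>\<phi>. test_fun \<Omega> \<phi> \<Longrightarrow> integrable (lebesgue_on \<Omega>) (\<lambda>x. g x * \<phi> x)"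
    and zero: "\<And>\<phi>. test_fun \<Omega> \<phi> \<Longrightarrow> (\<integral>x. g x * \<phi> x \<partial>lebesgue_on \<Omega>) = 0"
  shows "AE x in lebesgue_on \<Omega>. g x = 0"
proof -
  have \<Omega>m: "\<Omega> \<in> sets lebesgue" using \<Omega> by (simp add: borel_open sets_completionI_sets)
  have L: "integrable lebesgue (\<lambda>x. indicator \<Omega> x * (g x * \<phi> x))"
    "(\<integral>x. indicator \<Omega> x * (g x * \<phi> x) \<partial>lebesgue) = 0" if "test_fun \<Omega> \<phi>" for \<phi>
    using int[OF that] zero[OF that] \<Omega>m
    by (simp_all add: integrable_restrict_space integral_restrict_space)
  have box: "AE x in lebesgue. x \<in> box a b \<longrightarrow> g x = 0" if ab: "cbox a b \<subseteq> \<Omega>" for a b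
  proof -
    define w where "w = box_fun 1 a b"
    have w0: "w x \<noteq> 0 \<longleftrightarrow> x \<in> box a b" for x by (simp add: w_def box_fun_support)
    have ab': "box a b \<subseteq> \<Omega>" using ab box_subset_cbox by blast
    have test: "test_fun \<Omega> (\<lambda>x. w x * f x)" if "f \<in> flat_algebra" for f
      unfolding w_def by (rule test_fun_mult_box_fun[OF ab _ that]) simp
    have ind: "indicator \<Omega> x * (g x * (w x * y)) = g x * w x * y" for x y
      using w0[of x] ab' by (auto split: split_indicator)
    have I1: "integrable lebesgue (\<lambda>x. g x * w x)" "(\<integral>x. g x * w x \<partial>lebesgue) = 0"
      using L[OF test[OF flat_algebra.const[of 1]]] unfolding ind by simp_all
    have I2: "(\<integral>x. indicator (box c d) x * (g x * w x) \<partial>lebesgue) = 0" for c d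
    proof -
      have t: "test_fun \<Omega> (\<lambda>x. w x * box_fun (1 / real (Suc n)) c d x)" for n
        by (rule test[OF box_fun_algebra]) simp
      have "(\<lambda>n. \<integral>x. g x * w x * box_fun (1 / real (Suc n)) c d x \<partial>lebesgue)
          \<longlonglongrightarrow> (\<integral>x. g x * w x * indicator (box c d) x \<partial>lebesgue)"
      proof (rule integral_dominated_convergence[where w = "\<lambda>x. norm (g x * w x)"])
        show "(\<lambda>x. g x * w x * box_fun (1 / real (Suc n)) c d x) \<in> borel_measurable lebesgue" for n
          using L(1)[OF t[of n]] unfolding ind by (rule borel_measurable_integrable)
        show "(\<lambda>x. g x * w x * indicator (box c d) x) \<in> borel_measurable lebesgue"
          using borel_measurable_integrable[OF I1(1)]
          by (rule borel_measurable_times) (auto intro!: borel_measurable_indicator simp: sets_completionI_sets)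
        show "AE x in lebesgue. (\<lambda>n. g x * w x * box_fun (1 / real (Suc n)) c d x) \<longlonglongrightarrow> g x * w x * indicator (box c d) x"
          by (intro AE_I2 tendsto_intros box_fun_tendsto)
        show "AE x in lebesgue. norm (g x * w x * box_fun (1 / real (Suc n)) c d x) \<le> norm (g x * w x)" for n
          using box_fun_bounds[of "1 / real (Suc n)" c d]
          by (intro AE_I2) (simp add: abs_mult mult_left_le)
        show "integrable lebesgue (\<lambda>x. norm (g x * w x))" using I1(1) by (rule integrable_norm)
      qed
      moreover have "(\<integral>x. g x * w x * box_fun (1 / real (Suc n)) c d x \<partial>lebesgue) = 0" for n
        using L(2)[OF t[of n]] unfolding ind .
      ultimately show ?thesis by (simp add: LIMSEQ_const_iff mult.commute)
    qed
    \<comment> \<open>The product is only Lebesgue measurable, while the criterion by boxes speaks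
      about \<open>lborel\<close>; a Borel representative \<open>G\<close> bridges the two.\<close>
    from completion_ex_borel_measurable_real[OF borel_measurable_integrable[OF I1(1)]]
    obtain G where G [measurable]: "G \<in> borel_measurable lborel" and eq: "AE x in lborel. g x * w x = G x" by blast
    have eq': "AE x in lebesgue. g x * w x = G x" using eq by (rule AE_completion)
    have Gl: "G \<in> borel_measurable lebesgue" using G by (rule measurable_completion)
    have intG: "integrable lborel G"
    proof -
      have "integrable lebesgue G"
        using I1(1) integrable_cong_AE[OF borel_measurable_integrable[OF I1(1)] Gl eq'] by blast
      then show ?thesis using integrable_completion[OF G] by blast
    qed
    have tr: "(\<integral>x. h x * G x \<partial>lborel) = (\<integral>x. h x * (g x * w x) \<partial>lebesgue)"
      if h: "h \<in> borel_measurable lborel" for h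
    proof -
      have m: "(\<lambda>x. h x * G x) \<in> borel_measurable lborel" using h G by (rule borel_measurable_times)
      have hl: "h \<in> borel_measurable lebesgue" using h by (rule measurable_completion)
      have "(\<integral>x. h x * G x \<partial>lborel) = (\<integral>x. h x * G x \<partial>lebesgue)" by (rule integral_completion[OF m, symmetric])
      also have "\<dots> = (\<integral>x. h x * (g x * w x) \<partial>lebesgue)"
        by (intro integral_cong_AE borel_measurable_times hl Gl borel_measurable_integrable[OF I1(1)])
          (use eq' in \<open>auto\<close>)
      finally show ?thesis .
    qed
    have "AE x in lborel. G x = 0"
    proof (rule AE_zero_if_box_integrals_zero[OF intG])
      show "(\<integral>x. G x \<partial>lborel) = 0" using tr[of "\<lambda>_. 1"] I1(2) by simp
      show "(\<integral>x. indicator (box c d) x * G x \<partial>lborel) = 0" for c d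
        using tr[of "indicator (box c d)"] I2 by simp
    qed
    then have "AE x in lebesgue. G x = 0" by (rule AE_completion)
    with eq' show ?thesis by eventually_elim (use w0 in auto)
  qed
  obtain \<D> where D: "countable \<D>" "\<D> \<subseteq> Pow \<Omega>" "\<And>X. X \<in> \<D> \<Longrightarrow> \<exists>a b. X = cbox a b" "\<Union>\<D> = \<Omega>"
    using open_countable_Union_open_cbox[OF \<Omega>] by blast
  have "AE x in lebesgue. x \<in> X \<longrightarrow> g x = 0" if X: "X \<in> \<D>" for X
  proof -
    obtain a b where ab: "X = cbox a b" using D(3)[OF X] by blast
    have "cbox a b - box a b \<in> null_sets lebesgue"
      using negligible_frontier_interval[of a b] by (simp add: negligible_iff_null_sets)
    then have "AE x in lebesgue. x \<notin> cbox a b - box a b" by (rule AE_not_in)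
    moreover have "AE x in lebesgue. x \<in> box a b \<longrightarrow> g x = 0" using box ab X D(2) by blast
    ultimately show ?thesis unfolding ab by eventually_elim auto
  qed
  then have "AE x in lebesgue. \<forall>X\<in>\<D>. x \<in> X \<longrightarrow> g x = 0"
    by (intro AE_ball_countable[OF D(1), THEN iffD2] ballI)
  then have "AE x in lebesgue. x \<in> \<Omega> \<longrightarrow> g x = 0" by eventually_elim (use D(4) in blast)
  then show ?thesis by (subst AE_restrict_space_iff) (simp_all add: \<Omega>m)
qed

section \<open>Lebesgue spaces\<close>

lemma powr_convex_comb:
  fixes x y \<theta> p :: real
  assumes "p \<ge> 1" "x \<ge> 0" "y \<ge> 0" "0 \<le> \<theta>" "\<theta> \<le> 1"
  shows "((1 - \<theta>) * x + \<theta> * y) powr p \<le> (1 - \<theta>) * x powr p + \<theta> * y powr p"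
proof (cases "(1 - \<theta>) * x + \<theta> * y = 0")
  case False
  define c where "c = (1 - \<theta>) * x + \<theta> * y"
  have "c \<ge> 0" unfolding c_def using assms by (intro add_nonneg_nonneg mult_nonneg_nonneg) auto
  with False have c: "c > 0" by (simp add: c_def)
  have "(1 - \<theta>) * (c powr p + p * c powr (p - 1) * (x - c)) + \<theta> * (c powr p + p * c powr (p - 1) * (y - c))
      \<le> (1 - \<theta>) * x powr p + \<theta> * y powr p"
    using assms c by (intro add_mono mult_left_mono powr_tangent_le) auto
  moreover have "(1 - \<theta>) * (c powr p + p * c powr (p - 1) * (x - c)) + \<theta> * (c powr p + p * c powr (p - 1) * (y - c))
      = c powr p + p * c powr (p - 1) * ((1 - \<theta>) * x + \<theta> * y - c)" by (simp add: algebra_simps)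
  ultimately show ?thesis by (simp add: c_def)
qed (use assms in simp)

lemma Lp_norm_nonneg [simp]: "0 \<le> Lp_norm \<Omega> p f"
  by (simp add: Lp_norm_def)

lemma Lp_norm_powr:
  assumes "p > 0"
  shows "Lp_norm \<Omega> p f powr p = (\<integral>x. norm (f x) powr p \<partial>lebesgue_on \<Omega>)"
  using assms by (simp add: Lp_norm_def powr_powr)

lemma Lp_norm_cong_AE:
  assumes "AE x in lebesgue_on \<Omega>. f x = g x"
    and "f \<in> borel_measurable (lebesgue_on \<Omega>)" "g \<in> borel_measurable (lebesgue_on \<Omega>)"
  shows "Lp_norm \<Omega> p f = Lp_norm \<Omega> p g"
proof -
  have "(\<integral>x. norm (f x) powr p \<partial>lebesgue_on \<Omega>) = (\<integral>x. norm (g x) powr p \<partial>lebesgue_on \<Omega>)"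
    using assms by (intro integral_cong_AE) (auto elim!: AE_mp)
  then show ?thesis by (simp add: Lp_norm_def)
qed

lemma in_Lp_cong_AE:
  assumes "AE x in lebesgue_on \<Omega>. f x = g x" "in_Lp \<Omega> p f" "g \<in> borel_measurable (lebesgue_on \<Omega>)"
  shows "in_Lp \<Omega> p g"
proof -
  have [measurable]: "f \<in> borel_measurable (lebesgue_on \<Omega>)" "g \<in> borel_measurable (lebesgue_on \<Omega>)"
    using assms by (auto simp: in_Lp_def)
  have "integrable (lebesgue_on \<Omega>) (\<lambda>x. norm (g x) powr p)"
    by (rule integrable_cong_AE_imp[where g = "\<lambda>x. norm (f x) powr p"])
      (use assms in \<open>auto simp: in_Lp_def elim!: AE_mp\<close>)
  then show ?thesis using assms by (simp add: in_Lp_def)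
qed

lemma in_Lp_bound:
  assumes "in_Lp \<Omega> p f" "g \<in> borel_measurable (lebesgue_on \<Omega>)" "p > 0"
    and "\<And>x. x \<in> \<Omega> \<Longrightarrow> norm (g x) \<le> norm (f x)"
  shows "in_Lp \<Omega> p g"
proof -
  have [measurable]: "g \<in> borel_measurable (lebesgue_on \<Omega>)" by fact
  have "integrable (lebesgue_on \<Omega>) (\<lambda>x. norm (g x) powr p)"
  proof (rule Bochner_Integration.integrable_bound[where f = "\<lambda>x. norm (f x) powr p"])
    show "AE x in lebesgue_on \<Omega>. norm (norm (g x) powr p) \<le> norm (norm (f x) powr p)"
      using assms(3,4) by (intro AE_I2) (auto intro!: powr_mono2 simp: space_restrict_space)
  qed (use assms in \<open>auto simp: in_Lp_def\<close>)
  then show ?thesis using assms by (simp add: in_Lp_def)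
qed

lemma in_Lp_add:
  assumes "in_Lp \<Omega> p f" "in_Lp \<Omega> p g" "p > 0"
  shows "in_Lp \<Omega> p (\<lambda>x. f x + g x)"
proof -
  have [measurable]: "f \<in> borel_measurable (lebesgue_on \<Omega>)" "g \<in> borel_measurable (lebesgue_on \<Omega>)"
    using assms by (auto simp: in_Lp_def)
  have "integrable (lebesgue_on \<Omega>) (\<lambda>x. norm (f x + g x) powr p)"
  proof (rule Bochner_Integration.integrable_bound[where f = "\<lambda>x. 2 powr p * (norm (f x) powr p + norm (g x) powr p)"])
    show "AE x in lebesgue_on \<Omega>. norm (norm (f x + g x) powr p) \<le> norm (2 powr p * (norm (f x) powr p + norm (g x) powr p))"
      using norm_add_powr_le[OF assms(3)] by (intro AE_I2) auto
  qed (use assms in \<open>auto simp: in_Lp_def\<close>)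
  then show ?thesis by (simp add: in_Lp_def)
qed

lemma in_Lp_scaleR:
  assumes "in_Lp \<Omega> p f"
  shows "in_Lp \<Omega> p (\<lambda>x. c *\<^sub>R f x)"
  using assms by (auto simp: in_Lp_def powr_mult)

lemma in_Lp_diff:
  assumes "in_Lp \<Omega> p f" "in_Lp \<Omega> p g" "p > 0"
  shows "in_Lp \<Omega> p (\<lambda>x. f x - g x)"
  using in_Lp_add[OF assms(1) in_Lp_scaleR[OF assms(2), of "-1"] assms(3)] by simp

lemma Lp_norm_scaleR:
  assumes "p > 0"
  shows "Lp_norm \<Omega> p (\<lambda>x. c *\<^sub>R f x) = \<bar>c\<bar> * Lp_norm \<Omega> p f"
  using assms by (simp add: Lp_norm_def powr_mult powr_powr)

lemma Lp_norm_diff_commute: "Lp_norm \<Omega> p (\<lambda>x. f x - g x) = Lp_norm \<Omega> p (\<lambda>x. g x - f x)"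
  by (simp add: Lp_norm_def norm_minus_commute)

lemma Lp_norm_eq_0_imp_AE:
  assumes "in_Lp \<Omega> p f" "p > 0" "Lp_norm \<Omega> p f = 0"
  shows "AE x in lebesgue_on \<Omega>. f x = 0"
proof -
  have "(\<integral>x. norm (f x) powr p \<partial>lebesgue_on \<Omega>) = 0"
    using Lp_norm_powr[OF assms(2), of \<Omega> f] assms by simp
  then have "AE x in lebesgue_on \<Omega>. norm (f x) powr p = 0"
    using assms(1) by (subst (asm) integral_nonneg_eq_0_iff_AE) (auto simp: in_Lp_def)
  then show ?thesis by eventually_elim simp
qed

text \<open>Convexity of the power with weight \<open>\<theta> = B / (A + B)\<close>, applied to
  \<open>f / A\<close> and \<open>g / B\<close>. Arbitrary positive upper bounds \<open>A\<close>
  and \<open>B\<close> replace the norms so that vanishing norms need no separate case; the slack is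
  removed at the end.\<close>

lemma Minkowski:
  assumes f: "in_Lp \<Omega> p f" and g: "in_Lp \<Omega> p g" and p: "p \<ge> 1"
  shows "Lp_norm \<Omega> p (\<lambda>x. f x + g x) \<le> Lp_norm \<Omega> p f + Lp_norm \<Omega> p g"
proof -
  have main: "Lp_norm \<Omega> p (\<lambda>x. f x + g x) \<le> A + B"
    if A: "A > 0" "Lp_norm \<Omega> p f \<le> A" and B: "B > 0" "Lp_norm \<Omega> p g \<le> B" for A B
  proof -
    have If: "(\<integral>x. norm (f x) powr p \<partial>lebesgue_on \<Omega>) \<le> A powr p"
      using Lp_norm_powr[of p \<Omega> f] powr_mono2[OF _ _ A(2), of p] p by simp
    have Ig: "(\<integral>x. norm (g x) powr p \<partial>lebesgue_on \<Omega>) \<le> B powr p"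
      using Lp_norm_powr[of p \<Omega> g] powr_mono2[OF _ _ B(2), of p] p by simp
    define \<theta> where "\<theta> = B / (A + B)"
    have \<theta>: "0 \<le> \<theta>" "\<theta> \<le> 1" "(1 - \<theta>) * (A + B) = A" "\<theta> * (A + B) = B"
      using A B by (auto simp: \<theta>_def field_simps)
    have pt: "norm (f x + g x) powr p \<le> (A + B) powr p * ((1 - \<theta>) / A powr p * norm (f x) powr p
        + \<theta> / B powr p * norm (g x) powr p)" for x
    proof -
      have "norm (f x + g x) \<le> norm (f x) + norm (g x)" by (rule norm_triangle_ineq)
      also have "\<dots> = (A + B) * ((1 - \<theta>) * (norm (f x) / A) + \<theta> * (norm (g x) / B))"
      proof -
        have "(A + B) * ((1 - \<theta>) * u + \<theta> * v) = ((1 - \<theta>) * (A + B)) * u + (\<theta> * (A + B)) * v" for u v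
          by (simp add: algebra_simps)
        from this[of "norm (f x) / A" "norm (g x) / B"] show ?thesis unfolding \<theta> using A B by simp
      qed
      finally have "norm (f x + g x) powr p \<le> ((A + B) * ((1 - \<theta>) * (norm (f x) / A) + \<theta> * (norm (g x) / B))) powr p"
        using p by (intro powr_mono2) auto
      also have "\<dots> = (A + B) powr p * ((1 - \<theta>) * (norm (f x) / A) + \<theta> * (norm (g x) / B)) powr p"
        by (rule powr_mult)
      also have "\<dots> \<le> (A + B) powr p * ((1 - \<theta>) * (norm (f x) / A) powr p + \<theta> * (norm (g x) / B) powr p)"
        using p \<theta> A B by (intro mult_left_mono powr_convex_comb) auto
      finally show ?thesis using A B by (simp add: powr_divide)
    qed
    have "(\<integral>x. norm (f x + g x) powr p \<partial>lebesgue_on \<Omega>) \<le> (\<integral>x. (A + B) powr p * ((1 - \<theta>) / A powr p * norm (f x) powr p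
        + \<theta> / B powr p * norm (g x) powr p) \<partial>lebesgue_on \<Omega>)"
      using in_Lp_add[OF f g] f g p pt by (intro integral_mono) (auto simp: in_Lp_def)
    also have "\<dots> = (A + B) powr p * ((1 - \<theta>) / A powr p * (\<integral>x. norm (f x) powr p \<partial>lebesgue_on \<Omega>)
        + \<theta> / B powr p * (\<integral>x. norm (g x) powr p \<partial>lebesgue_on \<Omega>))"
      using f g by (simp add: in_Lp_def)
    also have "\<dots> \<le> (A + B) powr p * ((1 - \<theta>) / A powr p * A powr p + \<theta> / B powr p * B powr p)"
      using \<theta> If Ig by (intro mult_left_mono add_mono) auto
    also have "\<dots> = (A + B) powr p" using A B by simp
    finally have "(\<integral>x. norm (f x + g x) powr p \<partial>lebesgue_on \<Omega>) powr (1 / p) \<le> ((A + B) powr p) powr (1 / p)"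
      using p by (intro powr_mono2) auto
    then show ?thesis using p A B by (simp add: Lp_norm_def powr_powr)
  qed
  show ?thesis
  proof (rule field_le_epsilon)
    fix e :: real assume e: "e > 0"
    have "Lp_norm \<Omega> p (\<lambda>x. f x + g x) \<le> (Lp_norm \<Omega> p f + e / 2) + (Lp_norm \<Omega> p g + e / 2)"
      using e by (intro main) (auto simp: add_nonneg_pos)
    then show "Lp_norm \<Omega> p (\<lambda>x. f x + g x) \<le> Lp_norm \<Omega> p f + Lp_norm \<Omega> p g + e" by simp
  qed
qed

lemma Lp_norm_triangle_sub:
  assumes "in_Lp \<Omega> p f" "in_Lp \<Omega> p g" "in_Lp \<Omega> p h" "p \<ge> 1"
  shows "Lp_norm \<Omega> p (\<lambda>x. f x - h x) \<le> Lp_norm \<Omega> p (\<lambda>x. f x - g x) + Lp_norm \<Omega> p (\<lambda>x. g x - h x)"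
  using Minkowski[OF in_Lp_diff[OF assms(1,2)] in_Lp_diff[OF assms(2,3)]] assms(4) by simp

lemma Lp_norm_diff_le:
  assumes "in_Lp \<Omega> p f" "in_Lp \<Omega> p g" "p \<ge> 1"
  shows "\<bar>Lp_norm \<Omega> p f - Lp_norm \<Omega> p g\<bar> \<le> Lp_norm \<Omega> p (\<lambda>x. f x - g x)"
proof -
  have "Lp_norm \<Omega> p f \<le> Lp_norm \<Omega> p (\<lambda>x. f x - g x) + Lp_norm \<Omega> p g"
    using Minkowski[OF in_Lp_diff[OF assms(1,2)] assms(2)] assms(3) by simp
  moreover have "Lp_norm \<Omega> p g \<le> Lp_norm \<Omega> p (\<lambda>x. g x - f x) + Lp_norm \<Omega> p f"
    using Minkowski[OF in_Lp_diff[OF assms(2,1)] assms(1)] assms(3) by simp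
  ultimately show ?thesis by (simp add: Lp_norm_diff_commute[of \<Omega> p g f])
qed

lemma Lp_norm_tendsto:
  assumes "\<And>n. in_Lp \<Omega> p (f n)" "in_Lp \<Omega> p g" "p \<ge> 1"
    and "(\<lambda>n. Lp_norm \<Omega> p (\<lambda>x. f n x - g x)) \<longlonglongrightarrow> 0"
  shows "(\<lambda>n. Lp_norm \<Omega> p (f n)) \<longlonglongrightarrow> Lp_norm \<Omega> p g"
proof -
  have "(\<lambda>n. Lp_norm \<Omega> p (f n) - Lp_norm \<Omega> p g) \<longlonglongrightarrow> 0"
    by (rule Lim_null_comparison[OF always_eventually assms(4)])
      (use Lp_norm_diff_le[OF assms(1-3)] in simp)
  then show ?thesis by (simp add: LIM_zero_iff)
qed

lemma nn_integral_Lp: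
  assumes "in_Lp \<Omega> p f" "p > 0"
  shows "(\<integral>\<^sup>+x. ennreal (norm (f x) powr p) \<partial>lebesgue_on \<Omega>) = ennreal (Lp_norm \<Omega> p f powr p)"
  using assms by (subst Lp_norm_powr) (auto simp: in_Lp_def intro!: nn_integral_eq_integral)

lemma in_Lp_nn_integral:
  assumes "f \<in> borel_measurable (lebesgue_on \<Omega>)" "(\<integral>\<^sup>+x. ennreal (norm (f x) powr p) \<partial>lebesgue_on \<Omega>) < \<infinity>"
  shows "in_Lp \<Omega> p f"
  using assms by (auto simp: in_Lp_def intro!: integrableI_nonneg)

lemma Lp_norm_le_nn_integral:
  assumes "f \<in> borel_measurable (lebesgue_on \<Omega>)" "p > 0" "c \<ge> 0"
    and "(\<integral>\<^sup>+x. ennreal (norm (f x) powr p) \<partial>lebesgue_on \<Omega>) \<le> ennreal c"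
  shows "in_Lp \<Omega> p f" "Lp_norm \<Omega> p f powr p \<le> c"
proof -
  show f: "in_Lp \<Omega> p f"
    by (rule in_Lp_nn_integral[OF assms(1)]) (rule le_less_trans[OF assms(4)], simp)
  show "Lp_norm \<Omega> p f powr p \<le> c"
    using assms(3,4) unfolding nn_integral_Lp[OF f assms(2)] by (simp add: ennreal_le_iff)
qed

text \<open>Riesz-Fischer. Along a subsequence the \<open>p\<close>-th powers of consecutive
  distances are below \<open>(1 / 4) ^ k\<close>. Weighting them with \<open>2 ^ k\<close> keeps the
  sum finite, and finiteness at a point forces geometric decay of the increments there.\<close>

theorem Lp_complete:
  fixes f :: "nat \<Rightarrow> real^'n \<Rightarrow> 'b::euclidean_space"
  assumes f: "\<And>n. in_Lp \<Omega> p (f n)" and p: "p \<ge> 1"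
    and Cauchy: "\<And>e. e > 0 \<Longrightarrow> \<exists>N. \<forall>i\<ge>N. \<forall>j\<ge>N. Lp_norm \<Omega> p (\<lambda>x. f i x - f j x) < e"
  shows "\<exists>g. in_Lp \<Omega> p g \<and> (\<lambda>n. Lp_norm \<Omega> p (\<lambda>x. f n x - g x)) \<longlonglongrightarrow> 0"
proof -
  have fm [measurable]: "f n \<in> borel_measurable (lebesgue_on \<Omega>)" for n using f by (auto simp: in_Lp_def)
  have "\<forall>k. \<exists>N. \<forall>i\<ge>N. \<forall>j\<ge>N. Lp_norm \<Omega> p (\<lambda>x. f i x - f j x) powr p < (1 / 4) ^ k"
  proof
    fix k :: nat
    obtain N where N: "\<forall>i\<ge>N. \<forall>j\<ge>N. Lp_norm \<Omega> p (\<lambda>x. f i x - f j x) < ((1 / 4) ^ k) powr (1 / p)"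
      using Cauchy[of "((1 / 4) ^ k) powr (1 / p)"] by auto
    have "Lp_norm \<Omega> p (\<lambda>x. f i x - f j x) powr p < (1 / 4) ^ k" if "i \<ge> N" "j \<ge> N" for i j
    proof -
      have "Lp_norm \<Omega> p (\<lambda>x. f i x - f j x) powr p < (((1 / 4) ^ k) powr (1 / p)) powr p"
        using N that p by (intro powr_less_mono2) auto
      also have "\<dots> = (1 / 4) ^ k" using p by (simp add: powr_powr)
      finally show ?thesis .
    qed
    then show "\<exists>N. \<forall>i\<ge>N. \<forall>j\<ge>N. Lp_norm \<Omega> p (\<lambda>x. f i x - f j x) powr p < (1 / 4) ^ k" by blast
  qed
  then obtain N where N: "\<And>k i j. i \<ge> N k \<Longrightarrow> j \<ge> N k \<Longrightarrow> Lp_norm \<Omega> p (\<lambda>x. f i x - f j x) powr p < (1 / 4) ^ k"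
    by metis
  \<comment> \<open>Partial sums instead of a strictly increasing choice: \<open>s k\<close> and
    \<open>s (Suc k)\<close> are both at least \<open>N k\<close>, and \<open>s\<close> eventually
    stays above every \<open>N l\<close>, which is all that is used.\<close>
  define s where "s k = (\<Sum>l\<le>k. N l)" for k
  have sN: "s k \<ge> N k" "s (Suc k) \<ge> N k" for k
    unfolding s_def by (auto intro: member_le_sum trans_le_add1)
  have s_lim: "\<exists>K. \<forall>k\<ge>K. s k \<ge> N l" for l
    unfolding s_def by (intro exI[of _ l]) (auto intro: member_le_sum)
  define \<Delta> where "\<Delta> k x = f (s (Suc k)) x - f (s k) x" for k x
  have "(\<integral>\<^sup>+x. (\<Sum>k. ennreal (2 ^ k * norm (\<Delta> k x) powr p)) \<partial>lebesgue_on \<Omega>)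
      = (\<Sum>k. \<integral>\<^sup>+x. ennreal (2 ^ k * norm (\<Delta> k x) powr p) \<partial>lebesgue_on \<Omega>)"
    by (rule nn_integral_suminf) (simp add: \<Delta>_def)
  also have "\<dots> \<le> (\<Sum>k. ennreal ((1 / 2) ^ k))"
  proof (intro suminf_le)
    fix k
    have "(\<integral>\<^sup>+x. ennreal (2 ^ k * norm (\<Delta> k x) powr p) \<partial>lebesgue_on \<Omega>)
        = ennreal (2 ^ k) * (\<integral>\<^sup>+x. ennreal (norm (\<Delta> k x) powr p) \<partial>lebesgue_on \<Omega>)"
      by (subst nn_integral_cmult[symmetric]) (auto simp: \<Delta>_def ennreal_mult)
    also have "\<dots> = ennreal (2 ^ k) * ennreal (Lp_norm \<Omega> p (\<lambda>x. f (s (Suc k)) x - f (s k) x) powr p)"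
      unfolding \<Delta>_def using p by (subst nn_integral_Lp) (auto intro: in_Lp_diff f)
    also have "\<dots> \<le> ennreal (2 ^ k) * ennreal ((1 / 4) ^ k)"
      using N[OF sN(2) sN(1), of k] by (intro mult_left_mono ennreal_leI) auto
    also have "\<dots> = ennreal ((1 / 2) ^ k)"
      by (simp add: ennreal_mult[symmetric] power_mult_distrib[symmetric])
    finally show "(\<integral>\<^sup>+x. ennreal (2 ^ k * norm (\<Delta> k x) powr p) \<partial>lebesgue_on \<Omega>) \<le> ennreal ((1 / 2) ^ k)" .
  qed auto
  also have "\<dots> = ennreal (\<Sum>k. (1 / 2) ^ k)" by (rule suminf_ennreal2) (auto intro: summable_geometric)
  also have "\<dots> < \<infinity>" by simp
  finally have fin: "(\<integral>\<^sup>+x. (\<Sum>k. ennreal (2 ^ k * norm (\<Delta> k x) powr p)) \<partial>lebesgue_on \<Omega>) < \<infinity>" .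
  have [measurable]: "\<Delta> k \<in> borel_measurable (lebesgue_on \<Omega>)" for k unfolding \<Delta>_def by measurable
  have "AE x in lebesgue_on \<Omega>. (\<Sum>k. ennreal (2 ^ k * norm (\<Delta> k x) powr p)) \<noteq> \<infinity>"
    by (rule nn_integral_PInf_AE[OF borel_measurable_suminf_order less_imp_neq[OF fin]]) simp
  then have conv: "AE x in lebesgue_on \<Omega>. convergent (\<lambda>k. f (s k) x)"
  proof eventually_elim
    case (elim x)
    define Z where "Z = (\<Sum>k. ennreal (2 ^ k * norm (\<Delta> k x) powr p))"
    have "Z \<noteq> \<infinity>" using elim unfolding Z_def .
    then obtain C where "Z = ennreal C" "C \<ge> 0" by (cases Z) auto
    then have C: "(\<Sum>k. ennreal (2 ^ k * norm (\<Delta> k x) powr p)) = ennreal C" "C \<ge> 0"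
      unfolding Z_def by blast+
    have le: "norm (\<Delta> k x) \<le> C powr (1 / p) * ((1 / 2) powr (1 / p)) ^ k" for k
    proof -
      have "ennreal (2 ^ k * norm (\<Delta> k x) powr p) = (\<Sum>k\<in>{k}. ennreal (2 ^ k * norm (\<Delta> k x) powr p))" by simp
      also have "\<dots> \<le> ennreal C" unfolding C(1)[symmetric] by (rule sum_le_suminf) auto
      finally have "2 ^ k * norm (\<Delta> k x) powr p \<le> C" using C(2) by (simp add: ennreal_le_iff)
      then have "norm (\<Delta> k x) powr p \<le> C * (1 / 2) ^ k" by (simp add: field_simps power_divide)
      then have "(norm (\<Delta> k x) powr p) powr (1 / p) \<le> (C * (1 / 2) ^ k) powr (1 / p)"
        using p by (intro powr_mono2) auto
      also have "\<dots> = C powr (1 / p) * ((1 / 2) powr (1 / p)) ^ k"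
        by (simp add: powr_mult powr_realpow[symmetric] powr_powr mult.commute)
      finally show ?thesis using p by (simp add: powr_powr)
    qed
    have "(1 / 2 :: real) powr (1 / p) < 1"
      using powr_less_mono2[of "1 / p" "1 / 2" 1] p by simp
    then have "summable (\<lambda>k. C powr (1 / p) * ((1 / 2) powr (1 / p)) ^ k)"
      by (intro summable_mult summable_geometric) simp
    then have "summable (\<lambda>k. \<Delta> k x)"
      by (rule summable_comparison_test[rotated]) (use le in blast)
    then have "convergent (\<lambda>n. \<Sum>k<n. \<Delta> k x)" by (simp add: summable_iff_convergent)
    moreover have "(\<Sum>k<n. \<Delta> k x) = f (s n) x - f (s 0) x" for n
      unfolding \<Delta>_def by (rule sum_lessThan_telescope)
    ultimately have "convergent (\<lambda>n. f (s n) x - f (s 0) x)" by simp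
    from convergent_add[OF this convergent_const[of "f (s 0) x"]] show ?case by simp
  qed
  define g where "g x = lim (\<lambda>k. f (s k) x)" for x
  have gm [measurable]: "g \<in> borel_measurable (lebesgue_on \<Omega>)"
    unfolding g_def by (rule borel_measurable_lim_metric) simp
  have glim: "AE x in lebesgue_on \<Omega>. (\<lambda>k. f (s k) x) \<longlonglongrightarrow> g x"
    using conv by eventually_elim (simp add: g_def convergent_LIMSEQ_iff)
  \<comment> \<open>Fatou's lemma along the subsequence controls the distance of every late
    \<open>f i\<close> to the limit, so the whole sequence converges.\<close>
  have bound: "(\<integral>\<^sup>+x. ennreal (norm (f i x - g x) powr p) \<partial>lebesgue_on \<Omega>) \<le> ennreal ((1 / 4) ^ l)"
    if i: "i \<ge> N l" for i l
  proof -
    have "(\<integral>\<^sup>+x. ennreal (norm (f i x - g x) powr p) \<partial>lebesgue_on \<Omega>)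
        = (\<integral>\<^sup>+x. liminf (\<lambda>k. ennreal (norm (f i x - f (s k) x) powr p)) \<partial>lebesgue_on \<Omega>)"
    proof (rule nn_integral_cong_AE)
      show "AE x in lebesgue_on \<Omega>. ennreal (norm (f i x - g x) powr p) = liminf (\<lambda>k. ennreal (norm (f i x - f (s k) x) powr p))"
        using glim
      proof eventually_elim
        case (elim x)
        have "(\<lambda>k. ennreal (norm (f i x - f (s k) x) powr p)) \<longlonglongrightarrow> ennreal (norm (f i x - g x) powr p)"
          using p by (intro tendsto_ennrealI tendsto_powr2 tendsto_norm tendsto_diff tendsto_const elim) auto
        from lim_imp_Liminf[OF _ this] show ?case by (metis trivial_limit_sequentially)
      qed
    qed
    also have "\<dots> \<le> liminf (\<lambda>k. \<integral>\<^sup>+x. ennreal (norm (f i x - f (s k) x) powr p) \<partial>lebesgue_on \<Omega>)"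
      by (rule nn_integral_liminf) simp
    also have "\<dots> \<le> ennreal ((1 / 4) ^ l)"
    proof (rule Liminf_le)
      obtain K where K: "\<forall>k\<ge>K. s k \<ge> N l" using s_lim by blast
      have "(\<integral>\<^sup>+x. ennreal (norm (f i x - f (s k) x) powr p) \<partial>lebesgue_on \<Omega>) \<le> ennreal ((1 / 4) ^ l)" if "k \<ge> K" for k
        using N[OF i, of "s k"] K that p
        by (subst nn_integral_Lp) (auto intro!: in_Lp_diff f ennreal_leI less_imp_le)
      then show "\<forall>\<^sub>F k in sequentially. (\<integral>\<^sup>+x. ennreal (norm (f i x - f (s k) x) powr p) \<partial>lebesgue_on \<Omega>) \<le> ennreal ((1 / 4) ^ l)"
        by (auto simp: eventually_sequentially)
    qed simp
    finally show ?thesis .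
  qed
  have small: "in_Lp \<Omega> p (\<lambda>x. f i x - g x)" "Lp_norm \<Omega> p (\<lambda>x. f i x - g x) powr p \<le> (1 / 4) ^ l"
    if "i \<ge> N l" for i l
    using Lp_norm_le_nn_integral[OF _ _ _ bound[OF that]] p by auto
  have g: "in_Lp \<Omega> p g"
    using in_Lp_diff[OF f[of "N 0"] small(1)[of 0 "N 0"]] p by simp
  have "(\<lambda>n. Lp_norm \<Omega> p (\<lambda>x. f n x - g x)) \<longlonglongrightarrow> 0"
  proof (rule LIMSEQ_I)
    fix e :: real assume e: "e > 0"
    then obtain l where l: "(1 / 4) ^ l < e powr p"
      using real_arch_pow_inv[of "e powr p" "1 / 4"] by auto
    have "norm (Lp_norm \<Omega> p (\<lambda>x. f n x - g x) - 0) < e" if "n \<ge> N l" for n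
    proof (rule ccontr)
      assume "\<not> norm (Lp_norm \<Omega> p (\<lambda>x. f n x - g x) - 0) < e"
      then have "e powr p \<le> Lp_norm \<Omega> p (\<lambda>x. f n x - g x) powr p"
        using e p by (intro powr_mono2) auto
      then show False using small(2)[OF that] l by linarith
    qed
    then show "\<exists>n0. \<forall>n\<ge>n0. norm (Lp_norm \<Omega> p (\<lambda>x. f n x - g x) - 0) < e" by blast
  qed
  with g show ?thesis by blast
qed

section \<open>Uniform convexity\<close>

lemma powr_strict_midpoint:
  fixes x y p :: real
  assumes p: "p > 1" and x: "0 \<le> x" "x < y"
  shows "((x + y) / 2) powr p < (x powr p + y powr p) / 2"
proof -
  define c where "c = (x + y) / 2"
  have c: "x < c" "c < y" "c > 0" "y - c = c - x" using x by (auto simp: c_def field_simps)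
  have mvt: "\<exists>z. a < z \<and> z < b \<and> b powr p - a powr p = (b - a) * (p * z powr (p - 1))"
    if "0 \<le> a" "a < b" for a b :: real
  proof -
    have d: "((\<lambda>x. x powr p) has_real_derivative p * z powr (p - 1)) (at z)" if "z > 0" for z :: real
      using that by (auto intro!: derivative_eq_intros)
    have "\<exists>l z. a < z \<and> z < b \<and> ((\<lambda>x. x powr p) has_real_derivative l) (at z) \<and> b powr p - a powr p = (b - a) * l"
    proof (rule MVT[OF \<open>a < b\<close>])
      show "continuous_on {a..b} (\<lambda>x. x powr p)"
        using p \<open>0 \<le> a\<close> by (intro continuous_on_powr') (auto intro!: continuous_intros)
      show "(\<lambda>x. x powr p) differentiable at z" if "a < z" "z < b" for z
        using d[of z] that \<open>0 \<le> a\<close> by (auto simp: real_differentiable_def)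
    qed
    then obtain l z where "a < z" "z < b" "((\<lambda>x. x powr p) has_real_derivative l) (at z)"
      "b powr p - a powr p = (b - a) * l" by blast
    moreover have "l = p * z powr (p - 1)"
      using d[of z] calculation \<open>0 \<le> a\<close> by (intro DERIV_unique) auto
    ultimately show ?thesis by blast
  qed
  obtain z1 where z1: "x < z1" "z1 < c" "c powr p - x powr p = (c - x) * (p * z1 powr (p - 1))"
    using mvt[of x c] x c by auto
  obtain z2 where z2: "c < z2" "z2 < y" "y powr p - c powr p = (y - c) * (p * z2 powr (p - 1))"
    using mvt[of c y] c by auto
  have "z1 powr (p - 1) < z2 powr (p - 1)" using z1 z2 x p by (intro powr_less_mono2) auto
  then have "(c - x) * (p * z1 powr (p - 1)) < (c - x) * (p * z2 powr (p - 1))"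
    using c p by (intro mult_strict_left_mono) auto
  then have "c powr p - x powr p < y powr p - c powr p" unfolding z1(3) z2(3) c(4) .
  then have "2 * c powr p < x powr p + y powr p" by simp
  then show ?thesis unfolding c_def by simp
qed

text \<open>Strictness has two sources: for equal norms it comes from the parallelogram law, for
  different norms from strict convexity of the power.\<close>

lemma norm_powr_strict_midpoint:
  fixes a b :: "'a::real_inner"
  assumes p: "p > 1" and ab: "a \<noteq> b"
  shows "norm ((1 / 2) *\<^sub>R (a + b)) powr p < (norm a powr p + norm b powr p) / 2"
proof (cases "norm a = norm b")
  case True
  have "(norm (a + b))\<^sup>2 + (norm (a - b))\<^sup>2 = 4 * (norm a)\<^sup>2"
    using True by (simp add: power2_norm_eq_inner algebra_simps)
      (simp add: dot_square_norm)
  moreover have "(norm (a - b))\<^sup>2 > 0" using ab by simp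
  moreover have "(2 * norm a)\<^sup>2 = 4 * (norm a)\<^sup>2" by (simp add: power_mult_distrib)
  ultimately have "(norm (a + b))\<^sup>2 < (2 * norm a)\<^sup>2" by linarith
  then have "norm (a + b) < 2 * norm a" by (rule power_less_imp_less_base) simp
  then have "norm ((1 / 2) *\<^sub>R (a + b)) powr p < norm a powr p"
    using p by (intro powr_less_mono2) auto
  then show ?thesis using True by simp
next
  case False
  have "norm ((1 / 2) *\<^sub>R (a + b)) \<le> (norm a + norm b) / 2"
    using norm_triangle_ineq[of a b] by simp
  then have "norm ((1 / 2) *\<^sub>R (a + b)) powr p \<le> ((norm a + norm b) / 2) powr p"
    using p by (intro powr_mono2) auto
  also have "\<dots> < (norm a powr p + norm b powr p) / 2"
  proof (cases "norm a < norm b")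
    case True
    then show ?thesis using powr_strict_midpoint[OF p, of "norm a" "norm b"] by simp
  next
    case False
    then show ?thesis using powr_strict_midpoint[OF p, of "norm b" "norm a"] \<open>norm a \<noteq> norm b\<close>
      by (simp add: add.commute)
  qed
  finally show ?thesis .
qed

text \<open>A soft form of uniform convexity, obtained from strict convexity by compactness and
  homogeneity; unlike Clarkson's inequalities it treats all \<open>p > 1\<close> at once.\<close>

lemma soft_uniform_convexity:
  assumes p: "p > 1" and \<epsilon>: "\<epsilon> > 0"
  shows "\<exists>K>0. \<forall>a b :: 'a::euclidean_space. norm (a - b) powr p \<le> \<epsilon> * (norm a powr p + norm b powr p)
    + K * ((norm a powr p + norm b powr p) / 2 - norm ((1 / 2) *\<^sub>R (a + b)) powr p)"
proof -
  define N where "N z = norm (fst z) powr p + norm (snd z) powr p" for z :: "'a \<times> 'a"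
  define \<Phi> where "\<Phi> z = N z / 2 - norm ((1 / 2) *\<^sub>R (fst z + snd z)) powr p" for z :: "'a \<times> 'a"
  \<comment> \<open>Normalised pairs whose distance is not already strictly covered by the
    \<open>\<epsilon>\<close> term. They form a compact set on which the convexity defect
    \<open>\<Phi>\<close> is positive, so it is bounded below by some
    \<open>\<delta> > 0\<close>.\<close>
  define S where "S = {z :: 'a \<times> 'a. N z = 1 \<and> \<epsilon> \<le> norm (fst z - snd z) powr p}"
  have contN: "continuous_on UNIV N" and cont\<Phi>: "continuous_on UNIV \<Phi>"
    unfolding N_def \<Phi>_def using p by (auto intro!: continuous_intros continuous_on_powr')
  have contD: "continuous_on UNIV (\<lambda>z :: 'a \<times> 'a. norm (fst z - snd z) powr p)"
    using p by (intro continuous_on_powr' continuous_intros) auto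
  have "closed S"
    unfolding S_def
    by (intro closed_Collect_conj closed_Collect_eq closed_Collect_le contN contD continuous_on_const)
  moreover have "S \<subseteq> cball 0 1 \<times> cball 0 1"
  proof
    fix z assume "z \<in> S"
    then have "norm (fst z) powr p \<le> 1" "norm (snd z) powr p \<le> 1"
      using powr_ge_zero[of "norm (fst z)" p] powr_ge_zero[of "norm (snd z)" p]
      unfolding S_def N_def mem_Collect_eq by linarith+
    then have "norm (fst z) \<le> 1" "norm (snd z) \<le> 1"
      using powr_less_mono2[of p 1 "norm (fst z)"] powr_less_mono2[of p 1 "norm (snd z)"] p
      by (fastforce simp: not_le[symmetric])+
    then show "z \<in> cball 0 1 \<times> cball 0 1" by (cases z) auto
  qed
  ultimately have "compact S"
    using compact_Int_closed[OF compact_Times[OF compact_cball compact_cball], of S "0::'a" 1 "0::'a" 1]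
    by (simp add: Int_absorb1)
  have pos: "\<Phi> z > 0" if "z \<in> S" for z
  proof -
    have "fst z \<noteq> snd z" using that \<epsilon> by (auto simp: S_def)
    then show ?thesis using norm_powr_strict_midpoint[OF p] by (simp add: \<Phi>_def N_def)
  qed
  obtain \<delta> where \<delta>: "\<delta> > 0" "\<And>z. z \<in> S \<Longrightarrow> \<delta> \<le> \<Phi> z"
  proof (cases "S = {}")
    case False
    then obtain z0 where "z0 \<in> S" "\<And>z. z \<in> S \<Longrightarrow> \<Phi> z0 \<le> \<Phi> z"
      using continuous_attains_inf[OF \<open>compact S\<close> False continuous_on_subset[OF cont\<Phi>]] by auto
    then show ?thesis using that pos by blast
  qed (use that[of 1] in auto)
  have \<Phi>0: "\<Phi> z \<ge> 0" for z
    using norm_powr_strict_midpoint[OF p, of "fst z" "snd z"]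
    by (cases "fst z = snd z") (auto simp: \<Phi>_def N_def scaleR_2[symmetric])
  \<comment> \<open>In the remaining case the distance term is at most
    \<open>2 powr p * N (a, b)\<close>, and rescaling the pair into \<open>S\<close> gives
    \<open>\<delta> * N (a, b) \<le> \<Phi> (a, b)\<close>.\<close>
  define K where "K = 2 powr p / \<delta>"
  have K: "K > 0" using \<delta> by (simp add: K_def)
  have "norm (a - b) powr p \<le> \<epsilon> * N (a, b) + K * \<Phi> (a, b)" for a b :: 'a
  proof (cases "norm (a - b) powr p \<le> \<epsilon> * N (a, b)")
    case True
    then show ?thesis using \<Phi>0[of "(a, b)"] K by (simp add: add_increasing2)
  next
    case False
    define t where "t = N (a, b) powr (1 / p)"
    have "N (a, b) \<noteq> 0"
    proof
      assume "N (a, b) = 0"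
      then have "norm a powr p = 0" "norm b powr p = 0" unfolding N_def
        by (auto simp: add_nonneg_eq_0_iff)
      then show False using False by (simp add: N_def)
    qed
    moreover have "N (a, b) \<ge> 0" by (simp add: N_def)
    ultimately have N0: "N (a, b) > 0" by simp
    then have t: "t > 0" "t powr p = N (a, b)" using p by (auto simp: t_def powr_powr)
    have sc: "norm ((1 / t) *\<^sub>R z) powr p = norm z powr p / N (a, b)" for z :: 'a
      using t by (simp add: powr_divide)
    have eqN: "N ((1 / t) *\<^sub>R a, (1 / t) *\<^sub>R b) = 1"
    proof -
      have "N ((1 / t) *\<^sub>R a, (1 / t) *\<^sub>R b) = norm a powr p / N (a, b) + norm b powr p / N (a, b)"
        using sc[of a] sc[of b] by (simp add: N_def)
      also have "\<dots> = N (a, b) / N (a, b)" by (simp only: N_def fst_conv snd_conv add_divide_distrib)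
      finally show ?thesis using N0 by simp
    qed
    have eqD: "norm ((1 / t) *\<^sub>R a - (1 / t) *\<^sub>R b) powr p = norm (a - b) powr p / N (a, b)"
      using sc[of "a - b"] by (simp add: scaleR_diff_right)
    have eqM: "norm ((1 / 2) *\<^sub>R ((1 / t) *\<^sub>R a + (1 / t) *\<^sub>R b)) powr p = norm ((1 / 2) *\<^sub>R (a + b)) powr p / N (a, b)"
      using sc[of "(1 / 2) *\<^sub>R (a + b)"] by (simp add: scaleR_add_right mult.commute)
    have "((1 / t) *\<^sub>R a, (1 / t) *\<^sub>R b) \<in> S"
      using False N0 unfolding S_def mem_Collect_eq fst_conv snd_conv eqN eqD by (simp add: field_simps)
    from \<delta>(2)[OF this] have "\<delta> * N (a, b) \<le> \<Phi> (a, b)"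
      unfolding \<Phi>_def fst_conv snd_conv eqN eqM using N0 by (simp add: field_simps)
    then have "2 powr p * N (a, b) \<le> K * \<Phi> (a, b)"
      using \<delta>(1) by (simp add: K_def field_simps)
    moreover have "norm (a - b) powr p \<le> 2 powr p * N (a, b)"
      using norm_add_powr_le[of p a "- b"] p by (simp add: N_def)
    moreover have "\<epsilon> * N (a, b) \<ge> 0" using \<epsilon> N0 by simp
    ultimately show ?thesis by linarith
  qed
  then show ?thesis using K unfolding N_def \<Phi>_def by auto
qed

text \<open>The pointwise inequality is integrated. The order of choices matters:
  \<open>\<epsilon>\<close> comes first, since \<open>K\<close> depends on it; then the midpoint
  defect, at most \<open>2 * d\<close>, is made small compared with \<open>1 / K\<close>.\<close>

lemma Lp_uniform_convexity:
  fixes F :: "nat \<Rightarrow> real^'n \<Rightarrow> 'b::euclidean_space"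
  assumes F: "\<And>n. in_Lp \<Omega> p (F n)" and p: "p > 1" and lim: "(\<lambda>n. Lp_norm \<Omega> p (F n) powr p) \<longlonglongrightarrow> L"
    and mid: "\<And>e. e > 0 \<Longrightarrow> \<exists>N. \<forall>i\<ge>N. \<forall>j\<ge>N. Lp_norm \<Omega> p (\<lambda>x. (1 / 2) *\<^sub>R (F i x + F j x)) powr p \<ge> L - e"
    and e: "e > 0"
  shows "\<exists>N. \<forall>i\<ge>N. \<forall>j\<ge>N. Lp_norm \<Omega> p (\<lambda>x. F i x - F j x) < e"
proof -
  define P where "P f = (\<integral>x. norm (f x) powr p \<partial>lebesgue_on \<Omega>)" for f :: "real^'n \<Rightarrow> 'b"
  have P: "Lp_norm \<Omega> p f powr p = P f" for f :: "real^'n \<Rightarrow> 'b"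
    unfolding P_def using p by (intro Lp_norm_powr) auto
  have L0: "L \<ge> 0" by (rule LIMSEQ_le_const[OF lim]) auto
  define \<epsilon> where "\<epsilon> = e powr p / (8 * (L + 1))"
  have \<epsilon>: "\<epsilon> > 0" using e L0 by (simp add: \<epsilon>_def add_nonneg_pos)
  obtain K where K: "K > 0" "\<And>a b :: 'b. norm (a - b) powr p \<le> \<epsilon> * (norm a powr p + norm b powr p)
    + K * ((norm a powr p + norm b powr p) / 2 - norm ((1 / 2) *\<^sub>R (a + b)) powr p)"
    using soft_uniform_convexity[OF p \<epsilon>] by blast
  define d where "d = min 1 (e powr p / (8 * K))"
  have d: "d > 0" using e K by (simp add: d_def)
  obtain N1 where N1: "\<And>n. n \<ge> N1 \<Longrightarrow> \<bar>P (F n) - L\<bar> < d"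
    using LIMSEQ_D[OF lim d] unfolding P by auto
  obtain N2 where N2: "\<And>i j. i \<ge> N2 \<Longrightarrow> j \<ge> N2 \<Longrightarrow> P (\<lambda>x. (1 / 2) *\<^sub>R (F i x + F j x)) \<ge> L - d"
    using mid[OF d] unfolding P by blast
  have "Lp_norm \<Omega> p (\<lambda>x. F i x - F j x) < e" if ij: "i \<ge> max N1 N2" "j \<ge> max N1 N2" for i j
  proof -
    have int: "integrable (lebesgue_on \<Omega>) (\<lambda>x. norm (F i x) powr p)" "integrable (lebesgue_on \<Omega>) (\<lambda>x. norm (F j x) powr p)"
      "integrable (lebesgue_on \<Omega>) (\<lambda>x. norm (F i x - F j x) powr p)"
      "integrable (lebesgue_on \<Omega>) (\<lambda>x. norm ((1 / 2) *\<^sub>R (F i x + F j x)) powr p)"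
      using F[of i] F[of j] in_Lp_diff[OF F[of i] F[of j]] in_Lp_scaleR[OF in_Lp_add[OF F[of i] F[of j]], of "1 / 2"] p
      unfolding in_Lp_def by auto
    have "P (\<lambda>x. F i x - F j x) \<le> (\<integral>x. \<epsilon> * (norm (F i x) powr p + norm (F j x) powr p)
      + K * ((norm (F i x) powr p + norm (F j x) powr p) / 2 - norm ((1 / 2) *\<^sub>R (F i x + F j x)) powr p) \<partial>lebesgue_on \<Omega>)"
      unfolding P_def
    proof (rule integral_mono)
      show "integrable (lebesgue_on \<Omega>) (\<lambda>x. \<epsilon> * (norm (F i x) powr p + norm (F j x) powr p)
        + K * ((norm (F i x) powr p + norm (F j x) powr p) / 2 - norm ((1 / 2) *\<^sub>R (F i x + F j x)) powr p))"
        by (intro Bochner_Integration.integrable_add Bochner_Integration.integrable_diff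
            integrable_mult_right integrable_divide int)
    qed (use int K in auto)
    also have "\<dots> = \<epsilon> * (P (F i) + P (F j)) + K * ((P (F i) + P (F j)) / 2 - P (\<lambda>x. (1 / 2) *\<^sub>R (F i x + F j x)))"
      unfolding P_def using int by (simp del: norm_scaleR)
    also have "\<dots> \<le> \<epsilon> * (2 * (L + 1)) + K * (2 * d)"
    proof -
      have b: "P (F i) < L + d" "P (F j) < L + d" "d \<le> 1" using N1[of i] N1[of j] ij by (auto simp: d_def)
      have m: "P (\<lambda>x. (1 / 2) *\<^sub>R (F i x + F j x)) \<ge> L - d" using N2 ij by simp
      have arith: "u + v \<le> 2 * (L + 1) \<and> (u + v) / 2 - w \<le> 2 * d"
        if "u < L + d" "v < L + d" "d \<le> 1" "w \<ge> L - d" for u v w :: real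
        using that by argo
      from arith[OF b m] have "P (F i) + P (F j) \<le> 2 * (L + 1)"
        "(P (F i) + P (F j)) / 2 - P (\<lambda>x. (1 / 2) *\<^sub>R (F i x + F j x)) \<le> 2 * d" by blast+
      then show ?thesis using \<epsilon> K(1) by (intro add_mono mult_left_mono) auto
    qed
    also have "\<dots> \<le> e powr p / 4 + e powr p / 4"
    proof (intro add_mono)
      show "\<epsilon> * (2 * (L + 1)) \<le> e powr p / 4" using L0 by (simp add: \<epsilon>_def field_simps)
      have "K * (2 * d) \<le> K * (2 * (e powr p / (8 * K)))"
        using K by (intro mult_left_mono) (auto simp: d_def)
      then show "K * (2 * d) \<le> e powr p / 4" using K by simp
    qed
    also have "\<dots> < e powr p" using e by simp
    finally have lt: "Lp_norm \<Omega> p (\<lambda>x. F i x - F j x) powr p < e powr p" unfolding P .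
    show ?thesis
    proof (rule ccontr)
      assume "\<not> Lp_norm \<Omega> p (\<lambda>x. F i x - F j x) < e"
      then have "e powr p \<le> Lp_norm \<Omega> p (\<lambda>x. F i x - F j x) powr p"
        using e p by (intro powr_mono2) auto
      with lt show False by simp
    qed
  qed
  then show ?thesis by blast
qed

section \<open>Differentiation of power integrals\<close>

lemma powr_diff_le:
  fixes x y p :: real
  assumes "p \<ge> 1" "0 \<le> x" "x \<le> c" "0 \<le> y" "y \<le> c"
  shows "\<bar>x powr p - y powr p\<bar> \<le> p * c powr (p - 1) * \<bar>x - y\<bar>"
proof -
  have *: "\<bar>x powr p - y powr p\<bar> \<le> p * c powr (p - 1) * \<bar>x - y\<bar>" if "0 \<le> y" "y < x" "x \<le> c" for x y :: real
  proof -
    have "x powr p - y powr p \<le> p * x powr (p - 1) * (x - y)"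
      using powr_tangent_le[of p y x] that assms(1) by (simp add: algebra_simps)
    also have "\<dots> \<le> p * c powr (p - 1) * (x - y)"
      using that assms(1) by (intro mult_right_mono mult_left_mono powr_mono2) auto
    finally show ?thesis using that assms(1) powr_mono2[of p y x] by simp
  qed
  consider "x = y" | "y < x" | "x < y" by linarith
  then show ?thesis
    using *[of y x] *[of x y] assms by cases (auto simp: abs_minus_commute)
qed

text \<open>At \<open>a = 0\<close> the function is \<open>\<bar>t\<bar> powr p\<close> times a
  constant, differentiable because \<open>p > 1\<close>, and the formula gives 0 there since
  \<open>a \<bullet> b = 0\<close>, whatever the sign of \<open>p - 2\<close>. Elsewhere the norm is
  a power of the smooth function \<open>a \<bullet> a\<close>.\<close>

lemma norm_line_powr_derivative:
  fixes a b :: "'a::real_inner"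
  assumes p: "p > 1"
  shows "((\<lambda>t. norm (a + t *\<^sub>R b) powr p) has_real_derivative p * (norm a powr (p - 2) * (a \<bullet> b))) (at 0)"
proof (cases "a = 0")
  case True
  have "((\<lambda>h. \<bar>h\<bar> powr (p - 1) * norm b powr p) \<longlongrightarrow> \<bar>0\<bar> powr (p - 1) * norm b powr p) (at (0::real))"
    using p by (intro tendsto_intros tendsto_powr2) (auto simp: eventually_at_filter)
  then have lim: "((\<lambda>h. \<bar>\<bar>h\<bar> powr (p - 1) * norm b powr p\<bar>) \<longlongrightarrow> 0) (at (0::real))" using p by simp
  have ev: "\<forall>\<^sub>F h in at (0::real). \<bar>(norm (a + (0 + h) *\<^sub>R b) powr p - norm (a + 0 *\<^sub>R b) powr p) / h\<bar>
      = \<bar>\<bar>h\<bar> powr (p - 1) * norm b powr p\<bar>"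
    using True p by (auto simp: eventually_at_filter powr_mult abs_mult powr_diff)
  have "((\<lambda>h. \<bar>(norm (a + (0 + h) *\<^sub>R b) powr p - norm (a + 0 *\<^sub>R b) powr p) / h\<bar>) \<longlongrightarrow> 0) (at 0)"
    using lim unfolding tendsto_cong[OF ev] .
  from tendsto_rabs_zero_cancel[OF this] show ?thesis using True by (simp add: DERIV_def)
next
  case False
  have n: "norm z powr r = (z \<bullet> z) powr (r / 2)" for z :: 'a and r
    by (simp add: norm_eq_sqrt_inner powr_half_sqrt[symmetric] powr_powr)
  have "((\<lambda>t. (a + t *\<^sub>R b) \<bullet> (a + t *\<^sub>R b)) has_real_derivative 2 * (a \<bullet> b)) (at 0)"
    by (auto intro!: derivative_eq_intros simp: has_field_derivative_def inner_commute fun_eq_iff)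
  from DERIV_powr[OF this _ DERIV_const[of "p / 2"]] False
  have "((\<lambda>t. ((a + t *\<^sub>R b) \<bullet> (a + t *\<^sub>R b)) powr (p / 2)) has_real_derivative
      (a \<bullet> a) powr (p / 2) * (2 * (a \<bullet> b) * (p / 2) / (a \<bullet> a))) (at 0)" by simp
  moreover have "(a \<bullet> a) powr (p / 2) * (2 * (a \<bullet> b) * (p / 2) / (a \<bullet> a)) = p * (norm a powr (p - 2) * (a \<bullet> b))"
    using False by (simp add: n diff_divide_distrib powr_diff)
  ultimately show ?thesis by (simp add: n)
qed

lemma Lp_integral_derivative:
  fixes a b :: "real^'n \<Rightarrow> 'b::euclidean_space"
  assumes a: "in_Lp \<Omega> p a" and b: "in_Lp \<Omega> p b" and p: "p > 1"
  shows "((\<lambda>t. \<integral>x. norm (a x + t *\<^sub>R b x) powr p \<partial>lebesgue_on \<Omega>) has_real_derivative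
    p * (\<integral>x. norm (a x) powr (p - 2) * (a x \<bullet> b x) \<partial>lebesgue_on \<Omega>)) (at 0)"
proof -
  let ?M = "lebesgue_on \<Omega>"
  have [measurable]: "a \<in> borel_measurable ?M" "b \<in> borel_measurable ?M" using a b by (auto simp: in_Lp_def)
  have int: "integrable ?M (\<lambda>x. norm (a x + t *\<^sub>R b x) powr p)" for t
    using in_Lp_add[OF a in_Lp_scaleR[OF b], of t] p by (simp add: in_Lp_def)
  have "((\<lambda>t. ((\<integral>x. norm (a x + t *\<^sub>R b x) powr p \<partial>?M) - (\<integral>x. norm (a x + 0 *\<^sub>R b x) powr p \<partial>?M)) / t) \<longlongrightarrow>
    (\<integral>x. p * (norm (a x) powr (p - 2) * (a x \<bullet> b x)) \<partial>?M)) (at 0)"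
    unfolding tendsto_at_iff_sequentially
  proof (intro allI impI)
    fix X :: "nat \<Rightarrow> real" assume X: "\<forall>i. X i \<in> UNIV - {0}" "X \<longlonglongrightarrow> 0"
    have "Bseq X" using X(2) convergent_def convergent_imp_Bseq by blast
    then obtain K where K': "K > 0" "\<forall>n. norm (X n) \<le> K" by (auto simp: Bseq_def)
    define k where "k = max 1 K"
    have k: "k \<ge> 1" "\<And>n. \<bar>X n\<bar> \<le> k" using K' by (auto simp: k_def max_def intro: order_trans)
    \<comment> \<open>A majorant of all difference quotients. With
      \<open>c = norm (a x) + k * norm (b x)\<close>, \<open>powr_diff_le\<close> bounds them by
      \<open>p * c powr (p - 1) * norm (b x)\<close>, and \<open>k \<ge> 1\<close> allows
      \<open>norm (b x)\<close> to be replaced by \<open>c\<close>. The outer norm only gives the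
      form required by \<open>in_Lp\<close>.\<close>
    define w where "w x = p * norm (norm (a x) + k * norm (b x)) powr p" for x
    have "in_Lp \<Omega> p (\<lambda>x. norm (a x) + k *\<^sub>R norm (b x))"
    proof (intro in_Lp_add in_Lp_scaleR)
      show "in_Lp \<Omega> p (\<lambda>x. norm (a x))" "in_Lp \<Omega> p (\<lambda>x. norm (b x))" using a b by (auto simp: in_Lp_def)
    qed (use p in auto)
    then have wint: "integrable ?M w" unfolding w_def by (auto simp: in_Lp_def)
    define D where "D n x = (norm (a x + X n *\<^sub>R b x) powr p - norm (a x) powr p) / X n" for n x
    have "(\<lambda>n. \<integral>x. D n x \<partial>?M) \<longlonglongrightarrow> (\<integral>x. p * (norm (a x) powr (p - 2) * (a x \<bullet> b x)) \<partial>?M)"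
    proof (rule integral_dominated_convergence[where w = w])
      show "D n \<in> borel_measurable ?M" for n unfolding D_def by measurable
      show "(\<lambda>x. p * (norm (a x) powr (p - 2) * (a x \<bullet> b x))) \<in> borel_measurable ?M" by measurable
      show "AE x in ?M. (\<lambda>n. D n x) \<longlonglongrightarrow> p * (norm (a x) powr (p - 2) * (a x \<bullet> b x))"
      proof (intro AE_I2)
        fix x
        have "((\<lambda>h. (norm (a x + (0 + h) *\<^sub>R b x) powr p - norm (a x + 0 *\<^sub>R b x) powr p) / h)
            \<longlongrightarrow> p * (norm (a x) powr (p - 2) * (a x \<bullet> b x))) (at 0)"
          using norm_line_powr_derivative[OF p, of "a x" "b x"] unfolding DERIV_def .
        then have "((\<lambda>h. (norm (a x + h *\<^sub>R b x) powr p - norm (a x) powr p) / h)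
            \<longlongrightarrow> p * (norm (a x) powr (p - 2) * (a x \<bullet> b x))) (at 0)" by simp
        moreover have "filterlim X (at 0) sequentially" using X by (simp add: filterlim_at)
        ultimately show "(\<lambda>n. D n x) \<longlonglongrightarrow> p * (norm (a x) powr (p - 2) * (a x \<bullet> b x))"
          unfolding D_def by (rule filterlim_compose)
      qed
      show "AE x in ?M. norm (D n x) \<le> w x" for n
      proof (intro AE_I2)
        fix x
        let ?c = "norm (a x) + k * norm (b x)"
        have 1: "norm (a x + X n *\<^sub>R b x) \<le> ?c"
        proof -
          have "norm (a x + X n *\<^sub>R b x) \<le> norm (a x) + \<bar>X n\<bar> * norm (b x)"
            using norm_triangle_ineq[of "a x" "X n *\<^sub>R b x"] by simp
          also have "\<dots> \<le> ?c" using k by (intro add_left_mono mult_right_mono) auto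
          finally show ?thesis .
        qed
        have 2: "norm (b x) \<le> ?c" using k mult_right_mono[of 1 k "norm (b x)"] by (simp add: add_increasing)
        have 3: "?c \<ge> 0" using k by simp
        have "\<bar>norm (a x + X n *\<^sub>R b x) powr p - norm (a x) powr p\<bar>
            \<le> p * ?c powr (p - 1) * \<bar>norm (a x + X n *\<^sub>R b x) - norm (a x)\<bar>"
          using 1 k p by (intro powr_diff_le) auto
        also have "\<dots> \<le> p * ?c powr (p - 1) * (\<bar>X n\<bar> * norm (b x))"
          using p norm_triangle_ineq3[of "a x + X n *\<^sub>R b x" "a x"] by (intro mult_left_mono) auto
        also have "\<dots> \<le> p * ?c powr (p - 1) * (\<bar>X n\<bar> * ?c)"
          using p 2 by (intro mult_left_mono) auto
        also have "\<dots> = \<bar>X n\<bar> * w x"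
        proof -
          have "?c powr p = ?c powr (p - 1) * ?c"
            using 3 by (cases "?c = 0") (auto simp: powr_diff)
          then show ?thesis using 3 by (simp add: w_def)
        qed
        finally show "norm (D n x) \<le> w x"
          using X(1) by (simp add: D_def divide_le_eq mult.commute)
      qed
    qed (use wint in auto)
    moreover have "(\<integral>x. D n x \<partial>?M) = ((\<integral>x. norm (a x + X n *\<^sub>R b x) powr p \<partial>?M) - (\<integral>x. norm (a x + 0 *\<^sub>R b x) powr p \<partial>?M)) / X n" for n
      unfolding D_def using int[of "X n"] int[of 0] by simp
    ultimately show "((\<lambda>t. ((\<integral>x. norm (a x + t *\<^sub>R b x) powr p \<partial>?M) - (\<integral>x. norm (a x + 0 *\<^sub>R b x) powr p \<partial>?M)) / t) \<circ> X)
      \<longlonglongrightarrow> (\<integral>x. p * (norm (a x) powr (p - 2) * (a x \<bullet> b x)) \<partial>?M)" by (simp add: o_def)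
  qed
  then show ?thesis by (simp add: DERIV_def)
qed

section \<open>The Sobolev space\<close>

lemma smooth_on_lincomb:
  fixes f g :: "'a::euclidean_space \<Rightarrow> real"
  assumes "smooth_on UNIV f" "smooth_on UNIV g"
  shows "smooth_on UNIV (\<lambda>x. a * f x + b * g x)"
proof -
  obtain F where F: "f \<in> F" "\<And>h x. h \<in> F \<Longrightarrow> h differentiable at x"
    "\<And>h i. h \<in> F \<Longrightarrow> i \<in> Basis \<Longrightarrow> \<exists>k\<in>F. \<forall>x. frechet_derivative h (at x) i = k x"
    using assms(1) unfolding smooth_on_def by auto
  obtain G where G: "g \<in> G" "\<And>h x. h \<in> G \<Longrightarrow> h differentiable at x"
    "\<And>h i. h \<in> G \<Longrightarrow> i \<in> Basis \<Longrightarrow> \<exists>k\<in>G. \<forall>x. frechet_derivative h (at x) i = k x"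
    using assms(2) unfolding smooth_on_def by auto
  define H where "H = {\<lambda>x. a * f x + b * g x |f g. f \<in> F \<and> g \<in> G}"
  have D: "((\<lambda>x. a * f x + b * g x) has_derivative (\<lambda>e. a * frechet_derivative f (at x) e + b * frechet_derivative g (at x) e)) (at x)"
    if "f \<in> F" "g \<in> G" for f g x
    using F(2)[OF that(1), of x] G(2)[OF that(2), of x]
    by (intro has_derivative_add has_derivative_mult_right) (simp_all add: frechet_derivative_works)
  show ?thesis
    unfolding smooth_on_def
  proof (intro exI[of _ H] conjI ballI)
    show "(\<lambda>x. a * f x + b * g x) \<in> H" unfolding H_def using F(1) G(1) by blast
    fix h x i assume "h \<in> H"
    then obtain f' g' where h: "h = (\<lambda>x. a * f' x + b * g' x)" "f' \<in> F" "g' \<in> G" unfolding H_def by blast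
    show "h differentiable at x" using D[OF h(2,3)] unfolding h(1) differentiable_def by blast
    assume i: "i \<in> (Basis :: 'a set)"
    obtain k where k: "k \<in> F" "\<And>x. frechet_derivative f' (at x) i = k x" using F(3)[OF h(2) i] by blast
    obtain l where l: "l \<in> G" "\<And>x. frechet_derivative g' (at x) i = l x" using G(3)[OF h(3) i] by blast
    have fd: "frechet_derivative h (at x) i = a * k x + b * l x" for x
      unfolding h(1) using frechet_derivative_at[OF D[OF h(2,3), of x]] k(2) l(2) by metis
    have "(\<lambda>x. a * k x + b * l x) \<in> H" unfolding H_def using k(1) l(1) by blast
    then show "\<exists>k\<in>H. \<forall>x\<in>UNIV. frechet_derivative h (at x) i = k x"
      by (rule bexI[rotated]) (simp add: fd)
  qed
qed

lemma test_fun_lincomb: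
  assumes "test_fun \<Omega> \<phi>" "test_fun \<Omega> \<psi>"
  shows "test_fun \<Omega> (\<lambda>x. a * \<phi> x + b * \<psi> x)"
proof -
  let ?S = "closure {x. \<phi> x \<noteq> 0} \<union> closure {x. \<psi> x \<noteq> 0}"
  have c: "compact ?S" "?S \<subseteq> \<Omega>" using assms unfolding test_fun_def by auto
  have "{x. a * \<phi> x + b * \<psi> x \<noteq> 0} \<subseteq> {x. \<phi> x \<noteq> 0} \<union> {x. \<psi> x \<noteq> 0}" by auto
  also have "\<dots> \<subseteq> ?S" by (intro Un_mono closure_subset)
  finally have sub: "closure {x. a * \<phi> x + b * \<psi> x \<noteq> 0} \<subseteq> ?S"
    by (rule closure_minimal) (rule compact_imp_closed[OF c(1)])
  have "compact (closure {x. a * \<phi> x + b * \<psi> x \<noteq> 0})"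
    using compact_Int_closed[OF c(1) closed_closure, of "{x. a * \<phi> x + b * \<psi> x \<noteq> 0}"] sub
    by (simp add: Int_absorb1)
  then show ?thesis
    using assms sub c(2) unfolding test_fun_def by (auto intro: smooth_on_lincomb)
qed

lemma vec_nth_measurable [measurable]:
  fixes F :: "'a \<Rightarrow> real^'n"
  assumes "F \<in> borel_measurable N"
  shows "(\<lambda>x. F x $ j) \<in> borel_measurable N"
  unfolding cart_eq_inner_axis using assms by measurable

text \<open>A threshold argument in place of Hoelder's inequality. Over a set of finite measure, a
  small \<open>\<eta>\<close> followed by a small \<open>s\<close>-norm makes the
  \<open>t\<close>-norm small.\<close>

lemma powr_embed:
  fixes y \<eta> t s :: real
  assumes "0 < t" "t \<le> s" "0 \<le> y" "0 < \<eta>"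
  shows "y powr t \<le> \<eta> powr t + \<eta> powr (t - s) * y powr s"
proof (cases "y \<le> \<eta>")
  case True
  then have "y powr t \<le> \<eta> powr t" using assms by (intro powr_mono2) auto
  then show ?thesis by (simp add: add_increasing2)
next
  case False
  have "y powr t = y powr (t - s) * y powr s" using False assms by (simp flip: powr_add)
  also have "\<dots> \<le> \<eta> powr (t - s) * y powr s"
    using False assms by (intro mult_right_mono powr_mono2') auto
  finally show ?thesis by (simp add: add_increasing)
qed

locale dirichlet = horizontal_basis gmul V m e \<sigma> B
  for gmul :: "real^'a \<Rightarrow> real^'a \<Rightarrow> real^'a" (infixl "\<odot>" 70) and V m and e :: "'a::finite \<Rightarrow> real^'a" and \<sigma>
    and B :: "'k::finite \<Rightarrow> real^'a" +
  fixes \<Omega> :: "(real^'a) set" and p :: real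
  assumes \<Omega>: "open \<Omega>" "bounded \<Omega>" and p: "1 < p" "p < real (hom_dim V m)"
begin

abbreviation "M \<equiv> lebesgue_on \<Omega>"
abbreviation "W \<equiv> W0 gmul B \<Omega> p"
abbreviation "D \<equiv> whgrad gmul B \<Omega>"

lemma \<Omega>_sets: "\<Omega> \<in> sets lebesgue" "\<Omega> \<inter> space lebesgue \<in> sets lebesgue"
  using \<Omega> by (simp_all add: borel_open sets_completionI_sets)

lemma finite_M: "finite_measure M"
proof
  have "emeasure M (space M) = emeasure lborel \<Omega>"
    using \<Omega> \<Omega>_sets by (simp add: emeasure_restrict_space space_restrict_space borel_open)
  then show "emeasure M (space M) \<noteq> \<infinity>" using emeasure_bounded_finite[OF \<Omega>(2)] by simp
qed

definition vol :: real where "vol = measure M (space M)"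

lemma vol: "vol \<ge> 0" "emeasure M (space M) = ennreal vol"
  using finite_measure.emeasure_eq_measure[OF finite_M] by (simp_all add: vol_def)

lemma continuous_measurable_M:
  fixes f :: "real^'a \<Rightarrow> 'b::euclidean_space"
  assumes "continuous_on UNIV f"
  shows "f \<in> borel_measurable M"
proof -
  have "f \<in> borel_measurable lborel" using assms by (simp add: borel_measurable_continuous_onI)
  then show ?thesis by (intro measurable_restrict_space1 measurable_completion)
qed

lemma continuous_bounded_\<Omega>:
  fixes f :: "real^'a \<Rightarrow> 'b::euclidean_space"
  assumes "continuous_on UNIV f"
  shows "\<exists>b\<ge>0. \<forall>x\<in>\<Omega>. norm (f x) \<le> b"
proof -
  have "compact (f ` closure \<Omega>)"
    using \<Omega> by (intro compact_continuous_image continuous_on_subset[OF assms]) (auto simp: compact_closure)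
  then obtain b where b: "b > 0" "\<forall>y\<in>f ` closure \<Omega>. norm y \<le> b"
    using compact_imp_bounded bounded_pos by metis
  have "norm (f x) \<le> b" if "x \<in> \<Omega>" for x
    using b(2) closure_subset that by (meson image_eqI subsetD)
  with b(1) show ?thesis by (intro exI[of _ b]) auto
qed

lemma nn_integral_M:
  assumes "f \<in> borel_measurable borel" "\<And>x. x \<notin> \<Omega> \<Longrightarrow> f x = 0"
  shows "(\<integral>\<^sup>+x. f x \<partial>M) = (\<integral>\<^sup>+x. f x \<partial>lborel)"
proof -
  have "(\<integral>\<^sup>+x. f x \<partial>M) = (\<integral>\<^sup>+x. f x * indicator \<Omega> x \<partial>lebesgue)"
    using \<Omega>_sets by (intro nn_integral_restrict_space)
  also have "(\<lambda>x. f x * indicator \<Omega> x) = f" using assms(2) by (auto split: split_indicator)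
  also have "(\<integral>\<^sup>+x. f x \<partial>lebesgue) = (\<integral>\<^sup>+x. f x \<partial>lborel)"
    by (rule nn_integral_completion)
  finally show ?thesis .
qed

lemma in_Lp_continuous:
  fixes f :: "real^'a \<Rightarrow> 'b::euclidean_space"
  assumes "continuous_on UNIV f" "s > 0"
  shows "in_Lp \<Omega> s f"
proof -
  have [measurable]: "f \<in> borel_measurable M" by (rule continuous_measurable_M[OF assms(1)])
  obtain b where b: "b \<ge> 0" "\<forall>x\<in>\<Omega>. norm (f x) \<le> b" using continuous_bounded_\<Omega>[OF assms(1)] by blast
  have "integrable M (\<lambda>x. norm (f x) powr s)"
  proof (rule finite_measure.integrable_const_bound[OF finite_M, where B = "b powr s"])
    show "AE x in M. norm (norm (f x) powr s) \<le> b powr s"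
      using b assms(2) by (intro AE_I2) (auto intro!: powr_mono2)
  qed measurable
  then show ?thesis by (simp add: in_Lp_def)
qed

lemma in_Lp_test: "test_fun \<Omega> \<phi> \<Longrightarrow> s > 0 \<Longrightarrow> in_Lp \<Omega> s \<phi>"
  and in_Lp_grad: "test_fun \<Omega> \<phi> \<Longrightarrow> s > 0 \<Longrightarrow> in_Lp \<Omega> s (grad \<phi>)"
  by (auto intro!: in_Lp_continuous C2_continuous continuous_hgrad test_fun_C2)

lemma Lp_embed:
  assumes "0 < t" "t \<le> s" "in_Lp \<Omega> s f"
  shows "in_Lp \<Omega> t f"
    and "\<eta> > 0 \<Longrightarrow> Lp_norm \<Omega> t f powr t \<le> \<eta> powr t * vol + \<eta> powr (t - s) * Lp_norm \<Omega> s f powr s"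
proof -
  have [measurable]: "f \<in> borel_measurable M" and int: "integrable M (\<lambda>x. norm (f x) powr s)"
    using assms(3) by (auto simp: in_Lp_def)
  have int2: "integrable M (\<lambda>x. \<eta> powr t + \<eta> powr (t - s) * norm (f x) powr s)" for \<eta>
    by (intro Bochner_Integration.integrable_add integrable_mult_right int finite_measure.integrable_const[OF finite_M])
  show t: "in_Lp \<Omega> t f"
  proof -
    have "integrable M (\<lambda>x. norm (f x) powr t)"
    proof (rule Bochner_Integration.integrable_bound[OF int2[of 1]])
      have "norm (norm (f x) powr t) \<le> norm (1 powr t + 1 powr (t - s) * norm (f x) powr s)" for x
        using powr_embed[OF assms(1,2), of "norm (f x)" 1] by simp
      then show "AE x in M. norm (norm (f x) powr t) \<le> norm (1 powr t + 1 powr (t - s) * norm (f x) powr s)"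
        by (intro AE_I2)
    qed measurable
    then show ?thesis by (simp add: in_Lp_def)
  qed
  assume \<eta>: "\<eta> > 0"
  have "Lp_norm \<Omega> t f powr t \<le> (\<integral>x. \<eta> powr t + \<eta> powr (t - s) * norm (f x) powr s \<partial>M)"
    unfolding Lp_norm_powr[OF assms(1)] using t powr_embed[OF assms(1,2) _ \<eta>]
    by (intro integral_mono int2) (auto simp: in_Lp_def)
  also have "\<dots> = \<eta> powr t * vol + \<eta> powr (t - s) * Lp_norm \<Omega> s f powr s"
  proof -
    have "(\<integral>x. \<eta> powr t + \<eta> powr (t - s) * norm (f x) powr s \<partial>M)
        = (\<integral>x. \<eta> powr t \<partial>M) + (\<integral>x. \<eta> powr (t - s) * norm (f x) powr s \<partial>M)"
      by (intro Bochner_Integration.integral_add integrable_mult_right int finite_measure.integrable_const[OF finite_M])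
    then show ?thesis using assms(1,2) by (simp add: Lp_norm_powr vol_def mult.commute)
  qed
  finally show "Lp_norm \<Omega> t f powr t \<le> \<eta> powr t * vol + \<eta> powr (t - s) * Lp_norm \<Omega> s f powr s" .
qed

lemma Lp_embed_tendsto:
  assumes t: "0 < t" "t \<le> s" and f: "\<And>n. in_Lp \<Omega> s (f n)" and lim: "(\<lambda>n. Lp_norm \<Omega> s (f n)) \<longlonglongrightarrow> 0"
  shows "(\<lambda>n. Lp_norm \<Omega> t (f n)) \<longlonglongrightarrow> 0"
proof (rule LIMSEQ_I)
  fix e :: real assume e: "e > 0"
  define \<eta> where "\<eta> = (e powr t / (2 * (vol + 1))) powr (1 / t)"
  have \<eta>: "\<eta> > 0" "\<eta> powr t = e powr t / (2 * (vol + 1))"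
    using e vol(1) t by (simp_all add: \<eta>_def powr_powr add_nonneg_pos)
  have small: "\<eta> powr t * vol < e powr t / 2 * 1"
  proof -
    have "\<eta> powr t * vol = e powr t / 2 * (vol / (vol + 1))" using vol(1) by (simp add: \<eta>(2) field_simps)
    also have "\<dots> < e powr t / 2 * 1" using e vol(1) by (intro mult_strict_left_mono) auto
    finally show ?thesis .
  qed
  have "(\<lambda>n. \<eta> powr (t - s) * Lp_norm \<Omega> s (f n) powr s) \<longlonglongrightarrow> \<eta> powr (t - s) * 0 powr s"
    using t by (intro tendsto_intros tendsto_powr2 lim) auto
  then have "\<forall>\<^sub>F n in sequentially. \<eta> powr (t - s) * Lp_norm \<Omega> s (f n) powr s < e powr t / 2"
    using e by (intro order_tendstoD(2)) auto
  then obtain N where N: "\<And>n. n \<ge> N \<Longrightarrow> \<eta> powr (t - s) * Lp_norm \<Omega> s (f n) powr s < e powr t / 2"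
    by (auto simp: eventually_sequentially)
  have "norm (Lp_norm \<Omega> t (f n) - 0) < e" if "n \<ge> N" for n
  proof (rule ccontr)
    assume "\<not> norm (Lp_norm \<Omega> t (f n) - 0) < e"
    then have "e powr t \<le> Lp_norm \<Omega> t (f n) powr t" using e t by (intro powr_mono2) auto
    then show False using Lp_embed(2)[OF t f \<eta>(1), of n] N[OF that] small by linarith
  qed
  then show "\<exists>N. \<forall>n\<ge>N. norm (Lp_norm \<Omega> t (f n) - 0) < e" by blast
qed

lemma Lp_norm_1: "Lp_norm \<Omega> 1 f = (\<integral>x. norm (f x) \<partial>M)"
  by (simp add: Lp_norm_def)

lemma in_L1: "in_Lp \<Omega> 1 f \<longleftrightarrow> integrable M f"
  by (auto simp: in_Lp_def integrable_norm_iff)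

lemma Lp_norm_mono:
  assumes "in_Lp \<Omega> s f" "g \<in> borel_measurable M" "s > 0" "\<And>x. x \<in> \<Omega> \<Longrightarrow> norm (g x) \<le> norm (f x)"
  shows "Lp_norm \<Omega> s g \<le> Lp_norm \<Omega> s f"
proof -
  have "(\<integral>x. norm (g x) powr s \<partial>M) \<le> (\<integral>x. norm (f x) powr s \<partial>M)"
    using assms in_Lp_bound[OF assms(1,2,3,4)]
    by (intro integral_mono) (auto simp: in_Lp_def intro!: powr_mono2)
  then show ?thesis unfolding Lp_norm_def using assms(3) by (intro powr_mono2) auto
qed

lemma integrable_mult_bounded:
  fixes f h :: "real^'a \<Rightarrow> real"
  assumes "in_Lp \<Omega> p f" "continuous_on UNIV h"
  shows "integrable M (\<lambda>x. f x * h x)"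
proof -
  obtain b where b: "b \<ge> 0" "\<forall>x\<in>\<Omega>. norm (h x) \<le> b" using continuous_bounded_\<Omega>[OF assms(2)] by blast
  have f: "integrable M f" using Lp_embed(1)[of 1 p f] assms(1) p by (simp add: in_L1)
  have [measurable]: "h \<in> borel_measurable M" by (rule continuous_measurable_M[OF assms(2)])
  show ?thesis
  proof (rule Bochner_Integration.integrable_bound[OF integrable_mult_right[OF f, of b]])
    show "AE x in M. norm (f x * h x) \<le> norm (b * f x)"
    proof (rule AE_I2)
      fix x assume "x \<in> space M"
      then have "\<bar>h x\<bar> \<le> b" using b(2) by simp
      then have "\<bar>f x\<bar> * \<bar>h x\<bar> \<le> \<bar>f x\<bar> * b" by (intro mult_left_mono) auto
      then show "norm (f x * h x) \<le> norm (b * f x)" using b(1) by (simp add: abs_mult mult.commute)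
    qed
  qed (use f in measurable)
qed

lemma integral_mult_tendsto:
  fixes f :: "nat \<Rightarrow> real^'a \<Rightarrow> real"
  assumes f: "\<And>n. in_Lp \<Omega> p (f n)" and g: "in_Lp \<Omega> p g" and h: "continuous_on UNIV h"
    and lim: "(\<lambda>n. Lp_norm \<Omega> p (\<lambda>x. f n x - g x)) \<longlonglongrightarrow> 0"
  shows "(\<lambda>n. \<integral>x. f n x * h x \<partial>M) \<longlonglongrightarrow> (\<integral>x. g x * h x \<partial>M)"
proof -
  obtain b where b: "b \<ge> 0" "\<forall>x\<in>\<Omega>. norm (h x) \<le> b" using continuous_bounded_\<Omega>[OF h] by blast
  have d: "in_Lp \<Omega> p (\<lambda>x. f n x - g x)" for n using f g p by (intro in_Lp_diff) auto
  then have di: "integrable M (\<lambda>x. f n x - g x)" for n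
    using Lp_embed(1)[of 1 p "\<lambda>x. f n x - g x"] p by (simp add: in_L1)
  have "(\<lambda>n. b * Lp_norm \<Omega> 1 (\<lambda>x. f n x - g x)) \<longlonglongrightarrow> b * 0"
    using p by (intro tendsto_intros Lp_embed_tendsto[OF _ _ d lim]) auto
  then have lim0: "(\<lambda>n. b * Lp_norm \<Omega> 1 (\<lambda>x. f n x - g x)) \<longlonglongrightarrow> 0" by simp
  have "norm ((\<integral>x. f n x * h x \<partial>M) - (\<integral>x. g x * h x \<partial>M)) \<le> b * Lp_norm \<Omega> 1 (\<lambda>x. f n x - g x)" for n
  proof -
    have "(\<integral>x. f n x * h x \<partial>M) - (\<integral>x. g x * h x \<partial>M) = (\<integral>x. (f n x - g x) * h x \<partial>M)"
      using integrable_mult_bounded[OF f h] integrable_mult_bounded[OF g h] by (simp add: left_diff_distrib)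
    also have "norm \<dots> \<le> (\<integral>x. norm ((f n x - g x) * h x) \<partial>M)" by (rule integral_norm_bound)
    also have "\<dots> \<le> (\<integral>x. b * norm (f n x - g x) \<partial>M)"
    proof (rule integral_mono)
      show "integrable M (\<lambda>x. norm ((f n x - g x) * h x))"
        by (intro integrable_norm integrable_mult_bounded d h)
      show "integrable M (\<lambda>x. b * norm (f n x - g x))" using di by simp
      fix x assume "x \<in> space M"
      then have "\<bar>h x\<bar> \<le> b" using b(2) by simp
      then have "\<bar>f n x - g x\<bar> * \<bar>h x\<bar> \<le> \<bar>f n x - g x\<bar> * b" by (intro mult_left_mono) auto
      then show "norm ((f n x - g x) * h x) \<le> b * norm (f n x - g x)" by (simp add: abs_mult mult.commute)
    qed
    also have "\<dots> = b * Lp_norm \<Omega> 1 (\<lambda>x. f n x - g x)" by (simp add: Lp_norm_1)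
    finally show ?thesis .
  qed
  then have "(\<lambda>n. (\<integral>x. f n x * h x \<partial>M) - (\<integral>x. g x * h x \<partial>M)) \<longlonglongrightarrow> 0"
    by (intro Lim_null_comparison[OF always_eventually lim0]) auto
  then show ?thesis by (simp add: LIM_zero_iff)
qed

lemma weak_hgrad_unique:
  assumes "weak_hgrad gmul B \<Omega> u G" "weak_hgrad gmul B \<Omega> u H"
  shows "AE x in M. G x = H x"
proof -
  have "AE x in M. G x $ j - H x $ j = 0" for j
  proof (rule AE_zero_if_test_integrals_zero[OF \<Omega>(1)])
    fix \<phi> assume t: "test_fun \<Omega> \<phi>"
    have "integrable M (\<lambda>x. G x $ j * \<phi> x)" "integrable M (\<lambda>x. H x $ j * \<phi> x)"
      "(\<integral>x. G x $ j * \<phi> x \<partial>M) = (\<integral>x. H x $ j * \<phi> x \<partial>M)"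
      using assms t unfolding weak_hgrad_def by auto
    then show "integrable M (\<lambda>x. (G x $ j - H x $ j) * \<phi> x)" "(\<integral>x. (G x $ j - H x $ j) * \<phi> x \<partial>M) = 0"
      by (simp_all add: left_diff_distrib)
  qed
  then have "AE x in M. \<forall>j. G x $ j - H x $ j = 0" by (simp add: AE_all_countable)
  then show ?thesis by eventually_elim (simp add: vec_eq_iff)
qed

text \<open>\<open>D u\<close> is obtained by choice, so every computation with it passes through
  some explicit weak gradient and holds only almost everywhere.\<close>

lemma whgrad_eqI:
  assumes "weak_hgrad gmul B \<Omega> u G"
  shows "weak_hgrad gmul B \<Omega> u (D u)" "AE x in M. D u x = G x"
proof -
  show "weak_hgrad gmul B \<Omega> u (D u)" unfolding whgrad_def by (rule someI[of "weak_hgrad gmul B \<Omega> u" G, OF assms])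
  from weak_hgrad_unique[OF this assms] show "AE x in M. D u x = G x" .
qed

lemma W_intro:
  assumes "weak_hgrad gmul B \<Omega> u G" "in_Lp \<Omega> p u" "in_Lp \<Omega> p G" "\<And>k. test_fun \<Omega> (\<phi> k)"
    "(\<lambda>k. Lp_norm \<Omega> p (\<lambda>x. \<phi> k x - u x)) \<longlonglongrightarrow> 0" "(\<lambda>k. Lp_norm \<Omega> p (\<lambda>x. grad (\<phi> k) x - G x)) \<longlonglongrightarrow> 0"
  shows "u \<in> W"
  unfolding W0_def using assms tendsto_add[OF assms(5,6)] by auto

lemma W_elim:
  assumes "u \<in> W"
  shows "weak_hgrad gmul B \<Omega> u (D u)" "in_Lp \<Omega> p u" "in_Lp \<Omega> p (D u)"
    "\<exists>\<phi>. (\<forall>k::nat. test_fun \<Omega> (\<phi> k)) \<and> (\<lambda>k. Lp_norm \<Omega> p (\<lambda>x. \<phi> k x - u x)) \<longlonglongrightarrow> 0 \<and>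
      (\<lambda>k. Lp_norm \<Omega> p (\<lambda>x. grad (\<phi> k) x - D u x)) \<longlonglongrightarrow> 0"
proof -
  obtain G \<phi> where G: "weak_hgrad gmul B \<Omega> u G" "in_Lp \<Omega> p u" "in_Lp \<Omega> p G"
    and \<phi>: "\<And>k::nat. test_fun \<Omega> (\<phi> k)"
    and lim: "(\<lambda>k. Lp_norm \<Omega> p (\<lambda>x. \<phi> k x - u x) + Lp_norm \<Omega> p (\<lambda>x. grad (\<phi> k) x - G x)) \<longlonglongrightarrow> 0"
    using assms unfolding W0_def by blast
  note w = whgrad_eqI[OF G(1)]
  show "weak_hgrad gmul B \<Omega> u (D u)" "in_Lp \<Omega> p u" by (rule w G)+
  have Dm: "D u \<in> borel_measurable M" using w(1) by (simp add: weak_hgrad_def)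
  have eq: "AE x in M. G x = D u x" using w(2) by eventually_elim simp
  show Du: "in_Lp \<Omega> p (D u)" by (rule in_Lp_cong_AE[OF eq G(3) Dm])
  have "Lp_norm \<Omega> p (\<lambda>x. grad (\<phi> k) x - D u x) = Lp_norm \<Omega> p (\<lambda>x. grad (\<phi> k) x - G x)" for k
  proof (rule Lp_norm_cong_AE)
    have "in_Lp \<Omega> p (grad (\<phi> k))" using \<phi> p by (intro in_Lp_grad) auto
    then show "(\<lambda>x. grad (\<phi> k) x - D u x) \<in> borel_measurable M" "(\<lambda>x. grad (\<phi> k) x - G x) \<in> borel_measurable M"
      using Dm G(3) by (auto simp: in_Lp_def)
    show "AE x in M. grad (\<phi> k) x - D u x = grad (\<phi> k) x - G x" using w(2) by eventually_elim simp
  qed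
  then have eqD: "(\<lambda>k. Lp_norm \<Omega> p (\<lambda>x. grad (\<phi> k) x - D u x)) = (\<lambda>k. Lp_norm \<Omega> p (\<lambda>x. grad (\<phi> k) x - G x))" by blast
  have l1: "(\<lambda>k. Lp_norm \<Omega> p (\<lambda>x. \<phi> k x - u x)) \<longlonglongrightarrow> 0"
    and l2: "(\<lambda>k. Lp_norm \<Omega> p (\<lambda>x. grad (\<phi> k) x - G x)) \<longlonglongrightarrow> 0"
    by (rule tendsto_sandwich[OF _ _ tendsto_const lim]; simp)+
  show "\<exists>\<phi>. (\<forall>k::nat. test_fun \<Omega> (\<phi> k)) \<and> (\<lambda>k. Lp_norm \<Omega> p (\<lambda>x. \<phi> k x - u x)) \<longlonglongrightarrow> 0 \<and>
      (\<lambda>k. Lp_norm \<Omega> p (\<lambda>x. grad (\<phi> k) x - D u x)) \<longlonglongrightarrow> 0"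
    by (intro exI[of _ \<phi>] conjI allI \<phi> l1 l2[folded eqD])
qed

lemma grad_lincomb:
  assumes "C2 \<phi>" "C2 \<psi>"
  shows "grad (\<lambda>x. a * \<phi> x + b * \<psi> x) x = a *\<^sub>R grad \<phi> x + b *\<^sub>R grad \<psi> x"
proof -
  have "lfield gmul w (\<lambda>x. a * \<phi> x + b * \<psi> x) x = a * lfield gmul w \<phi> x + b * lfield gmul w \<psi> x" for w
  proof -
    have D: "(\<phi> has_derivative (\<lambda>e. fdir \<phi> e x)) (at x)" "(\<psi> has_derivative (\<lambda>e. fdir \<psi> e x)) (at x)"
      by (intro has_derivative_fdir C2_differentiable assms)+
    have "((\<lambda>x. a * \<phi> x + b * \<psi> x) has_derivative (\<lambda>e. a * fdir \<phi> e x + b * fdir \<psi> e x)) (at x)"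
      by (intro has_derivative_add has_derivative_mult_right D)
    then show ?thesis by (simp add: lfield_eq[OF D(1)] lfield_eq[OF D(2)] lfield_eq)
  qed
  then show ?thesis by (simp add: hgrad_def vec_eq_iff)
qed

lemma weak_hgrad_lincomb:
  assumes "weak_hgrad gmul B \<Omega> u G" "weak_hgrad gmul B \<Omega> v H"
  shows "weak_hgrad gmul B \<Omega> (\<lambda>x. a * u x + b * v x) (\<lambda>x. a *\<^sub>R G x + b *\<^sub>R H x)"
  unfolding weak_hgrad_def
proof (intro conjI allI impI)
  show "(\<lambda>x. a *\<^sub>R G x + b *\<^sub>R H x) \<in> borel_measurable M" using assms unfolding weak_hgrad_def by auto
  fix j \<phi> assume t: "test_fun \<Omega> \<phi>"
  have i: "integrable M (\<lambda>x. u x * lfield gmul (B j) \<phi> x)" "integrable M (\<lambda>x. v x * lfield gmul (B j) \<phi> x)"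
    "integrable M (\<lambda>x. G x $ j * \<phi> x)" "integrable M (\<lambda>x. H x $ j * \<phi> x)"
    and q: "(\<integral>x. G x $ j * \<phi> x \<partial>M) = - (\<integral>x. u x * lfield gmul (B j) \<phi> x \<partial>M)"
      "(\<integral>x. H x $ j * \<phi> x \<partial>M) = - (\<integral>x. v x * lfield gmul (B j) \<phi> x \<partial>M)"
    using assms t unfolding weak_hgrad_def by auto
  have e1: "(\<lambda>x. (a * u x + b * v x) * lfield gmul (B j) \<phi> x)
      = (\<lambda>x. a * (u x * lfield gmul (B j) \<phi> x) + b * (v x * lfield gmul (B j) \<phi> x))"
    and e2: "(\<lambda>x. (a *\<^sub>R G x + b *\<^sub>R H x) $ j * \<phi> x) = (\<lambda>x. a * (G x $ j * \<phi> x) + b * (H x $ j * \<phi> x))"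
    by (auto simp: algebra_simps)
  show "integrable M (\<lambda>x. (a * u x + b * v x) * lfield gmul (B j) \<phi> x)"
    "integrable M (\<lambda>x. (a *\<^sub>R G x + b *\<^sub>R H x) $ j * \<phi> x)"
    unfolding e1 e2 by (intro Bochner_Integration.integrable_add integrable_mult_right i)+
  show "(\<integral>x. (a *\<^sub>R G x + b *\<^sub>R H x) $ j * \<phi> x \<partial>M) = - (\<integral>x. (a * u x + b * v x) * lfield gmul (B j) \<phi> x \<partial>M)"
    unfolding e1 e2 using i q by simp
qed

lemma W_lincomb:
  assumes "u \<in> W" "v \<in> W"
  shows "(\<lambda>x. a * u x + b * v x) \<in> W" "AE x in M. D (\<lambda>x. a * u x + b * v x) x = a *\<^sub>R D u x + b *\<^sub>R D v x"
proof -
  note u = W_elim[OF assms(1)] and v = W_elim[OF assms(2)]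
  have p0: "p > 0" "p \<ge> 1" using p by auto
  have w: "weak_hgrad gmul B \<Omega> (\<lambda>x. a * u x + b * v x) (\<lambda>x. a *\<^sub>R D u x + b *\<^sub>R D v x)"
    by (rule weak_hgrad_lincomb[OF u(1) v(1)])
  obtain \<phi> where \<phi>: "\<And>k::nat. test_fun \<Omega> (\<phi> k)" "(\<lambda>k. Lp_norm \<Omega> p (\<lambda>x. \<phi> k x - u x)) \<longlonglongrightarrow> 0"
    "(\<lambda>k. Lp_norm \<Omega> p (\<lambda>x. grad (\<phi> k) x - D u x)) \<longlonglongrightarrow> 0" using u(4) by blast
  obtain \<psi> where \<psi>: "\<And>k::nat. test_fun \<Omega> (\<psi> k)" "(\<lambda>k. Lp_norm \<Omega> p (\<lambda>x. \<psi> k x - v x)) \<longlonglongrightarrow> 0"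
    "(\<lambda>k. Lp_norm \<Omega> p (\<lambda>x. grad (\<psi> k) x - D v x)) \<longlonglongrightarrow> 0" using v(4) by blast
  have comb: "(\<lambda>k. Lp_norm \<Omega> p (\<lambda>x. (a *\<^sub>R f k x + b *\<^sub>R g k x) - (a *\<^sub>R F x + b *\<^sub>R G x))) \<longlonglongrightarrow> 0"
    if f: "\<And>k. in_Lp \<Omega> p (f k)" and g: "\<And>k. in_Lp \<Omega> p (g k)" and F: "in_Lp \<Omega> p F" and G: "in_Lp \<Omega> p G"
      and l1: "(\<lambda>k. Lp_norm \<Omega> p (\<lambda>x. f k x - F x)) \<longlonglongrightarrow> 0" and l2: "(\<lambda>k. Lp_norm \<Omega> p (\<lambda>x. g k x - G x)) \<longlonglongrightarrow> 0"
    for f g :: "nat \<Rightarrow> real^'a \<Rightarrow> 'c::euclidean_space" and F G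
  proof -
    have "(\<lambda>k. \<bar>a\<bar> * Lp_norm \<Omega> p (\<lambda>x. f k x - F x) + \<bar>b\<bar> * Lp_norm \<Omega> p (\<lambda>x. g k x - G x)) \<longlonglongrightarrow> \<bar>a\<bar> * 0 + \<bar>b\<bar> * 0"
      by (intro tendsto_intros l1 l2)
    then have lim: "(\<lambda>k. \<bar>a\<bar> * Lp_norm \<Omega> p (\<lambda>x. f k x - F x) + \<bar>b\<bar> * Lp_norm \<Omega> p (\<lambda>x. g k x - G x)) \<longlonglongrightarrow> 0" by simp
    have "Lp_norm \<Omega> p (\<lambda>x. (a *\<^sub>R f k x + b *\<^sub>R g k x) - (a *\<^sub>R F x + b *\<^sub>R G x))
        \<le> \<bar>a\<bar> * Lp_norm \<Omega> p (\<lambda>x. f k x - F x) + \<bar>b\<bar> * Lp_norm \<Omega> p (\<lambda>x. g k x - G x)" for k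
    proof -
      have "(\<lambda>x. (a *\<^sub>R f k x + b *\<^sub>R g k x) - (a *\<^sub>R F x + b *\<^sub>R G x))
          = (\<lambda>x. a *\<^sub>R (f k x - F x) + b *\<^sub>R (g k x - G x))" by (auto simp: algebra_simps)
      then show ?thesis
        using Minkowski[OF in_Lp_scaleR[OF in_Lp_diff[OF f F p0(1)]] in_Lp_scaleR[OF in_Lp_diff[OF g G p0(1)]] p0(2), of a k b k]
        by (simp only: Lp_norm_scaleR[OF p0(1)])
    qed
    then show ?thesis by (intro tendsto_sandwich[OF _ _ tendsto_const lim]) auto
  qed
  show "(\<lambda>x. a * u x + b * v x) \<in> W"
  proof (rule W_intro[OF w])
    show "test_fun \<Omega> (\<lambda>x. a * \<phi> k x + b * \<psi> k x)" for k by (intro test_fun_lincomb \<phi> \<psi>)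
    show "in_Lp \<Omega> p (\<lambda>x. a * u x + b * v x)"
      using in_Lp_add[OF in_Lp_scaleR[OF u(2), of a] in_Lp_scaleR[OF v(2), of b] p0(1)] by simp
    show "in_Lp \<Omega> p (\<lambda>x. a *\<^sub>R D u x + b *\<^sub>R D v x)"
      by (intro in_Lp_add in_Lp_scaleR u v p0)
    show "(\<lambda>k. Lp_norm \<Omega> p (\<lambda>x. a * \<phi> k x + b * \<psi> k x - (a * u x + b * v x))) \<longlonglongrightarrow> 0"
      using comb[of \<phi> \<psi> u v] in_Lp_test \<phi> \<psi> u v p0 by simp
    have "grad (\<lambda>x. a * \<phi> k x + b * \<psi> k x) = (\<lambda>x. a *\<^sub>R grad (\<phi> k) x + b *\<^sub>R grad (\<psi> k) x)" for k
      using grad_lincomb[OF test_fun_C2[OF \<phi>(1)] test_fun_C2[OF \<psi>(1)]] by blast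
    then show "(\<lambda>k. Lp_norm \<Omega> p (\<lambda>x. grad (\<lambda>x. a * \<phi> k x + b * \<psi> k x) x - (a *\<^sub>R D u x + b *\<^sub>R D v x))) \<longlonglongrightarrow> 0"
      using comb[of "\<lambda>k. grad (\<phi> k)" "\<lambda>k. grad (\<psi> k)" "D u" "D v"] in_Lp_grad \<phi> \<psi> u v p0 by simp
  qed
  show "AE x in M. D (\<lambda>x. a * u x + b * v x) x = a *\<^sub>R D u x + b *\<^sub>R D v x" by (rule whgrad_eqI(2)[OF w])
qed

lemma W_scale:
  assumes "u \<in> W"
  shows "(\<lambda>x. c * u x) \<in> W" "AE x in M. D (\<lambda>x. c * u x) x = c *\<^sub>R D u x"
    "Lp_norm \<Omega> p (D (\<lambda>x. c * u x)) = \<bar>c\<bar> * Lp_norm \<Omega> p (D u)"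
proof -
  show 1: "(\<lambda>x. c * u x) \<in> W" and 2: "AE x in M. D (\<lambda>x. c * u x) x = c *\<^sub>R D u x"
    using W_lincomb[OF assms assms, of c 0] by simp_all
  have "Lp_norm \<Omega> p (D (\<lambda>x. c * u x)) = Lp_norm \<Omega> p (\<lambda>x. c *\<^sub>R D u x)"
    using 2 W_elim(3)[OF 1] in_Lp_scaleR[OF W_elim(3)[OF assms], of c]
    by (intro Lp_norm_cong_AE) (auto simp: in_Lp_def)
  then show "Lp_norm \<Omega> p (D (\<lambda>x. c * u x)) = \<bar>c\<bar> * Lp_norm \<Omega> p (D u)"
    using p by (simp add: Lp_norm_scaleR)
qed

lemma W_diff:
  assumes "u \<in> W" "v \<in> W"
  shows "(\<lambda>x. u x - v x) \<in> W" "Lp_norm \<Omega> p (D (\<lambda>x. u x - v x)) = Lp_norm \<Omega> p (\<lambda>x. D u x - D v x)"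
proof -
  show 1: "(\<lambda>x. u x - v x) \<in> W" using W_lincomb(1)[OF assms, of 1 "-1"] by simp
  have "AE x in M. D (\<lambda>x. u x - v x) x = D u x - D v x" using W_lincomb(2)[OF assms, of 1 "-1"] by simp
  then show "Lp_norm \<Omega> p (D (\<lambda>x. u x - v x)) = Lp_norm \<Omega> p (\<lambda>x. D u x - D v x)"
    using W_elim(3)[OF 1] in_Lp_diff[OF W_elim(3)[OF assms(1)] W_elim(3)[OF assms(2)]] p
    by (intro Lp_norm_cong_AE) (auto simp: in_Lp_def)
qed

lemma W_approx:
  assumes "u \<in> W" "\<epsilon> > 0"
  shows "\<exists>\<phi>. test_fun \<Omega> \<phi> \<and> Lp_norm \<Omega> p (\<lambda>x. \<phi> x - u x) < \<epsilon> \<and> Lp_norm \<Omega> p (\<lambda>x. grad \<phi> x - D u x) < \<epsilon>"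
proof -
  obtain \<phi> where \<phi>: "\<And>k::nat. test_fun \<Omega> (\<phi> k)" "(\<lambda>k. Lp_norm \<Omega> p (\<lambda>x. \<phi> k x - u x)) \<longlonglongrightarrow> 0"
    "(\<lambda>k. Lp_norm \<Omega> p (\<lambda>x. grad (\<phi> k) x - D u x)) \<longlonglongrightarrow> 0" using W_elim(4)[OF assms(1)] by blast
  have "\<forall>\<^sub>F k in sequentially. Lp_norm \<Omega> p (\<lambda>x. \<phi> k x - u x) < \<epsilon> \<and> Lp_norm \<Omega> p (\<lambda>x. grad (\<phi> k) x - D u x) < \<epsilon>"
    by (intro eventually_conj order_tendstoD(2)[OF \<phi>(2) assms(2)] order_tendstoD(2)[OF \<phi>(3) assms(2)])
  then obtain k where "Lp_norm \<Omega> p (\<lambda>x. \<phi> k x - u x) < \<epsilon> \<and> Lp_norm \<Omega> p (\<lambda>x. grad (\<phi> k) x - D u x) < \<epsilon>"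
    by (rule eventually_happens'[OF sequentially_bot, THEN exE])
  with \<phi>(1) show ?thesis by blast
qed

text \<open>Weak gradients survive the limit because test functions and their derivatives are
  bounded on \<open>\<Omega>\<close>. Membership in \<open>W\<close> asks for test functions: one is
  taken within \<open>1 / real (Suc n)\<close> of each \<open>u n\<close>, in value and
  gradient.\<close>

theorem W_closed:
  assumes u: "\<And>n. u n \<in> W" and w: "in_Lp \<Omega> p w" and H: "in_Lp \<Omega> p H"
    and l1: "(\<lambda>n. Lp_norm \<Omega> p (\<lambda>x. u n x - w x)) \<longlonglongrightarrow> 0"
    and l2: "(\<lambda>n. Lp_norm \<Omega> p (\<lambda>x. D (u n) x - H x)) \<longlonglongrightarrow> 0"
  shows "w \<in> W" "AE x in M. D w x = H x"
proof -
  have p0: "p > 0" "p \<ge> 1" using p by auto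
  note uE = W_elim[OF u]
  have wk: "weak_hgrad gmul B \<Omega> w H"
    unfolding weak_hgrad_def
  proof (intro conjI allI impI)
    show Hm: "H \<in> borel_measurable M" using H by (simp add: in_Lp_def)
    fix j \<phi> assume t: "test_fun \<Omega> \<phi>"
    have c: "continuous_on UNIV \<phi>" "continuous_on UNIV (lfield gmul (B j) \<phi>)"
      by (intro C2_continuous continuous_lfield test_fun_C2[OF t])+
    have comp: "in_Lp \<Omega> p (\<lambda>x. F x $ j)" if "in_Lp \<Omega> p F" for F :: "real^'a \<Rightarrow> real^'k"
      using that p0 by (intro in_Lp_bound[OF that]) (auto simp: in_Lp_def component_le_norm_cart)
    show "integrable M (\<lambda>x. w x * lfield gmul (B j) \<phi> x)" by (intro integrable_mult_bounded w c)
    show "integrable M (\<lambda>x. H x $ j * \<phi> x)" by (intro integrable_mult_bounded comp H c)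
    have "(\<lambda>n. \<integral>x. D (u n) x $ j * \<phi> x \<partial>M) \<longlonglongrightarrow> (\<integral>x. H x $ j * \<phi> x \<partial>M)"
    proof (rule integral_mult_tendsto[OF comp[OF uE(3)] comp[OF H] c(1)])
      have "Lp_norm \<Omega> p (\<lambda>x. D (u n) x $ j - H x $ j) \<le> Lp_norm \<Omega> p (\<lambda>x. D (u n) x - H x)" for n
        using in_Lp_diff[OF uE(3) H p0(1), of n] comp[OF uE(3), of n] comp[OF H] p0
        by (intro Lp_norm_mono) (auto simp: in_Lp_def component_le_norm_cart simp flip: vector_minus_component)
      then show "(\<lambda>n. Lp_norm \<Omega> p (\<lambda>x. D (u n) x $ j - H x $ j)) \<longlonglongrightarrow> 0"
        by (intro tendsto_sandwich[OF _ _ tendsto_const l2]) auto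
    qed
    moreover have "(\<lambda>n. - (\<integral>x. u n x * lfield gmul (B j) \<phi> x \<partial>M)) \<longlonglongrightarrow> - (\<integral>x. w x * lfield gmul (B j) \<phi> x \<partial>M)"
      by (intro tendsto_minus integral_mult_tendsto[OF uE(2) w c(2) l1])
    moreover have "(\<integral>x. D (u n) x $ j * \<phi> x \<partial>M) = - (\<integral>x. u n x * lfield gmul (B j) \<phi> x \<partial>M)" for n
      using uE(1)[of n] t unfolding weak_hgrad_def by auto
    ultimately show "(\<integral>x. H x $ j * \<phi> x \<partial>M) = - (\<integral>x. w x * lfield gmul (B j) \<phi> x \<partial>M)"
      using LIMSEQ_unique by simp
  qed
  have "\<forall>n. \<exists>\<phi>. test_fun \<Omega> \<phi> \<and> Lp_norm \<Omega> p (\<lambda>x. \<phi> x - u n x) < 1 / real (Suc n) \<and>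
      Lp_norm \<Omega> p (\<lambda>x. grad \<phi> x - D (u n) x) < 1 / real (Suc n)"
    by (intro allI W_approx[OF u]) simp
  from choice[OF this] obtain \<phi> where "\<forall>n. test_fun \<Omega> (\<phi> n) \<and>
      Lp_norm \<Omega> p (\<lambda>x. \<phi> n x - u n x) < 1 / real (Suc n) \<and>
      Lp_norm \<Omega> p (\<lambda>x. grad (\<phi> n) x - D (u n) x) < 1 / real (Suc n)" ..
  then have \<phi>: "\<And>n. test_fun \<Omega> (\<phi> n)" "\<And>n. Lp_norm \<Omega> p (\<lambda>x. \<phi> n x - u n x) < 1 / real (Suc n)"
    "\<And>n. Lp_norm \<Omega> p (\<lambda>x. grad (\<phi> n) x - D (u n) x) < 1 / real (Suc n)" by blast+
  have tri: "(\<lambda>n. Lp_norm \<Omega> p (\<lambda>x. f n x - h x)) \<longlonglongrightarrow> 0"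
    if "\<And>n. in_Lp \<Omega> p (f n)" "\<And>n. in_Lp \<Omega> p (g n)" "in_Lp \<Omega> p h" "\<And>n. Lp_norm \<Omega> p (\<lambda>x. f n x - g n x) < 1 / real (Suc n)"
      "(\<lambda>n. Lp_norm \<Omega> p (\<lambda>x. g n x - h x)) \<longlonglongrightarrow> 0" for f g :: "nat \<Rightarrow> real^'a \<Rightarrow> 'c::euclidean_space" and h
  proof -
    have "(\<lambda>n. 1 / real (Suc n) + Lp_norm \<Omega> p (\<lambda>x. g n x - h x)) \<longlonglongrightarrow> 0 + 0"
      by (intro tendsto_add LIMSEQ_Suc[OF lim_1_over_n] that)
    then have lim: "(\<lambda>n. 1 / real (Suc n) + Lp_norm \<Omega> p (\<lambda>x. g n x - h x)) \<longlonglongrightarrow> 0" by simp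
    have "Lp_norm \<Omega> p (\<lambda>x. f n x - h x) \<le> 1 / real (Suc n) + Lp_norm \<Omega> p (\<lambda>x. g n x - h x)" for n
      using Lp_norm_triangle_sub[OF that(1)[of n] that(2)[of n] that(3) p0(2)] that(4)[of n] by linarith
    then show ?thesis by (intro tendsto_sandwich[OF _ _ tendsto_const lim]) auto
  qed
  show "w \<in> W"
  proof (rule W_intro[OF wk w H \<phi>(1)])
    show "(\<lambda>n. Lp_norm \<Omega> p (\<lambda>x. \<phi> n x - w x)) \<longlonglongrightarrow> 0"
      by (rule tri[OF in_Lp_test[OF \<phi>(1) p0(1)] uE(2) w \<phi>(2) l1])
    show "(\<lambda>n. Lp_norm \<Omega> p (\<lambda>x. grad (\<phi> n) x - H x)) \<longlonglongrightarrow> 0"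
      by (rule tri[OF in_Lp_grad[OF \<phi>(1) p0(1)] uE(3) H \<phi>(3) l2])
  qed
  show "AE x in M. D w x = H x" by (rule whgrad_eqI(2)[OF wk])
qed

section \<open>Subcritical compact embedding\<close>

lemma energy_eq:
  assumes "test_fun \<Omega> \<phi>"
  shows "energy p \<phi> = ennreal (Lp_norm \<Omega> p (grad \<phi>) powr p)"
proof -
  have [measurable]: "grad \<phi> \<in> borel_measurable borel" by (rule hgrad_measurable[OF test_fun_C2[OF assms]])
  have "energy p \<phi> = (\<integral>\<^sup>+x. ennreal (norm (grad \<phi> x) powr p) \<partial>M)"
    unfolding energy_def using grad_zero_outside[OF assms] p by (intro nn_integral_M[symmetric]) auto
  also have "\<dots> = ennreal (Lp_norm \<Omega> p (grad \<phi>) powr p)"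
    using p by (intro nn_integral_Lp in_Lp_grad[OF assms]) auto
  finally show ?thesis .
qed

lemma admissibleI:
  assumes "test_fun \<Omega> \<phi>" "Lp_norm \<Omega> p (grad \<phi>) \<le> 1"
  shows "admissible \<Omega> p \<phi>"
proof -
  have "Lp_norm \<Omega> p (grad \<phi>) powr p \<le> 1 powr p" using assms p by (intro powr_mono2) auto
  then show ?thesis using assms(1) energy_eq[OF assms(1)] by (simp add: admissible_def ennreal_le_1)
qed

lemma emeasure_level_test:
  assumes "test_fun \<Omega> \<phi>" "s > 0"
  shows "emeasure M {x \<in> space M. \<bar>\<phi> x\<bar> > s} = emeasure lborel {x. \<bar>\<phi> x\<bar> > s}"
proof -
  have c: "continuous_on UNIV \<phi>" by (intro C2_continuous test_fun_C2[OF assms(1)])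
  have [measurable]: "\<phi> \<in> borel_measurable borel" "\<phi> \<in> borel_measurable M"
    using borel_measurable_continuous_onI[OF c] continuous_measurable_M[OF c] by auto
  have "emeasure M {x \<in> space M. \<bar>\<phi> x\<bar> > s} = (\<integral>\<^sup>+x. indicator {x \<in> space M. \<bar>\<phi> x\<bar> > s} x \<partial>M)"
    by (rule nn_integral_indicator[symmetric]) measurable
  also have "\<dots> = (\<integral>\<^sup>+x. indicator {x. \<bar>\<phi> x\<bar> > s} x \<partial>M)"
    by (intro nn_integral_cong) (auto split: split_indicator)
  also have "\<dots> = (\<integral>\<^sup>+x. indicator {x. \<bar>\<phi> x\<bar> > s} x \<partial>lborel)"
    using test_fun_zero[OF assms(1)] assms(2) by (intro nn_integral_M) (auto split: split_indicator)
  finally show ?thesis by simp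
qed

lemma Chebyshev_Lp:
  fixes f :: "real^'a \<Rightarrow> real"
  assumes "in_Lp \<Omega> p f" "s > 0"
  shows "emeasure M {x \<in> space M. \<bar>f x\<bar> > s} \<le> ennreal (Lp_norm \<Omega> p f powr p / s powr p)"
proof -
  have [measurable]: "f \<in> borel_measurable M" using assms by (simp add: in_Lp_def)
  let ?A = "{x \<in> space M. \<bar>f x\<bar> > s}"
  have "ennreal (s powr p) * emeasure M ?A = (\<integral>\<^sup>+x. ennreal (s powr p) * indicator ?A x \<partial>M)"
    by (rule nn_integral_cmult_indicator[symmetric]) measurable
  also have "\<dots> \<le> (\<integral>\<^sup>+x. ennreal (norm (f x) powr p) \<partial>M)"
    using assms(2) p by (intro nn_integral_mono) (auto split: split_indicator intro!: ennreal_leI powr_mono2)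
  also have "\<dots> = ennreal (Lp_norm \<Omega> p f powr p)" using p by (intro nn_integral_Lp assms) auto
  finally have le: "ennreal (s powr p) * emeasure M ?A \<le> ennreal (Lp_norm \<Omega> p f powr p)" .
  have "ennreal (1 / s powr p) * ennreal (s powr p) = ennreal (1 / s powr p * s powr p)"
    by (intro ennreal_mult[symmetric]) auto
  also have "1 / s powr p * s powr p = 1" using assms(2) by simp
  finally have "emeasure M ?A = (ennreal (1 / s powr p) * ennreal (s powr p)) * emeasure M ?A" by simp
  also have "\<dots> = ennreal (1 / s powr p) * (ennreal (s powr p) * emeasure M ?A)" by (rule mult.assoc)
  also have "\<dots> \<le> ennreal (1 / s powr p) * ennreal (Lp_norm \<Omega> p f powr p)"
    using le by (rule mult_left_mono) simp
  also have "\<dots> = ennreal (1 / s powr p * Lp_norm \<Omega> p f powr p)" by (intro ennreal_mult[symmetric]) auto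
  finally show ?thesis by simp
qed

text \<open>Where \<open>\<bar>u\<bar>\<close> exceeds \<open>s\<close>, either the approximating
  test function or its distance to \<open>u\<close> exceeds \<open>s / 2\<close>; the second event
  is rare by Chebyshev. Halving the level costs the factor \<open>2 powr r\<close>, and the bound
  \<open>1 / 2\<close> on the gradient leaves room for the test function to be admissible.\<close>

lemma W_weak_type:
  assumes weak: "\<And>\<phi> s. admissible \<Omega> p \<phi> \<Longrightarrow> s > 0 \<Longrightarrow> emeasure lborel {x. \<bar>\<phi> x\<bar> > s} \<le> ennreal (A * s powr (- r))"
    and A: "A > 0" and u: "u \<in> W" "Lp_norm \<Omega> p (D u) \<le> 1 / 2" and s: "s > 0"
  shows "emeasure M {x \<in> space M. \<bar>u x\<bar> > s} \<le> ennreal (A * 2 powr r * s powr (- r))"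
proof (rule ennreal_le_epsilon)
  fix \<epsilon> :: real assume \<epsilon>: "\<epsilon> > 0"
  note uE = W_elim[OF u(1)]
  have p0: "p > 0" "p \<ge> 1" using p by auto
  define \<delta> where "\<delta> = min (1 / 2) (s / 2 * \<epsilon> powr (1 / p))"
  have \<delta>: "\<delta> > 0" using s \<epsilon> by (simp add: \<delta>_def)
  obtain \<phi> where \<phi>: "test_fun \<Omega> \<phi>" "Lp_norm \<Omega> p (\<lambda>x. \<phi> x - u x) < \<delta>" "Lp_norm \<Omega> p (\<lambda>x. grad \<phi> x - D u x) < \<delta>"
    using W_approx[OF u(1) \<delta>] by blast
  have "Lp_norm \<Omega> p (grad \<phi>) \<le> 1"
    using Lp_norm_diff_le[OF in_Lp_grad[OF \<phi>(1) p0(1)] uE(3) p0(2)] \<phi>(3) u(2) unfolding \<delta>_def by linarith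
  then have adm: "admissible \<Omega> p \<phi>" by (intro admissibleI \<phi>)
  have inD: "in_Lp \<Omega> p (\<lambda>x. \<phi> x - u x)" by (intro in_Lp_diff in_Lp_test[OF \<phi>(1)] uE p0)
  have [measurable]: "u \<in> borel_measurable M" "\<phi> \<in> borel_measurable M"
    using uE(2) in_Lp_test[OF \<phi>(1) p0(1)] by (auto simp: in_Lp_def)
  have "emeasure M {x \<in> space M. \<bar>u x\<bar> > s} \<le> emeasure M ({x \<in> space M. \<bar>\<phi> x\<bar> > s / 2} \<union> {x \<in> space M. \<bar>\<phi> x - u x\<bar> > s / 2})"
  proof (rule emeasure_mono)
    have "\<bar>\<phi> x\<bar> > s / 2 \<or> \<bar>\<phi> x - u x\<bar> > s / 2" if "\<bar>u x\<bar> > s" for x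
      using that by linarith
    then show "{x \<in> space M. \<bar>u x\<bar> > s} \<subseteq> {x \<in> space M. \<bar>\<phi> x\<bar> > s / 2} \<union> {x \<in> space M. \<bar>\<phi> x - u x\<bar> > s / 2}"
      by blast
    show "{x \<in> space M. \<bar>\<phi> x\<bar> > s / 2} \<union> {x \<in> space M. \<bar>\<phi> x - u x\<bar> > s / 2} \<in> sets M"
      by measurable
  qed
  also have "\<dots> \<le> emeasure M {x \<in> space M. \<bar>\<phi> x\<bar> > s / 2} + emeasure M {x \<in> space M. \<bar>\<phi> x - u x\<bar> > s / 2}"
    by (intro emeasure_subadditive) measurable
  also have "\<dots> \<le> ennreal (A * (s / 2) powr (- r)) + ennreal \<epsilon>"
  proof (intro add_mono)
    show "emeasure M {x \<in> space M. \<bar>\<phi> x\<bar> > s / 2} \<le> ennreal (A * (s / 2) powr (- r))"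
      using weak[OF adm, of "s / 2"] emeasure_level_test[OF \<phi>(1), of "s / 2"] s by simp
    have "emeasure M {x \<in> space M. \<bar>\<phi> x - u x\<bar> > s / 2}
        \<le> ennreal (Lp_norm \<Omega> p (\<lambda>x. \<phi> x - u x) powr p / (s / 2) powr p)"
      using s by (intro Chebyshev_Lp inD) simp
    also have "\<dots> \<le> ennreal \<epsilon>"
    proof (intro ennreal_leI)
      have "Lp_norm \<Omega> p (\<lambda>x. \<phi> x - u x) powr p \<le> (s / 2 * \<epsilon> powr (1 / p)) powr p"
        using \<phi>(2) p0 unfolding \<delta>_def by (intro powr_mono2) auto
      also have "\<dots> = (s / 2) powr p * (\<epsilon> powr (1 / p)) powr p" by (rule powr_mult)
      also have "(\<epsilon> powr (1 / p)) powr p = \<epsilon>" using p0 \<epsilon> by (simp add: powr_powr)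
      finally show "Lp_norm \<Omega> p (\<lambda>x. \<phi> x - u x) powr p / (s / 2) powr p \<le> \<epsilon>"
        using s by (simp add: divide_le_eq mult.commute)
    qed
    finally show "emeasure M {x \<in> space M. \<bar>\<phi> x - u x\<bar> > s / 2} \<le> ennreal \<epsilon>" .
  qed
  also have "A * (s / 2) powr (- r) = A * 2 powr r * s powr (- r)"
    by (simp add: powr_divide powr_minus field_simps)
  finally show "emeasure M {x \<in> space M. \<bar>u x\<bar> > s} \<le> ennreal (A * 2 powr r * s powr (- r)) + ennreal \<epsilon>" .
qed

abbreviation (input) "crit \<equiv> real (hom_dim V m) * p / (real (hom_dim V m) - p)"

lemma p_less_crit: "p < crit"
proof -
  have "p * (real (hom_dim V m) - p) < real (hom_dim V m) * p" using p by (simp add: algebra_simps)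
  then show ?thesis using p by (simp add: less_divide_eq)
qed

text \<open>Uniform \<open>q\<close>-integrability over a ball of \<open>W\<close>, since
  \<open>q - r < 0\<close>. This is what upgrades convergence in \<open>L\<^sup>1\<close> to
  convergence in \<open>L\<^sup>q\<close>.\<close>

lemma W_tail:
  assumes q: "q < crit" "q > 0"
  shows "\<exists>r K. q < r \<and> K > 0 \<and> (\<forall>u T. u \<in> W \<longrightarrow> Lp_norm \<Omega> p (D u) \<le> 1 / 2 \<longrightarrow> T > 0 \<longrightarrow>
    (\<integral>\<^sup>+x. ennreal (\<bar>u x\<bar> powr q) * indicator {x. \<bar>u x\<bar> > T} x \<partial>M) \<le> ennreal (K * T powr (q - r)))"
proof -
  have "1 \<le> p" using p by simp
  from weak_type_subcritical[OF \<Omega>(2,1) this p(2) q(1)] obtain r A where r: "q < r" and A: "A > 0"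
    and weak: "\<And>\<phi> s. admissible \<Omega> p \<phi> \<Longrightarrow> s > 0 \<Longrightarrow> emeasure lborel {x. \<bar>\<phi> x\<bar> > s} \<le> ennreal (A * s powr (- r))"
    by blast
  define K where "K = A * 2 powr r * 2 powr q / (1 - 2 powr (q - r))"
  have "(2::real) powr (q - r) < 1" using r by (simp add: powr_less_one)
  then have K: "K > 0" using A by (simp add: K_def)
  have "(\<integral>\<^sup>+x. ennreal (\<bar>u x\<bar> powr q) * indicator {x. \<bar>u x\<bar> > T} x \<partial>M) \<le> ennreal (K * T powr (q - r))"
    if u: "u \<in> W" "Lp_norm \<Omega> p (D u) \<le> 1 / 2" and T: "T > 0" for u T
  proof -
    have [measurable]: "u \<in> borel_measurable M" using W_elim(2)[OF u(1)] by (simp add: in_Lp_def)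
    have "(\<integral>\<^sup>+x. ennreal (\<bar>u x\<bar> powr q) * indicator {x. \<bar>u x\<bar> > T} x \<partial>M)
        \<le> ennreal ((A * 2 powr r) * 2 powr q * T powr (q - r) / (1 - 2 powr (q - r)))"
      by (intro nn_integral_tail_weak W_weak_type[OF weak A u]) (use q r A T in auto)
    then show ?thesis by (simp add: K_def)
  qed
  with r K show ?thesis by blast
qed

lemma W_in_Lp_small:
  assumes q: "q < crit" "q > 0" and u: "u \<in> W" "Lp_norm \<Omega> p (D u) \<le> 1 / 2"
  shows "in_Lp \<Omega> q u"
proof -
  from W_tail[OF q] obtain r K where K: "(\<integral>\<^sup>+x. ennreal (\<bar>u x\<bar> powr q) * indicator {x. \<bar>u x\<bar> > 1} x \<partial>M) \<le> ennreal (K * 1 powr (q - r))"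
    using u zero_less_one by blast
  have m [measurable]: "u \<in> borel_measurable M" using W_elim(2)[OF u(1)] by (simp add: in_Lp_def)
  have "(\<integral>\<^sup>+x. ennreal (norm (u x) powr q) \<partial>M)
      \<le> (\<integral>\<^sup>+x. 1 + ennreal (\<bar>u x\<bar> powr q) * indicator {x. \<bar>u x\<bar> > 1} x \<partial>M)"
  proof (intro nn_integral_mono)
    fix x
    show "ennreal (norm (u x) powr q) \<le> 1 + ennreal (\<bar>u x\<bar> powr q) * indicator {x. \<bar>u x\<bar> > 1} x"
    proof (cases "\<bar>u x\<bar> > 1")
      case False
      then have "\<bar>u x\<bar> powr q \<le> 1 powr q" using q by (intro powr_mono2) auto
      then show ?thesis using False by (simp add: ennreal_le_1)
    qed simp
  qed
  also have "\<dots> = emeasure M (space M) + (\<integral>\<^sup>+x. ennreal (\<bar>u x\<bar> powr q) * indicator {x. \<bar>u x\<bar> > 1} x \<partial>M)"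
    by (subst nn_integral_add) auto
  also have "\<dots> \<le> ennreal vol + ennreal (K * 1 powr (q - r))"
    unfolding vol(2) by (intro add_left_mono K)
  also have "\<dots> < \<infinity>" by simp
  finally show ?thesis by (rule in_Lp_nn_integral[OF m])
qed

lemma W_in_Lp:
  assumes q: "q < crit" "q > 0" and u: "u \<in> W"
  shows "in_Lp \<Omega> q u"
proof -
  define c where "c = 1 / (2 * (Lp_norm \<Omega> p (D u) + 1))"
  have c: "c > 0" by (simp add: c_def add_nonneg_pos)
  have "Lp_norm \<Omega> p (D (\<lambda>x. c * u x)) \<le> 1 / 2"
    using c Lp_norm_nonneg[of \<Omega> p "D u"] by (simp add: W_scale(3)[OF u]) (simp add: c_def field_simps)
  from W_in_Lp_small[OF q W_scale(1)[OF u] this] have "in_Lp \<Omega> q (\<lambda>x. (1 / c) *\<^sub>R (c * u x))"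
    by (rule in_Lp_scaleR)
  then show ?thesis using c by simp
qed

text \<open>The bound \<open>1 / 4\<close> on the gradients puts differences of two members within
  the bound \<open>1 / 2\<close> of \<open>W_tail\<close>. Differences are split at a height
  \<open>T\<close>: below it the \<open>L\<^sup>1\<close> norm controls them, above it the tail
  estimate.\<close>

lemma W_precompact_small:
  assumes q: "q < crit" "q \<ge> 1" and u: "\<And>n. u n \<in> W" "\<And>n. Lp_norm \<Omega> p (D (u n)) \<le> 1 / 4"
  shows "\<exists>r::nat \<Rightarrow> nat. strict_mono r \<and>
    (\<forall>\<epsilon>>0. \<exists>N. \<forall>i\<ge>N. \<forall>j\<ge>N. Lp_norm \<Omega> q (\<lambda>x. u (r i) x - u (r j) x) < \<epsilon>)"
proof -
  have p0: "p > 0" "p \<ge> 1" using p by auto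
  note uE = W_elim[OF u(1)]
  \<comment> \<open>The shift by two in \<open>Suc (Suc n)\<close> keeps the error at most
    \<open>1 / 2\<close> already for \<open>n = 0\<close>, so that
    \<open>1 / 4 + 1 / 2 \<le> 1\<close> makes every approximant admissible.\<close>
  have "\<forall>n. \<exists>\<phi>. test_fun \<Omega> \<phi> \<and> Lp_norm \<Omega> p (\<lambda>x. \<phi> x - u n x) < 1 / real (Suc (Suc n)) \<and>
      Lp_norm \<Omega> p (\<lambda>x. grad \<phi> x - D (u n) x) < 1 / real (Suc (Suc n))"
    by (intro allI W_approx[OF u(1)]) simp
  from choice[OF this] obtain \<phi> where "\<forall>n. test_fun \<Omega> (\<phi> n) \<and>
      Lp_norm \<Omega> p (\<lambda>x. \<phi> n x - u n x) < 1 / real (Suc (Suc n)) \<and>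
      Lp_norm \<Omega> p (\<lambda>x. grad (\<phi> n) x - D (u n) x) < 1 / real (Suc (Suc n))" ..
  then have \<phi>: "\<And>n. test_fun \<Omega> (\<phi> n)" "\<And>n. Lp_norm \<Omega> p (\<lambda>x. \<phi> n x - u n x) < 1 / real (Suc (Suc n))"
    "\<And>n. Lp_norm \<Omega> p (\<lambda>x. grad (\<phi> n) x - D (u n) x) < 1 / real (Suc (Suc n))" by blast+
  have adm: "admissible \<Omega> p (\<phi> n)" for n
  proof (rule admissibleI[OF \<phi>(1)])
    have "1 / real (Suc (Suc n)) \<le> 1 / 2" by simp
    then show "Lp_norm \<Omega> p (grad (\<phi> n)) \<le> 1"
      using Lp_norm_diff_le[OF in_Lp_grad[OF \<phi>(1) p0(1)] uE(3) p0(2), of n n] \<phi>(3)[of n] u(2)[of n] by linarith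
  qed
  from admissible_L1_precompact[where \<phi> = \<phi>, OF \<Omega>(2,1) p0(2) p(2) adm] obtain r :: "nat \<Rightarrow> nat" where r: "strict_mono r"
    and rC: "\<forall>\<eta>>0. \<exists>N. \<forall>i\<ge>N. \<forall>j\<ge>N. (\<integral>\<^sup>+x. ennreal \<bar>\<phi> (r i) x - \<phi> (r j) x\<bar> \<partial>lborel) \<le> ennreal \<eta>"
    by (elim exE conjE)
  have inp: "in_Lp \<Omega> p (\<lambda>x. \<phi> n x - u n x)" for n by (intro in_Lp_diff in_Lp_test[OF \<phi>(1)] uE p0)
  have lim0: "(\<lambda>n. 1 / real (Suc (Suc n))) \<longlonglongrightarrow> 0" by (rule LIMSEQ_Suc[OF LIMSEQ_Suc[OF lim_1_over_n]])
  have "(\<lambda>n. Lp_norm \<Omega> p (\<lambda>x. \<phi> n x - u n x)) \<longlonglongrightarrow> 0"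
  proof (rule Lim_null_comparison[OF always_eventually lim0], rule allI)
    fix n show "norm (Lp_norm \<Omega> p (\<lambda>x. \<phi> n x - u n x)) \<le> 1 / real (Suc (Suc n))"
      using less_imp_le[OF \<phi>(2)[of n]] by (simp only: real_norm_def abs_of_nonneg[OF Lp_norm_nonneg])
  qed
  then have l1: "(\<lambda>n. Lp_norm \<Omega> 1 (\<lambda>x. \<phi> n x - u n x)) \<longlonglongrightarrow> 0"
    by (rule Lp_embed_tendsto[OF zero_less_one p0(2) inp])
  have i1: "in_Lp \<Omega> 1 (\<phi> n)" "in_Lp \<Omega> 1 (u n)" for n
    using Lp_embed(1)[OF _ p0(2) uE(2)] in_Lp_test[OF \<phi>(1)] by auto
  have L1: "\<exists>N. \<forall>i\<ge>N. \<forall>j\<ge>N. Lp_norm \<Omega> 1 (\<lambda>x. u (r i) x - u (r j) x) < \<eta>" if \<eta>: "\<eta> > 0" for \<eta>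
  proof -
    have "\<forall>\<^sub>F n in sequentially. Lp_norm \<Omega> 1 (\<lambda>x. \<phi> n x - u n x) < \<eta> / 4"
      using \<eta> by (intro order_tendstoD(2)[OF l1]) simp
    then obtain N1 where N1: "\<And>n. n \<ge> N1 \<Longrightarrow> Lp_norm \<Omega> 1 (\<lambda>x. \<phi> n x - u n x) < \<eta> / 4"
      by (auto simp: eventually_sequentially)
    obtain N2 where N2: "\<And>i j. i \<ge> N2 \<Longrightarrow> j \<ge> N2 \<Longrightarrow> (\<integral>\<^sup>+x. ennreal \<bar>\<phi> (r i) x - \<phi> (r j) x\<bar> \<partial>lborel) \<le> ennreal (\<eta> / 4)"
      using rC[rule_format, of "\<eta> / 4"] \<eta> by auto
    have "Lp_norm \<Omega> 1 (\<lambda>x. u (r i) x - u (r j) x) < \<eta>" if ij: "i \<ge> max N1 N2" "j \<ge> max N1 N2" for i j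
    proof -
      have ri: "r i \<ge> N1" "r j \<ge> N1" using ij seq_suble[OF r, of i] seq_suble[OF r, of j] by auto
      have cont: "continuous_on UNIV (\<lambda>x. \<phi> (r i) x - \<phi> (r j) x)"
        by (intro continuous_intros C2_continuous test_fun_C2[OF \<phi>(1)])
      have "(\<integral>\<^sup>+x. ennreal (norm (\<phi> (r i) x - \<phi> (r j) x) powr 1) \<partial>M) = (\<integral>\<^sup>+x. ennreal (norm (\<phi> (r i) x - \<phi> (r j) x) powr 1) \<partial>lborel)"
        using borel_measurable_continuous_onI[OF cont] test_fun_zero[OF \<phi>(1)] by (intro nn_integral_M) auto
      also have "\<dots> \<le> ennreal (\<eta> / 4)" using N2 ij by simp
      finally have "Lp_norm \<Omega> 1 (\<lambda>x. \<phi> (r i) x - \<phi> (r j) x) powr 1 \<le> \<eta> / 4"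
        using \<eta> by (intro Lp_norm_le_nn_integral(2) continuous_measurable_M[OF cont]) auto
      then have a: "Lp_norm \<Omega> 1 (\<lambda>x. \<phi> (r i) x - \<phi> (r j) x) \<le> \<eta> / 4" by simp
      have "Lp_norm \<Omega> 1 (\<lambda>x. u (r i) x - u (r j) x)
          \<le> Lp_norm \<Omega> 1 (\<lambda>x. u (r i) x - \<phi> (r i) x) + Lp_norm \<Omega> 1 (\<lambda>x. \<phi> (r i) x - u (r j) x)"
        by (intro Lp_norm_triangle_sub i1) simp
      also have "Lp_norm \<Omega> 1 (\<lambda>x. \<phi> (r i) x - u (r j) x)
          \<le> Lp_norm \<Omega> 1 (\<lambda>x. \<phi> (r i) x - \<phi> (r j) x) + Lp_norm \<Omega> 1 (\<lambda>x. \<phi> (r j) x - u (r j) x)"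
        by (intro Lp_norm_triangle_sub i1) simp
      finally show ?thesis
        using a N1[OF ri(1)] N1[OF ri(2)] \<eta> Lp_norm_diff_commute[of \<Omega> 1 "u (r i)" "\<phi> (r i)"] by linarith
    qed
    then show ?thesis by blast
  qed
  have q0: "q > 0" using q by simp
  from W_tail[OF q(1) q0] obtain s K where s: "q < s" and K: "K > 0"
    and tail: "\<And>u T. u \<in> W \<Longrightarrow> Lp_norm \<Omega> p (D u) \<le> 1 / 2 \<Longrightarrow> T > 0 \<Longrightarrow>
    (\<integral>\<^sup>+x. ennreal (\<bar>u x\<bar> powr q) * indicator {x. \<bar>u x\<bar> > T} x \<partial>M) \<le> ennreal (K * T powr (q - s))" by blast
  have "\<exists>N. \<forall>i\<ge>N. \<forall>j\<ge>N. Lp_norm \<Omega> q (\<lambda>x. u (r i) x - u (r j) x) < \<epsilon>" if \<epsilon>: "\<epsilon> > 0" for \<epsilon>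
  proof -
    \<comment> \<open>\<open>T\<close> makes the tail equal to \<open>\<epsilon> powr q / 4\<close>,
      and \<open>\<eta>\<close> then makes the part below the height \<open>T\<close>, at most
      \<open>T powr (q - 1) * \<eta>\<close>, equal to the same amount.\<close>
    define T where "T = (\<epsilon> powr q / (4 * K)) powr (1 / (q - s))"
    have T: "T > 0" using \<epsilon> K by (simp add: T_def)
    have KT: "K * T powr (q - s) = \<epsilon> powr q / 4" using \<epsilon> K s by (simp add: T_def powr_powr)
    define \<eta> where "\<eta> = \<epsilon> powr q / (4 * T powr (q - 1))"
    have \<eta>: "\<eta> > 0" using \<epsilon> T by (simp add: \<eta>_def)
    obtain N where N: "\<And>i j. i \<ge> N \<Longrightarrow> j \<ge> N \<Longrightarrow> Lp_norm \<Omega> 1 (\<lambda>x. u (r i) x - u (r j) x) < \<eta>"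
      using L1[OF \<eta>] by blast
    have "Lp_norm \<Omega> q (\<lambda>x. u (r i) x - u (r j) x) < \<epsilon>" if ij: "i \<ge> N" "j \<ge> N" for i j
    proof -
      define v where "v x = u (r i) x - u (r j) x" for x
      have v: "v \<in> W" unfolding v_def by (rule W_diff(1)[OF u(1) u(1)])
      have "Lp_norm \<Omega> p (D v) \<le> Lp_norm \<Omega> p (D (u (r i))) + Lp_norm \<Omega> p (D (u (r j)))"
        using Minkowski[OF uE(3) in_Lp_scaleR[OF uE(3), of "-1"] p0(2), of "r i" "r j"]
          Lp_norm_scaleR[OF p0(1), of \<Omega> "-1" "D (u (r j))"]
        unfolding v_def W_diff(2)[OF u(1) u(1)] by simp
      then have Dv: "Lp_norm \<Omega> p (D v) \<le> 1 / 2" using u(2)[of "r i"] u(2)[of "r j"] by linarith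
      have v1: "in_Lp \<Omega> 1 v" unfolding v_def by (intro in_Lp_diff i1) simp
      have vm [measurable]: "v \<in> borel_measurable M" using v1 by (simp add: in_Lp_def)
      have "(\<integral>\<^sup>+x. ennreal (norm (v x) powr q) \<partial>M) \<le> (\<integral>\<^sup>+x. ennreal (T powr (q - 1)) * ennreal (norm (v x) powr 1)
          + ennreal (\<bar>v x\<bar> powr q) * indicator {x. \<bar>v x\<bar> > T} x \<partial>M)"
      proof (intro nn_integral_mono)
        fix x
        show "ennreal (norm (v x) powr q) \<le> ennreal (T powr (q - 1)) * ennreal (norm (v x) powr 1)
          + ennreal (\<bar>v x\<bar> powr q) * indicator {x. \<bar>v x\<bar> > T} x"
        proof (cases "\<bar>v x\<bar> > T")
          case False
          have "\<bar>v x\<bar> powr q = \<bar>v x\<bar> powr (q - 1) * \<bar>v x\<bar>" by (cases "v x = 0") (simp_all add: powr_diff)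
          also have "\<dots> \<le> T powr (q - 1) * \<bar>v x\<bar>"
            using False q by (intro mult_right_mono powr_mono2) auto
          finally have "ennreal (\<bar>v x\<bar> powr q) \<le> ennreal (T powr (q - 1) * \<bar>v x\<bar>)" by (rule ennreal_leI)
          then show ?thesis using False by (simp add: ennreal_mult)
        qed (simp add: add_increasing)
      qed
      also have "\<dots> = ennreal (T powr (q - 1)) * (\<integral>\<^sup>+x. ennreal (norm (v x) powr 1) \<partial>M)
          + (\<integral>\<^sup>+x. ennreal (\<bar>v x\<bar> powr q) * indicator {x. \<bar>v x\<bar> > T} x \<partial>M)"
        by (subst nn_integral_add, measurable, subst nn_integral_cmult, measurable)
      also have "\<dots> \<le> ennreal (T powr (q - 1)) * ennreal \<eta> + ennreal (\<epsilon> powr q / 4)"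
      proof (intro add_mono mult_left_mono)
        show "(\<integral>\<^sup>+x. ennreal (norm (v x) powr 1) \<partial>M) \<le> ennreal \<eta>"
          using N[OF ij] by (subst nn_integral_Lp[OF v1]) (auto simp: v_def[abs_def] intro!: ennreal_leI)
        show "(\<integral>\<^sup>+x. ennreal (\<bar>v x\<bar> powr q) * indicator {x. \<bar>v x\<bar> > T} x \<partial>M) \<le> ennreal (\<epsilon> powr q / 4)"
          unfolding KT[symmetric] by (rule tail[OF v Dv T])
      qed simp
      also have "\<dots> = ennreal (\<epsilon> powr q / 4 + \<epsilon> powr q / 4)"
        using T \<eta> by (simp add: ennreal_mult[symmetric] \<eta>_def flip: ennreal_plus)
      also have "\<epsilon> powr q / 4 + \<epsilon> powr q / 4 = \<epsilon> powr q / 2" by simp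
      finally have "Lp_norm \<Omega> q v powr q \<le> \<epsilon> powr q / 2"
        by (intro Lp_norm_le_nn_integral(2)[OF vm q0]) simp_all
      also have "\<dots> < \<epsilon> powr q" using \<epsilon> by simp
      finally have "\<not> \<epsilon> powr q \<le> Lp_norm \<Omega> q v powr q" by simp
      then have "\<not> \<epsilon> \<le> Lp_norm \<Omega> q v" using powr_mono2[of q \<epsilon> "Lp_norm \<Omega> q v"] \<epsilon> q0 by auto
      then show ?thesis by (simp add: v_def[abs_def])
    qed
    then show ?thesis by blast
  qed
  then show ?thesis by (intro exI[of _ r] conjI allI impI r)
qed

theorem W_precompact:
  assumes q: "q < crit" "q \<ge> 1" and u: "\<And>n. u n \<in> W" "\<And>n. Lp_norm \<Omega> p (D (u n)) \<le> R"
  shows "\<exists>r::nat \<Rightarrow> nat. strict_mono r \<and>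
    (\<forall>\<epsilon>>0. \<exists>N. \<forall>i\<ge>N. \<forall>j\<ge>N. Lp_norm \<Omega> q (\<lambda>x. u (r i) x - u (r j) x) < \<epsilon>)"
proof -
  define c where "c = 1 / (4 * (\<bar>R\<bar> + 1))"
  have c: "c > 0" by (simp add: c_def add_nonneg_pos)
  have q0: "q > 0" using q by simp
  have "Lp_norm \<Omega> p (D (\<lambda>x. c * u n x)) \<le> 1 / 4" for n
  proof -
    have "Lp_norm \<Omega> p (D (\<lambda>x. c * u n x)) \<le> c * (\<bar>R\<bar> + 1)"
      using c u(2)[of n] unfolding W_scale(3)[OF u(1)] by (intro mult_mono) auto
    also have "\<dots> = 1 / 4" by (simp add: c_def add_nonneg_pos less_imp_neq[symmetric])
    finally show ?thesis .
  qed
  from W_precompact_small[where u = "\<lambda>n x. c * u n x", OF q W_scale(1)[OF u(1)] this] obtain r :: "nat \<Rightarrow> nat" where r: "strict_mono r"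
    and N': "\<forall>\<epsilon>>0. \<exists>N. \<forall>i\<ge>N. \<forall>j\<ge>N. Lp_norm \<Omega> q (\<lambda>x. c * u (r i) x - c * u (r j) x) < \<epsilon>"
    by (elim exE conjE)
  note N = N'[rule_format]
  have sc: "Lp_norm \<Omega> q (\<lambda>x. c * u i x - c * u j x) = c * Lp_norm \<Omega> q (\<lambda>x. u i x - u j x)" for i j
    using Lp_norm_scaleR[OF q0, of \<Omega> c "\<lambda>x. u i x - u j x"] c by (simp add: right_diff_distrib)
  have "\<exists>N. \<forall>i\<ge>N. \<forall>j\<ge>N. Lp_norm \<Omega> q (\<lambda>x. u (r i) x - u (r j) x) < \<epsilon>" if "\<epsilon> > 0" for \<epsilon>
    using N[of "c * \<epsilon>"] that c unfolding sc by simp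
  then show ?thesis by (intro exI[of _ r] conjI allI impI r)
qed

end

section \<open>Minimizers and eigenfunctions\<close>

lemma powr_minus_2_mult_square: "\<bar>y\<bar> powr (s - 2) * y * y = \<bar>y\<bar> powr s" for y s :: real
proof (cases "y = 0")
  case False
  have "\<bar>y\<bar> powr (s - 2) * y * y = \<bar>y\<bar> powr (s - 2) * \<bar>y\<bar> powr 2"
    using False by (simp add: mult.assoc flip: power2_eq_square)
  also have "\<dots> = \<bar>y\<bar> powr s" by (simp only: powr_add[symmetric]) simp
  finally show ?thesis .
qed simp

locale eigenproblem = dirichlet gmul V m e \<sigma> B \<Omega> p
  for gmul :: "real^'a \<Rightarrow> real^'a \<Rightarrow> real^'a" (infixl "\<odot>" 70) and V m and e :: "'a::finite \<Rightarrow> real^'a" and \<sigma>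
    and B :: "'k::finite \<Rightarrow> real^'a" and \<Omega> p +
  fixes q lam :: real
  assumes q: "1 < q" "q < real (hom_dim V m) * p / (real (hom_dim V m) - p)"
    and lam: "lam = Inf {(\<integral>x. norm (whgrad gmul B \<Omega> v x) powr p \<partial>lebesgue_on \<Omega>) | v.
                 v \<in> W0 gmul B \<Omega> p \<and> in_Lp \<Omega> q v \<and> Lp_norm \<Omega> q v = 1}"
begin

lemma p0: "p > 0" "p \<ge> 1" and q0: "q > 0" "q \<ge> 1"
  using p q by auto

lemma W_Lq: "v \<in> W \<Longrightarrow> in_Lp \<Omega> q v"
  by (rule W_in_Lp[OF q(2) q0(1)])

lemma W_measurable [measurable_dest]:
  assumes "v \<in> W"
  shows "v \<in> borel_measurable M" "D v \<in> borel_measurable M"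
  using W_elim(2,3)[OF assms] by (auto simp: in_Lp_def)

lemma lam_le:
  assumes "v \<in> W" "Lp_norm \<Omega> q v = 1"
  shows "lam \<le> Lp_norm \<Omega> p (D v) powr p"
  unfolding lam Lp_norm_powr[OF p0(1)]
proof (rule cInf_lower)
  show "bdd_below {\<integral>x. norm (D v x) powr p \<partial>M |v. v \<in> W \<and> in_Lp \<Omega> q v \<and> Lp_norm \<Omega> q v = 1}"
    by (rule bdd_belowI[of _ 0]) (auto intro: Bochner_Integration.integral_nonneg)
qed (use assms W_Lq in blast)

lemma Lp_norm_cmult: "s > 0 \<Longrightarrow> Lp_norm \<Omega> s (\<lambda>x. c * f x) = \<bar>c\<bar> * Lp_norm \<Omega> s f" for f :: "real^'a \<Rightarrow> real"
  using Lp_norm_scaleR[of s \<Omega> c f] by simp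

text \<open>The homogeneous form of the infimum, free of the constraint. It also holds for vanishing
  norm, because \<open>0 powr p = 0\<close>.\<close>

lemma rayleigh:
  assumes v: "v \<in> W"
  shows "lam * Lp_norm \<Omega> q v powr p \<le> Lp_norm \<Omega> p (D v) powr p"
proof (cases "Lp_norm \<Omega> q v = 0")
  case False
  then have N: "Lp_norm \<Omega> q v > 0" using Lp_norm_nonneg[of \<Omega> q v] by linarith
  define c where "c = 1 / Lp_norm \<Omega> q v"
  have c: "c > 0" using N by (simp add: c_def)
  have "Lp_norm \<Omega> q (\<lambda>x. c * v x) = 1" using N c unfolding Lp_norm_cmult[OF q0(1)] by (simp add: c_def)
  from lam_le[OF W_scale(1)[OF v] this] have "lam \<le> (c * Lp_norm \<Omega> p (D v)) powr p"
    using c by (simp add: W_scale(3)[OF v])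
  also have "\<dots> = c powr p * Lp_norm \<Omega> p (D v) powr p" by (rule powr_mult)
  also have "c powr p = 1 / Lp_norm \<Omega> q v powr p" by (simp add: c_def powr_divide)
  finally show ?thesis using N by (simp add: field_simps)
qed simp

text \<open>Along the line \<open>w + t v\<close> the difference \<open>h\<close> of the two sides
  of \<open>rayleigh\<close> is nonnegative and vanishes at \<open>t = 0\<close>, so its derivative
  there is 0. As \<open>rayleigh\<close> holds without the constraint, no variation within the unit
  sphere and no multiplier enter.\<close>

lemma euler_lagrange:
  assumes w: "w \<in> W" "Lp_norm \<Omega> q w = 1" "Lp_norm \<Omega> p (D w) powr p = lam" and v: "v \<in> W"
  shows "(\<integral>x. norm (D w x) powr (p - 2) * (D w x \<bullet> D v x) \<partial>M) = lam * (\<integral>x. \<bar>w x\<bar> powr (q - 2) * w x * v x \<partial>M)"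
proof -
  define I where "I = (\<integral>x. norm (D w x) powr (p - 2) * (D w x \<bullet> D v x) \<partial>M)"
  define J where "J = (\<integral>x. norm (w x) powr (q - 2) * (w x \<bullet> v x) \<partial>M)"
  define f where "f t = (\<integral>x. norm (D w x + t *\<^sub>R D v x) powr p \<partial>M)" for t
  define F where "F t = (\<integral>x. norm (w x + t *\<^sub>R v x) powr q \<partial>M)" for t
  define h where "h t = f t - lam * F t powr (p / q)" for t
  have F0: "F 0 = 1" using w(2) Lp_norm_powr[OF q0(1), of \<Omega> w] by (simp add: F_def)
  have f0: "f 0 = lam" using w(3) Lp_norm_powr[OF p0(1), of \<Omega> "D w"] by (simp add: f_def)
  have h0: "h 0 = 0" by (simp add: h_def F0 f0)
  have hpos: "0 \<le> h t" for t
  proof -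
    let ?z = "\<lambda>x. 1 * w x + t * v x"
    have z: "?z \<in> W" "AE x in M. D ?z x = 1 *\<^sub>R D w x + t *\<^sub>R D v x" by (rule W_lincomb[OF w(1) v])+
    have "Lp_norm \<Omega> p (D ?z) = Lp_norm \<Omega> p (\<lambda>x. 1 *\<^sub>R D w x + t *\<^sub>R D v x)"
      by (rule Lp_norm_cong_AE[OF z(2)]) (use W_measurable[OF w(1)] W_measurable[OF v] W_measurable[OF z(1)] in measurable)
    then have "Lp_norm \<Omega> p (D ?z) powr p = f t" by (simp add: Lp_norm_powr[OF p0(1)] f_def)
    moreover have "Lp_norm \<Omega> q ?z powr p = F t powr (p / q)" by (simp add: Lp_norm_def F_def powr_powr)
    ultimately show ?thesis using rayleigh[OF z(1)] by (simp add: h_def)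
  qed
  have df: "(f has_real_derivative p * I) (at 0)"
    unfolding f_def I_def by (rule Lp_integral_derivative[OF W_elim(3)[OF w(1)] W_elim(3)[OF v] p(1)])
  have dF: "(F has_real_derivative q * J) (at 0)"
    unfolding F_def J_def by (rule Lp_integral_derivative[OF W_Lq[OF w(1)] W_Lq[OF v] q(1)])
  have "((\<lambda>t. F t powr (p / q)) has_real_derivative p / q * F 0 powr (p / q - of_nat 1) * (q * J)) (at 0)"
    by (rule DERIV_fun_powr[OF dF]) (simp add: F0)
  then have dF': "((\<lambda>t. F t powr (p / q)) has_real_derivative p * J) (at 0)" using q0 by (simp add: F0)
  have "(h has_real_derivative p * I - lam * (p * J)) (at 0)"
    unfolding h_def by (intro DERIV_diff df DERIV_cmult dF')
  then have "p * I - lam * (p * J) = 0"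
    by (rule DERIV_local_min[OF _ zero_less_one]) (use hpos h0 in auto)
  then have "I = lam * J" using p0 by (simp add: algebra_simps)
  then show ?thesis unfolding I_def J_def by (simp add: mult.assoc)
qed

text \<open>Both sides of the equation are homogeneous of degree \<open>p - 1\<close> in the
  eigenfunction: the norm factor with exponent \<open>p - q\<close> makes up for the degree
  \<open>q - 1\<close> of the integral. So the equation for the normalised minimizer passes to all
  nonzero multiples.\<close>

lemma eigenpair_scaled_minimizer:
  assumes v: "v \<in> W" "Lp_norm \<Omega> q v = 1" "Lp_norm \<Omega> p (D v) powr p = lam" and c: "c \<noteq> 0"
  shows "eigenpair gmul B \<Omega> p q lam (\<lambda>x. c * v x)"
  unfolding eigenpair_def
proof (intro conjI ballI notI)
  let ?f = "\<lambda>x. c * v x"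
  note f = W_scale(1,2)[OF v(1), of c]
  show "?f \<in> W" by (rule f)
  show False if ae: "AE x in M. c * v x = 0"
  proof -
    have "AE x in M. v x = 0" using ae by eventually_elim (use c in simp)
    then have "Lp_norm \<Omega> q v = Lp_norm \<Omega> q (\<lambda>x. 0::real)"
      by (rule Lp_norm_cong_AE) (use W_measurable[OF v(1)] in auto)
    then show False using v(2) q0 by (simp add: Lp_norm_def)
  qed
  fix g assume g: "g \<in> W"
  have "(\<integral>x. norm (D ?f x) powr (p - 2) * (D ?f x \<bullet> D g x) \<partial>M)
      = (\<integral>x. (\<bar>c\<bar> powr (p - 2) * c) * (norm (D v x) powr (p - 2) * (D v x \<bullet> D g x)) \<partial>M)"
  proof (rule integral_cong_AE)
    show "AE x in M. norm (D ?f x) powr (p - 2) * (D ?f x \<bullet> D g x)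
      = (\<bar>c\<bar> powr (p - 2) * c) * (norm (D v x) powr (p - 2) * (D v x \<bullet> D g x))"
      using f(2) by eventually_elim (simp add: powr_mult)
  qed (use W_measurable[OF f(1)] W_measurable[OF v(1)] W_measurable[OF g] in measurable)
  also have "\<dots> = (\<bar>c\<bar> powr (p - 2) * c) * (lam * (\<integral>x. \<bar>v x\<bar> powr (q - 2) * v x * g x \<partial>M))"
    by (simp add: euler_lagrange[OF v g])
  also have "\<bar>c\<bar> powr (p - 2) = \<bar>c\<bar> powr (p - q) * \<bar>c\<bar> powr (q - 2)" by (simp flip: powr_add)
  also have "\<bar>c\<bar> powr (p - q) * \<bar>c\<bar> powr (q - 2) * c * (lam * (\<integral>x. \<bar>v x\<bar> powr (q - 2) * v x * g x \<partial>M))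
      = lam * \<bar>c\<bar> powr (p - q) * (\<integral>x. (\<bar>c\<bar> powr (q - 2) * c) * (\<bar>v x\<bar> powr (q - 2) * v x * g x) \<partial>M)"
    unfolding integral_mult_right_zero by (simp add: ac_simps)
  also have "(\<lambda>x. (\<bar>c\<bar> powr (q - 2) * c) * (\<bar>v x\<bar> powr (q - 2) * v x * g x)) = (\<lambda>x. \<bar>c * v x\<bar> powr (q - 2) * (c * v x) * g x)"
    by (simp add: abs_mult powr_mult ac_simps)
  finally show "(\<integral>x. norm (D ?f x) powr (p - 2) * (D ?f x \<bullet> D g x) \<partial>M)
      = lam * Lp_norm \<Omega> q ?f powr (p - q) * (\<integral>x. \<bar>c * v x\<bar> powr (q - 2) * (c * v x) * g x \<partial>M)"
    by (simp add: Lp_norm_cmult[OF q0(1)] v(2))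
qed

text \<open>With \<open>f\<close> as test function the factor \<open>N powr (p - q)\<close> meets an
  integral equal to \<open>N powr q\<close>, so the energy of \<open>f\<close> is
  \<open>lam * N powr p\<close> and \<open>f / N\<close> attains the infimum. Here
  \<open>N > 0\<close> because an eigenfunction does not vanish almost everywhere.\<close>

lemma eigenpair_normalized:
  assumes "eigenpair gmul B \<Omega> p q lam f"
  shows "\<exists>c v. c \<noteq> 0 \<and> v \<in> W \<and> Lp_norm \<Omega> q v = 1 \<and> Lp_norm \<Omega> p (D v) powr p = lam \<and> (\<forall>x. f x = c * v x)"
proof -
  have f: "f \<in> W" "\<not> (AE x in M. f x = 0)"
    and eq: "(\<integral>x. norm (D f x) powr (p - 2) * (D f x \<bullet> D f x) \<partial>M)
      = lam * Lp_norm \<Omega> q f powr (p - q) * (\<integral>x. \<bar>f x\<bar> powr (q - 2) * f x * f x \<partial>M)"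
    using assms unfolding eigenpair_def by auto
  define N where "N = Lp_norm \<Omega> q f"
  have "N \<noteq> 0" using Lp_norm_eq_0_imp_AE[OF W_Lq[OF f(1)] q0(1)] f(2) by (auto simp: N_def)
  then have N: "N > 0" using Lp_norm_nonneg[of \<Omega> q f] unfolding N_def by linarith
  have "norm (D f x) powr (p - 2) * (D f x \<bullet> D f x) = norm (D f x) powr p" for x
    using powr_minus_2_mult_square[of "norm (D f x)" p] by (simp add: dot_square_norm power2_eq_square mult.assoc)
  then have "Lp_norm \<Omega> p (D f) powr p = (\<integral>x. norm (D f x) powr (p - 2) * (D f x \<bullet> D f x) \<partial>M)"
    by (simp add: Lp_norm_powr[OF p0(1)])
  also have "\<dots> = lam * N powr (p - q) * N powr q"
    unfolding eq powr_minus_2_mult_square N_def Lp_norm_powr[OF q0(1)] by simp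
  also have "\<dots> = lam * N powr p" by (simp add: mult.assoc flip: powr_add)
  finally have E: "Lp_norm \<Omega> p (D f) powr p = lam * N powr p" .
  have "Lp_norm \<Omega> p (D (\<lambda>x. 1 / N * f x)) powr p = (1 / N) powr p * Lp_norm \<Omega> p (D f) powr p"
    using N unfolding W_scale(3)[OF f(1)] by (simp add: powr_mult[of "1 / N" "Lp_norm \<Omega> p (D f)" p, simplified] powr_divide)
  also have "\<dots> = lam" using N by (simp add: E powr_divide)
  finally have D: "Lp_norm \<Omega> p (D (\<lambda>x. 1 / N * f x)) powr p = lam" .
  have 1: "Lp_norm \<Omega> q (\<lambda>x. 1 / N * f x) = 1"
    using N unfolding Lp_norm_cmult[OF q0(1)] by (simp add: N_def)
  show ?thesis
    by (intro exI[of _ N] exI[of _ "\<lambda>x. 1 / N * f x"] conjI D 1 W_scale(1)[OF f(1)]) (use N in auto)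
qed

text \<open>The functionals in \<open>weak_conv_U\<close> are bounded by the gradient norm, so
  convergence of gradients in norm decides.\<close>

lemma strong_imp_weak_conv:
  assumes u: "\<And>n. u n \<in> W" and w: "w \<in> W" and lim: "(\<lambda>n. Lp_norm \<Omega> p (D (\<lambda>x. u n x - w x))) \<longlonglongrightarrow> 0"
  shows "weak_conv_U gmul B \<Omega> p u w"
  unfolding weak_conv_U_def
proof (intro allI impI, elim conjE exE)
  fix L C
  assume lin: "\<forall>v\<in>W. \<forall>v'\<in>W. \<forall>a b. L (\<lambda>x. a * v x + b * v' x) = a * L v + b * L v'"
    and bd: "\<forall>v\<in>W. \<bar>L v\<bar> \<le> C * Lp_norm \<Omega> p (D v)"
  have "(\<lambda>n. L (u n) - L w) \<longlonglongrightarrow> 0"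
  proof (rule Lim_null_comparison[OF always_eventually], rule allI)
    fix n
    have "L (\<lambda>x. u n x - w x) = L (u n) - L w"
      using lin[rule_format, OF u[of n] w, of 1 "-1"] by simp
    then show "norm (L (u n) - L w) \<le> C * Lp_norm \<Omega> p (D (\<lambda>x. u n x - w x))"
      using bd[rule_format, OF W_diff(1)[OF u[of n] w]] by simp
  next
    show "(\<lambda>n. C * Lp_norm \<Omega> p (D (\<lambda>x. u n x - w x))) \<longlonglongrightarrow> 0"
      using tendsto_mult_left[OF lim, of C] by simp
  qed
  then show "(\<lambda>n. L (u n)) \<longlonglongrightarrow> L w" by (simp add: LIM_zero_iff)
qed

theorem minimizing_sequence_converges:
  assumes u: "\<And>n. u n \<in> W" "\<And>n. Lp_norm \<Omega> q (u n) = 1"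
    and lim: "(\<lambda>n. Lp_norm \<Omega> p (D (u n)) powr p) \<longlonglongrightarrow> lam"
  shows "\<exists>(r::nat \<Rightarrow> nat) w. strict_mono r \<and> w \<in> W \<and> Lp_norm \<Omega> q w = 1 \<and> Lp_norm \<Omega> p (D w) powr p = lam \<and>
    (\<lambda>j. Lp_norm \<Omega> p (D (\<lambda>x. u (r j) x - w x))) \<longlonglongrightarrow> 0"
proof -
  have lam0: "lam \<ge> 0" by (rule LIMSEQ_le_const[OF lim]) auto
  have "(\<lambda>n. (Lp_norm \<Omega> p (D (u n)) powr p) powr (1 / p)) \<longlonglongrightarrow> lam powr (1 / p)"
    using p0 by (intro tendsto_powr2 lim tendsto_const) auto
  then have "(\<lambda>n. Lp_norm \<Omega> p (D (u n))) \<longlonglongrightarrow> lam powr (1 / p)" using p0 by (simp add: powr_powr)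
  then have "Bseq (\<lambda>n. Lp_norm \<Omega> p (D (u n)))" by (rule convergent_imp_Bseq[OF convergentI])
  then obtain R where "\<forall>n. norm (Lp_norm \<Omega> p (D (u n))) \<le> R" by (rule BseqE)
  then have R: "Lp_norm \<Omega> p (D (u n)) \<le> R" for n by (simp add: abs_le_iff)
  \<comment> \<open>Convergence in \<open>L\<^sup>q\<close> preserves the constraint, and
    convergence in \<open>L\<^sup>p\<close> is required by \<open>W_closed\<close>. The larger
    exponent gives both, and it is still subcritical since \<open>p < crit\<close>.\<close>
  define Q where "Q = max p q"
  have Q: "Q < crit" "Q \<ge> 1" "Q > 0" "p \<le> Q" "q \<le> Q" using p_less_crit p0 q unfolding Q_def by auto
  from W_precompact[where u = u, OF Q(1,2) u(1) R] obtain r :: "nat \<Rightarrow> nat" where r: "strict_mono r"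
    and rC: "\<forall>\<epsilon>>0. \<exists>N. \<forall>i\<ge>N. \<forall>j\<ge>N. Lp_norm \<Omega> Q (\<lambda>x. u (r i) x - u (r j) x) < \<epsilon>"
    by (elim exE conjE)
  define U where "U j = u (r j)" for j
  have U: "U n \<in> W" "Lp_norm \<Omega> q (U n) = 1" for n using u by (simp_all add: U_def)
  have UQ: "in_Lp \<Omega> Q (U n)" for n by (rule W_in_Lp[OF Q(1,3) U(1)])
  have limU: "(\<lambda>n. Lp_norm \<Omega> p (D (U n)) powr p) \<longlonglongrightarrow> lam"
    using LIMSEQ_subseq_LIMSEQ[OF lim r] by (simp add: U_def o_def)
  have "\<exists>w. in_Lp \<Omega> Q w \<and> (\<lambda>n. Lp_norm \<Omega> Q (\<lambda>x. U n x - w x)) \<longlonglongrightarrow> 0"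
    by (rule Lp_complete[OF UQ Q(2)]) (use rC in \<open>simp add: U_def\<close>)
  then obtain w where w: "in_Lp \<Omega> Q w" "(\<lambda>n. Lp_norm \<Omega> Q (\<lambda>x. U n x - w x)) \<longlonglongrightarrow> 0" by blast
  have dQ: "in_Lp \<Omega> Q (\<lambda>x. U n x - w x)" for n by (rule in_Lp_diff[OF UQ w(1) Q(3)])
  have wp: "in_Lp \<Omega> p w" and wq: "in_Lp \<Omega> q w"
    using Lp_embed(1)[OF p0(1) Q(4) w(1)] Lp_embed(1)[OF q0(1) Q(5) w(1)] .
  have limp: "(\<lambda>n. Lp_norm \<Omega> p (\<lambda>x. U n x - w x)) \<longlonglongrightarrow> 0" by (rule Lp_embed_tendsto[OF p0(1) Q(4) dQ w(2)])
  have limq: "(\<lambda>n. Lp_norm \<Omega> q (\<lambda>x. U n x - w x)) \<longlonglongrightarrow> 0" by (rule Lp_embed_tendsto[OF q0(1) Q(5) dQ w(2)])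
  have w1: "Lp_norm \<Omega> q w = 1"
    using Lp_norm_tendsto[OF W_Lq[OF U(1)] wq q0(2) limq] unfolding U(2) by (simp add: tendsto_const_iff)
  have mid: "\<exists>N. \<forall>i\<ge>N. \<forall>j\<ge>N. Lp_norm \<Omega> p (\<lambda>x. (1 / 2) *\<^sub>R (D (U i) x + D (U j) x)) powr p \<ge> lam - \<epsilon>"
    if \<epsilon>: "\<epsilon> > 0" for \<epsilon>
  proof -
    \<comment> \<open>Norms within \<open>\<delta>\<close> of 1 have \<open>p\<close>-th power at
      least \<open>1 - p * \<delta>\<close>, by the tangent at 1, so the energy of a midpoint loses
      at most \<open>lam * p * \<delta> \<le> \<epsilon>\<close>. The \<open>lam + 1\<close> allows
      \<open>lam = 0\<close>, and \<open>\<delta> \<le> 1\<close> keeps \<open>1 - \<delta>\<close>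
      nonnegative.\<close>
    define \<delta> where "\<delta> = min 1 (\<epsilon> / (p * (lam + 1)))"
    have \<delta>: "\<delta> > 0" "\<delta> \<le> 1" using \<epsilon> p0 lam0 by (auto simp: \<delta>_def)
    have small: "lam * (p * \<delta>) \<le> \<epsilon>"
    proof -
      have "lam * (p * \<delta>) \<le> (lam + 1) * (p * (\<epsilon> / (p * (lam + 1))))"
        using lam0 p0 \<delta> by (intro mult_mono mult_left_mono) (auto simp: \<delta>_def)
      also have "\<dots> = \<epsilon>" using lam0 p0 by simp
      finally show ?thesis .
    qed
    have "\<forall>\<^sub>F n in sequentially. Lp_norm \<Omega> q (\<lambda>x. U n x - w x) < \<delta>" by (rule order_tendstoD(2)[OF limq \<delta>(1)])
    then obtain N where N: "\<And>n. n \<ge> N \<Longrightarrow> Lp_norm \<Omega> q (\<lambda>x. U n x - w x) < \<delta>"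
      by (auto simp: eventually_sequentially)
    have "Lp_norm \<Omega> p (\<lambda>x. (1 / 2) *\<^sub>R (D (U i) x + D (U j) x)) powr p \<ge> lam - \<epsilon>" if ij: "i \<ge> N" "j \<ge> N" for i j
    proof -
      let ?z = "\<lambda>x. 1 / 2 * U i x + 1 / 2 * U j x"
      have z: "?z \<in> W" "AE x in M. D ?z x = (1 / 2) *\<^sub>R D (U i) x + (1 / 2) *\<^sub>R D (U j) x"
        by (rule W_lincomb[OF U(1) U(1)])+
      have Dz: "Lp_norm \<Omega> p (D ?z) = Lp_norm \<Omega> p (\<lambda>x. (1 / 2) *\<^sub>R (D (U i) x + D (U j) x))"
        unfolding scaleR_add_right
        by (rule Lp_norm_cong_AE[OF z(2)]) (use W_measurable[OF U(1)] W_measurable[OF z(1)] in measurable)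
      have dq: "in_Lp \<Omega> q (\<lambda>x. U n x - w x)" for n by (rule in_Lp_diff[OF W_Lq[OF U(1)] wq q0(1)])
      have "Lp_norm \<Omega> q (\<lambda>x. ?z x - w x) = Lp_norm \<Omega> q (\<lambda>x. (1 / 2) *\<^sub>R (U i x - w x) + (1 / 2) *\<^sub>R (U j x - w x))"
        by (intro arg_cong[where f = "Lp_norm \<Omega> q"] ext) (simp add: field_simps)
      also have "\<dots> \<le> 1 / 2 * Lp_norm \<Omega> q (\<lambda>x. U i x - w x) + 1 / 2 * Lp_norm \<Omega> q (\<lambda>x. U j x - w x)"
        using Minkowski[OF in_Lp_scaleR[OF dq] in_Lp_scaleR[OF dq] q0(2), of "1 / 2" i "1 / 2" j]
        unfolding Lp_norm_scaleR[OF q0(1)] by simp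
      also have "\<dots> \<le> \<delta>" using N[OF ij(1)] N[OF ij(2)] by simp
      finally have "Lp_norm \<Omega> q ?z \<ge> 1 - \<delta>"
        using Lp_norm_diff_le[OF W_Lq[OF z(1)] wq q0(2)] w1 by linarith
      then have "(1 - \<delta>) powr p \<le> Lp_norm \<Omega> q ?z powr p" using \<delta> p0 by (intro powr_mono2) auto
      moreover have "1 - p * \<delta> \<le> (1 - \<delta>) powr p"
        using powr_tangent_le[of p "1 - \<delta>" 1] \<delta> p0 by simp
      ultimately have "lam * (1 - p * \<delta>) \<le> lam * Lp_norm \<Omega> q ?z powr p" using lam0 by (intro mult_left_mono) auto
      also have "\<dots> \<le> Lp_norm \<Omega> p (D ?z) powr p" by (rule rayleigh[OF z(1)])
      finally show ?thesis using small unfolding Dz by (simp add: algebra_simps)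
    qed
    then show ?thesis by blast
  qed
  \<comment> \<open>The midpoint bound makes the gradients a Cauchy sequence;
    \<open>W_closed\<close> then identifies their limit \<open>H\<close> with the gradient of the
    limit \<open>w\<close> found in \<open>L\<^sup>Q\<close>.\<close>
  have "\<exists>H. in_Lp \<Omega> p H \<and> (\<lambda>n. Lp_norm \<Omega> p (\<lambda>x. D (U n) x - H x)) \<longlonglongrightarrow> 0"
    by (rule Lp_complete[OF W_elim(3)[OF U(1)] p0(2)]) (rule Lp_uniform_convexity[OF W_elim(3)[OF U(1)] p(1) limU mid])
  then obtain H where H: "in_Lp \<Omega> p H" "(\<lambda>n. Lp_norm \<Omega> p (\<lambda>x. D (U n) x - H x)) \<longlonglongrightarrow> 0" by blast
  have wW: "w \<in> W" and Dw: "AE x in M. D w x = H x" by (rule W_closed[OF U(1) wp H(1) limp H(2)])+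
  have Hm: "H \<in> borel_measurable M" using H(1) by (simp add: in_Lp_def)
  have "Lp_norm \<Omega> p (D (\<lambda>x. U n x - w x)) = Lp_norm \<Omega> p (\<lambda>x. D (U n) x - H x)" for n
    unfolding W_diff(2)[OF U(1) wW]
  proof (rule Lp_norm_cong_AE)
    show "AE x in M. D (U n) x - D w x = D (U n) x - H x" using Dw by eventually_elim simp
  qed (use W_measurable[OF U(1)] W_measurable[OF wW] Hm in measurable)
  then have lD: "(\<lambda>n. Lp_norm \<Omega> p (D (\<lambda>x. U n x - w x))) \<longlonglongrightarrow> 0" using H(2) by simp
  have "(\<lambda>n. Lp_norm \<Omega> p (D (U n))) \<longlonglongrightarrow> Lp_norm \<Omega> p (D w)"
    using lD unfolding W_diff(2)[OF U(1) wW] by (rule Lp_norm_tendsto[OF W_elim(3)[OF U(1)] W_elim(3)[OF wW] p0(2)])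
  then have "(\<lambda>n. Lp_norm \<Omega> p (D (U n)) powr p) \<longlonglongrightarrow> Lp_norm \<Omega> p (D w) powr p"
    using p0 by (intro tendsto_powr2 tendsto_const) auto
  from LIMSEQ_unique[OF this limU] have E: "Lp_norm \<Omega> p (D w) powr p = lam" .
  show ?thesis
    by (intro exI[of _ r] exI[of _ w] conjI r wW w1 E lD[unfolded U_def])
qed

end

theorem theorem3p3:
  fixes gmul :: "real^'n \<Rightarrow> real^'n \<Rightarrow> real^'n"
    and V :: "nat \<Rightarrow> (real^'n) set" and m :: nat
    and B :: "'k::finite \<Rightarrow> real^'n"
    and \<Omega> :: "(real^'n) set" and p q lam :: real
    and u :: "nat \<Rightarrow> real^'n \<Rightarrow> real"
  assumes G: "carnot_group gmul V m"
    and B: "inj B" "independent (range B)" "span (range B) = V 1"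
    and dom: "open \<Omega>" "connected \<Omega>" "bounded \<Omega>" "\<Omega> \<noteq> {}"
    and p: "1 < p" "p < real (hom_dim V m)"
    and q: "1 < q" "q < real (hom_dim V m) * p / (real (hom_dim V m) - p)"
    and lam: "lam = Inf {(\<integral>x. norm (whgrad gmul B \<Omega> v x) powr p \<partial>lebesgue_on \<Omega>) | v.
                 v \<in> W0 gmul B \<Omega> p \<and> in_Lp \<Omega> q v \<and> Lp_norm \<Omega> q v = 1}"
    and seq: "\<And>n. u n \<in> W0 gmul B \<Omega> p \<and> in_Lp \<Omega> q (u n) \<and> Lp_norm \<Omega> q (u n) = 1"
    and mini: "(\<lambda>n. Lp_norm \<Omega> p (whgrad gmul B \<Omega> (u n)) powr p) \<longlonglongrightarrow> lam"
  shows "(\<exists>r w. strict_mono r \<and> w \<in> W0 gmul B \<Omega> p \<and> in_Lp \<Omega> q w \<and> Lp_norm \<Omega> q w = 1 \<and>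
            weak_conv_U gmul B \<Omega> p (\<lambda>j. u (r j)) w \<and>
            lam = (\<integral>x. norm (whgrad gmul B \<Omega> w x) powr p \<partial>lebesgue_on \<Omega>) \<and>
            eigenpair gmul B \<Omega> p q lam w) \<and>
         (\<forall>f. eigenpair gmul B \<Omega> p q lam f \<longleftrightarrow>
            (\<exists>c v. c \<noteq> 0 \<and> v \<in> W0 gmul B \<Omega> p \<and> in_Lp \<Omega> q v \<and> Lp_norm \<Omega> q v = 1 \<and>
                   (\<integral>x. norm (whgrad gmul B \<Omega> v x) powr p \<partial>lebesgue_on \<Omega>) = lam \<and>
                   (\<forall>x. f x = c * v x)))"
proof -
  interpret carnot gmul V m by (rule carnot.intro[OF G])
  show ?thesis
  \<comment> \<open>The adapted basis does not occur in the statement; it is fixed only to enter the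
    locales that carry the dilations.\<close>
  proof (rule adapted_basis)
    fix e :: "'n \<Rightarrow> real^'n" and \<sigma> :: "'n \<Rightarrow> nat"
    assume e: "\<And>k. \<sigma> k \<in> {1..m}" "\<And>i. i \<in> {1..m} \<Longrightarrow> V i = span (e ` {k. \<sigma> k = i})"
        "span (range e) = UNIV" "(\<Sum>k\<in>UNIV. \<sigma> k) = hom_dim V m"
    interpret eigenproblem gmul V m e \<sigma> B \<Omega> p q lam
      by unfold_locales (fact e B dom p q lam)+
    have u: "u n \<in> W" "Lp_norm \<Omega> q (u n) = 1" for n using seq[of n] by auto
    from minimizing_sequence_converges[where u = u, OF u mini] obtain r :: "nat \<Rightarrow> nat" and w where r: "strict_mono r"
      and w: "w \<in> W" "Lp_norm \<Omega> q w = 1" "Lp_norm \<Omega> p (D w) powr p = lam"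
      and lim: "(\<lambda>j. Lp_norm \<Omega> p (D (\<lambda>x. u (r j) x - w x))) \<longlonglongrightarrow> 0"
      by (elim exE conjE)
    have E: "Lp_norm \<Omega> p (D v) powr p = (\<integral>x. norm (D v x) powr p \<partial>M)" for v by (rule Lp_norm_powr[OF p0(1)])
    have eig: "eigenpair gmul B \<Omega> p q lam w" using eigenpair_scaled_minimizer[OF w, of 1] by simp
    have weak: "weak_conv_U gmul B \<Omega> p (\<lambda>j. u (r j)) w" by (rule strong_imp_weak_conv[OF u(1) w(1) lim])
    have iff: "eigenpair gmul B \<Omega> p q lam f \<longleftrightarrow> (\<exists>c v. c \<noteq> 0 \<and> v \<in> W \<and> in_Lp \<Omega> q v \<and> Lp_norm \<Omega> q v = 1 \<and>
        (\<integral>x. norm (D v x) powr p \<partial>M) = lam \<and> (\<forall>x. f x = c * v x))" for f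
    proof
      assume "eigenpair gmul B \<Omega> p q lam f"
      from eigenpair_normalized[OF this] obtain c v where "c \<noteq> 0" "v \<in> W" "Lp_norm \<Omega> q v = 1"
        "Lp_norm \<Omega> p (D v) powr p = lam" "\<forall>x. f x = c * v x" by (elim exE conjE)
      then show "\<exists>c v. c \<noteq> 0 \<and> v \<in> W \<and> in_Lp \<Omega> q v \<and> Lp_norm \<Omega> q v = 1 \<and>
        (\<integral>x. norm (D v x) powr p \<partial>M) = lam \<and> (\<forall>x. f x = c * v x)"
        unfolding E by (intro exI[of _ c] exI[of _ v] conjI W_Lq)
    next
      assume "\<exists>c v. c \<noteq> 0 \<and> v \<in> W \<and> in_Lp \<Omega> q v \<and> Lp_norm \<Omega> q v = 1 \<and>
        (\<integral>x. norm (D v x) powr p \<partial>M) = lam \<and> (\<forall>x. f x = c * v x)"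
      then obtain c v where c: "c \<noteq> 0" and v: "v \<in> W" "Lp_norm \<Omega> q v = 1" "(\<integral>x. norm (D v x) powr p \<partial>M) = lam"
        and f: "\<forall>x. f x = c * v x" by (elim exE conjE)
      have "f = (\<lambda>x. c * v x)" using f by auto
      then show "eigenpair gmul B \<Omega> p q lam f" using eigenpair_scaled_minimizer[OF v(1,2) _ c] v(3) E by simp
    qed
    show ?thesis
      by (intro conjI exI[of _ r] exI[of _ w] allI iff r w(1,2) W_Lq[OF w(1)] weak eig w(3)[symmetric, unfolded E])
  qed
qed

end
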